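(* Let $\tau=e^{2i\pi/3}$, $\gamma^2=2\pi/\sqrt3$. Consider $v_0\in\mathcal F_\gamma\cap\widetilde{\mathcal E}$ and let $v(t,z)=\sum_{n\in\mathbb Z}c_n(t)\psi_n(z)$ be the solution of $i\partial_tv+\lambda v=\Pi\big[2|\Psi_0|^2v+\Psi_0^2\,\overline v\big]$ with $v(0)=v_0$. Set $f_0(\xi)=\sum_nc_n(0)e^{-2\pi in\xi}$ and $g_0(\xi)=\sum_n\overline{c_n(0)}e^{-2\pi in\xi}$. Then, for $t>0$ and with implicit constants independent of $t$ and $v_0$: (i) If $c_n(0)\in i\mathbb R$ for all $n\in\mathbb Z$, then $$\|v(t)\|_{L^\infty(S_\gamma)}\lesssim t^{-1/3}\|v_0\|_{L^1(S_\gamma)}.$$ (ii) One has $$\|v(t)\|_{L^\infty(S_\gamma)}\lesssim t^{-1/3}\left[\|f_0\|_{H^1([0,1])}+\Big\|\frac{f_0+g_0}\mu\Big\|_{H^1([0,1])}\right].$$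
   Context: $L$ is Lebesgue measure on $\mathbb C$. For a function $u$ on $\mathbb C$ of at most polynomial growth, $[\Pi u](z)=\frac1\pi e^{-|z|^2/2}\int_{\mathbb C}e^{\overline w z-|w|^2/2}u(w)\,dL(w)$. $\widetilde{\mathcal E}$ is the set of functions $u(z)=e^{-|z|^2/2}F(z)$ with $F$ entire such that $|u(z)|\lesssim\langle z\rangle^M$ for some $M$; $R_\alpha u(z)=e^{(\alpha\overline z-\overline\alpha z)/2}u(z+\alpha)$; $\mathcal F_\gamma=\{u\in\widetilde{\mathcal E}:R_\gamma u=u\}$; $S_\gamma=\{z:-\gamma/2<\mathrm{Re}\,z\le\gamma/2\}$. With $\tau=e^{2i\pi/3}$ and $\gamma^2=2\pi/\sqrt3$, a Hilbert basis of $L^2(S_\gamma)\cap\mathcal F_\gamma$ is $$\psi_k(z)=\Big(\frac2{\pi\gamma^2}\Big)^{1/4}\exp\Big(\frac{2ik\pi z}\gamma+i\pi\tau k^2+\frac{z^2}2-\frac{|z|^2}2\Big),\quad k\in\mathbb Z,$$ and $\Psi_0=\sum_{n\in\mathbb Z}\psi_n$. Define $$\ell(\xi)=1+2\sum_{k\ge1}e^{-\pi^2k^2/\gamma^2}\cos(2\pi k\xi),\qquad h(\xi)=2\sum_{k\ge0}e^{-\pi^2(2k+1)^2/\gamma^2}\cos(2(2k+1)\pi\xi),$$ $$\lambda=\frac1{\gamma\sqrt\pi}\big(\ell^2(0)-2h^2(0)\big),\quad a(\xi)=\frac2{\gamma\sqrt\pi}\big(\ell(\xi)\ell(0)-2h(\xi)h(0)\big)-\lambda,\quad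 b(\xi)=\frac1{\gamma\sqrt\pi}\big(\ell^2(\xi)-2h^2(\xi)\big),$$ $$\mu(\xi)=\big(a^2(\xi)-b^2(\xi)\big)^{1/2}.$$ The estimates are understood for data for which the right-hand side is finite (then $v_0\in L^2(S_\gamma)$, and the expansion in the basis makes sense). *)

theory Defs
  imports "HOL-Analysis.Analysis" "HOL-Probability.Essential_Supremum"
begin

section \<open>Lebesgue and Sobolev norms of complex-valued functions\<close>

definition L1_on :: "'a::euclidean_space set \<Rightarrow> ('a \<Rightarrow> complex) \<Rightarrow> bool" where
  "L1_on S u \<longleftrightarrow> integrable (lebesgue_on S) u"

definition L1_norm :: "'a::euclidean_space set \<Rightarrow> ('a \<Rightarrow> complex) \<Rightarrow> real" where
  "L1_norm S u = (LINT x|lebesgue_on S. cmod (u x))"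

definition L2_on :: "'a::euclidean_space set \<Rightarrow> ('a \<Rightarrow> complex) \<Rightarrow> bool" where
  "L2_on S u \<longleftrightarrow> u \<in> borel_measurable (lebesgue_on S) \<and>
     integrable (lebesgue_on S) (\<lambda>x. (cmod (u x))\<^sup>2)"

definition L2_norm :: "'a::euclidean_space set \<Rightarrow> ('a \<Rightarrow> complex) \<Rightarrow> real" where
  "L2_norm S u = sqrt (LINT x|lebesgue_on S. (cmod (u x))\<^sup>2)"

definition Linf_norm :: "'a::euclidean_space set \<Rightarrow> ('a \<Rightarrow> complex) \<Rightarrow> ereal" where
  "Linf_norm S u = esssup (lebesgue_on S) (\<lambda>x. ereal (cmod (u x)))"

text \<open>Unconditional convergence in \<open>L\<^sup>2(S)\<close> of the series of the \<open>e n\<close> to \<open>u\<close>;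
  the limit \<open>u\<close> is determined up to a null set only.\<close>

definition L2_has_sum ::
    "'a::euclidean_space set \<Rightarrow> ('i \<Rightarrow> 'a \<Rightarrow> complex) \<Rightarrow> ('a \<Rightarrow> complex) \<Rightarrow> bool" where
  "L2_has_sum S e u \<longleftrightarrow> (\<forall>n. L2_on S (e n)) \<and> L2_on S u \<and>
     ((\<lambda>I. L2_norm S (\<lambda>x. (\<Sum>n\<in>I. e n x) - u x)) \<longlongrightarrow> 0) (finite_subsets_at_top UNIV)"

text \<open>Derivative at \<open>t\<close>, relative to the time interval \<open>J\<close>, of a curve in \<open>L\<^sup>2(S)\<close>.\<close>

definition has_L2_derivative ::
    "(real \<Rightarrow> 'a::euclidean_space \<Rightarrow> complex) \<Rightarrow> ('a \<Rightarrow> complex) \<Rightarrow> 'a set \<Rightarrow> real \<Rightarrow> real set \<Rightarrow> bool"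
  where
  "has_L2_derivative v w S t J \<longleftrightarrow> L2_on S w \<and>
     ((\<lambda>s. L2_norm S (\<lambda>x. (v s x - v t x) /\<^sub>R (s - t) - w x)) \<longlongrightarrow> 0) (at t within J)"

definition has_weak_derivative :: "(real \<Rightarrow> complex) \<Rightarrow> (real \<Rightarrow> complex) \<Rightarrow> real \<Rightarrow> real \<Rightarrow> bool" where
  "has_weak_derivative f f' a b \<longleftrightarrow>
     (\<forall>\<phi> \<phi>'. (\<forall>x. (\<phi> has_real_derivative \<phi>' x) (at x)) \<and> continuous_on UNIV \<phi>' \<and>
         closure {x. \<phi> x \<noteq> 0} \<subseteq> {a<..<b} \<longrightarrow>
       (LINT x|lebesgue_on {a..b}. \<phi>' x *\<^sub>R f x) = - (LINT x|lebesgue_on {a..b}. \<phi> x *\<^sub>R f' x))"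

text \<open>The Sobolev space \<open>H\<^sup>1([a,b])\<close> of the interval; no periodicity is imposed at the
  end points.\<close>

definition H1_on :: "real \<Rightarrow> real \<Rightarrow> (real \<Rightarrow> complex) \<Rightarrow> bool" where
  "H1_on a b f \<longleftrightarrow> L2_on {a..b} f \<and> (\<exists>f'. L2_on {a..b} f' \<and> has_weak_derivative f f' a b)"

text \<open>The weak derivative is unique up to a null set, so the norm does not depend on the choice.\<close>

definition weak_derivative :: "real \<Rightarrow> real \<Rightarrow> (real \<Rightarrow> complex) \<Rightarrow> real \<Rightarrow> complex" where
  "weak_derivative a b f = (SOME f'. L2_on {a..b} f' \<and> has_weak_derivative f f' a b)"

definition H1_norm :: "real \<Rightarrow> real \<Rightarrow> (real \<Rightarrow> complex) \<Rightarrow> real" where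
  "H1_norm a b f = sqrt ((L2_norm {a..b} f)\<^sup>2 + (L2_norm {a..b} (weak_derivative a b f))\<^sup>2)"


section \<open>The lowest Landau level\<close>

definition LLL_proj :: "(complex \<Rightarrow> complex) \<Rightarrow> complex \<Rightarrow> complex" where
  "LLL_proj u z = complex_of_real (1 / pi * exp (- (cmod z)\<^sup>2 / 2)) *
     (LINT w|lebesgue. exp (cnj w * z - complex_of_real ((cmod w)\<^sup>2 / 2)) * u w)"

definition E_tilde :: "(complex \<Rightarrow> complex) set" where
  "E_tilde = {u.
     (\<exists>F. F holomorphic_on UNIV \<and> (\<forall>z. u z = complex_of_real (exp (- (cmod z)\<^sup>2 / 2)) * F z)) \<and>
     (\<exists>(M::real) C. \<forall>z. cmod (u z) \<le> C * sqrt (1 + (cmod z)\<^sup>2) powr M)}"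

definition magnetic_translation :: "complex \<Rightarrow> (complex \<Rightarrow> complex) \<Rightarrow> complex \<Rightarrow> complex" where
  "magnetic_translation \<alpha> u z = exp ((\<alpha> * cnj z - cnj \<alpha> * z) / 2) * u (z + \<alpha>)"

definition F_space :: "real \<Rightarrow> (complex \<Rightarrow> complex) set" where
  "F_space p = {u \<in> E_tilde. magnetic_translation (complex_of_real p) u = u}"

definition strip :: "real \<Rightarrow> complex set" where
  "strip p = {z. - p / 2 < Re z \<and> Re z \<le> p / 2}"


section \<open>Hexagonal lattice\<close>

definition \<tau> :: complex where
  "\<tau> = exp (2 * \<i> * complex_of_real pi / 3)"

definition \<gamma> :: real where
  "\<gamma> = sqrt (2 * pi / sqrt 3)"

definition \<psi> :: "int \<Rightarrow> complex \<Rightarrow> complex" where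
  "\<psi> k z = complex_of_real ((2 / (pi * \<gamma>\<^sup>2)) powr (1/4)) *
     exp (2 * \<i> * of_int k * complex_of_real pi * z / complex_of_real \<gamma>
          + \<i> * complex_of_real pi * \<tau> * (of_int k)\<^sup>2
          + z\<^sup>2 / 2 - complex_of_real ((cmod z)\<^sup>2 / 2))"

definition \<Psi>\<^sub>0 :: "complex \<Rightarrow> complex" where
  "\<Psi>\<^sub>0 z = (\<Sum>\<^sub>\<infinity>n\<in>(UNIV::int set). \<psi> n z)"

definition ell :: "real \<Rightarrow> real" where
  "ell \<xi> = 1 + 2 * (\<Sum>j. exp (- pi\<^sup>2 * (real (Suc j))\<^sup>2 / \<gamma>\<^sup>2) * cos (2 * pi * real (Suc j) * \<xi>))"

definition hh :: "real \<Rightarrow> real" where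
  "hh \<xi> = 2 * (\<Sum>k. exp (- pi\<^sup>2 * (2 * real k + 1)\<^sup>2 / \<gamma>\<^sup>2) * cos (2 * (2 * real k + 1) * pi * \<xi>))"

definition lam :: real where
  "lam = 1 / (\<gamma> * sqrt pi) * ((ell 0)\<^sup>2 - 2 * (hh 0)\<^sup>2)"

definition coeff_a :: "real \<Rightarrow> real" where
  "coeff_a \<xi> = 2 / (\<gamma> * sqrt pi) * (ell \<xi> * ell 0 - 2 * hh \<xi> * hh 0) - lam"

definition coeff_b :: "real \<Rightarrow> real" where
  "coeff_b \<xi> = 1 / (\<gamma> * sqrt pi) * ((ell \<xi>)\<^sup>2 - 2 * (hh \<xi>)\<^sup>2)"

text \<open>The radicand is nonnegative and vanishes only at the integers, so a quotient by \<open>\<mu>\<close> is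
  meaningful almost everywhere.\<close>

definition \<mu> :: "real \<Rightarrow> real" where
  "\<mu> \<xi> = sqrt ((coeff_a \<xi>)\<^sup>2 - (coeff_b \<xi>)\<^sup>2)"


section \<open>The linearized equation\<close>

text \<open>Strong solutions for \<open>t \<ge> 0\<close>: differentiable curves in \<open>L\<^sup>2(S\<^sub>\<gamma>) \<inter> F\<^sub>\<gamma>\<close>. The operator on
  the right-hand side is bounded and real-linear there, so the solution is unique and such
  curves are automatically continuously differentiable.\<close>

definition linearized_solution :: "(real \<Rightarrow> complex \<Rightarrow> complex) \<Rightarrow> bool" where
  "linearized_solution v \<longleftrightarrow>
     (\<forall>t\<ge>0. v t \<in> F_space \<gamma> \<and> L2_on (strip \<gamma>) (v t)) \<and>
     (\<exists>v'. \<forall>t\<ge>0. has_L2_derivative v (v' t) (strip \<gamma>) t {0..} \<and>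
        (\<forall>z. \<i> * v' t z + complex_of_real lam * v t z =
           LLL_proj (\<lambda>w. 2 * (complex_of_real (cmod (\<Psi>\<^sub>0 w)))\<^sup>2 * v t w
                        + (\<Psi>\<^sub>0 w)\<^sup>2 * cnj (v t w)) z))"

definition fourier_mode :: "int \<Rightarrow> real \<Rightarrow> complex" where
  "fourier_mode n \<xi> = exp (- 2 * complex_of_real pi * \<i> * of_int n * complex_of_real \<xi>)"

end

theory Submission
  imports Defs "HOL-Probability.Characteristic_Functions"
begin

text \<open>
  The operator \<open>\<Pi>\<close> is explicit on triple products of basis functions: \<open>\<Pi>(\<psi>\<^sub>k \<psi>\<^sub>l* \<psi>\<^sub>m)\<close> is a
  Gaussian multiple of \<open>\<psi>\<close> with index \<open>k - l + m\<close>. Hence the coefficients of a solution satisfy a convolution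
  equation, which on the Fourier side is multiplication by the symbols: \<open>i f' = a f + b g\<close>,
  \<open>- i g' = a g + b f\<close>, where \<open>g\<close> has the conjugate coefficients. The eigenvalues are
  \<open>\<plusminus> \<mu>\<close>, so every coefficient is an integral over \<open>[0,1]\<close> of \<open>cis (\<plusminus> t \<mu>(\<xi>) + 2 \<pi> n \<xi>)\<close> times an
  amplitude times \<open>f\<^sub>0\<close> or \<open>(f\<^sub>0 + g\<^sub>0) / \<mu>\<close>; uniqueness for bounded coefficient sequences
  identifies these integrals with the given solution. Since the second and third derivatives of \<open>\<mu>\<close> have no common zero on \<open>[0,1]\<close>,
  van der Corput's lemma bounds each integral by \<open>t powr (-1/3)\<close>, uniformly in \<open>n\<close>. Finally
  \<open>\<bar>v\<bar> \<le> sup\<^sub>n \<bar>c\<^sub>n\<bar> \<Sum>\<^sub>n \<bar>\<psi>\<^sub>n\<bar>\<close>, and the last sum is bounded. For imaginary coefficients the term with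
  \<open>f\<^sub>0 + g\<^sub>0\<close> vanishes, and the same bound on \<open>\<Sum>\<^sub>n \<bar>\<psi>\<^sub>n\<bar>\<close> controls \<open>\<Sum>\<^sub>n \<bar>c\<^sub>n(0)\<bar>\<close> by the \<open>L\<^sup>1\<close> norm
  of the data.
\<close>

section \<open>Oscillatory integrals\<close>

text \<open>The obstacle is the square root in \<mu>: its radicand vanishes to fourth order at the
  integers, and nothing in its definition shows that the root is smooth there. Completing squares
  writes a - b through the increments of \<open>ell\<close> and \<open>hh\<close> between 0 and
  \<xi>. With x = 2 pi \<xi>, each 1 - cos (k x) is divisible by 1 - cos x, the quotient being a
  Fejer sum, so a - b carries an explicit factor (1 - cos x)^2 and \<mu> is a constant times (1 -
  cos x) sqrt R with R bounded away from 0. The nome q = exp (- pi^2 / \<gamma>^2) lies between 0.06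
  and 0.07, hence R = 1 + 4 q cos x up to an error of at most 1/8 together with three derivatives.
  This is small enough to decide the signs of \<mu>'' and \<mu>''' from the range of cos x. The
  linear phase 2 pi n \<xi> does not enter these derivatives, which is why no estimate depends on n.
  On the data side an H^1 function is given up to a null set and without periodicity; it is
  integrated against the oscillating factor through its weak derivative, and only the primitive of
  that factor has to be small.\<close>

lemma cis_comp_has_vector_derivative:
  assumes "(\<phi> has_real_derivative d) (at x within S)"
  shows "((\<lambda>x. cis (\<phi> x)) has_vector_derivative \<i> * complex_of_real d * cis (\<phi> x)) (at x within S)"
proof -
  have "((\<lambda>x. Complex (cos (\<phi> x)) (sin (\<phi> x))) has_vector_derivative
      Complex (- (sin (\<phi> x) * d)) (cos (\<phi> x) * d)) (at x within S)"
    unfolding has_vector_derivative_complex_iff has_real_derivative_iff_has_vector_derivative[symmetric]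
    by (auto intro!: derivative_eq_intros assms)
  moreover have "Complex (- (sin (\<phi> x) * d)) (cos (\<phi> x) * d) = \<i> * complex_of_real d * cis (\<phi> x)"
    by (simp add: complex_eq_iff)
  ultimately show ?thesis
    by (simp add: cis.ctr)
qed

text \<open>\<open>G\<close>, the quotient of cis \<phi> by \<phi>', has derivative i cis \<phi>
  plus an error of modulus \<phi>''/\<phi>'^2. As \<phi>'' is nonnegative, this modulus is the
  derivative of -1/\<phi>' and integrates to boundary values: 2/l from \<open>G\<close> at the two
  ends and 1/l from the error make 3/l.\<close>

lemma van_der_corput_first:
  fixes \<phi> \<phi>1 \<phi>2 :: "real \<Rightarrow> real"
  assumes ab: "a \<le> b" and l: "0 < l"
    and d1: "\<And>x. (\<phi> has_real_derivative \<phi>1 x) (at x)"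
    and d2: "\<And>x. (\<phi>1 has_real_derivative \<phi>2 x) (at x)"
    and c2: "continuous_on UNIV \<phi>2"
    and low: "(\<forall>x\<in>{a..b}. l \<le> \<phi>1 x) \<or> (\<forall>x\<in>{a..b}. \<phi>1 x \<le> - l)"
    and pos: "\<And>x. x \<in> {a..b} \<Longrightarrow> 0 \<le> \<phi>2 x"
  shows "norm (integral {a..b} (\<lambda>x. cis (\<phi> x))) \<le> 3 / l"
proof -
  have nz: "\<phi>1 x \<noteq> 0" if "x \<in> {a..b}" for x
    using low l that by force
  have c0: "continuous_on A \<phi>" and c1: "continuous_on A \<phi>1" for A
    using d1 d2 by (meson DERIV_isCont continuous_at_imp_continuous_on)+
  have c2': "continuous_on A \<phi>2" for A
    using c2 continuous_on_subset by blast
  have cc: "continuous_on A (\<lambda>x. cis (\<phi> x))" for A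
    by (intro continuous_intros c0)
  define G where "G = (\<lambda>x. cis (\<phi> x) * complex_of_real (inverse (\<phi>1 x)))"
  have "(G has_vector_derivative \<i> * (cis (\<phi> x) + \<i> * cis (\<phi> x) * complex_of_real (\<phi>2 x / (\<phi>1 x)\<^sup>2)))
      (at x within {a..b})" if x: "x \<in> {a..b}" for x
  proof -
    have "((\<lambda>x. inverse (\<phi>1 x)) has_real_derivative - (\<phi>2 x / (\<phi>1 x)\<^sup>2)) (at x within {a..b})"
      using d2[of x] nz[OF x] by (auto intro!: derivative_eq_intros DERIV_subset[OF d2] simp: field_simps power2_eq_square)
    then have "((\<lambda>x. complex_of_real (inverse (\<phi>1 x))) has_vector_derivative
        complex_of_real (- (\<phi>2 x / (\<phi>1 x)\<^sup>2))) (at x within {a..b})"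
      by (intro has_vector_derivative_of_real)
        (simp add: has_real_derivative_iff_has_vector_derivative)
    from has_vector_derivative_mult[OF cis_comp_has_vector_derivative[OF has_field_derivative_at_within[OF d1]] this]
    show ?thesis
      unfolding G_def using nz[OF x] by (simp add: algebra_simps)
  qed
  then have "((\<lambda>x. \<i> * (cis (\<phi> x) + \<i> * cis (\<phi> x) * complex_of_real (\<phi>2 x / (\<phi>1 x)\<^sup>2)))
      has_integral (G b - G a)) {a..b}"
    by (intro fundamental_theorem_of_calculus ab)
  from has_integral_mult_right[OF this, of "- \<i>"]
  have i1: "((\<lambda>x. cis (\<phi> x) + \<i> * cis (\<phi> x) * complex_of_real (\<phi>2 x / (\<phi>1 x)\<^sup>2))
      has_integral - \<i> * (G b - G a)) {a..b}"
    by (simp add: algebra_simps)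
  have i2: "((\<lambda>x. cis (\<phi> x)) has_integral integral {a..b} (\<lambda>x. cis (\<phi> x))) {a..b}"
    by (intro integrable_integral integrable_continuous_interval cc)
  have i3: "((\<lambda>x. \<i> * cis (\<phi> x) * complex_of_real (\<phi>2 x / (\<phi>1 x)\<^sup>2)) has_integral
      - \<i> * (G b - G a) - integral {a..b} (\<lambda>x. cis (\<phi> x))) {a..b}"
    using has_integral_diff[OF i1 i2] by simp
  have "((\<lambda>x. - inverse (\<phi>1 x)) has_vector_derivative \<phi>2 x / (\<phi>1 x)\<^sup>2) (at x within {a..b})"
    if x: "x \<in> {a..b}" for x
    unfolding has_real_derivative_iff_has_vector_derivative[symmetric]
    using d2[of x] nz[OF x] by (auto intro!: derivative_eq_intros DERIV_subset[OF d2] simp: field_simps power2_eq_square)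
  then have i4: "((\<lambda>x. \<phi>2 x / (\<phi>1 x)\<^sup>2) has_integral (- inverse (\<phi>1 b) - (- inverse (\<phi>1 a)))) {a..b}"
    by (intro fundamental_theorem_of_calculus ab)

  have i5: "norm (- \<i> * (G b - G a) - integral {a..b} (\<lambda>x. cis (\<phi> x))) \<le> inverse (\<phi>1 a) - inverse (\<phi>1 b)"
  proof -
    have "norm (integral {a..b} (\<lambda>x. \<i> * cis (\<phi> x) * complex_of_real (\<phi>2 x / (\<phi>1 x)\<^sup>2)))
        \<le> integral {a..b} (\<lambda>x. \<phi>2 x / (\<phi>1 x)\<^sup>2)"
      using i3 i4 pos by (intro integral_norm_bound_integral) (auto simp: norm_mult norm_divide norm_power)
    with i3 i4 show ?thesis
      by (simp add: integral_unique)
  qed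
  have Gb: "norm (G x) \<le> inverse l" if "x \<in> {a..b}" for x
  proof -
    have "l \<le> \<bar>\<phi>1 x\<bar>" using low that l by force
    then show ?thesis
      using l by (simp add: G_def norm_mult norm_inverse le_imp_inverse_le)
  qed
  have "inverse (\<phi>1 a) - inverse (\<phi>1 b) \<le> inverse l"
    using low
  proof
    assume *: "\<forall>x\<in>{a..b}. l \<le> \<phi>1 x"
    then have *: "l \<le> \<phi>1 a" "l \<le> \<phi>1 b" using ab by auto
    then have "inverse (\<phi>1 a) \<le> inverse l" "0 \<le> inverse (\<phi>1 b)"
      using l by (auto intro: le_imp_inverse_le)
    then show ?thesis by linarith
  next
    assume "\<forall>x\<in>{a..b}. \<phi>1 x \<le> - l"
    then have *: "\<phi>1 a \<le> - l" "\<phi>1 b \<le> - l" using ab by auto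
    then have "inverse (- \<phi>1 b) \<le> inverse l" "inverse (- \<phi>1 a) \<ge> 0"
      using l le_imp_inverse_le[of l "- \<phi>1 b"] by auto
    then show ?thesis unfolding inverse_minus_eq by linarith
  qed
  moreover have "norm (integral {a..b} (\<lambda>x. cis (\<phi> x)))
      \<le> norm (\<i> * (G b - G a)) + norm (- \<i> * (G b - G a) - integral {a..b} (\<lambda>x. cis (\<phi> x)))"
    using norm_triangle_ineq4[of "- \<i> * (G b - G a)" "- \<i> * (G b - G a) - integral {a..b} (\<lambda>x. cis (\<phi> x))"]
    by simp
  moreover have "norm (\<i> * (G b - G a)) \<le> 2 * inverse l"
    using Gb[of a] Gb[of b] ab norm_triangle_ineq4[of "G b" "G a"] by (simp add: norm_mult)
  ultimately show ?thesis
    using i5 by (simp add: field_simps)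
qed

text \<open>The point c is the zero of the increasing function, or the end of the interval next to
  which a zero would lie. In each case |g| grows at least with slope l away from c, which serves to
  pass from one derivative order to the next outside a small window around c.\<close>

lemma increasing_split:
  fixes g g' :: "real \<Rightarrow> real"
  assumes ab: "a \<le> b" and l: "0 < l"
    and d: "\<And>x. (g has_real_derivative g' x) (at x)"
    and low: "\<And>x. x \<in> {a..b} \<Longrightarrow> l \<le> g' x"
  obtains c where "c \<in> {a..b}" "\<And>x. x \<in> {c<..b} \<Longrightarrow> l * (x - c) \<le> g x"
    "\<And>x. x \<in> {a..<c} \<Longrightarrow> g x \<le> - (l * (c - x))"
proof -
  have mono: "l * (y - x) \<le> g y - g x" if xy: "a \<le> x" "x \<le> y" "y \<le> b" for x y
  proof (cases "x = y")
    case False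
    then have "x < y" using xy by simp
    then obtain z where "x < z" "z < y" "g y - g x = (y - x) * g' z"
      using MVT2[of x y g g'] d by blast
    moreover have "l \<le> g' z" using low calculation that by auto
    ultimately show ?thesis using that by (simp add: mult.commute mult_left_mono)
  qed auto
  have cont: "continuous_on {a..b} g"
    using d by (meson DERIV_isCont continuous_at_imp_continuous_on)
  consider "0 \<le> g a" | "g b \<le> 0" | "g a < 0" "0 < g b" by linarith
  then show thesis
  proof cases
    case 1
    show thesis
    proof (rule that[of a])
      show "l * (x - a) \<le> g x" if "x \<in> {a<..b}" for x
        using mono[of a x] 1 that by auto
    qed (use ab in auto)
  next
    case 2
    show thesis
    proof (rule that[of b])
      show "g x \<le> - (l * (b - x))" if "x \<in> {a..<b}" for x
        using mono[of x b] 2 that by auto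
    qed (use ab in auto)
  next
    case 3
    obtain c where c: "a \<le> c" "c \<le> b" "g c = 0"
      using IVT'[of g a 0 b] 3 ab cont by force
    show thesis
    proof (rule that[of c])
      show "l * (x - c) \<le> g x" if "x \<in> {c<..b}" for x
        using mono[of c x] c that by auto
      show "g x \<le> - (l * (c - x))" if "x \<in> {a..<c}" for x
        using mono[of x c] c that by auto
    qed (use c in auto)
  qed
qed

text \<open>The window of radius d around c is bounded trivially by its length 2 d, the at most two
  remaining intervals by B each.\<close>

lemma norm_integral_split_le:
  fixes f :: "real \<Rightarrow> complex"
  assumes f: "continuous_on UNIV f" "\<And>x. norm (f x) \<le> 1"
    and c: "c \<in> {a..b}" and d: "0 < d" and B: "0 \<le> B"
    and le: "\<And>p q. a \<le> p \<Longrightarrow> p \<le> q \<Longrightarrow> q \<le> b \<Longrightarrow> c + d \<le> p \<or> q \<le> c - d \<Longrightarrow> norm (integral {p..q} f) \<le> B"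
  shows "norm (integral {a..b} f) \<le> 2 * d + 2 * B"
proof -
  define p q where "p = max a (c - d)" and "q = min b (c + d)"
  have pq: "a \<le> p" "p \<le> q" "q \<le> b" "q - p \<le> 2 * d"
    using c d by (auto simp: p_def q_def)
  have i: "f integrable_on {x..y}" for x y
    using f(1) continuous_on_subset integrable_continuous_interval by blast
  have "integral {a..b} f = integral {a..p} f + integral {p..q} f + integral {q..b} f"
    using pq by (simp add: Henstock_Kurzweil_Integration.integral_combine i)
  then have n0: "norm (integral {a..b} f) \<le> norm (integral {a..p} f) + norm (integral {p..q} f) + norm (integral {q..b} f)"
    by (metis norm_triangle_ineq norm_triangle_mono order_refl)
  have n1: "norm (integral {a..p} f) \<le> B"
  proof (cases "p = a")
    case False
    then show ?thesis using pq by (intro le) (auto simp: p_def)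
  qed (use B in auto)
  have n2: "norm (integral {q..b} f) \<le> B"
  proof (cases "q = b")
    case False
    then show ?thesis using pq by (intro le) (auto simp: q_def)
  qed (use B in auto)
  have n3: "norm (integral {p..q} f) \<le> 1 * (q - p)"
    using f pq by (intro integral_bound) (auto intro: continuous_on_subset)
  have "norm (integral {a..b} f) \<le> B + 1 * (q - p) + B"
    by (intro order.trans[OF n0] add_mono n1 n2 n3)
  then show ?thesis using pq(4) by simp
qed

text \<open>Conjugation reduces phases with a negative derivative to those with a positive
  one.\<close>

lemma norm_integral_cis_uminus:
  "norm (integral A (\<lambda>x. cis (- \<phi> x))) = norm (integral A (\<lambda>x. cis (\<phi> x :: real)))"
  using integral_cnj[of A "\<lambda>x. cis (\<phi> x)"]
  by (metis (no_types, lifting) cis_cnj complex_mod_cnj ext)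

lemma van_der_corput_second:
  fixes \<phi> \<phi>1 \<phi>2 :: "real \<Rightarrow> real"
  assumes ab: "a \<le> b" and l: "0 < l"
    and d1: "\<And>x. (\<phi> has_real_derivative \<phi>1 x) (at x)"
    and d2: "\<And>x. (\<phi>1 has_real_derivative \<phi>2 x) (at x)"
    and c2: "continuous_on UNIV \<phi>2"
    and low: "(\<forall>x\<in>{a..b}. l \<le> \<phi>2 x) \<or> (\<forall>x\<in>{a..b}. \<phi>2 x \<le> - l)"
  shows "norm (integral {a..b} (\<lambda>x. cis (\<phi> x))) \<le> 8 / sqrt l"
proof -
  have main: "norm (integral {a..b} (\<lambda>x. cis (\<phi> x))) \<le> 8 / sqrt l"
    if d1: "\<And>x. (\<phi> has_real_derivative \<phi>1 x) (at x)"
    and d2: "\<And>x. (\<phi>1 has_real_derivative \<phi>2 x) (at x)"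
    and c2: "continuous_on UNIV \<phi>2"
    and low: "\<And>x. x\<in>{a..b} \<Longrightarrow> l \<le> \<phi>2 x" for \<phi> \<phi>1 \<phi>2
  proof -
    obtain c where c: "c \<in> {a..b}" "\<And>x. x \<in> {c<..b} \<Longrightarrow> l * (x - c) \<le> \<phi>1 x"
      "\<And>x. x \<in> {a..<c} \<Longrightarrow> \<phi>1 x \<le> - (l * (c - x))"
      using increasing_split[OF ab l d2 low] by blast
    \<comment> \<open>This radius balances the trivial bound 2 d on the window against the two outer
      contributions 3 / (l d).\<close>
    define d where "d = 1 / sqrt l"
    have d: "0 < d" "l * d = sqrt l"
      using l by (auto simp: d_def field_simps real_div_sqrt)
    have "norm (integral {a..b} (\<lambda>x. cis (\<phi> x))) \<le> 2 * d + 2 * (3 / sqrt l)"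
    proof (rule norm_integral_split_le[OF _ _ c(1) d(1)])
      show "continuous_on UNIV (\<lambda>x. cis (\<phi> x))"
        using d1 by (intro continuous_intros) (meson DERIV_isCont continuous_at_imp_continuous_on)
      fix p q assume pq: "a \<le> p" "p \<le> q" "q \<le> b" "c + d \<le> p \<or> q \<le> c - d"
      have low1: "(\<forall>x\<in>{p..q}. sqrt l \<le> \<phi>1 x) \<or> (\<forall>x\<in>{p..q}. \<phi>1 x \<le> - sqrt l)"
        using pq(4)
      proof
        assume *: "c + d \<le> p"
        have "sqrt l \<le> \<phi>1 x" if "x \<in> {p..q}" for x
        proof -
          have "l * d \<le> l * (x - c)" using that * l by auto
          also have "\<dots> \<le> \<phi>1 x" using c(2)[of x] that * pq d by auto
          finally show ?thesis using d by simp
        qed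
        then show ?thesis by blast
      next
        assume *: "q \<le> c - d"
        have "\<phi>1 x \<le> - sqrt l" if "x \<in> {p..q}" for x
        proof -
          have "l * d \<le> l * (c - x)" using that * l by auto
          moreover have "\<phi>1 x \<le> - (l * (c - x))" using c(3)[of x] that * pq d by auto
          ultimately show ?thesis using d by simp
        qed
        then show ?thesis by blast
      qed
      have "0 \<le> \<phi>2 x" if "x \<in> {p..q}" for x using low[of x] that pq l by auto
      then show "norm (integral {p..q} (\<lambda>x. cis (\<phi> x))) \<le> 3 / sqrt l"
        using van_der_corput_first[OF pq(2) _ d1 d2 c2 low1] l by simp
    qed (use l in auto)
    then show ?thesis by (simp add: d_def field_simps)
  qed
  from low show ?thesis
  proof
    assume "\<forall>x\<in>{a..b}. l \<le> \<phi>2 x"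
    then show ?thesis by (intro main[OF d1 d2 c2]) blast
  next
    assume *: "\<forall>x\<in>{a..b}. \<phi>2 x \<le> - l"
    have "norm (integral {a..b} (\<lambda>x. cis (- \<phi> x))) \<le> 8 / sqrt l"
      using * by (intro main[of _ "\<lambda>x. - \<phi>1 x" "\<lambda>x. - \<phi>2 x"])
        (force intro!: DERIV_minus d1 d2 continuous_intros c2)+
    then show ?thesis by (simp add: norm_integral_cis_uminus)
  qed
qed

lemma van_der_corput_third:
  fixes \<phi> \<phi>1 \<phi>2 \<phi>3 :: "real \<Rightarrow> real"
  assumes ab: "a \<le> b" and l: "0 < l"
    and d1: "\<And>x. (\<phi> has_real_derivative \<phi>1 x) (at x)"
    and d2: "\<And>x. (\<phi>1 has_real_derivative \<phi>2 x) (at x)"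
    and d3: "\<And>x. (\<phi>2 has_real_derivative \<phi>3 x) (at x)"
    and low: "(\<forall>x\<in>{a..b}. l \<le> \<phi>3 x) \<or> (\<forall>x\<in>{a..b}. \<phi>3 x \<le> - l)"
  shows "norm (integral {a..b} (\<lambda>x. cis (\<phi> x))) \<le> 18 * l powr (-1/3)"
proof -
  have main: "norm (integral {a..b} (\<lambda>x. cis (\<phi> x))) \<le> 18 * l powr (-1/3)"
    if d1: "\<And>x. (\<phi> has_real_derivative \<phi>1 x) (at x)"
    and d2: "\<And>x. (\<phi>1 has_real_derivative \<phi>2 x) (at x)"
    and d3: "\<And>x. (\<phi>2 has_real_derivative \<phi>3 x) (at x)"
    and low: "\<And>x. x\<in>{a..b} \<Longrightarrow> l \<le> \<phi>3 x" for \<phi> \<phi>1 \<phi>2 \<phi>3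
  proof -
    obtain c where c: "c \<in> {a..b}" "\<And>x. x \<in> {c<..b} \<Longrightarrow> l * (x - c) \<le> \<phi>2 x"
      "\<And>x. x \<in> {a..<c} \<Longrightarrow> \<phi>2 x \<le> - (l * (c - x))"
      using increasing_split[OF ab l d3 low] by blast
    \<comment> \<open>Outside the window |\<phi>''| is at least l d, so each outer part costs 8 /
      sqrt (l d). With this choice that is 8 d, and the total is 2 d + 16 d.\<close>
    define d where "d = l powr (-1/3)"
    have d: "0 < d" using l by (auto simp: d_def)
    have ld: "0 < l * d" using l d by simp
    have "l * d = l powr 1 * l powr (-1/3)"
      using l by (simp add: d_def)
    also have "\<dots> = l powr (2/3)"
      unfolding powr_add[symmetric] by simp
    finally have ld': "l * d = l powr (2/3)" .
    have sq: "sqrt (l * d) = l powr (1/3)"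
      unfolding ld' using l by (simp add: powr_half_sqrt[symmetric] powr_powr)
    have "norm (integral {a..b} (\<lambda>x. cis (\<phi> x))) \<le> 2 * d + 2 * (8 / sqrt (l * d))"
    proof (rule norm_integral_split_le[OF _ _ c(1) d(1)])
      show "continuous_on UNIV (\<lambda>x. cis (\<phi> x))"
        using d1 by (intro continuous_intros) (meson DERIV_isCont continuous_at_imp_continuous_on)
      have c2: "continuous_on UNIV \<phi>2"
        using d3 by (meson DERIV_isCont continuous_at_imp_continuous_on)
      fix p q assume pq: "a \<le> p" "p \<le> q" "q \<le> b" "c + d \<le> p \<or> q \<le> c - d"
      have low1: "(\<forall>x\<in>{p..q}. l * d \<le> \<phi>2 x) \<or> (\<forall>x\<in>{p..q}. \<phi>2 x \<le> - (l * d))"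
        using pq(4)
      proof
        assume *: "c + d \<le> p"
        have "l * d \<le> \<phi>2 x" if "x \<in> {p..q}" for x
        proof -
          have "l * d \<le> l * (x - c)" using that * l by auto
          also have "\<dots> \<le> \<phi>2 x" using c(2)[of x] that * pq d by auto
          finally show ?thesis by simp
        qed
        then show ?thesis by blast
      next
        assume *: "q \<le> c - d"
        have "\<phi>2 x \<le> - (l * d)" if "x \<in> {p..q}" for x
        proof -
          have "l * d \<le> l * (c - x)" using that * l by auto
          moreover have "\<phi>2 x \<le> - (l * (c - x))" using c(3)[of x] that * pq d by auto
          ultimately show ?thesis by simp
        qed
        then show ?thesis by blast
      qed
      show "norm (integral {p..q} (\<lambda>x. cis (\<phi> x))) \<le> 8 / sqrt (l * d)"
        by (rule van_der_corput_second[OF pq(2) ld d1 d2 c2 low1])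
    qed (use ld in auto)
    also have "8 / sqrt (l * d) = 8 * d"
      unfolding sq using powr_minus_divide[of l "1/3"] by (simp add: d_def)
    finally show ?thesis by (simp add: d_def)
  qed
  from low show ?thesis
  proof
    assume "\<forall>x\<in>{a..b}. l \<le> \<phi>3 x"
    then show ?thesis by (intro main[OF d1 d2 d3]) auto
  next
    assume *: "\<forall>x\<in>{a..b}. \<phi>3 x \<le> - l"
    have "norm (integral {a..b} (\<lambda>x. cis (- \<phi> x))) \<le> 18 * l powr (-1/3)"
      using * by (intro main[of _ "\<lambda>x. - \<phi>1 x" "\<lambda>x. - \<phi>2 x" "\<lambda>x. - \<phi>3 x"])
        (force intro!: DERIV_minus d1 d2 d3)+
    then show ?thesis by (simp add: norm_integral_cis_uminus)
  qed
qed

text \<open>The free slope s makes the decay uniform in the index of a Fourier coefficient. All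
  subintervals are included so that adjacent intervals can be glued and so that the running integral
  can be used in an integration by parts.\<close>

definition oscillatory_decay :: "(real \<Rightarrow> real) \<Rightarrow> real \<Rightarrow> real \<Rightarrow> bool" where
  "oscillatory_decay m a b \<longleftrightarrow> (\<exists>C. \<forall>p q t s. a \<le> p \<longrightarrow> p \<le> q \<longrightarrow> q \<le> b \<longrightarrow> 0 < t \<longrightarrow>
     norm (integral {p..q} (\<lambda>x. cis (t * m x + s * x))) \<le> C * t powr (-1/3))"

lemma oscillatory_decay_join:
  assumes m: "continuous_on UNIV m" and abc: "a \<le> b" "b \<le> c"
    and ab: "oscillatory_decay m a b" and bc: "oscillatory_decay m b c"
  shows "oscillatory_decay m a c"
proof -
  let ?f = "\<lambda>t s x. cis (t * m x + s * x)"
  obtain C1 where C1: "\<And>p q t s. a \<le> p \<Longrightarrow> p \<le> q \<Longrightarrow> q \<le> b \<Longrightarrow> 0 < t \<Longrightarrow>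
     norm (integral {p..q} (?f t s)) \<le> C1 * t powr (-1/3)"
    using ab unfolding oscillatory_decay_def by metis
  obtain C2 where C2: "\<And>p q t s. b \<le> p \<Longrightarrow> p \<le> q \<Longrightarrow> q \<le> c \<Longrightarrow> 0 < t \<Longrightarrow>
     norm (integral {p..q} (?f t s)) \<le> C2 * t powr (-1/3)"
    using bc unfolding oscillatory_decay_def by metis
  show ?thesis
    unfolding oscillatory_decay_def
  proof (intro exI allI impI)
    fix p q t s :: real
    assume pq: "a \<le> p" "p \<le> q" "q \<le> c" and t: "0 < t"
    define p' q' where "p' = min b q" and "q' = max b p"
    have i: "?f t s integrable_on {x..y}" for x y
      by (intro integrable_continuous_interval continuous_intros continuous_on_subset[OF m]) auto
    \<comment> \<open>Clipping the end points at b makes one of the two integrals degenerate when b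
      lies outside [p, q], so both bounds apply without a case distinction.\<close>
    have "integral {p..q} (?f t s) = integral {min b p..p'} (?f t s) + integral {q'..max b q} (?f t s)"
      using pq Henstock_Kurzweil_Integration.integral_combine[of p b q "?f t s"] i
      by (auto simp: p'_def q'_def min_def max_def)
    then have "norm (integral {p..q} (?f t s)) \<le> norm (integral {min b p..p'} (?f t s)) + norm (integral {q'..max b q} (?f t s))"
      by (simp add: norm_triangle_ineq)
    also have "\<dots> \<le> C1 * t powr (-1/3) + C2 * t powr (-1/3)"
      using pq abc t by (intro add_mono C1 C2) (auto simp: p'_def q'_def)
    finally show "norm (integral {p..q} (?f t s)) \<le> (C1 + C2) * t powr (-1/3)"
      by (simp add: algebra_simps)
  qed
qed

lemma scaled_lower_bound:
  fixes g :: "real \<Rightarrow> real"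
  assumes "(\<forall>x\<in>A. l \<le> g x) \<or> (\<forall>x\<in>A. g x \<le> - l)" "0 < t" "B \<subseteq> A"
  shows "(\<forall>x\<in>B. t * l \<le> t * g x) \<or> (\<forall>x\<in>B. t * g x \<le> - (t * l))"
proof -
  have "t * l \<le> t * g x \<longleftrightarrow> l \<le> g x" "t * g x \<le> - (t * l) \<longleftrightarrow> g x \<le> - l" for x
    using \<open>0 < t\<close> mult_le_cancel_left_pos[of t "g x" "- l"] by auto
  then show ?thesis using assms(1,3) by blast
qed

lemma phase_derivatives:
  fixes m m1 :: "real \<Rightarrow> real"
  assumes "\<And>x. (m has_real_derivative m1 x) (at x)"
  shows "((\<lambda>x. t * m x + s * x) has_real_derivative t * m1 x + s) (at x)"
    and "((\<lambda>x. t * m x + s) has_real_derivative t * m1 x) (at x)"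
    and "((\<lambda>x. t * m x) has_real_derivative t * m1 x) (at x)"
  by (auto intro!: derivative_eq_intros assms)

lemma oscillatory_decay_second:
  fixes m m1 m2 :: "real \<Rightarrow> real"
  assumes l: "0 < l"
    and d1: "\<And>x. (m has_real_derivative m1 x) (at x)"
    and d2: "\<And>x. (m1 has_real_derivative m2 x) (at x)"
    and c2: "continuous_on UNIV m2"
    and low: "(\<forall>x\<in>{a..b}. l \<le> m2 x) \<or> (\<forall>x\<in>{a..b}. m2 x \<le> - l)"
  shows "oscillatory_decay m a b"
  unfolding oscillatory_decay_def
proof (intro exI allI impI)
  fix p q t s :: real
  assume pq: "a \<le> p" "p \<le> q" "q \<le> b" and t: "0 < t"
  let ?f = "\<lambda>x. cis (t * m x + s * x)"
  have "norm (integral {p..q} ?f) \<le> 8 / sqrt (t * l)"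
  proof (rule van_der_corput_second[OF pq(2)])
    show "0 < t * l" using t l by simp
    show "continuous_on UNIV (\<lambda>x. t * m2 x)" by (intro continuous_intros c2)
    show "(\<forall>x\<in>{p..q}. t * l \<le> t * m2 x) \<or> (\<forall>x\<in>{p..q}. t * m2 x \<le> - (t * l))"
      using pq by (intro scaled_lower_bound[OF low t]) auto
  qed (rule phase_derivatives d1 d2)+
  also have "\<dots> = 8 / sqrt l * t powr (-1/2)"
    using t l by (simp add: real_sqrt_mult powr_minus powr_half_sqrt field_simps)
  finally have A: "norm (integral {p..q} ?f) \<le> 8 / sqrt l * t powr (-1/2)" .
  have "norm (integral {p..q} ?f) \<le> 1 * (q - p)"
    by (intro integral_bound pq continuous_intros)
      (use d1 in \<open>auto intro: DERIV_isCont continuous_at_imp_continuous_on\<close>)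
  then have B: "norm (integral {p..q} ?f) \<le> \<bar>b - a\<bar>" using pq by simp
  show "norm (integral {p..q} ?f) \<le> (\<bar>b - a\<bar> + 8 / sqrt l) * t powr (-1/3)"
  \<comment> \<open>For t \<le> 1 the rate t^(-1/2) exceeds t^(-1/3); there the trivial bound by the
    length of the interval takes over.\<close>
  proof (cases "t \<le> 1")
    case True
    then have "1 \<le> t powr (-1/3)" using t powr_mono2[of "1/3" t 1] by (simp add: powr_minus field_simps)
    then have "\<bar>b - a\<bar> * 1 \<le> (\<bar>b - a\<bar> + 8 / sqrt l) * t powr (-1/3)"
      using l by (intro mult_mono) auto
    then show ?thesis using B by simp
  next
    case False
    then have "t powr (-1/2) \<le> t powr (-1/3)" by (intro powr_mono) auto
    then have "8 / sqrt l * t powr (-1/2) \<le> (\<bar>b - a\<bar> + 8 / sqrt l) * t powr (-1/3)"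
      using l by (intro mult_mono) auto
    then show ?thesis using A by linarith
  qed
qed

lemma oscillatory_decay_third:
  fixes m m1 m2 m3 :: "real \<Rightarrow> real"
  assumes l: "0 < l"
    and d1: "\<And>x. (m has_real_derivative m1 x) (at x)"
    and d2: "\<And>x. (m1 has_real_derivative m2 x) (at x)"
    and d3: "\<And>x. (m2 has_real_derivative m3 x) (at x)"
    and low: "(\<forall>x\<in>{a..b}. l \<le> m3 x) \<or> (\<forall>x\<in>{a..b}. m3 x \<le> - l)"
  shows "oscillatory_decay m a b"
  unfolding oscillatory_decay_def
proof (intro exI allI impI)
  fix p q t s :: real
  assume pq: "a \<le> p" "p \<le> q" "q \<le> b" and t: "0 < t"
  have "norm (integral {p..q} (\<lambda>x. cis (t * m x + s * x))) \<le> 18 * (t * l) powr (-1/3)"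
  proof (rule van_der_corput_third[OF pq(2)])
    show "0 < t * l" using t l by simp
    show "(\<forall>x\<in>{p..q}. t * l \<le> t * m3 x) \<or> (\<forall>x\<in>{p..q}. t * m3 x \<le> - (t * l))"
      using pq by (intro scaled_lower_bound[OF low t]) auto
  qed (rule phase_derivatives d1 d2 d3)+
  then show "norm (integral {p..q} (\<lambda>x. cis (t * m x + s * x))) \<le> 18 * l powr (-1/3) * t powr (-1/3)"
    using t l by (simp add: powr_mult algebra_simps)
qed

text \<open>Integration by parts with the running integral \<open>E\<close> of the bare phase:
  \<open>E\<close> is small at every end point in [a, b], and the derivative falls on the amplitude,
  bounded with its derivative by compactness. For \<sigma> = -1, conjugating the phase also reverses
  the slope s, harmless because s is arbitrary.\<close>

lemma oscillatory_decay_amplitude: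
  assumes dec: "oscillatory_decay m a b" and ab: "a \<le> b"
    and m: "continuous_on UNIV m"
    and A: "\<And>x. (A has_vector_derivative A' x) (at x)" and A': "continuous_on UNIV A'"
  shows "\<exists>C. \<forall>q t s \<sigma>. q \<in> {a..b} \<longrightarrow> 0 < t \<longrightarrow> \<bar>\<sigma>\<bar> = 1 \<longrightarrow>
     norm (integral {a..q} (\<lambda>x. cis (\<sigma> * t * m x + s * x) * (A x :: complex))) \<le> C * t powr (-1/3)"
proof -
  obtain C where C: "\<And>p q t s. a \<le> p \<Longrightarrow> p \<le> q \<Longrightarrow> q \<le> b \<Longrightarrow> 0 < t \<Longrightarrow>
     norm (integral {p..q} (\<lambda>x. cis (t * m x + s * x))) \<le> C * t powr (-1/3)"
    using dec unfolding oscillatory_decay_def by metis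
  have cA: "continuous_on S A" for S
    using A by (intro continuous_at_imp_continuous_on) (auto intro: has_vector_derivative_continuous)
  have "bounded (A ` {a..b})" "bounded (A' ` {a..b})"
    by (intro compact_imp_bounded compact_continuous_image cA continuous_on_subset[OF A'] compact_Icc; simp)+
  then obtain M M' where M: "\<And>x. x \<in> {a..b} \<Longrightarrow> norm (A x) \<le> M"
    and M': "\<And>x. x \<in> {a..b} \<Longrightarrow> norm (A' x) \<le> M'"
    unfolding bounded_iff by (meson imageI)
  have M0: "0 \<le> M" "0 \<le> M'" using order.trans[OF norm_ge_zero M[of a]] order.trans[OF norm_ge_zero M'[of a]] ab by auto
  show ?thesis
  proof (intro exI allI impI)
    fix q t s \<sigma> :: real
    assume q: "q \<in> {a..b}" and t: "0 < t" and \<sigma>: "\<bar>\<sigma>\<bar> = 1"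
    let ?f = "\<lambda>x. cis (\<sigma> * t * m x + s * x)"
    define E where "E = (\<lambda>x. integral {a..x} ?f)"
    have cf: "continuous_on S ?f" for S
      by (intro continuous_intros continuous_on_subset[OF m]) auto
    have Eb: "norm (E x) \<le> C * t powr (-1/3)" if "x \<in> {a..b}" for x
    proof -
      consider "\<sigma> = 1" | "\<sigma> = -1" using \<sigma> by linarith
      then show ?thesis
      proof cases
        case 1
        then show ?thesis using C[of a x t s] that t by (simp add: E_def)
      next
        case 2
        then show ?thesis using C[of a x t "-s"] that t
            norm_integral_cis_uminus[of "{a..x}" "\<lambda>x. t * m x + (-s) * x"]
          by (simp add: E_def)
      qed
    qed
    have dE: "(E has_vector_derivative ?f x) (at x within {a..q})" if "x \<in> {a..q}" for x
      unfolding E_def using integral_has_vector_derivative[OF cf that] .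
    have cE: "continuous_on {a..q} E"
      using dE by (meson continuous_on_eq_continuous_within has_vector_derivative_continuous)
    have "((\<lambda>x. E x * A x) has_vector_derivative (E x * A' x + ?f x * A x)) (at x within {a..q})"
      if "x \<in> {a..q}" for x
      using has_vector_derivative_mult[OF dE[OF that] has_vector_derivative_at_within[OF A]] by simp
    then have "((\<lambda>x. E x * A' x + ?f x * A x) has_integral (E q * A q - E a * A a)) {a..q}"
      using q by (intro fundamental_theorem_of_calculus) auto
    then have 1: "integral {a..q} (\<lambda>x. E x * A' x + ?f x * A x) = E q * A q"
      by (simp add: integral_unique E_def)
    have i: "(\<lambda>x. E x * A' x) integrable_on {a..q}"
      by (intro integrable_continuous_interval continuous_intros cE continuous_on_subset[OF A']) auto
    have "(\<lambda>x. ?f x * A x) integrable_on {a..q}"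
      by (intro integrable_continuous_interval continuous_on_mult cf cA)
    then have "integral {a..q} (\<lambda>x. ?f x * A x) = E q * A q - integral {a..q} (\<lambda>x. E x * A' x)"
      using 1 i by (simp add: integral_add eq_diff_eq add.commute)
    then have "norm (integral {a..q} (\<lambda>x. ?f x * A x)) \<le> norm (E q * A q) + norm (integral {a..q} (\<lambda>x. E x * A' x))"
      by (simp add: norm_triangle_ineq4)
    also have "norm (E q * A q) \<le> C * t powr (-1/3) * M"
      unfolding norm_mult using q Eb[OF q] M0 by (intro mult_mono M Eb) (auto intro: order.trans[OF norm_ge_zero])
    also have "norm (integral {a..q} (\<lambda>x. E x * A' x)) \<le> (C * t powr (-1/3) * M') * (q - a)"
    proof (rule integral_bound)
      show "norm (E x * A' x) \<le> C * t powr (-1/3) * M'" if "x \<in> {a..q}" for x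
        unfolding norm_mult using q that Eb[of x] M0 by (intro mult_mono M' Eb) (auto intro: order.trans[OF norm_ge_zero])
    qed (use q in \<open>auto intro!: continuous_intros cE continuous_on_subset[OF A']\<close>)
    also have "\<dots> \<le> (C * t powr (-1/3) * M') * (b - a)"
      using q by (intro mult_left_mono mult_nonneg_nonneg[OF order.trans[OF norm_ge_zero Eb[OF q]] M0(2)]) auto
    finally show "norm (integral {a..q} (\<lambda>x. ?f x * A x)) \<le> (C * M + C * M' * (b - a)) * t powr (-1/3)"
      by (simp add: algebra_simps)
  qed
qed

section \<open>The symbol\<close>

text \<open>Three derivatives are what the phase estimates consume. A single constant for all orders
  lets the bounds of sums, products and series be computed by applying rules.\<close>

definition C3_le :: "(real \<Rightarrow> real) \<Rightarrow> real \<Rightarrow> bool" where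
  "C3_le f N \<longleftrightarrow> (\<exists>j :: nat \<Rightarrow> real \<Rightarrow> real. j 0 = f \<and>
     (\<forall>r<3. \<forall>x. (j r has_real_derivative j (Suc r) x) (at x)) \<and> (\<forall>r\<le>3. \<forall>x. \<bar>j r x\<bar> \<le> N))"

lemma Suc_2: "Suc 2 = 3" by simp

lemma less_3_cases: "(r::nat) < 3 \<longleftrightarrow> r = 0 \<or> r = 1 \<or> r = 2" by auto

lemma C3_leI:
  assumes "j 0 = f" "\<And>r x. r < 3 \<Longrightarrow> (j r has_real_derivative j (Suc r) x) (at x)"
    "\<And>r x. r \<le> 3 \<Longrightarrow> \<bar>j r x\<bar> \<le> N"
  shows "C3_le f N"
  using assms unfolding C3_le_def by blast

lemma C3_leE:
  assumes "C3_le f N"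
  obtains j where "j 0 = f" "\<And>r x. r < 3 \<Longrightarrow> (j r has_real_derivative j (Suc r) x) (at x)"
    "\<And>r x. r \<le> 3 \<Longrightarrow> \<bar>j r x\<bar> \<le> N"
  using assms unfolding C3_le_def by blast

lemma C3_le_mono:
  assumes "C3_le f N" "N \<le> M"
  shows "C3_le f M"
proof -
  from assms(1) obtain j where "j 0 = f" "\<And>r x. r < 3 \<Longrightarrow> (j r has_real_derivative j (Suc r) x) (at x)"
    "\<And>r x. r \<le> 3 \<Longrightarrow> \<bar>j r x\<bar> \<le> N" by (rule C3_leE) blast
  then show ?thesis
    using assms(2) by (intro C3_leI[of j]) (blast intro: order.trans)+
qed

lemma C3_le_abs: "C3_le f N \<Longrightarrow> \<bar>f x\<bar> \<le> N"
  unfolding C3_le_def by (metis le0)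

lemma C3_le_const: "C3_le (\<lambda>x. c) \<bar>c\<bar>"
  by (rule C3_leI[of "\<lambda>r x. if r = 0 then c else 0"]) auto

lemma C3_le_cos:
  assumes "1 \<le> k"
  shows "C3_le (\<lambda>x. cos (k * x)) (k ^ 3)"
\<comment> \<open>Each derivative of a cosine is a quarter-period shift, so one formula lists them
  all.\<close>
proof (rule C3_leI[of "\<lambda>r x. k ^ r * cos (k * x + real r * pi / 2)"])
  fix r :: nat and x
  have "cos (k * x + real (Suc r) * pi / 2) = - sin (k * x + real r * pi / 2)"
    by (simp add: algebra_simps add_divide_distrib cos_add sin_add)
  then show "((\<lambda>x. k ^ r * cos (k * x + real r * pi / 2)) has_real_derivative
      k ^ Suc r * cos (k * x + real (Suc r) * pi / 2)) (at x)"
    by (auto intro!: derivative_eq_intros)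
next
  fix r :: nat and x assume "r \<le> 3"
  have "\<bar>k ^ r\<bar> * \<bar>cos (k * x + real r * pi / 2)\<bar> \<le> k ^ 3 * 1"
    using assms \<open>r \<le> 3\<close> by (intro mult_mono) (auto intro: power_increasing)
  then show "\<bar>k ^ r * cos (k * x + real r * pi / 2)\<bar> \<le> k ^ 3" by (simp add: abs_mult)
qed auto

lemma C3_le_add:
  assumes "C3_le f N" "C3_le g M"
  shows "C3_le (\<lambda>x. f x + g x) (N + M)"
proof -
  from assms(1) obtain j where j: "j 0 = f" "\<And>r x. r < 3 \<Longrightarrow> (j r has_real_derivative j (Suc r) x) (at x)"
    "\<And>r x. r \<le> 3 \<Longrightarrow> \<bar>j r x\<bar> \<le> N" by (rule C3_leE) blast
  from assms(2) obtain k where k: "k 0 = g" "\<And>r x. r < 3 \<Longrightarrow> (k r has_real_derivative k (Suc r) x) (at x)"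
    "\<And>r x. r \<le> 3 \<Longrightarrow> \<bar>k r x\<bar> \<le> M" by (rule C3_leE) blast
  show ?thesis
    by (rule C3_leI[of "\<lambda>r x. j r x + k r x"])
      (use j k in \<open>auto intro!: derivative_eq_intros order.trans[OF abs_triangle_ineq] add_mono\<close>)
qed

lemma C3_le_cmult:
  assumes "C3_le f N"
  shows "C3_le (\<lambda>x. c * f x) (\<bar>c\<bar> * N)"
proof -
  from assms(1) obtain j where j: "j 0 = f" "\<And>r x. r < 3 \<Longrightarrow> (j r has_real_derivative j (Suc r) x) (at x)"
    "\<And>r x. r \<le> 3 \<Longrightarrow> \<bar>j r x\<bar> \<le> N" by (rule C3_leE) blast
  show ?thesis
    by (rule C3_leI[of "\<lambda>r x. c * j r x"])
      (use j in \<open>auto intro!: derivative_eq_intros mult_left_mono simp: abs_mult\<close>)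
qed

lemma C3_le_diff:
  assumes "C3_le f N" "C3_le g M"
  shows "C3_le (\<lambda>x. f x - g x) (N + M)"
  using C3_le_add[OF assms(1) C3_le_cmult[OF assms(2), of "-1"]] by simp

text \<open>The factor is 1 + 3 + 3 + 1, the sum of the Leibniz coefficients in the third
  derivative; the lower orders have smaller sums.\<close>

lemma C3_le_mult:
  assumes "C3_le f N" "C3_le g M"
  shows "C3_le (\<lambda>x. f x * g x) (8 * (N * M))"
proof -
  from assms(1) obtain j where j: "j 0 = f" "\<And>r x. r < 3 \<Longrightarrow> (j r has_real_derivative j (Suc r) x) (at x)"
    "\<And>r x. r \<le> 3 \<Longrightarrow> \<bar>j r x\<bar> \<le> N" by (rule C3_leE) blast
  from assms(2) obtain k where k: "k 0 = g" "\<And>r x. r < 3 \<Longrightarrow> (k r has_real_derivative k (Suc r) x) (at x)"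
    "\<And>r x. r \<le> 3 \<Longrightarrow> \<bar>k r x\<bar> \<le> M" by (rule C3_leE) blast
  define p where "p = (\<lambda>(r::nat) x. if r = 0 then j 0 x * k 0 x else if r = 1 then j 1 x * k 0 x + j 0 x * k 1 x
     else if r = 2 then j 2 x * k 0 x + 2 * (j 1 x * k 1 x) + j 0 x * k 2 x
     else j 3 x * k 0 x + 3 * (j 2 x * k 1 x) + 3 * (j 1 x * k 2 x) + j 0 x * k 3 x)"
  have p': "p 0 = (\<lambda>x. j 0 x * k 0 x)" "p (Suc 0) = (\<lambda>x. j 1 x * k 0 x + j 0 x * k 1 x)"
    "p 2 = (\<lambda>x. j 2 x * k 0 x + 2 * (j 1 x * k 1 x) + j 0 x * k 2 x)"
    "p 3 = (\<lambda>x. j 3 x * k 0 x + 3 * (j 2 x * k 1 x) + 3 * (j 1 x * k 2 x) + j 0 x * k 3 x)"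
    by (auto simp: p_def fun_eq_iff)
  then have p1: "p 1 = (\<lambda>x. j 1 x * k 0 x + j 0 x * k 1 x)" by simp
  have dj: "(j 0 has_real_derivative j 1 x) (at x)" "(j 1 has_real_derivative j 2 x) (at x)"
     "(j 2 has_real_derivative j 3 x) (at x)" for x
    using j(2)[of 0 x] j(2)[of 1 x] j(2)[of 2 x] by (simp_all add: numeral_2_eq_2 numeral_3_eq_3)
  have dk: "(k 0 has_real_derivative k 1 x) (at x)" "(k 1 has_real_derivative k 2 x) (at x)"
     "(k 2 has_real_derivative k 3 x) (at x)" for x
    using k(2)[of 0 x] k(2)[of 1 x] k(2)[of 2 x] by (simp_all add: numeral_2_eq_2 numeral_3_eq_3)
  have "(p 0 has_real_derivative p 1 x) (at x)" "(p 1 has_real_derivative p 2 x) (at x)"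
    "(p 2 has_real_derivative p 3 x) (at x)" for x
    unfolding p' p1 by (rule derivative_eq_intros dj dk refl | simp add: algebra_simps)+
  then have d: "(p r has_real_derivative p (Suc r) x) (at x)" if "r < 3" for r x
    using that unfolding less_3_cases by (auto simp: numeral_eq_Suc)
  have b: "\<bar>j r x * k s x\<bar> \<le> N * M" if "r \<le> 3" "s \<le> 3" for r s x
    using j(3)[OF that(1), of x] k(3)[OF that(2), of x] unfolding abs_mult by (intro mult_mono) auto
  have NM: "0 \<le> N * M" using b[of 0 0 undefined] by linarith
  have "\<bar>p r x\<bar> \<le> 8 * (N * M)" if "r \<le> 3" for r x
  proof -
    have "r = 0 \<or> r = 1 \<or> r = 2 \<or> r = 3" using that by auto
    then show ?thesis
      using NM b[of 0 0 x] b[of 1 0 x] b[of 0 1 x] b[of 2 0 x] b[of 1 1 x] b[of 0 2 x]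
        b[of 3 0 x] b[of 2 1 x] b[of 1 2 x] b[of 0 3 x]
      by (elim disjE) (simp_all add: p' abs_le_iff)
  qed
  with d show ?thesis
    by (intro C3_leI[of p]) (auto simp: p' j k)
qed

lemma C3_le_sum:
  "finite A \<Longrightarrow> (\<And>i. i \<in> A \<Longrightarrow> C3_le (f i) (N i)) \<Longrightarrow> C3_le (\<lambda>x. \<Sum>i\<in>A. f i x) (\<Sum>i\<in>A. N i)"
proof (induction A rule: finite_induct)
  case empty
  then show ?case using C3_le_const[of 0] by simp
next
  case (insert i A)
  then show ?case by (simp add: C3_le_add)
qed

text \<open>Termwise differentiation by the Weierstrass M-test, once for each order, with the same
  majorant \<open>M\<close>.\<close>

lemma C3_le_suminf:
  assumes f: "\<And>n. C3_le (f n) (M n)" and M: "summable M"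
  shows "C3_le (\<lambda>x. \<Sum>n. f n x) (suminf M)"
proof -
  have "\<forall>n. \<exists>j. j 0 = f n \<and> (\<forall>r<3. \<forall>x. (j r has_real_derivative j (Suc r) x) (at x)) \<and> (\<forall>r\<le>3. \<forall>x. \<bar>j r x\<bar> \<le> M n)"
    using f unfolding C3_le_def by blast
  then obtain j where j: "\<And>n. j n 0 = f n" "\<And>n r x. r < 3 \<Longrightarrow> (j n r has_real_derivative j n (Suc r) x) (at x)"
    "\<And>n r x. r \<le> 3 \<Longrightarrow> \<bar>j n r x\<bar> \<le> M n" by metis
  have sm: "summable (\<lambda>n. j n r x)" if "r \<le> 3" for r x
    using j(3)[OF that] by (intro summable_comparison_test'[OF M]) auto
  show ?thesis
  proof (rule C3_leI[of "\<lambda>r x. \<Sum>n. j n r x"])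
    fix r :: nat and x assume r: "r < 3"
    have uc: "uniformly_convergent_on UNIV (\<lambda>n x. \<Sum>i<n. j i (Suc r) x)"
      by (rule Weierstrass_m_test'[OF _ M]) (use j(3)[of "Suc r"] r in auto)
    show "((\<lambda>x. \<Sum>n. j n r x) has_real_derivative (\<Sum>n. j n (Suc r) x)) (at x)"
      by (rule has_field_derivative_series'[OF _ _ uc, of _ 0]) (use r sm j(2) in \<open>auto intro: has_field_derivative_at_within\<close>)
  next
    fix r :: nat and x assume r: "r \<le> 3"
    have "\<bar>\<Sum>n. j n r x\<bar> \<le> (\<Sum>n. \<bar>j n r x\<bar>)"
      using j(3)[OF r] by (intro summable_rabs summable_comparison_test'[OF M]) auto
    also have "\<dots> \<le> suminf M"
      using j(3)[OF r] by (intro suminf_le M summable_comparison_test'[OF M]) auto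
    finally show "\<bar>\<Sum>n. j n r x\<bar> \<le> suminf M" .
  qed (simp add: j)
qed

text \<open>This is k times the Fejer kernel, as a sum of Dirichlet kernels. It stands for (1 - cos
  (k x)) / (1 - cos x) in a form that is smooth where the denominator vanishes.\<close>

definition fejer :: "nat \<Rightarrow> real \<Rightarrow> real" where
  "fejer k x = (\<Sum>i<k. 1 + (\<Sum>j=1..i. 2 * cos (real j * x)))"

lemma fejer_mult: "(1 - cos x) * fejer k x = 1 - cos (real k * x)"
proof -
  \<comment> \<open>A Dirichlet kernel times 1 - cos x is a difference of consecutive cosines, so
    the sum over i telescopes.\<close>
  have D: "(1 - cos x) * (1 + (\<Sum>j=1..i. 2 * cos (real j * x))) = cos (real i * x) - cos (real (Suc i) * x)" for i
  proof (induction i)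
    case (Suc i)
    have "cos (real (Suc i) * x + x) + cos (real (Suc i) * x - x) = 2 * cos (real (Suc i) * x) * cos x"
      by (simp add: cos_add cos_diff)
    moreover have "real (Suc i) * x + x = real (Suc (Suc i)) * x" "real (Suc i) * x - x = real i * x"
      by (simp_all add: algebra_simps)
    ultimately have "2 * cos (real (Suc i) * x) * cos x = cos (real (Suc (Suc i)) * x) + cos (real i * x)" by simp
    then have "(1 - cos x) * (2 * cos (real (Suc i) * x)) = 2 * cos (real (Suc i) * x) - cos (real (Suc (Suc i)) * x) - cos (real i * x)"
      by (simp only: left_diff_distrib) (simp add: mult_ac)
    with Suc show ?case by (simp add: distrib_left del: of_nat_Suc)
  qed simp
  show ?thesis
    unfolding fejer_def sum_distrib_left D
    using sum_lessThan_telescope'[of "\<lambda>i. cos (real i * x)" k] by simp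
qed

lemma fejer_mult': "cos (real k * x) = 1 - (1 - cos x) * fejer k x"
  unfolding fejer_mult by simp

text \<open>Termwise estimates give the polynomial 2 + m + 2 (m + 1)^5. It is enlarged to a
  geometric bound, 32 = 2^5 coming from m + 1 \<le> 2^m, because the tails are summed as geometric
  series.\<close>

lemma fejer_C3_le: "C3_le (fejer (Suc (Suc m))) (6 * 32 ^ m)"
proof -
  let ?k = "Suc (Suc m)"
  have "C3_le (fejer ?k) (\<Sum>i<?k. 1 + (\<Sum>j=1..i. 2 * real j ^ 3))"
    unfolding fejer_def
    by (intro C3_le_sum C3_le_add C3_le_const[of 1, simplified] C3_le_cmult[of _ _ 2, simplified] C3_le_cos) auto
  then show ?thesis
  proof (rule C3_le_mono)
    have "1 + (\<Sum>j=1..i. 2 * real j ^ 3) \<le> 1 + 2 * real i ^ 4" for i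
    proof -
      have "(\<Sum>j=1..i. 2 * real j ^ 3) \<le> real (card {1..i}) * (2 * real i ^ 3)"
        by (intro sum_bounded_above) (auto intro: power_mono)
      then show ?thesis by (simp add: power_numeral_reduce)
    qed
    then have "(\<Sum>i<?k. 1 + (\<Sum>j=1..i. 2 * real j ^ 3)) \<le> (\<Sum>i<?k. 1 + 2 * real i ^ 4)"
      by (intro sum_mono)
    also have "\<dots> = 1 + (\<Sum>i<Suc m. 1 + 2 * real (Suc i) ^ 4)"
      by (subst sum.lessThan_Suc_shift) simp
    also have "\<dots> \<le> 1 + real (card {..<Suc m}) * (1 + 2 * real (Suc m) ^ 4)"
      by (intro add_left_mono sum_bounded_above) (auto intro!: power_mono)
    also have "\<dots> = 2 + real m + 2 * real (Suc m) ^ 5"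
      by (simp add: power_numeral_reduce algebra_simps)
    also have "\<dots> \<le> 2 * 32 ^ m + 2 * 32 ^ m + 2 * 32 ^ m"
    proof (intro add_mono)
      have s: "real (Suc m) \<le> 2 ^ m" using of_nat_mono[OF Suc_leI[OF less_exp[of m]]] by simp
      have "real (Suc m) ^ 5 \<le> (2 ^ m) ^ 5" by (intro power_mono s) auto
      also have "\<dots> = ((2::real) ^ 5) ^ m" by (simp only: power_mult[symmetric] mult.commute)
      also have "\<dots> = (32::real) ^ m" by simp
      finally show "2 * real (Suc m) ^ 5 \<le> 2 * 32 ^ m" by simp
      have "(2::real) ^ m \<le> 32 ^ m" by (intro power_mono) auto
      then show "real m \<le> 2 * 32 ^ m" using s by simp
      show "(2::real) \<le> 2 * 32 ^ m" by simp
    qed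
    finally show "(\<Sum>i<?k. 1 + (\<Sum>j=1..i. 2 * real j ^ 3)) \<le> 6 * 32 ^ m" by simp
  qed
qed

section \<open>Size of the nome and tails of the theta series\<close>

definition nome :: real where "nome = exp (- (pi\<^sup>2 / \<gamma>\<^sup>2))"

lemma gamma_pos: "0 < \<gamma>" and gamma_sq: "\<gamma>\<^sup>2 = 2 * pi / sqrt 3"
  by (simp_all add: \<gamma>_def)

lemma pi_sq_gamma_sq: "pi\<^sup>2 / \<gamma>\<^sup>2 = pi * sqrt 3 / 2"
  unfolding gamma_sq by (simp add: power2_eq_square)

lemma nome_power: "exp (- pi\<^sup>2 * (real n)\<^sup>2 / \<gamma>\<^sup>2) = nome ^ (n\<^sup>2)"
  by (simp add: nome_def exp_of_nat_mult[symmetric] field_simps)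

text \<open>The exponent pi sqrt 3 / 2 lies between 27/10 and 11/4. Raising to the powers 10 and 4
  clears the denominators and leaves integer powers of e, compared through 2.71 \<le> e \<le>
  2.72.\<close>

lemma nome_bounds: "6/100 \<le> nome" "nome \<le> 7/100"
proof -
  have s3: "173/100 \<le> sqrt 3" "sqrt 3 \<le> 174/100"
    by (rule real_le_rsqrt real_le_lsqrt; simp add: power2_eq_square)+
  have pi: "314/100 \<le> pi" "pi \<le> 315/100" using pi_approx by simp_all
  have "27/10 \<le> pi * sqrt 3 / 2"
    using mult_mono[OF pi(1) s3(1)] by simp
  moreover have "pi * sqrt 3 / 2 \<le> 11/4"
    using mult_mono[OF pi(2) s3(2)] by simp
  ultimately have n: "nome \<le> exp (- (27/10))" "exp (- (11/4)) \<le> nome"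
    unfolding nome_def pi_sq_gamma_sq by simp_all
  have e: "exp (1::real) \<le> 272/100" "271/100 \<le> exp (1::real)"
    using e_less_272 e_approx_32 by (simp_all add: abs_if split: if_splits)
  have "nome ^ 10 \<le> exp (- (27/10)) ^ 10" using n(1) by (intro power_mono) (auto simp: nome_def)
  also have "\<dots> = 1 / exp 1 ^ 27"
    by (simp add: exp_of_nat_mult[symmetric] exp_minus field_simps)
  also have "\<dots> \<le> 1 / (271/100) ^ 27" using e(2) by (intro divide_left_mono power_mono) auto
  also have "\<dots> \<le> (7/100) ^ 10" by (simp only: power_divide) simp
  finally show "nome \<le> 7/100" by (rule power_le_imp_le_base[of nome 9, unfolded Suc_eq_plus1, simplified]) simp
  have "(6/100) ^ 4 \<le> 1 / (272/100::real) ^ 11" by (simp only: power_divide) simp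
  also have "\<dots> \<le> 1 / exp 1 ^ 11" using e(1) by (intro divide_left_mono power_mono) auto
  also have "\<dots> = exp (- (11/4)) ^ 4"
    by (simp add: exp_of_nat_mult[symmetric] exp_minus field_simps)
  also have "\<dots> \<le> nome ^ 4" using n(2) by (intro power_mono) auto
  finally show "6/100 \<le> nome" by (rule power_le_imp_le_base[of _ 3, unfolded Suc_eq_plus1, simplified]) (simp add: nome_def)
qed

lemma C3_le_geometric_series:
  assumes f: "\<And>n. C3_le (f n) (A * c ^ n)" and c: "0 \<le> c" "c < 1"
  shows "C3_le (\<lambda>x. \<Sum>n. f n x) (A / (1 - c))" "summable (\<lambda>n. f n x)"
proof -
  have s: "summable (\<lambda>n. A * c ^ n)" using c by (intro summable_mult summable_geometric) auto
  have "(\<Sum>n. A * c ^ n) = A / (1 - c)"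
    using c suminf_mult[of "\<lambda>n. c ^ n" A] suminf_geometric[of c] by (simp add: summable_geometric)
  then show "C3_le (\<lambda>x. \<Sum>n. f n x) (A / (1 - c))" using C3_le_suminf[OF f s] by simp
  show "summable (\<lambda>n. f n x)"
    using C3_le_abs[OF f] by (intro summable_comparison_test'[OF s, of 0]) auto
qed

text \<open>Both theta series have this form after their leading cosine, with x standing for 2 pi
  \<xi>: the identity as m gives the frequencies 2, 3, 4, ... of \<open>ell\<close>, and 2 n + 1
  gives the frequencies 3, 5, 7, ... of \<open>hh\<close>.\<close>

definition cos_tail :: "(nat \<Rightarrow> nat) \<Rightarrow> real \<Rightarrow> real" where
  "cos_tail m x = (\<Sum>n. 2 * nome ^ ((m n + 2)\<^sup>2) * cos (real (m n + 2) * x))"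

text \<open>The increment of \<open>cos_tail\<close> between 0 and x divided by 2
  \<open>nome\<close> (1 - cos x). The exponent is lowered by one because a factor
  \<open>nome\<close> is taken out, in common with the leading cosine.\<close>

definition fejer_tail :: "(nat \<Rightarrow> nat) \<Rightarrow> real \<Rightarrow> real" where
  "fejer_tail m x = (\<Sum>n. nome ^ ((m n + 2)\<^sup>2 - 1) * fejer (m n + 2) x)"

lemma nome_pos: "0 < nome" by (simp add: nome_def)

lemma nome_power_le: "nome ^ k \<le> (7/100) ^ k"
  using nome_bounds nome_pos by (intro power_mono) auto

lemma nome_power3: "nome ^ 3 \<le> 343/1000000" and nome_power4: "nome ^ 4 \<le> 2401/100000000"
  using nome_power_le[of 3] nome_power_le[of 4] by (simp_all only: power_divide) simp_all

text \<open>(m + 2)^2 \<ge> 4 + 4 m trades Gaussian for geometric decay, and (m + 2)^3 \<le> 8 * 8^m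
  does the same for the cost of three derivatives. The ratio is then 8 nome^4 \<le> 1/100 and the
  constant 16 nome^4.\<close>

lemma cos_tail_term:
  assumes "n \<le> m"
  shows "C3_le (\<lambda>x. 2 * nome ^ ((m + 2)\<^sup>2) * cos (real (m + 2) * x)) (39/100000 * (1/100) ^ n)"
proof (rule C3_le_mono[OF C3_le_cmult[OF C3_le_cos]])
  have "real m + 2 \<le> 2 * 2 ^ m" using of_nat_mono[OF Suc_leI[OF less_exp[of m]], where 'a = real] one_le_power[of "2::real" m] by simp
  then have "real (m + 2) ^ 3 \<le> (2 * 2 ^ m) ^ 3" by (intro power_mono) auto
  also have "\<dots> = 8 * ((2::real) ^ 3) ^ m" by (simp only: power_mult_distrib power_mult[symmetric] mult.commute) simp
  finally have k: "real (m + 2) ^ 3 \<le> 8 * 8 ^ m" by simp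
  have "nome ^ ((m + 2)\<^sup>2) \<le> nome ^ (4 + 4 * m)"
    using nome_pos nome_bounds by (intro power_decreasing) (auto simp: power2_eq_square)
  then have "\<bar>2 * nome ^ ((m + 2)\<^sup>2)\<bar> * real (m + 2) ^ 3 \<le> 2 * nome ^ (4 + 4 * m) * (8 * 8 ^ m)"
    using k nome_pos by (intro mult_mono) auto
  also have "\<dots> = 16 * nome ^ 4 * (8 * nome ^ 4) ^ m"
    by (simp add: power_add power_mult power_mult_distrib)
  also have "\<dots> \<le> 39/100000 * (1/100) ^ m"
    using nome_power4 nome_pos by (intro mult_mono power_mono) auto
  also have "\<dots> \<le> 39/100000 * (1/100) ^ n"
    using assms by (intro mult_left_mono power_decreasing) auto
  finally show "\<bar>2 * nome ^ ((m + 2)\<^sup>2)\<bar> * real (m + 2) ^ 3 \<le> 39/100000 * (1/100) ^ n" .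
qed simp

text \<open>As for the cosines, now with (m + 2)^2 - 1 \<ge> 3 + 3 m, ratio 32 nome^3 \<le> 1/50 and
  constant 6 nome^3.\<close>

lemma fejer_tail_term:
  assumes "n \<le> m"
  shows "C3_le (\<lambda>x. nome ^ ((m + 2)\<^sup>2 - 1) * fejer (m + 2) x) (206/100000 * (1/50) ^ n)"
proof -
  have "C3_le (\<lambda>x. nome ^ ((m + 2)\<^sup>2 - 1) * fejer (m + 2) x) (\<bar>nome ^ ((m + 2)\<^sup>2 - 1)\<bar> * (6 * 32 ^ m))"
    using C3_le_cmult[OF fejer_C3_le[of m]] by simp
  then show ?thesis
  proof (rule C3_le_mono)
    have "nome ^ ((m + 2)\<^sup>2 - 1) \<le> nome ^ (3 + 3 * m)"
      using nome_pos nome_bounds by (intro power_decreasing) (auto simp: power2_eq_square)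
    then have "\<bar>nome ^ ((m + 2)\<^sup>2 - 1)\<bar> * (6 * 32 ^ m) \<le> nome ^ (3 + 3 * m) * (6 * 32 ^ m)"
      using nome_pos by (intro mult_mono) auto
    also have "\<dots> = 6 * nome ^ 3 * (32 * nome ^ 3) ^ m"
      by (simp add: power_add power_mult power_mult_distrib)
    also have "\<dots> \<le> 206/100000 * (1/50) ^ m"
      using nome_power3 nome_pos by (intro mult_mono power_mono) auto
    also have "\<dots> \<le> 206/100000 * (1/50) ^ n"
      using assms by (intro mult_left_mono power_decreasing) auto
    finally show "\<bar>nome ^ ((m + 2)\<^sup>2 - 1)\<bar> * (6 * 32 ^ m) \<le> 206/100000 * (1/50) ^ n" .
  qed
qed

lemma cosine_tails:
  assumes m: "\<And>n. n \<le> m n"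
  shows cos_tail_C3: "C3_le (cos_tail m) (5/10000)"
    and fejer_tail_C3: "C3_le (fejer_tail m) (22/10000)"
    and cos_tail_summable: "summable (\<lambda>n. 2 * nome ^ ((m n + 2)\<^sup>2) * cos (real (m n + 2) * x))"
    and cos_tail_diff: "cos_tail m 0 - cos_tail m x = 2 * nome * (1 - cos x) * fejer_tail m x"
proof -
  note c = C3_le_geometric_series[OF cos_tail_term[OF m], simplified]
  note f = C3_le_geometric_series[OF fejer_tail_term[OF m], simplified]
  show "C3_le (cos_tail m) (5/10000)" "C3_le (fejer_tail m) (22/10000)"
    unfolding cos_tail_def fejer_tail_def
    using c(1) f(1) by (auto intro: C3_le_mono)
  show s: "summable (\<lambda>n. 2 * nome ^ ((m n + 2)\<^sup>2) * cos (real (m n + 2) * x))" for x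
    using c(2)[of x] by simp
  have sf: "summable (\<lambda>n. nome ^ ((m n + 2)\<^sup>2 - 1) * fejer (m n + 2) x)"
    using f(2)[of x] by simp
  have "cos_tail m 0 - cos_tail m x = (\<Sum>n. 2 * nome ^ ((m n + 2)\<^sup>2) * cos (real (m n + 2) * 0) - 2 * nome ^ ((m n + 2)\<^sup>2) * cos (real (m n + 2) * x))"
    unfolding cos_tail_def by (rule suminf_diff[OF s s])
  also have "\<dots> = (\<Sum>n. 2 * nome * (1 - cos x) * (nome ^ ((m n + 2)\<^sup>2 - 1) * fejer (m n + 2) x))"
  proof (rule suminf_cong)
    fix n
    have "nome ^ ((m n + 2)\<^sup>2) = nome * nome ^ ((m n + 2)\<^sup>2 - 1)"
      by (subst power_Suc[symmetric]) (simp add: power2_eq_square)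
    then show "2 * nome ^ ((m n + 2)\<^sup>2) * cos (real (m n + 2) * 0) - 2 * nome ^ ((m n + 2)\<^sup>2) * cos (real (m n + 2) * x)
       = 2 * nome * (1 - cos x) * (nome ^ ((m n + 2)\<^sup>2 - 1) * fejer (m n + 2) x)"
      unfolding fejer_mult'[of "m n + 2" x] by (simp add: algebra_simps)
  qed
  also have "\<dots> = 2 * nome * (1 - cos x) * fejer_tail m x"
    unfolding fejer_tail_def by (rule suminf_mult[OF sf])
  finally show "cos_tail m 0 - cos_tail m x = 2 * nome * (1 - cos x) * fejer_tail m x" .
qed

lemma ell_eq: "ell \<xi> = 1 + 2 * nome * cos (2 * pi * \<xi>) + cos_tail (\<lambda>n. n) (2 * pi * \<xi>)"
proof -
  let ?f = "\<lambda>j. exp (- pi\<^sup>2 * (real (Suc j))\<^sup>2 / \<gamma>\<^sup>2) * cos (2 * pi * real (Suc j) * \<xi>)"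
  have f: "2 * ?f (Suc j) = 2 * nome ^ ((j + 2)\<^sup>2) * cos (real (j + 2) * (2 * pi * \<xi>))" for j
    unfolding nome_power by (simp add: mult_ac)
  have "summable (\<lambda>j. 2 * ?f (Suc j))"
    unfolding f using cos_tail_summable[of "\<lambda>n. n" "2 * pi * \<xi>"] by simp
  then have s1: "summable (\<lambda>j. ?f (Suc j))" by (subst (asm) summable_cmult_iff) simp
  then have s: "summable ?f" by (subst (asm) summable_Suc_iff)
  have "cos_tail (\<lambda>n. n) (2 * pi * \<xi>) = (\<Sum>j. 2 * ?f (Suc j))"
    unfolding cos_tail_def f ..
  also have "\<dots> = 2 * (suminf ?f - ?f 0)"
    using suminf_mult[OF s1, of 2] suminf_split_head[OF s] by simp
  also have "?f 0 = nome * cos (2 * pi * \<xi>)" unfolding nome_power by simp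
  finally show ?thesis unfolding ell_def by simp
qed

lemma hh_eq: "hh \<xi> = 2 * nome * cos (2 * pi * \<xi>) + cos_tail (\<lambda>n. 2 * n + 1) (2 * pi * \<xi>)"
proof -
  let ?f = "\<lambda>k. exp (- pi\<^sup>2 * (2 * real k + 1)\<^sup>2 / \<gamma>\<^sup>2) * cos (2 * (2 * real k + 1) * pi * \<xi>)"
  have e: "exp (- pi\<^sup>2 * (2 * real k + 1)\<^sup>2 / \<gamma>\<^sup>2) = nome ^ ((2 * k + 1)\<^sup>2)" for k
    using nome_power[of "2 * k + 1"] by (simp add: add.commute)
  have f: "2 * ?f (Suc j) = 2 * nome ^ ((2 * j + 1 + 2)\<^sup>2) * cos (real (2 * j + 1 + 2) * (2 * pi * \<xi>))" for j
    unfolding e by (simp add: mult_ac)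
  have "summable (\<lambda>j. 2 * ?f (Suc j))"
    unfolding f using cos_tail_summable[of "\<lambda>n. 2 * n + 1" "2 * pi * \<xi>"] by simp
  then have s1: "summable (\<lambda>j. ?f (Suc j))" by (subst (asm) summable_cmult_iff) simp
  then have s: "summable ?f" by (subst (asm) summable_Suc_iff)
  have "cos_tail (\<lambda>n. 2 * n + 1) (2 * pi * \<xi>) = (\<Sum>j. 2 * ?f (Suc j))"
    unfolding cos_tail_def f ..
  also have "\<dots> = 2 * (suminf ?f - ?f 0)"
    using suminf_mult[OF s1, of 2] suminf_split_head[OF s] by simp
  also have "?f 0 = nome * cos (2 * pi * \<xi>)" unfolding e by simp
  finally show ?thesis unfolding hh_def by simp
qed

text \<open>With p and r the Fejer quotients of \<open>hh\<close> and \<open>ell\<close>, a - b is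
  proportional to 2 (1 + p)^2 - (1 + r)^2; this is that expression minus its leading value
  1.\<close>

definition defect_diff :: "real \<Rightarrow> real" where
  "defect_diff x = (let p = fejer_tail (\<lambda>n. 2 * n + 1) x; r = fejer_tail (\<lambda>n. n) x
     in 4 * p + 2 * (p * p) - 2 * r - r * r)"

text \<open>The remainder of (a + b) \<gamma> sqrt pi / 2 after 1 + 4 \<open>nome\<close> cos x,
  expanded so that each summand carries \<open>nome\<close>^2 or a tail.\<close>

definition defect_sum :: "real \<Rightarrow> real" where
  "defect_sum x = (let l0 = cos_tail (\<lambda>n. n) 0; h0 = cos_tail (\<lambda>n. 2 * n + 1) 0;
     u = cos_tail (\<lambda>n. n) x + l0; w = cos_tail (\<lambda>n. 2 * n + 1) x + h0
     in nome\<^sup>2 * (1 - 4 * cos x - cos (2 * x)) + (2 + 2 * nome) * u + (2 * nome) * (cos x * u) + 1/2 * (u * u)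
       - (2 * (1 + 2 * nome) * l0 + l0 * l0) - (4 * nome) * w - (4 * nome) * (cos x * w) - w * w + (8 * nome * h0 + 2 * (h0 * h0)))"

text \<open>The theta terms of a - b combine to 2 (hh 0 - hh \<xi>)^2 - (ell 0 - ell \<xi>)^2, and
  both increments contain (1 - cos x) \<open>nome\<close>. Each increment vanishes to second order
  at the integers, hence each square to fourth.\<close>

lemma symbol_diff:
  "coeff_a \<xi> - coeff_b \<xi> =
    4 / (\<gamma> * sqrt pi) * ((1 - cos (2 * pi * \<xi>)) * nome)\<^sup>2 * (1 + defect_diff (2 * pi * \<xi>))"
proof -
  let ?x = "2 * pi * \<xi>"
  have l: "ell 0 - ell \<xi> = (1 - cos ?x) * nome * (2 * (1 + fejer_tail (\<lambda>n. n) ?x))"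
    using cos_tail_diff[of "\<lambda>n. n" ?x] unfolding ell_eq by (simp add: algebra_simps)
  have h: "hh 0 - hh \<xi> = (1 - cos ?x) * nome * (2 * (1 + fejer_tail (\<lambda>n. 2 * n + 1) ?x))"
    using cos_tail_diff[of "\<lambda>n. 2 * n + 1" ?x] unfolding hh_eq by (simp add: algebra_simps)
  have "coeff_a \<xi> - coeff_b \<xi> = 1 / (\<gamma> * sqrt pi) * (2 * (hh 0 - hh \<xi>)\<^sup>2 - (ell 0 - ell \<xi>)\<^sup>2)"
    unfolding coeff_a_def coeff_b_def lam_def by (simp add: power2_eq_square algebra_simps)
  also have "\<dots> = 4 / (\<gamma> * sqrt pi) * ((1 - cos ?x) * nome)\<^sup>2 * (1 + defect_diff ?x)"
    unfolding l h power_mult_distrib[of _ "2 * _"] defect_diff_def Let_def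
    by (simp add: power2_eq_square algebra_simps)
  finally show ?thesis .
qed

lemma symbol_sum:
  "coeff_a \<xi> + coeff_b \<xi> =
    2 / (\<gamma> * sqrt pi) * (1 + 4 * nome * cos (2 * pi * \<xi>) + defect_sum (2 * pi * \<xi>))"
proof -
  let ?x = "2 * pi * \<xi>"
  have poly: "(1 + 2 * q * x + L + (1 + 2 * q + l))\<^sup>2 - 2 * (1 + 2 * q + l)\<^sup>2 - 2 * (2 * q * x + H + (2 * q + h))\<^sup>2 + 4 * (2 * q + h)\<^sup>2
     = 2 * (1 + 4 * q * x + (q\<^sup>2 * (1 - 4 * x - (2 * x\<^sup>2 - 1)) + (2 + 2 * q) * (L + l) + (2 * q) * (x * (L + l)) + 1/2 * ((L + l) * (L + l))
       - (2 * (1 + 2 * q) * l + l * l) - (4 * q) * (H + h) - (4 * q) * (x * (H + h)) - (H + h) * (H + h) + (8 * q * h + 2 * (h * h))))"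
    for q x L l H h :: real
    by (simp add: power2_eq_square field_simps)
  \<comment> \<open>The mirror image of the completed squares of a - b, with sums in place of
    increments; the corrections at 0 account for \<open>lam\<close>.\<close>
  have "coeff_a \<xi> + coeff_b \<xi> = 1 / (\<gamma> * sqrt pi) *
     ((ell \<xi> + ell 0)\<^sup>2 - 2 * (ell 0)\<^sup>2 - 2 * (hh \<xi> + hh 0)\<^sup>2 + 4 * (hh 0)\<^sup>2)"
    unfolding coeff_a_def coeff_b_def lam_def by (simp add: power2_eq_square algebra_simps)
  also have "\<dots> = 1 / (\<gamma> * sqrt pi) * (2 * (1 + 4 * nome * cos ?x + defect_sum ?x))"
    using poly[of nome "cos ?x"] unfolding ell_eq hh_eq defect_sum_def Let_def cos_double_cos by simp
  finally show ?thesis by simp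
qed

section \<open>Error bounds for the radicand of \<mu>\<close>

lemma C3_le_cos1: "C3_le cos 1" and C3_le_cos2: "C3_le (\<lambda>x. cos (2 * x)) 8"
  using C3_le_cos[of 1] C3_le_cos[of 2] by simp_all

lemma cos_tail_at_le: "(\<And>n. n \<le> m n) \<Longrightarrow> \<bar>cos_tail m x\<bar> \<le> 5/10000"
  using C3_le_abs[OF cos_tail_C3] by blast

lemma C3_le_const_bound: "\<bar>c\<bar> \<le> N \<Longrightarrow> C3_le (\<lambda>x. c) N"
  using C3_le_const C3_le_mono by blast

lemma defect_diff_C3: "C3_le defect_diff (1333/100000)"
proof -
  have 1: "C3_le (fejer_tail (\<lambda>n. n)) (22/10000)" "C3_le (fejer_tail (\<lambda>n. 2 * n + 1)) (22/10000)"
    by (rule fejer_tail_C3; simp)+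
  show ?thesis
    unfolding defect_diff_def Let_def
    by (rule C3_le_mono, (rule 1 C3_le_add C3_le_diff C3_le_cmult C3_le_mult)+) simp
qed

lemma defect_sum_C3: "C3_le defect_sum (71/1000)"
proof -
  let ?l = "cos_tail (\<lambda>n. n)" and ?h = "cos_tail (\<lambda>n. 2 * n + 1)"
  have q: "0 < nome" "nome \<le> 7/100" using nome_pos nome_bounds by auto
  have 1: "C3_le ?l (5/10000)" "C3_le ?h (5/10000)" by (rule cos_tail_C3; simp)+
  have l0: "\<bar>?l 0\<bar> \<le> 5/10000" "\<bar>?h 0\<bar> \<le> 5/10000" by (rule cos_tail_at_le; simp)+
  have u: "C3_le (\<lambda>x. ?l x + ?l 0) (1/1000)" "C3_le (\<lambda>x. ?h x + ?h 0) (1/1000)"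
    by (rule C3_le_mono[OF C3_le_add[OF 1(1) C3_le_const_bound[OF l0(1)]]], simp)
      (rule C3_le_mono[OF C3_le_add[OF 1(2) C3_le_const_bound[OF l0(2)]]], simp)
  have sq: "\<bar>?l 0 * ?l 0\<bar> \<le> 5/10000 * (5/10000)" "\<bar>?h 0 * ?h 0\<bar> \<le> 5/10000 * (5/10000)"
    unfolding abs_mult using l0 by (intro mult_mono; simp)+
  have m: "\<bar>2 * (1 + 2 * nome) * ?l 0\<bar> \<le> 2 * (1 + 2 * (7/100)) * (5/10000)" "\<bar>8 * nome * ?h 0\<bar> \<le> 8 * (7/100) * (5/10000)"
    unfolding abs_mult using l0 q by (intro mult_mono; simp)+
  have c1: "C3_le (\<lambda>x. 2 * (1 + 2 * nome) * ?l 0 + ?l 0 * ?l 0) (115/100000)"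
    by (intro C3_le_const_bound order.trans[OF abs_triangle_ineq order.trans[OF add_mono[OF m(1) sq(1)]]]) simp
  have c2: "C3_le (\<lambda>x. 8 * nome * ?h 0 + 2 * (?h 0 * ?h 0)) (29/100000)"
    using sq(2) by (intro C3_le_const_bound order.trans[OF abs_triangle_ineq order.trans[OF add_mono[OF m(2) order_refl]]])
      (simp add: abs_mult)
  have "nome\<^sup>2 \<le> (7/100)\<^sup>2" by (rule nome_power_le)
  then have q2: "nome\<^sup>2 \<le> 49/10000" by (simp add: power2_eq_square)
  \<comment> \<open>The dominant contribution: \<open>nome\<close>^2 \<le> 49/10000 times 1 + 4 + 8.
    All terms with tails together add less than 8/1000.\<close>
  have t1: "C3_le (\<lambda>x. nome\<^sup>2 * (1 - 4 * cos x - cos (2 * x))) (637/10000)"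
    by (rule C3_le_mono, (rule C3_le_cos1 C3_le_cos2 C3_le_cmult C3_le_diff C3_le_const)+) (use q2 in simp)
  have t2: "C3_le (\<lambda>x. (2 + 2 * nome) * (?l x + ?l 0)) (214/100000)"
    by (rule C3_le_mono, rule C3_le_cmult, rule u) (use q in simp)
  have t3: "C3_le (\<lambda>x. (2 * nome) * (cos x * (?l x + ?l 0))) (112/100000)"
    by (rule C3_le_mono, rule C3_le_cmult, rule C3_le_mult, rule C3_le_cos1, rule u) (use q in simp)
  have t4: "C3_le (\<lambda>x. 1/2 * ((?l x + ?l 0) * (?l x + ?l 0))) (4/1000000)"
    by (rule C3_le_mono, rule C3_le_cmult, rule C3_le_mult, rule u, rule u) simp
  have t5: "C3_le (\<lambda>x. (4 * nome) * (?h x + ?h 0)) (28/100000)"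
    by (rule C3_le_mono, rule C3_le_cmult, rule u) (use q in simp)
  have t6: "C3_le (\<lambda>x. (4 * nome) * (cos x * (?h x + ?h 0))) (224/100000)"
    by (rule C3_le_mono, rule C3_le_cmult, rule C3_le_mult, rule C3_le_cos1, rule u) (use q in simp)
  have t7: "C3_le (\<lambda>x. (?h x + ?h 0) * (?h x + ?h 0)) (8/1000000)"
    by (rule C3_le_mono, rule C3_le_mult, rule u, rule u) simp
  show ?thesis
    unfolding defect_sum_def Let_def
    by (rule C3_le_mono[OF C3_le_add[OF C3_le_diff[OF C3_le_diff[OF C3_le_diff[OF C3_le_diff[OF C3_le_add[OF C3_le_add[OF C3_le_add[OF
        t1 t2] t3] t4] c1] t5] t6] t7] c2]]) simp
qed

definition radicand_defect :: "real \<Rightarrow> real" where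
  "radicand_defect x = defect_diff x + (4 * nome) * (defect_diff x * cos x) + defect_diff x * defect_sum x + defect_sum x"

lemma radicand_defect_C3: "C3_le radicand_defect (1/8)"
  unfolding radicand_defect_def
  by (rule C3_le_mono, (rule defect_diff_C3 defect_sum_C3 C3_le_cos1 C3_le_add C3_le_cmult C3_le_mult)+)
    (use nome_bounds in simp)

text \<open>The factor of a^2 - b^2 that stays away from 0: the product of 1 +
  \<open>defect_diff\<close> x and 1 + 4 \<open>nome\<close> cos x + \<open>defect_sum\<close> x,
  multiplied out.\<close>

definition radicand :: "real \<Rightarrow> real" where
  "radicand x = 1 + 4 * nome * cos x + radicand_defect x"

lemma radicand_bounds: "5/9 \<le> radicand x" "radicand x \<le> 1.44"
proof -
  have "\<bar>nome * cos x\<bar> \<le> 7/100 * 1"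
    unfolding abs_mult using nome_bounds nome_pos by (intro mult_mono) auto
  then show "5/9 \<le> radicand x" "radicand x \<le> 1.44"
    using C3_le_abs[OF radicand_defect_C3, of x] unfolding radicand_def by (auto simp: abs_le_iff)
qed

text \<open>Since 1 - cos is nonnegative, the root of its square introduces no absolute value. This
  is what makes \<mu> smooth across its zeros at the integers.\<close>

lemma mu_eq:
  "\<mu> \<xi> = sqrt 8 * nome / (\<gamma> * sqrt pi) * ((1 - cos (2 * pi * \<xi>)) * sqrt (radicand (2 * pi * \<xi>)))"
proof -
  let ?x = "2 * pi * \<xi>"
  have r: "(1 + defect_diff ?x) * (1 + 4 * nome * cos ?x + defect_sum ?x) = radicand ?x"
    unfolding radicand_def radicand_defect_def by (simp add: algebra_simps)
  have "(coeff_a \<xi>)\<^sup>2 - (coeff_b \<xi>)\<^sup>2 = (coeff_a \<xi> - coeff_b \<xi>) * (coeff_a \<xi> + coeff_b \<xi>)"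
    by (simp add: power2_eq_square algebra_simps)
  also have "\<dots> = 4 / (\<gamma> * sqrt pi) * (2 / (\<gamma> * sqrt pi)) * ((1 - cos ?x) * nome)\<^sup>2 *
      ((1 + defect_diff ?x) * (1 + 4 * nome * cos ?x + defect_sum ?x))"
    unfolding symbol_diff symbol_sum by (simp only: mult_ac)
  also have "\<dots> = 8 * (nome / (\<gamma> * sqrt pi) * (1 - cos ?x))\<^sup>2 * radicand ?x"
    unfolding r using gamma_pos by (simp add: power2_eq_square field_simps)
  finally have "\<mu> \<xi> = sqrt (8 * (nome / (\<gamma> * sqrt pi) * (1 - cos ?x))\<^sup>2 * radicand ?x)"
    unfolding \<mu>_def by simp
  also have "\<dots> = sqrt 8 * (nome / (\<gamma> * sqrt pi) * (1 - cos ?x)) * sqrt (radicand ?x)"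
    using gamma_pos nome_pos by (simp add: real_sqrt_mult real_sqrt_unique)
  finally show ?thesis by simp
qed

lemma symbol_sum_pos: "0 < coeff_a \<xi> + coeff_b \<xi>"
proof -
  have "\<bar>nome * cos (2 * pi * \<xi>)\<bar> \<le> 7/100 * 1"
    unfolding abs_mult using nome_bounds nome_pos by (intro mult_mono) auto
  then show ?thesis
    using C3_le_abs[OF defect_sum_C3, of "2 * pi * \<xi>"] gamma_pos unfolding symbol_sum
    by (intro mult_pos_pos) (auto simp: abs_le_iff)
qed

lemma mu_sq: "(\<mu> \<xi>)\<^sup>2 = (coeff_a \<xi> - coeff_b \<xi>) * (coeff_a \<xi> + coeff_b \<xi>)"
proof -
  have "0 \<le> coeff_a \<xi> - coeff_b \<xi>"
    using C3_le_abs[OF defect_diff_C3, of "2 * pi * \<xi>"] gamma_pos unfolding symbol_diff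
    by (intro mult_nonneg_nonneg) (auto simp: abs_le_iff)
  then have "0 \<le> (coeff_a \<xi>)\<^sup>2 - (coeff_b \<xi>)\<^sup>2"
    using symbol_sum_pos[of \<xi>] by (simp add: power2_eq_square square_diff_square_factored)
  then show ?thesis
    unfolding \<mu>_def by (simp add: power2_eq_square algebra_simps)
qed

lemma mu_nonzero:
  assumes "0 < \<xi>" "\<xi> < 1"
  shows "\<mu> \<xi> \<noteq> 0"
proof -
  have "sin (pi * \<xi>) > 0" using assms by (intro sin_gt_zero) auto
  then have "cos (2 * (pi * \<xi>)) < 1" unfolding cos_double_sin by simp
  moreover have "0 < radicand (2 * pi * \<xi>)" using radicand_bounds(1) by (rule less_le_trans[rotated]) simp
  ultimately show ?thesis
    unfolding mu_eq using gamma_pos nome_pos by (simp add: mult.assoc)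
qed

text \<open>The quantities \<open>-q sin\<close>, \<dots> below are the derivatives of \<open>4 q cos\<close>; the errors \<open>e\<^sub>i\<close> are those of
  \<^const>\<open>radicand_defect\<close>. The three expressions are, up to the factor \<open>sqrt radicand\<close>, the
  second and third derivatives of \<open>(1 - cos) * sqrt radicand\<close>.\<close>

lemma second_derivative_positive:
  fixes q x s e0 e1 e2 :: real
  assumes q: "6/100 \<le> q" "q \<le> 7/100" and x: "1/2 \<le> x" "x \<le> 1" and s: "s\<^sup>2 = 1 - x\<^sup>2"
    and e: "\<bar>e0\<bar> \<le> 1/8" "\<bar>e1\<bar> \<le> 1/8" "\<bar>e2\<bar> \<le> 1/8"
  defines "R0 \<equiv> 1 + 4 * q * x + e0" and "R1 \<equiv> - (4 * q * s) + e1" and "R2 \<equiv> - (4 * q * x) + e2"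
  shows "1/20 \<le> x * R0 + s * R1 + (1 - x) * (R2 / 2 - R1\<^sup>2 / (4 * R0))"
proof -
  have qx: "0 \<le> q * x" using q x by simp
  have s1: "\<bar>s\<bar> \<le> 1" using s by (intro abs_le_square_iff[THEN iffD2, of s 1, simplified]) simp
  have R0: "875/1000 \<le> R0" using e qx unfolding R0_def by (simp add: abs_le_iff)
  have "\<bar>q * s\<bar> \<le> 7/100 * 1" unfolding abs_mult using s1 q by (intro mult_mono) auto
  then have "\<bar>q * s\<bar> \<le> 7/100" by simp
  then have "\<bar>R1\<bar> \<le> 405/1000" using e(2) unfolding R1_def mult.assoc by linarith
  then have "R1\<^sup>2 \<le> (405/1000)\<^sup>2" by (metis abs_ge_zero power2_abs power_mono)
  then have "R1\<^sup>2 / (4 * R0) \<le> (405/1000)\<^sup>2 / (4 * (875/1000))" using R0 by (intro frac_le) auto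
  then have a: "(1 - x) * (R1\<^sup>2 / (4 * R0)) \<le> (1 - x) * (5/100)"
    using x by (intro mult_left_mono) (auto simp: power2_eq_square)
  have b: "- (1/8) \<le> s * e1"
    using mult_mono[OF s1 e(2)] by (simp add: abs_mult[symmetric] abs_le_iff)
  have c: "x * - (1/8) \<le> x * e0" using x e by (intro mult_left_mono) (auto simp: abs_le_iff)
  have d: "(1 - x) * (- (1/8)) \<le> (1 - x) * e2" using x e by (intro mult_left_mono) (auto simp: abs_le_iff)
  \<comment> \<open>The terms with q collect to q (10 x^2 - 2 x - 4). On [1/2, 1] this quadratic is
    least at 1/2, with value -5/2, which the product certifies.\<close>
  have "0 \<le> (x - 1/2) * (10 * x + 3)" using x by simp
  then have "q * (-5/2) \<le> q * (10 * x\<^sup>2 - 2 * x - 4)"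
    using q by (intro mult_left_mono) (auto simp: algebra_simps power2_eq_square)
  then have f: "- (7/40) \<le> q * (10 * x\<^sup>2 - 2 * x - 4)" using q by simp
  have "x * R0 + s * R1 + (1 - x) * (R2 / 2 - R1\<^sup>2 / (4 * R0)) =
     x + x * e0 + s * e1 + (1 - x) * e2 / 2 - (1 - x) * (R1\<^sup>2 / (4 * R0)) + (4 * q * x\<^sup>2 - 4 * q * s\<^sup>2 - 2 * q * x * (1 - x))"
    unfolding R0_def[symmetric] R1_def[symmetric]
    by (simp add: R0_def R1_def R2_def power2_eq_square algebra_simps diff_divide_distrib add_divide_distrib)
  also have "4 * q * x\<^sup>2 - 4 * q * s\<^sup>2 - 2 * q * x * (1 - x) = q * (10 * x\<^sup>2 - 2 * x - 4)"
    unfolding s by (simp add: power2_eq_square algebra_simps)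
  finally show ?thesis using a b c d f x by argo
qed

lemma second_derivative_negative:
  fixes q x s e0 e1 e2 :: real
  assumes q: "6/100 \<le> q" "q \<le> 7/100" and x: "-1 \<le> x" "x \<le> 0" and s: "s\<^sup>2 = 1 - x\<^sup>2"
    and e: "\<bar>e0\<bar> \<le> 1/8" "\<bar>e1\<bar> \<le> 1/8" "\<bar>e2\<bar> \<le> 1/8"
  defines "R0 \<equiv> 1 + 4 * q * x + e0" and "R1 \<equiv> - (4 * q * s) + e1" and "R2 \<equiv> - (4 * q * x) + e2"
  shows "x * R0 + s * R1 + (1 - x) * (R2 / 2 - R1\<^sup>2 / (4 * R0)) \<le> - (1/20)"
proof -
  define y where "y = - x"
  have y: "0 \<le> y" "y \<le> 1" "x = - y" using x by (auto simp: y_def)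
  have qy: "q * y \<le> 7/100 * 1" "0 \<le> q * y" using q y mult_mono[of q "7/100" y 1] by simp_all
  have x2: "x\<^sup>2 \<le> 1" using x by (simp add: abs_square_le_1)
  have s1: "\<bar>s\<bar> \<le> 1" using s by (intro abs_le_square_iff[THEN iffD2, of s 1, simplified]) simp
  have R0: "0 < R0" using e qy unfolding R0_def y(3) by (simp add: abs_le_iff)
  have a: "0 \<le> (1 + y) * (R1\<^sup>2 / (4 * R0))" using R0 y by simp
  have b: "s * e1 \<le> 1/8"
    using mult_mono[OF s1 e(2)] by (simp add: abs_mult[symmetric] abs_le_iff)
  have c: "y * - (1/8) \<le> y * e0" using y e by (intro mult_left_mono) (auto simp: abs_le_iff)
  have d: "(1 + y) * e2 \<le> (1 + y) * (1/8)" using y e by (intro mult_left_mono) (auto simp: abs_le_iff)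
  have f: "q * y\<^sup>2 \<le> q * y" using q y by (intro mult_left_mono) (auto simp: power2_eq_square mult_left_le_one_le)
  \<comment> \<open>These products replace the bilinear term q y by terms linear in q and y, using
    both bounds on q. The lower bound is decisive at y = 0, where - 4 q has to outweigh errors of up
    to 1/8 + 1/16.\<close>
  have g: "0 \<le> (1 - y) * (4 * q - 24/100)" "0 \<le> y * (56/100 - 8 * q)" using q y by (auto intro!: mult_nonneg_nonneg)
  have g': "4 * q - 24/100 - 4 * (q * y) + 24/100 * y \<ge> 0" "56/100 * y - 8 * (q * y) \<ge> 0"
    using g by (simp_all add: algebra_simps diff_divide_distrib)
  have "x * R0 + s * R1 + (1 - x) * (R2 / 2 - R1\<^sup>2 / (4 * R0)) =
     - y - y * e0 + s * e1 + (1 + y) * e2 / 2 - (1 + y) * (R1\<^sup>2 / (4 * R0)) + (4 * q * y\<^sup>2 - 4 * q * s\<^sup>2 + 2 * q * y * (1 + y))"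
    unfolding R0_def[symmetric] R1_def[symmetric]
    by (simp add: R0_def R1_def R2_def y(3) power2_eq_square algebra_simps)
  also have "4 * q * y\<^sup>2 - 4 * q * s\<^sup>2 + 2 * q * y * (1 + y) = 10 * (q * y\<^sup>2) + 2 * (q * y) - 4 * q"
    unfolding s y(3) by (simp add: power2_eq_square algebra_simps)
  finally show ?thesis using a b c d f g' y(1,2) by (simp add: algebra_simps) argo
qed

lemma third_derivative_negative:
  fixes q x s e0 e1 e2 e3 :: real
  assumes q: "6/100 \<le> q" "q \<le> 7/100" and x: "0 \<le> x" "x \<le> 1/2" and s: "866/1000 \<le> s" "s \<le> 1"
    and e: "\<bar>e0\<bar> \<le> 1/8" "\<bar>e1\<bar> \<le> 1/8" "\<bar>e2\<bar> \<le> 1/8" "\<bar>e3\<bar> \<le> 1/8"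
  defines "R0 \<equiv> 1 + 4 * q * x + e0" and "R1 \<equiv> - (4 * q * s) + e1" and "R2 \<equiv> - (4 * q * x) + e2"
    and "R3 \<equiv> 4 * q * s + e3"
  shows "- (s * R0) + 3 * x * (R1 / 2) + 3 * s * (R2 / 2 - R1\<^sup>2 / (4 * R0)) +
    (1 - x) * (R3 / 2 - 3 * R1 * R2 / (4 * R0) + 3 * R1 ^ 3 / (8 * R0\<^sup>2)) \<le> - (1/20)"
proof -
  have qx: "0 \<le> q * x" using q x by simp
  have qs: "6/100 * (866/1000) \<le> q * s" "q * s \<le> 7/100 * 1"
    by (rule mult_mono; use q s in simp)+
  have R0: "875/1000 \<le> R0" using e(1) qx unfolding R0_def mult.assoc by linarith
  have R1: "- (405/1000) \<le> R1" "R1 \<le> 0" using e(2) qs unfolding R1_def mult.assoc abs_le_iff by simp_all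
  have R2: "R2 \<le> 1/8" using e(3) qx unfolding R2_def mult.assoc by linarith
  have R3: "R3 \<le> 405/1000" using e(4) qs unfolding R3_def mult.assoc abs_le_iff by simp
  \<comment> \<open>The leading term - s R0 is below -3/4. Of the other summands one is nonpositive,
    and the remaining two are at most 3/16 and 247/1000.\<close>
  have a: "866/1000 * (875/1000) \<le> s * R0" using s R0 by (intro mult_mono) auto
  have b: "x * R1 \<le> 0" using x R1 by (intro mult_nonneg_nonpos) auto
  have "0 \<le> R1\<^sup>2 / (4 * R0)" using R0 by simp
  then have "R2 / 2 - R1\<^sup>2 / (4 * R0) \<le> 1/16" using R2 by linarith
  then have "s * (R2 / 2 - R1\<^sup>2 / (4 * R0)) \<le> s * (1/16)" using s by (intro mult_left_mono) auto
  then have c: "s * (R2 / 2 - R1\<^sup>2 / (4 * R0)) \<le> 1/16" using s by linarith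
  have "- R1 * R2 \<le> 405/1000 * (1/8)"
  proof (cases "0 \<le> R2")
    case True then show ?thesis using R1 R2 by (intro mult_mono) auto
  next
    case False
    then have "- R1 * R2 \<le> 0" using R1 by (intro mult_nonneg_nonpos) auto
    then show ?thesis by simp
  qed
  then have "3 * (- R1 * R2) / (4 * R0) \<le> 3 * (405/1000 * (1/8)) / (4 * R0)"
    using R0 by (intro divide_right_mono mult_left_mono) auto
  also have "\<dots> \<le> 3 * (405/1000 * (1/8)) / (4 * (875/1000))" using R0 by (intro divide_left_mono) auto
  finally have d: "- (3 * R1 * R2 / (4 * R0)) \<le> 44/1000" by simp
  have "R1 ^ 3 \<le> 0" using R1 by (simp add: power3_eq_cube mult_nonpos_nonpos mult_nonneg_nonpos)
  then have "3 * R1 ^ 3 / (8 * R0\<^sup>2) \<le> 0" by (intro divide_nonpos_nonneg) auto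
  then have "R3 / 2 - 3 * R1 * R2 / (4 * R0) + 3 * R1 ^ 3 / (8 * R0\<^sup>2) \<le> 247/1000" using d R3 by linarith
  then have "(1 - x) * (R3 / 2 - 3 * R1 * R2 / (4 * R0) + 3 * R1 ^ 3 / (8 * R0\<^sup>2)) \<le> (1 - x) * (247/1000)"
    using x by (intro mult_left_mono) auto
  also have "\<dots> \<le> 247/1000" using x by simp
  finally have f: "(1 - x) * (R3 / 2 - 3 * R1 * R2 / (4 * R0) + 3 * R1 ^ 3 / (8 * R0\<^sup>2)) \<le> 247/1000" .
  have "3 * s * (R2 / 2 - R1\<^sup>2 / (4 * R0)) = 3 * (s * (R2 / 2 - R1\<^sup>2 / (4 * R0)))" "3 * x * (R1 / 2) = 3/2 * (x * R1)"
    by simp_all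
  then show ?thesis using a b c f by linarith
qed

text \<open>All derivatives are kept as rational expressions in R0, ..., R3 over the same positive
  denominator sqrt R0. Taking it out of the derivatives of (1 - cos) sqrt R0 leaves exactly the
  expressions of the three preceding lemmas.\<close>

lemma sqrt_derivatives:
  fixes R0 R1 R2 R3 :: "real \<Rightarrow> real"
  assumes pos: "\<And>x. 0 < R0 x"
    and d: "\<And>x. (R0 has_real_derivative R1 x) (at x)" "\<And>x. (R1 has_real_derivative R2 x) (at x)"
      "\<And>x. (R2 has_real_derivative R3 x) (at x)"
  defines "W \<equiv> \<lambda>x. sqrt (R0 x)" and "W1 \<equiv> \<lambda>x. R1 x / 2 / sqrt (R0 x)"
    and "W2 \<equiv> \<lambda>x. (R2 x / 2 - (R1 x)\<^sup>2 / (4 * R0 x)) / sqrt (R0 x)"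
    and "W3 \<equiv> \<lambda>x. (R3 x / 2 - 3 * R1 x * R2 x / (4 * R0 x) + 3 * R1 x ^ 3 / (8 * (R0 x)\<^sup>2)) / sqrt (R0 x)"
  shows "(W has_real_derivative W1 x) (at x)" "(W1 has_real_derivative W2 x) (at x)"
    "(W2 has_real_derivative W3 x) (at x)"
proof -
  have W: "((\<lambda>x. sqrt (R0 x)) has_real_derivative R1 x / 2 / sqrt (R0 x)) (at x)"
    using pos[of x] by (auto intro!: derivative_eq_intros d simp: field_simps)
  then show "(W has_real_derivative W1 x) (at x)" by (simp add: W_def W1_def)
  have quot: "((\<lambda>x. V x / sqrt (R0 x)) has_real_derivative (V' - V x * R1 x / (2 * R0 x)) / sqrt (R0 x)) (at x)"
    if "(V has_real_derivative V') (at x)" for V V'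
  proof -
    define S where "S = sqrt (R0 x)"
    have S: "0 < S" "R0 x = S * S" using pos[of x] by (simp_all add: S_def)
    have "(V' * S - V x * (R1 x / 2 / S)) / (S * S) = (V' - V x * R1 x / (2 * (S * S))) / S"
      using S(1) by (simp add: field_simps)
    then show ?thesis
      using DERIV_divide[OF that W] pos[of x] unfolding S(2)[symmetric] S_def by simp
  qed
  have "((\<lambda>x. R1 x / 2) has_real_derivative R2 x / 2) (at x)"
    by (auto intro!: derivative_eq_intros d)
  from quot[OF this] show "(W1 has_real_derivative W2 x) (at x)"
    by (simp add: W1_def W2_def power2_eq_square field_simps)
  have V: "((\<lambda>x. R2 x / 2 - (R1 x)\<^sup>2 / (4 * R0 x)) has_real_derivative
      R3 x / 2 - (2 * R1 x * R2 x * (4 * R0 x) - (R1 x)\<^sup>2 * (4 * R1 x)) / (4 * R0 x)\<^sup>2) (at x)"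
    using pos[of x] by (auto intro!: derivative_eq_intros d simp: power2_eq_square)
  show "(W2 has_real_derivative W3 x) (at x)"
  proof -
    have "R3 x / 2 - (2 * R1 x * R2 x * (4 * R0 x) - (R1 x)\<^sup>2 * (4 * R1 x)) / (4 * R0 x)\<^sup>2 -
        (R2 x / 2 - (R1 x)\<^sup>2 / (4 * R0 x)) * R1 x / (2 * R0 x) =
      R3 x / 2 - 3 * R1 x * R2 x / (4 * R0 x) + 3 * R1 x ^ 3 / (8 * (R0 x)\<^sup>2)"
      using pos[of x] by (simp add: field_simps power2_eq_square power3_eq_cube)
    with quot[OF V] show ?thesis unfolding W2_def W3_def by (simp only:)
  qed
qed

section \<open>Decay of integrals with phase \<mu>\<close>

definition C1 :: "(real \<Rightarrow> real) \<Rightarrow> bool" where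
  "C1 f \<longleftrightarrow> (\<exists>f'. (\<forall>x. (f has_real_derivative f' x) (at x)) \<and> continuous_on UNIV f')"

text \<open>With x = 2 pi \<xi>: on [0, 1/6] and [5/6, 1] one has cos x \<ge> 1/2 and \<mu>'' is
  positive; on [1/4, 3/4] one has cos x \<le> 0 and \<mu>'' is negative. In the two gaps \<mu>''
  changes sign, but there |sin x| is at least sqrt 3 / 2 and \<mu>''' is bounded away from
  0.\<close>

lemma mu_oscillatory_decay: "oscillatory_decay \<mu> 0 1" and C1_mu: "C1 \<mu>"
proof -
  obtain j where j: "j 0 = radicand_defect" "\<And>r x. r < 3 \<Longrightarrow> (j r has_real_derivative j (Suc r) x) (at x)"
    "\<And>r x. r \<le> 3 \<Longrightarrow> \<bar>j r x\<bar> \<le> 1/8" using radicand_defect_C3 by (rule C3_leE) blast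
  have dj: "(j 0 has_real_derivative j 1 x) (at x)" "(j 1 has_real_derivative j 2 x) (at x)"
     "(j 2 has_real_derivative j 3 x) (at x)" for x
    by (rule j(2)[of 0, folded One_nat_def] j(2)[of 1, unfolded Suc_1] j(2)[of 2, unfolded Suc_2]; simp)+
  define R0 R1 R2 R3 where R: "R0 = radicand" "R1 = (\<lambda>x. - (4 * nome * sin x) + j 1 x)"
    "R2 = (\<lambda>x. - (4 * nome * cos x) + j 2 x)" "R3 = (\<lambda>x. 4 * nome * sin x + j 3 x)"
  have R0: "R0 = (\<lambda>x. 1 + 4 * nome * cos x + j 0 x)" unfolding R radicand_def[abs_def] j ..
  have pos: "0 < R0 x" for x using radicand_bounds(1)[of x] by (simp add: R)
  have dR: "(R0 has_real_derivative R1 x) (at x)" "(R1 has_real_derivative R2 x) (at x)"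
    "(R2 has_real_derivative R3 x) (at x)" for x
    unfolding R0 R(2-4) by (auto intro!: derivative_eq_intros dj simp del: One_nat_def)
  define W W1 W2 W3 where W: "W = (\<lambda>x. sqrt (R0 x))" "W1 = (\<lambda>x. R1 x / 2 / sqrt (R0 x))"
    "W2 = (\<lambda>x. (R2 x / 2 - (R1 x)\<^sup>2 / (4 * R0 x)) / sqrt (R0 x))"
    "W3 = (\<lambda>x. (R3 x / 2 - 3 * R1 x * R2 x / (4 * R0 x) + 3 * R1 x ^ 3 / (8 * (R0 x)\<^sup>2)) / sqrt (R0 x))"
  have dW: "(W has_real_derivative W1 x) (at x)" "(W1 has_real_derivative W2 x) (at x)"
    "(W2 has_real_derivative W3 x) (at x)" for x
    using sqrt_derivatives[OF pos dR] unfolding W by blast+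
  define K where "K = sqrt 8 * nome / (\<gamma> * sqrt pi)"
  have K: "0 < K" using gamma_pos nome_pos by (simp add: K_def)
  define N1 N2 N3 where N: "N1 = (\<lambda>x. sin x * W x + (1 - cos x) * W1 x)"
    "N2 = (\<lambda>x. cos x * W x + 2 * sin x * W1 x + (1 - cos x) * W2 x)"
    "N3 = (\<lambda>x. - (sin x * W x) + 3 * cos x * W1 x + 3 * sin x * W2 x + (1 - cos x) * W3 x)"
  define m1 m2 m3 where m: "m1 = (\<lambda>\<xi>. K * (2 * pi) * N1 (2 * pi * \<xi>))"
    "m2 = (\<lambda>\<xi>. K * (2 * pi)\<^sup>2 * N2 (2 * pi * \<xi>))" "m3 = (\<lambda>\<xi>. K * (2 * pi)^3 * N3 (2 * pi * \<xi>))"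
  have mu: "\<mu> = (\<lambda>\<xi>. K * ((1 - cos (2 * pi * \<xi>)) * W (2 * pi * \<xi>)))"
    by (auto simp: mu_eq W R K_def)
  have chain: "((\<lambda>\<xi>. f (2 * pi * \<xi>)) has_real_derivative 2 * pi * f' (2 * pi * \<xi>)) (at \<xi>)"
    if "\<And>x. (f has_real_derivative f' x) (at x)" for f f' \<xi>
  proof -
    have "((\<lambda>\<xi>. 2 * pi * \<xi>) has_real_derivative 2 * pi) (at \<xi>)"
      by (auto intro!: derivative_eq_intros)
    from DERIV_chain2[OF that this] show ?thesis by (simp add: mult.commute)
  qed
  have dN: "((\<lambda>x. (1 - cos x) * W x) has_real_derivative N1 x) (at x)"
    "(N1 has_real_derivative N2 x) (at x)" "(N2 has_real_derivative N3 x) (at x)" for x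
    unfolding N by (auto intro!: derivative_eq_intros dW simp: algebra_simps)
  have dm: "(\<mu> has_real_derivative m1 \<xi>) (at \<xi>)" "(m1 has_real_derivative m2 \<xi>) (at \<xi>)"
    "(m2 has_real_derivative m3 \<xi>) (at \<xi>)" for \<xi>
    unfolding mu m
    using DERIV_cmult[OF chain[OF dN(1)], of K \<xi>] DERIV_cmult[OF chain[OF dN(2)], of "K * (2 * pi)" \<xi>]
      DERIV_cmult[OF chain[OF dN(3)], of "K * (2 * pi)\<^sup>2" \<xi>]
    by (simp_all add: power2_eq_square power3_eq_cube mult_ac)
  have cont: "continuous_on UNIV f" if "\<And>x. (f has_real_derivative f' x) (at x)" for f f' :: "real \<Rightarrow> real"
    using that by (meson DERIV_isCont continuous_at_imp_continuous_on)
  show "C1 \<mu>" unfolding C1_def using dm cont[OF dm(2)] by blast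
  have Wb: "0 < W x" "W x \<le> 12/10" for x
  proof -
    have "radicand x \<le> (12/10)\<^sup>2" using radicand_bounds(2)[of x] by (simp add: power2_eq_square)
    then have "sqrt (radicand x) \<le> 12/10" by (intro real_le_lsqrt) auto
    then show "0 < W x" "W x \<le> 12/10" using pos[of x] by (simp_all add: W R)
  qed
  have N2: "N2 x = (cos x * R0 x + sin x * R1 x + (1 - cos x) * (R2 x / 2 - (R1 x)\<^sup>2 / (4 * R0 x))) / W x" for x
  proof -
    have "cos x * R0 x / W x = cos x * W x"
      using pos[of x] real_div_sqrt[of "R0 x"] by (simp add: W times_divide_eq_right[symmetric] del: times_divide_eq_right)
    then show ?thesis by (simp add: N W add_divide_distrib)
  qed
  have N3: "N3 x = (- (sin x * R0 x) + 3 * cos x * (R1 x / 2) + 3 * sin x * (R2 x / 2 - (R1 x)\<^sup>2 / (4 * R0 x)) +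
      (1 - cos x) * (R3 x / 2 - 3 * R1 x * R2 x / (4 * R0 x) + 3 * R1 x ^ 3 / (8 * (R0 x)\<^sup>2))) / W x" for x
  proof -
    have *: "- (s * w) + 3 * c * (A / w) + 3 * s * (B / w) + (1 - c) * (D / w) =
        (- (s * (w * w)) + 3 * c * A + 3 * s * B + (1 - c) * D) / w" if "0 < w" for s w c A B D :: real
      using that by (simp add: field_simps)
    have r: "W x * W x = R0 x" using pos[of x] by (simp add: W)
    have w: "W1 x = R1 x / 2 / W x" "W2 x = (R2 x / 2 - (R1 x)\<^sup>2 / (4 * R0 x)) / W x"
      "W3 x = (R3 x / 2 - 3 * R1 x * R2 x / (4 * R0 x) + 3 * R1 x ^ 3 / (8 * (R0 x)\<^sup>2)) / W x"
      by (simp_all only: W)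
    show ?thesis unfolding N w *[OF Wb(1)[of x]] r ..
  qed
  \<comment> \<open>1/24 is 1/20 divided by the upper bound 12/10 for \<open>W\<close>.\<close>
  have up: "1/24 \<le> A / W x" if "1/20 \<le> A" for A x
  proof -
    have "W x * (1/24) \<le> 12/10 * (1/24)" using Wb[of x] by (intro mult_right_mono) auto
    then show ?thesis using that Wb[of x] by (simp add: field_simps)
  qed
  have down: "A / W x \<le> - (1/24)" if "A \<le> - (1/20)" for A x
  proof -
    have "1/24 \<le> (- A) / W x" using that by (intro up) simp
    then show ?thesis unfolding minus_divide_left[symmetric] by linarith
  qed
  have jb: "\<bar>j 0 x\<bar> \<le> 1/8" "\<bar>j 1 x\<bar> \<le> 1/8" "\<bar>j 2 x\<bar> \<le> 1/8" "\<bar>j 3 x\<bar> \<le> 1/8" for x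
    by (rule j; simp)+
  have sc: "(sin x)\<^sup>2 = 1 - (cos x)\<^sup>2" for x :: real by (simp add: sin_squared_eq)
  have P: "1/24 \<le> N2 x" if "1/2 \<le> cos x" for x
    unfolding N2 R0 R(2-4)
    by (rule up[unfolded], rule second_derivative_positive) (use nome_bounds that jb sc in auto)
  have M: "N2 x \<le> - (1/24)" if "cos x \<le> 0" for x
    unfolding N2 R0 R(2-4)
    by (rule down, rule second_derivative_negative) (use nome_bounds that jb sc in auto)
  have T: "N3 x \<le> - (1/24)" if "0 \<le> cos x" "cos x \<le> 1/2" "866/1000 \<le> sin x" for x
    unfolding N3 R0 R(2-4)
    by (rule down, rule third_derivative_negative) (use nome_bounds that jb in auto)
  \<comment> \<open>Negating sin x and the odd-order errors \<open>j 1\<close> and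
    \<open>j 3\<close> reverses the sign of the whole expression. The errors enter the estimate only
    through their absolute values, so the previous case applies to the reflected data.\<close>
  have T': "1/24 \<le> N3 x" if "0 \<le> cos x" "cos x \<le> 1/2" "sin x \<le> - (866/1000)" for x
  proof -
    have "- (- sin x * (1 + 4 * nome * cos x + j 0 x)) + 3 * cos x * ((- (4 * nome * - sin x) + - j 1 x) / 2) +
        3 * - sin x * ((- (4 * nome * cos x) + j 2 x) / 2 - (- (4 * nome * - sin x) + - j 1 x)\<^sup>2 / (4 * (1 + 4 * nome * cos x + j 0 x))) +
        (1 - cos x) * ((4 * nome * - sin x + - j 3 x) / 2 - 3 * (- (4 * nome * - sin x) + - j 1 x) * (- (4 * nome * cos x) + j 2 x) / (4 * (1 + 4 * nome * cos x + j 0 x))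
          + 3 * (- (4 * nome * - sin x) + - j 1 x) ^ 3 / (8 * (1 + 4 * nome * cos x + j 0 x)\<^sup>2)) \<le> - (1/20)"
      (is "?A \<le> _")
      by (rule third_derivative_negative) (use nome_bounds that jb in auto)
    moreover have neg: "- (4 * nome * - sin x) + - j 1 x = - R1 x" "- (4 * nome * cos x) + j 2 x = R2 x"
      "4 * nome * - sin x + - j 3 x = - R3 x" "1 + 4 * nome * cos x + j 0 x = R0 x"
      by (simp_all add: R(2-4) R0)
    ultimately have "1/20 \<le> - (sin x * R0 x) + 3 * cos x * (R1 x / 2) + 3 * sin x * (R2 x / 2 - (R1 x)\<^sup>2 / (4 * R0 x)) +
      (1 - cos x) * (R3 x / 2 - 3 * R1 x * R2 x / (4 * R0 x) + 3 * R1 x ^ 3 / (8 * (R0 x)\<^sup>2))"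
      unfolding neg by (simp add: algebra_simps)
    then show ?thesis unfolding N3 by (rule up)
  qed
  define l where "l = min (K * (2 * pi)\<^sup>2 * (1/24)) (K * (2 * pi)^3 * (1/24))"
  have l: "0 < l" using K by (simp add: l_def)
  have up2: "l \<le> m2 \<xi>" if "1/24 \<le> N2 (2 * pi * \<xi>)" for \<xi>
    using that K unfolding m l_def by (intro min.coboundedI1 mult_left_mono) auto
  have down2: "m2 \<xi> \<le> - l" if "N2 (2 * pi * \<xi>) \<le> - (1/24)" for \<xi>
  proof -
    have "K * (2 * pi)\<^sup>2 * (1/24) \<le> K * (2 * pi)\<^sup>2 * - N2 (2 * pi * \<xi>)" using that K by (intro mult_left_mono) auto
    then show ?thesis unfolding m l_def by simp
  qed
  have up3: "l \<le> m3 \<xi>" if "1/24 \<le> N3 (2 * pi * \<xi>)" for \<xi>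
    using that K unfolding m l_def by (intro min.coboundedI2 mult_left_mono) auto
  have down3: "m3 \<xi> \<le> - l" if "N3 (2 * pi * \<xi>) \<le> - (1/24)" for \<xi>
  proof -
    have "K * (2 * pi)^3 * (1/24) \<le> K * (2 * pi)^3 * - N3 (2 * pi * \<xi>)" using that K by (intro mult_left_mono) auto
    then show ?thesis unfolding m l_def by simp
  qed
  have "1732/1000 \<le> sqrt (3::real)" by (rule real_le_rsqrt) (simp add: power2_eq_square)
  then have s3: "866/1000 \<le> sqrt 3 / 2" by simp
  have cos_refl: "cos (2 * pi * \<xi>) = cos (2 * pi * (1 - \<xi>))" "sin (2 * pi * \<xi>) = - sin (2 * pi * (1 - \<xi>))" for \<xi>
    by (simp_all add: algebra_simps cos_diff sin_diff)
  have A: "1/2 \<le> cos (2 * pi * \<xi>)" if "0 \<le> \<xi>" "\<xi> \<le> 1/6" for \<xi>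
    using cos_monotone_0_pi_le[of "2 * pi * \<xi>" "pi / 3"] that by (simp add: cos_60 field_simps)
  have B: "0 \<le> cos (2 * pi * \<xi>)" "cos (2 * pi * \<xi>) \<le> 1/2" "866/1000 \<le> sin (2 * pi * \<xi>)" if "1/6 \<le> \<xi>" "\<xi> \<le> 1/4" for \<xi>
  proof -
    have x: "pi / 3 \<le> 2 * pi * \<xi>" "2 * pi * \<xi> \<le> pi / 2"
      using mult_left_mono[OF that(1), of "2 * pi"] mult_left_mono[OF that(2), of "2 * pi"] by simp_all
    show "0 \<le> cos (2 * pi * \<xi>)" by (intro cos_ge_zero) (use x pi_gt_zero in linarith)+
    show "cos (2 * pi * \<xi>) \<le> 1/2"
      using cos_monotone_0_pi_le[of "pi / 3" "2 * pi * \<xi>"] x by (simp add: cos_60)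
    have "sin (pi / 3) \<le> sin (2 * pi * \<xi>)" by (intro sin_monotone_2pi_le) (use x pi_gt_zero in linarith)+
    then show "866/1000 \<le> sin (2 * pi * \<xi>)" using s3 by (simp add: sin_60)
  qed
  have C: "cos (2 * pi * \<xi>) \<le> 0" if "1/4 \<le> \<xi>" "\<xi> \<le> 3/4" for \<xi>
  proof -
    have x: "pi / 2 \<le> 2 * pi * \<xi>" "2 * pi * \<xi> \<le> 3 * pi / 2"
      using mult_left_mono[OF that(1), of "2 * pi"] mult_left_mono[OF that(2), of "2 * pi"] by simp_all
    have "0 \<le> cos (2 * pi * \<xi> - pi)" by (intro cos_ge_zero) (use x pi_gt_zero in linarith)+
    then show ?thesis by (simp add: cos_diff)
  qed
  note second = oscillatory_decay_second[OF l dm(1,2) cont[OF dm(3)]]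
  note third = oscillatory_decay_third[OF l dm]
  have 1: "oscillatory_decay \<mu> 0 (1/6)" by (intro second disjI1 ballI up2 P A) auto
  have 2: "oscillatory_decay \<mu> (1/6) (1/4)" by (intro third disjI2 ballI down3 T B) auto
  have 3: "oscillatory_decay \<mu> (1/4) (3/4)" by (intro second disjI2 ballI down2 M C) auto
  have 4: "oscillatory_decay \<mu> (3/4) (5/6)"
  proof (intro third disjI1 ballI up3 T')
    fix \<xi> :: real assume "\<xi> \<in> {3/4..5/6}"
    then have "1/6 \<le> 1 - \<xi>" "1 - \<xi> \<le> 1/4" by auto
    then show "0 \<le> cos (2 * pi * \<xi>)" "cos (2 * pi * \<xi>) \<le> 1/2" "sin (2 * pi * \<xi>) \<le> - (866/1000)"
      unfolding cos_refl[of \<xi>] using B[of "1 - \<xi>"] by auto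
  qed
  have 5: "oscillatory_decay \<mu> (5/6) 1"
  proof (intro second disjI1 ballI up2 P)
    fix \<xi> :: real assume "\<xi> \<in> {5/6..1}"
    then show "1/2 \<le> cos (2 * pi * \<xi>)"
      unfolding cos_refl[of \<xi>] by (intro A) auto
  qed
  note join = oscillatory_decay_join[OF cont[OF dm(1)]]
  show "oscillatory_decay \<mu> 0 1"
    by (rule join[OF _ _ join[OF _ _ join[OF _ _ join[OF _ _ 1 2] 3] 4] 5]) auto
qed

section \<open>Smoothness of the amplitudes\<close>

lemma C3_le_C1:
  assumes "C3_le f N"
  shows "C1 (\<lambda>\<xi>. f (2 * pi * \<xi>))"
proof -
  from assms(1) obtain j where j: "j 0 = f" "\<And>r x. r < 3 \<Longrightarrow> (j r has_real_derivative j (Suc r) x) (at x)"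
    by (rule C3_leE) blast
  have d: "(f has_real_derivative j 1 x) (at x)" "(j 1 has_real_derivative j 2 x) (at x)" for x
    using j(1) j(2)[of 0 x] j(2)[of 1 x] unfolding Suc_1 One_nat_def[symmetric] by auto
  have lin: "((\<lambda>\<xi>. 2 * pi * \<xi>) has_real_derivative 2 * pi) (at \<xi>)" for \<xi>
    by (auto intro!: derivative_eq_intros)
  have "((\<lambda>\<xi>. f (2 * pi * \<xi>)) has_real_derivative 2 * pi * j 1 (2 * pi * \<xi>)) (at \<xi>)" for \<xi>
    using DERIV_chain2[OF d(1) lin] by (simp add: mult.commute)
  moreover have "continuous_on UNIV (j 1)"
    using d(2) by (meson DERIV_isCont continuous_at_imp_continuous_on)
  then have "continuous_on UNIV (\<lambda>\<xi>. j 1 (2 * pi * \<xi>))"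
    by (rule continuous_on_compose2) (auto intro!: continuous_intros)
  then have "continuous_on UNIV (\<lambda>\<xi>. 2 * pi * j 1 (2 * pi * \<xi>))"
    by (rule continuous_on_mult_left)
  ultimately show ?thesis unfolding C1_def
    by (intro exI[of _ "\<lambda>\<xi>. 2 * pi * j 1 (2 * pi * \<xi>)"] conjI allI)
qed

lemma C1_coeff_b: "C1 coeff_b" and C1_symbol_sum: "C1 (\<lambda>\<xi>. coeff_a \<xi> + coeff_b \<xi>)"
proof -
  let ?l = "\<lambda>x. 1 + (2 * nome) * cos x + cos_tail (\<lambda>n. n) x"
  let ?h = "\<lambda>x. (2 * nome) * cos x + cos_tail (\<lambda>n. 2 * n + 1) x"
  have 1: "C3_le (cos_tail (\<lambda>n. n)) (5/10000)" "C3_le (cos_tail (\<lambda>n. 2 * n + 1)) (5/10000)"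
    by (rule cos_tail_C3; simp)+
  have "\<exists>N. C3_le (\<lambda>x. 1 / (\<gamma> * sqrt pi) * (?l x * ?l x - 2 * (?h x * ?h x))) N"
    by (rule exI, (rule 1 C3_le_cos1 C3_le_add C3_le_diff C3_le_cmult C3_le_mult C3_le_const)+)
  then obtain N where N: "C3_le (\<lambda>x. 1 / (\<gamma> * sqrt pi) * (?l x * ?l x - 2 * (?h x * ?h x))) N" ..
  show "C1 coeff_b"
    using C3_le_C1[OF N] unfolding coeff_b_def[abs_def] ell_eq hh_eq power2_eq_square .
  have "\<exists>N. C3_le (\<lambda>x. 2 / (\<gamma> * sqrt pi) * (1 + (4 * nome) * cos x + defect_sum x)) N"
    by (rule exI, (rule defect_sum_C3 C3_le_cos1 C3_le_add C3_le_diff C3_le_cmult C3_le_mult C3_le_const)+)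
  then obtain N where N: "C3_le (\<lambda>x. 2 / (\<gamma> * sqrt pi) * (1 + (4 * nome) * cos x + defect_sum x)) N" ..
  show "C1 (\<lambda>\<xi>. coeff_a \<xi> + coeff_b \<xi>)"
    using C3_le_C1[OF N] unfolding symbol_sum .
qed

lemma C1_divide:
  assumes "C1 f" "C1 g" "\<And>x. g x \<noteq> 0"
  shows "C1 (\<lambda>x. f x / g x)"
proof -
  obtain f' g' where d: "\<And>x. (f has_real_derivative f' x) (at x)" "\<And>x. (g has_real_derivative g' x) (at x)"
    and c: "continuous_on UNIV f'" "continuous_on UNIV g'" using assms(1,2) unfolding C1_def by blast
  have "continuous_on UNIV f" "continuous_on UNIV g"
    using d by (meson DERIV_isCont continuous_at_imp_continuous_on)+
  then have "continuous_on UNIV (\<lambda>x. (f' x * g x - f x * g' x) / (g x * g x))"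
    using assms(3) c by (intro continuous_intros) auto
  then show ?thesis unfolding C1_def
    by (intro exI[of _ "\<lambda>x. (f' x * g x - f x * g' x) / (g x * g x)"] conjI allI DERIV_divide d assms(3))
qed

section \<open>Square-integrable and Sobolev functions\<close>

lemma L2_on_cmult: "L2_on S u \<Longrightarrow> L2_on S (\<lambda>x. a * u x)"
  by (auto simp: L2_on_def norm_mult power_mult_distrib)

lemma L2_on_cnj: "L2_on S u \<Longrightarrow> L2_on S (\<lambda>x. cnj (u x))"
  using measurable_compose[of u "lebesgue_on S" borel cnj borel]
  by (simp add: L2_on_def borel_measurable_continuous_onI continuous_on_cnj)

lemma L2_on_add:
  assumes "L2_on S u" "L2_on S w"
  shows "L2_on S (\<lambda>x. u x + w x)"
proof -
  have "integrable (lebesgue_on S) (\<lambda>x. (cmod (u x + w x))\<^sup>2)"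
  proof (rule Bochner_Integration.integrable_bound)
    show "integrable (lebesgue_on S) (\<lambda>x. 2 * (cmod (u x))\<^sup>2 + 2 * (cmod (w x))\<^sup>2)"
      using assms by (auto simp: L2_on_def)
    have "(cmod (u x + w x))\<^sup>2 \<le> 2 * (cmod (u x))\<^sup>2 + 2 * (cmod (w x))\<^sup>2" for x
    proof -
      have "(cmod (u x + w x))\<^sup>2 \<le> (cmod (u x) + cmod (w x))\<^sup>2"
        by (intro power_mono norm_triangle_ineq) auto
      also have "\<dots> \<le> 2 * (cmod (u x))\<^sup>2 + 2 * (cmod (w x))\<^sup>2"
        using sum_squares_bound[of "cmod (u x)" "cmod (w x)"] by (simp add: power2_sum)
      finally show ?thesis .
    qed
    then show "AE x in lebesgue_on S. norm ((cmod (u x + w x))\<^sup>2) \<le> norm (2 * (cmod (u x))\<^sup>2 + 2 * (cmod (w x))\<^sup>2)"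
      by auto
  qed (use assms in \<open>auto simp: L2_on_def\<close>)
  then show ?thesis using assms by (auto simp: L2_on_def)
qed

lemma L2_on_diff: "L2_on S u \<Longrightarrow> L2_on S w \<Longrightarrow> L2_on S (\<lambda>x. u x - w x)"
  using L2_on_add[of S u "\<lambda>x. - 1 * w x"] L2_on_cmult[of S w "-1"] by simp

lemma L2_on_sum: "finite I \<Longrightarrow> (\<And>i. i \<in> I \<Longrightarrow> L2_on S (u i)) \<Longrightarrow> L2_on S (\<lambda>x. \<Sum>i\<in>I. u i x)"
proof (induction I rule: finite_induct)
  case empty
  then show ?case by (auto simp: L2_on_def)
next
  case (insert i I)
  then show ?case by (simp add: L2_on_add)
qed

lemma L2_integrable_product:
  assumes "L2_on S u" "L2_on S w"
  shows "integrable (lebesgue_on S) (\<lambda>x. u x * w x)"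
proof (rule Bochner_Integration.integrable_bound)
  show "integrable (lebesgue_on S) (\<lambda>x. (cmod (u x))\<^sup>2 + (cmod (w x))\<^sup>2)"
    using assms by (auto simp: L2_on_def)
  have "cmod (u x) * cmod (w x) \<le> (cmod (u x))\<^sup>2 + (cmod (w x))\<^sup>2" for x
    using sum_squares_bound[of "cmod (u x)" "cmod (w x)"] mult_nonneg_nonneg[OF norm_ge_zero norm_ge_zero, of "u x" "w x"] by linarith
  then show "AE x in lebesgue_on S. norm (u x * w x) \<le> norm ((cmod (u x))\<^sup>2 + (cmod (w x))\<^sup>2)"
    by (auto simp: norm_mult)
qed (use assms in \<open>auto simp: L2_on_def\<close>)

lemma L2_norm_sq: "(L2_norm S u)\<^sup>2 = (LINT x|lebesgue_on S. (cmod (u x))\<^sup>2)"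
  by (simp add: L2_norm_def)

lemma L2_norm_nonneg: "0 \<le> L2_norm S u"
  by (simp add: L2_norm_def)

lemma L2_Cauchy_Schwarz_abs:
  assumes u: "L2_on S u" and w: "L2_on S w"
  shows "(LINT x|lebesgue_on S. cmod (u x) * cmod (w x)) \<le> L2_norm S u * L2_norm S w"
proof -
  let ?M = "lebesgue_on S"
  define A B C where "A = (LINT x|?M. (cmod (u x))\<^sup>2)" and "B = (LINT x|?M. (cmod (w x))\<^sup>2)"
    and "C = (LINT x|?M. cmod (u x) * cmod (w x))"
  have i: "integrable ?M (\<lambda>x. (cmod (u x))\<^sup>2)" "integrable ?M (\<lambda>x. (cmod (w x))\<^sup>2)"
    "integrable ?M (\<lambda>x. cmod (u x) * cmod (w x))"
    using u w integrable_norm[OF L2_integrable_product[OF u w]] by (auto simp: L2_on_def norm_mult)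
  have nn: "0 \<le> A" "0 \<le> B" "0 \<le> C" by (auto simp: A_def B_def C_def)
  have quad: "0 \<le> s\<^sup>2 * A - 2 * s * C + B" for s
  proof -
    have "0 \<le> (LINT x|?M. (s * cmod (u x) - cmod (w x))\<^sup>2)" by simp
    also have "\<dots> = (LINT x|?M. s\<^sup>2 * (cmod (u x))\<^sup>2 - 2 * s * (cmod (u x) * cmod (w x)) + (cmod (w x))\<^sup>2)"
      by (simp add: power2_diff power_mult_distrib algebra_simps)
    also have "\<dots> = s\<^sup>2 * A - 2 * s * C + B"
      using i by (simp add: A_def B_def C_def)
    finally show ?thesis .
  qed
  have "C\<^sup>2 \<le> A * B"
  proof (cases "A = 0")
    case True
    have "C = 0"
    proof (rule ccontr)
      assume "C \<noteq> 0"
      \<comment> \<open>For A = 0 the quadratic is affine in s, and this s gives it the value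
        -1.\<close>
      then show False using quad[of "(B + 1) / (2 * C)"] nn True by (simp add: field_simps)
    qed
    then show ?thesis using True by simp
  next
    case False
    then show ?thesis using quad[of "C / A"] nn by (simp add: field_simps power2_eq_square)
  qed
  then have "C \<le> sqrt (A * B)" by (rule real_le_rsqrt)
  then show ?thesis
    by (simp add: L2_norm_def A_def B_def C_def real_sqrt_mult)
qed

lemma L2_Cauchy_Schwarz:
  assumes u: "L2_on S u" and w: "L2_on S w"
  shows "cmod (LINT x|lebesgue_on S. u x * w x) \<le> L2_norm S u * L2_norm S w"
  using integral_norm_bound[of "lebesgue_on S" "\<lambda>x. u x * w x"] L2_Cauchy_Schwarz_abs[OF u w]
  by (simp add: norm_mult)

text \<open>Pairing with \<open>e n\<close> is continuous in L^2, and on every finite index set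
  containing n the pairing of the partial sum is already \<open>c n\<close>.\<close>

lemma L2_has_sum_coefficient:
  assumes sum: "L2_has_sum S (\<lambda>n x. c n * e n x) u"
    and e: "\<And>n. L2_on S (e n)"
    and orth: "\<And>m n. (LINT x|lebesgue_on S. e m x * cnj (e n x)) = (if m = n then 1 else 0)"
  shows "(LINT x|lebesgue_on S. u x * cnj (e n x)) = c n"
proof -
  let ?M = "lebesgue_on S" and ?F = "finite_subsets_at_top UNIV"
  define T where "T = (\<lambda>I. LINT x|?M. ((\<Sum>m\<in>I. c m * e m x) - u x) * cnj (e n x))"
  have u: "L2_on S u" using sum by (simp add: L2_has_sum_def)
  have "norm (T I) \<le> L2_norm S (\<lambda>x. (\<Sum>m\<in>I. c m * e m x) - u x) * L2_norm S (\<lambda>x. cnj (e n x))"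
    if "finite I" for I
    unfolding T_def
    by (intro L2_Cauchy_Schwarz L2_on_diff L2_on_sum that L2_on_cmult e u L2_on_cnj)
  then have "\<forall>\<^sub>F I in ?F. norm (T I) \<le> L2_norm S (\<lambda>x. (\<Sum>m\<in>I. c m * e m x) - u x) * L2_norm S (\<lambda>x. cnj (e n x))"
    by (auto simp: eventually_finite_subsets_at_top)
  moreover have "((\<lambda>I. L2_norm S (\<lambda>x. (\<Sum>m\<in>I. c m * e m x) - u x) * L2_norm S (\<lambda>x. cnj (e n x))) \<longlongrightarrow> 0 * L2_norm S (\<lambda>x. cnj (e n x))) ?F"
    using sum by (intro tendsto_mult tendsto_const) (simp add: L2_has_sum_def)
  ultimately have lim: "(T \<longlongrightarrow> 0) ?F"
    using Lim_null_comparison by fastforce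
  have "T I = c n - (LINT x|?M. u x * cnj (e n x))" if "finite I" "n \<in> I" for I
  proof -
    have i: "integrable ?M (\<lambda>x. c m * (e m x * cnj (e n x)))" for m
      by (intro integrable_mult_right L2_integrable_product e L2_on_cnj)
    have "T I = (LINT x|?M. (\<Sum>m\<in>I. c m * (e m x * cnj (e n x))) - u x * cnj (e n x))"
      by (simp add: T_def algebra_simps sum_distrib_left sum_distrib_right)
    also have "\<dots> = (LINT x|?M. (\<Sum>m\<in>I. c m * (e m x * cnj (e n x)))) - (LINT x|?M. u x * cnj (e n x))"
      by (intro Bochner_Integration.integral_diff Bochner_Integration.integrable_sum i L2_integrable_product u L2_on_cnj e)
    also have "(LINT x|?M. (\<Sum>m\<in>I. c m * (e m x * cnj (e n x)))) = (\<Sum>m\<in>I. c m * (if m = n then 1 else 0))"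
      by (subst Bochner_Integration.integral_sum[OF i]) (simp add: orth)
    also have "\<dots> = (\<Sum>m\<in>I. if m = n then c m else 0)" by (intro sum.cong) auto
    also have "\<dots> = c n" using that by simp
    finally show ?thesis .
  qed
  then have "\<forall>\<^sub>F I in ?F. T I = c n - (LINT x|?M. u x * cnj (e n x))"
    unfolding eventually_finite_subsets_at_top by (intro exI[of _ "{n}"]) auto
  then have "(T \<longlongrightarrow> c n - (LINT x|?M. u x * cnj (e n x))) ?F"
    by (rule tendsto_eventually)
  with lim have "c n - (LINT x|?M. u x * cnj (e n x)) = 0"
    using tendsto_unique[OF finite_subsets_at_top_neq_bot] by blast
  then show ?thesis by simp
qed

section \<open>Weak integration by parts on the unit interval\<close>

lemma L2_on_const: "S \<in> lmeasurable \<Longrightarrow> L2_on S (\<lambda>x. c)"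
  by (auto simp: L2_on_def integrable_on_const[unfolded absolutely_integrable_on_def] finite_measure_lebesgue_on
      intro!: finite_measure.integrable_const)

lemma L2_imp_integrable: "S \<in> lmeasurable \<Longrightarrow> L2_on S f \<Longrightarrow> integrable (lebesgue_on S) f"
  using L2_integrable_product[OF _ L2_on_const[of S 1], of f] by simp

lemma L1_le_L2_unit_interval:
  assumes "L2_on {0..1::real} f"
  shows "(LINT x|lebesgue_on {0..1}. cmod (f x)) \<le> L2_norm {0..1} f"
  using L2_Cauchy_Schwarz_abs[OF assms L2_on_const[of _ 1]]
  by (simp add: L2_norm_def measure_restrict_space)

lemma integrable_continuous_mult:
  fixes g u :: "real \<Rightarrow> complex"
  assumes g: "continuous_on {a..b} g" and u: "integrable (lebesgue_on {a..b}) u"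
  shows "integrable (lebesgue_on {a..b}) (\<lambda>x. g x * u x)"
proof -
  have "bounded (g ` {a..b})" using g by (intro compact_imp_bounded compact_continuous_image) auto
  then obtain D where D: "\<And>x. x \<in> {a..b} \<Longrightarrow> cmod (g x) \<le> D" unfolding bounded_iff by (meson imageI)
  have gm: "g \<in> borel_measurable (lebesgue_on {a..b})"
    using g by (intro continuous_imp_measurable_on_sets_lebesgue) auto
  show ?thesis
  proof (rule Bochner_Integration.integrable_bound)
    show "integrable (lebesgue_on {a..b}) (\<lambda>x. D * cmod (u x))" using u by simp
    have "cmod (g x * u x) \<le> norm (D * cmod (u x))" if "x \<in> {a..b}" for x
      using D[OF that] by (simp add: norm_mult abs_mult mult_right_mono)
    then show "AE x in lebesgue_on {a..b}. norm (g x * u x) \<le> norm (D * cmod (u x))"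
      by (simp add: AE_restrict_space_iff)
  qed (use gm u in auto)
qed

text \<open>Test functions of \<open>has_weak_derivative\<close> are differentiable on the whole
  line, so the primitive must have a two-sided derivative at every real point, also outside
  [0, 1].\<close>

lemma continuous_primitive:
  fixes h :: "real \<Rightarrow> real"
  assumes "continuous_on UNIV h"
  obtains H where "H 0 = 0" "\<And>x. (H has_real_derivative h x) (at x)"
    "\<And>x y. y \<le> x \<Longrightarrow> (h has_integral (H x - H y)) {y..x}"
proof -
  obtain F where F: "\<And>x. (F has_vector_derivative h x) (at x)"
    using einterval_antiderivative[of "-\<infinity>" "\<infinity>" h] assms
    by (auto simp: continuous_on_eq_continuous_at)
  let ?H = "\<lambda>x. F x - F 0"
  have d: "(?H has_vector_derivative h x) (at x)" for x
    using F[of x] by (auto intro!: derivative_eq_intros)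
  show thesis
  proof (rule that[of ?H])
    show "(h has_integral (?H x - ?H y)) {y..x}" if "y \<le> x" for x y
      using d that by (intro fundamental_theorem_of_calculus) (auto intro: has_vector_derivative_at_within)
  qed (use d in \<open>auto simp: has_real_derivative_iff_has_vector_derivative\<close>)
qed

text \<open>Test functions with derivative \<open>\<kappa>\<^sub>k e - c\<^sub>k \<eta>\<close>, where \<open>\<kappa>\<^sub>k\<close> are cutoffs and \<open>\<eta>\<close> a fixed bump,
  turn the weak derivative into an integration by parts against the primitive of \<open>e\<close>.\<close>

lemma weak_integration_by_parts:
  fixes e :: "real \<Rightarrow> real"
  assumes f: "integrable (lebesgue_on {0..1}) f" and f': "integrable (lebesgue_on {0..1}) f'"
    and weak: "has_weak_derivative f f' 0 1"
    and e: "continuous_on UNIV e"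
    and \<eta>: "continuous_on UNIV \<eta>" "\<And>x. x \<notin> {1/4..3/4} \<Longrightarrow> \<eta> x = 0" "integral {0..1} \<eta> = 1"
  shows "(LINT x|lebesgue_on {0..1}. (e x - integral {0..1} e * \<eta> x) *\<^sub>R f x) =
    - (LINT x|lebesgue_on {0..1}. (integral {0..x} e - integral {0..1} e * integral {0..x} \<eta>) *\<^sub>R f' x)"
proof -
  let ?M = "lebesgue_on {0..1::real}"
  \<comment> \<open>A trapezoid: 0 within 1/(k + 4) of either end of [0, 1], 1 from 2/(k + 4) on,
    linear in between. The 4 keeps the two margins outside the open interval (1/4, 3/4), away from
    the bump \<eta>.\<close>
  define cut where "cut = (\<lambda>(k::nat) (x::real). max 0 (min 1 ((real k + 4) * min x (1 - x) - 1)))"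
  define ek where "ek = (\<lambda>k x. cut k x * e x)"
  \<comment> \<open>As \<eta> has integral 1, subtracting \<open>c k\<close> times \<eta> gives
    \<open>h k\<close> mean zero. Its primitive then vanishes near both ends and is an admissible
    test function.\<close>
  define c where "c = (\<lambda>k. integral {0..1} (ek k))"
  define h where "h = (\<lambda>k x. ek k x - c k * \<eta> x)"
  have cek: "continuous_on A (ek k)" for k A
    unfolding ek_def cut_def by (intro continuous_intros continuous_on_subset[OF e]) auto
  have ce: "continuous_on A e" and c\<eta>: "continuous_on A \<eta>" for A
    using e \<eta>(1) continuous_on_subset by blast+
  have ch: "continuous_on A (h k)" for k A
    unfolding h_def by (intro continuous_intros cek c\<eta>)
  have cut0: "cut k x = 0" if "x \<le> 1 / (real k + 4) \<or> 1 - 1 / (real k + 4) \<le> x" for k x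
  proof -
    have "min x (1 - x) \<le> 1 / (real k + 4)" using that by linarith
    then have "(real k + 4) * min x (1 - x) \<le> 1" by (simp add: pos_le_divide_eq mult.commute)
    then show ?thesis unfolding cut_def by linarith
  qed
  have k4: "1 / (real k + 4) \<le> 1 / 4" for k by (simp add: field_simps)
  have h0: "h k x = 0" if "x \<le> 1 / (real k + 4) - 0 \<and> x < 1/4 \<or> 1 - 1 / (real k + 4) \<le> x \<and> 3/4 < x" for k x
    using that cut0[of x k] \<eta>(2)[of x] by (auto simp: h_def ek_def)
  have ieta: "\<eta> integrable_on {a..b}" and iek: "ek k integrable_on {a..b}" for a b k
    by (intro integrable_continuous_interval c\<eta> cek)+
  have h_int: "integral {0..x} (h k) = integral {0..x} (ek k) - c k * integral {0..x} \<eta>" for k x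
    unfolding h_def
    by (subst Henstock_Kurzweil_Integration.integral_diff) (auto intro!: iek integrable_on_cmult_left[of \<eta>, simplified] ieta)
  have weak_k: "(LINT x|?M. h k x *\<^sub>R f x) = - (LINT x|?M. integral {0..x} (h k) *\<^sub>R f' x)" for k
  proof -
    obtain H where H: "H 0 = 0" "\<And>x. (H has_real_derivative h k x) (at x)"
      "\<And>x y. y \<le> x \<Longrightarrow> (h k has_integral (H x - H y)) {y..x}"
      using continuous_primitive[OF ch] by metis
    \<comment> \<open>The 1/5 keeps \<delta> strictly below 1/4, since \<eta> is known to vanish
      only outside the closed interval [1/4, 3/4].\<close>
    define \<delta> where "\<delta> = min (1 / (real k + 4)) (1 / 5)"
    have \<delta>: "0 < \<delta>" "\<delta> < 1/4" "\<delta> \<le> 1 / (real k + 4)" by (auto simp: \<delta>_def)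
    have Hint: "H x = integral {0..x} (h k)" if "0 \<le> x" for x
      using H(3)[of 0 x] H(1) that by (simp add: integral_unique)
    have H1: "H 1 = 0"
      using Hint[of 1] \<eta>(3) by (simp add: h_int c_def)
    have left: "H x = 0" if "x \<le> \<delta>" for x
    proof -
      have "(h k has_integral 0) {y..z}" if "z \<le> \<delta>" for y z
        using that \<delta> by (intro has_integral_is_0) (auto intro!: h0)
      then have "H z - H y = 0" if "y \<le> z" "z \<le> \<delta>" for y z
        using H(3)[OF that(1)] that has_integral_unique by blast
      from this[of 0 x] this[of x 0] H(1) \<delta> that show ?thesis
        by (cases "0 \<le> x") auto
    qed
    have right: "H x = 0" if "1 - \<delta> \<le> x" for x
    proof -
      have "(h k has_integral 0) {y..z}" if "1 - \<delta> \<le> y" for y z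
        using that \<delta> by (intro has_integral_is_0) (auto intro!: h0)
      then have "H z - H y = 0" if "y \<le> z" "1 - \<delta> \<le> y" for y z
        using H(3)[OF that(1)] that has_integral_unique by blast
      from this[of 1 x] this[of x 1] H1 \<delta> that show ?thesis
        by (cases "1 \<le> x") auto
    qed
    have "{x. H x \<noteq> 0} \<subseteq> {\<delta>..1-\<delta>}"
    proof
      fix x assume "x \<in> {x. H x \<noteq> 0}"
      then show "x \<in> {\<delta>..1-\<delta>}" using left[of x] right[of x] by (simp, linarith)
    qed
    then have "closure {x. H x \<noteq> 0} \<subseteq> {\<delta>..1-\<delta>}"
      by (rule closure_minimal) simp
    then have "closure {x. H x \<noteq> 0} \<subseteq> {0<..<1}" using \<delta> by force
    then have "(LINT x|?M. h k x *\<^sub>R f x) = - (LINT x|?M. H x *\<^sub>R f' x)"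
      using weak H(2) ch unfolding has_weak_derivative_def by blast
    also have "(LINT x|?M. H x *\<^sub>R f' x) = (LINT x|?M. integral {0..x} (h k) *\<^sub>R f' x)"
      by (intro Bochner_Integration.integral_cong) (auto simp: Hint)
    finally show ?thesis .
  qed
  have "bounded (e ` {0..1})" "bounded (\<eta> ` {0..1})"
    by (intro compact_imp_bounded compact_continuous_image ce c\<eta> compact_Icc)+
  then obtain B B' where B: "\<And>x. x \<in> {0..1} \<Longrightarrow> \<bar>e x\<bar> \<le> B" and B': "\<And>x. x \<in> {0..1} \<Longrightarrow> \<bar>\<eta> x\<bar> \<le> B'"
    unfolding bounded_iff real_norm_def by (meson imageI)
  have B0: "0 \<le> B" "0 \<le> B'" using B[of 0] B'[of 0] by auto
  have ekB: "\<bar>ek k x\<bar> \<le> B" if "x \<in> {0..1}" for k x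
  proof -
    have "\<bar>cut k x\<bar> \<le> 1" by (auto simp: cut_def)
    then have "\<bar>cut k x\<bar> * \<bar>e x\<bar> \<le> 1 * B" by (intro mult_mono B that) auto
    then show ?thesis by (simp add: ek_def abs_mult)
  qed
  have intB: "\<bar>integral {0..x} g\<bar> \<le> D" if "x \<in> {0..1}" "continuous_on UNIV g" "\<And>x. x \<in> {0..1} \<Longrightarrow> \<bar>g x\<bar> \<le> D" "0 \<le> D"
    for g :: "real \<Rightarrow> real" and x D
  proof -
    have "norm (integral {0..x} g) \<le> D * (x - 0)"
      using that by (intro integral_bound) (auto intro: continuous_on_subset)
    also have "\<dots> \<le> D * 1" using that by (intro mult_left_mono) auto
    finally show ?thesis by simp
  qed
  have ek_lim: "(\<lambda>k. ek k x) \<longlonglongrightarrow> (if x \<in> {0<..<1} then e x else 0)" if "x \<in> {0..1}" for x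
  proof (cases "x \<in> {0<..<1}")
    case True
    define d where "d = min x (1 - x)"
    have d: "0 < d" using True by (auto simp: d_def)
    have "\<forall>\<^sub>F k in sequentially. ek k x = e x"
    proof (rule eventually_sequentiallyI)
      fix k assume "nat \<lceil>2 / d\<rceil> \<le> k"
      then have "2 / d \<le> real k + 4" by linarith
      then have "2 \<le> (real k + 4) * d" using d by (simp add: field_simps)
      then show "ek k x = e x" by (simp add: ek_def cut_def d_def[symmetric])
    qed
    then show ?thesis using True by (simp add: tendsto_eventually)
  next
    case False
    then have "x = 0 \<or> x = 1" using that by auto
    then have "ek k x = 0" for k using cut0[of x k] by (auto simp: ek_def)
    then show ?thesis using False by auto
  qed
  have int_lim: "(\<lambda>k. integral {0..x} (ek k)) \<longlonglongrightarrow> integral {0..x} e" if "x \<in> {0..1}" for x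
  proof -
    have "(\<lambda>k. integral {0..x} (ek k)) \<longlonglongrightarrow> integral {0..x} (\<lambda>x. if x \<in> {0<..<1} then e x else 0)"
    proof (rule dominated_convergence(2)[where h = "\<lambda>_. B"])
      show "(\<lambda>k. ek k y) \<longlonglongrightarrow> (if y \<in> {0<..<1} then e y else 0)" if "y \<in> {0..x}" for y
        using that \<open>x \<in> {0..1}\<close> by (intro ek_lim) auto
      show "norm (ek k y) \<le> B" if "y \<in> {0..x}" for k y
        using that \<open>x \<in> {0..1}\<close> ekB[of y k] by simp
    qed (auto intro: iek)
    also have "integral {0..x} (\<lambda>x. if x \<in> {0<..<1} then e x else 0) = integral {0..x} e"
      using that by (intro integral_spike[of "{0,1}"]) auto
    finally show ?thesis .
  qed
  have c_lim: "c \<longlonglongrightarrow> integral {0..1} e"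
    unfolding c_def by (rule int_lim) simp
  have cB: "\<bar>c k\<bar> \<le> B" for k
    unfolding c_def by (rule intB) (auto simp: cek ekB B0)
  have 1: "(\<lambda>k. LINT x|?M. h k x *\<^sub>R f x) \<longlonglongrightarrow> (LINT x|?M. (e x - integral {0..1} e * \<eta> x) *\<^sub>R f x)"
  proof (rule integral_dominated_convergence[where w = "\<lambda>x. (B + B * B') * cmod (f x)"])
    show "AE x in ?M. (\<lambda>k. h k x *\<^sub>R f x) \<longlonglongrightarrow> (e x - integral {0..1} e * \<eta> x) *\<^sub>R f x"
    proof -
      have "AE x in ?M. x \<noteq> 0 \<and> x \<noteq> 1"
        using AE_completion[OF AE_lborel_singleton[of "0::real"]] AE_completion[OF AE_lborel_singleton[of "1::real"]]
        by (simp add: AE_restrict_space_iff) (auto elim: eventually_mono)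
      moreover have "AE x in ?M. x \<in> {0..1}" by (simp add: AE_restrict_space_iff)
      ultimately show ?thesis
      proof eventually_elim
        case (elim x)
        then have "(\<lambda>k. ek k x) \<longlonglongrightarrow> e x" using ek_lim[of x] by auto
        then show ?case unfolding h_def by (intro tendsto_intros c_lim)
      qed
    qed
    show "AE x in ?M. norm (h k x *\<^sub>R f x) \<le> (B + B * B') * cmod (f x)" for k
    proof -
      have "norm (h k x *\<^sub>R f x) \<le> (B + B * B') * cmod (f x)" if "x \<in> {0..1}" for x
      proof -
        have "\<bar>h k x\<bar> \<le> \<bar>ek k x\<bar> + \<bar>c k\<bar> * \<bar>\<eta> x\<bar>" unfolding h_def by (metis abs_mult abs_triangle_ineq4)
        also have "\<dots> \<le> B + B * B'" using that by (intro add_mono mult_mono ekB cB B' B0) auto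
        finally show ?thesis by (simp add: mult_right_mono)
      qed
      then show ?thesis by (simp add: AE_restrict_space_iff)
    qed
    have "h k \<in> borel_measurable ?M" "(\<lambda>x. e x - integral {0..1} e * \<eta> x) \<in> borel_measurable ?M" for k
      by (auto intro!: continuous_imp_measurable_on_sets_lebesgue ch continuous_intros ce c\<eta>)
    then show "(\<lambda>x. h k x *\<^sub>R f x) \<in> borel_measurable ?M" "(\<lambda>x. (e x - integral {0..1} e * \<eta> x) *\<^sub>R f x) \<in> borel_measurable ?M" for k
      using f by auto
  qed (use f in auto)
  have cont_int: "continuous_on {0..1} (\<lambda>x. integral {0..x} g)" if "continuous_on UNIV g" for g :: "real \<Rightarrow> real"
    using that by (intro indefinite_integral_continuous_1 integrable_continuous_interval) (auto intro: continuous_on_subset)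
  have 2: "(\<lambda>k. LINT x|?M. integral {0..x} (h k) *\<^sub>R f' x) \<longlonglongrightarrow>
      (LINT x|?M. (integral {0..x} e - integral {0..1} e * integral {0..x} \<eta>) *\<^sub>R f' x)"
  proof (rule integral_dominated_convergence[where w = "\<lambda>x. (B + B * B') * cmod (f' x)"])
    have "(\<lambda>k. integral {0..x} (h k) *\<^sub>R f' x) \<longlonglongrightarrow> (integral {0..x} e - integral {0..1} e * integral {0..x} \<eta>) *\<^sub>R f' x"
      if "x \<in> {0..1}" for x
      unfolding h_int by (intro tendsto_intros int_lim c_lim that)
    then show "AE x in ?M. (\<lambda>k. integral {0..x} (h k) *\<^sub>R f' x) \<longlonglongrightarrow> (integral {0..x} e - integral {0..1} e * integral {0..x} \<eta>) *\<^sub>R f' x"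
      by (simp add: AE_restrict_space_iff)
    show "AE x in ?M. norm (integral {0..x} (h k) *\<^sub>R f' x) \<le> (B + B * B') * cmod (f' x)" for k
    proof -
      have "norm (integral {0..x} (h k) *\<^sub>R f' x) \<le> (B + B * B') * cmod (f' x)" if "x \<in> {0..1}" for x
      proof -
        have "\<bar>integral {0..x} (h k)\<bar> \<le> \<bar>integral {0..x} (ek k)\<bar> + \<bar>c k\<bar> * \<bar>integral {0..x} \<eta>\<bar>"
          unfolding h_int by (metis abs_mult abs_triangle_ineq4)
        also have "\<dots> \<le> B + B * B'" using that by (intro add_mono mult_mono intB ekB cB cek c\<eta> B' B0) auto
        finally show ?thesis by (simp add: mult_right_mono)
      qed
      then show ?thesis by (simp add: AE_restrict_space_iff)
    qed
    have "(\<lambda>x. integral {0..x} (h k)) \<in> borel_measurable ?M"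
      "(\<lambda>x. integral {0..x} e - integral {0..1} e * integral {0..x} \<eta>) \<in> borel_measurable ?M" for k
      by (auto intro!: continuous_imp_measurable_on_sets_lebesgue cont_int ch continuous_intros ce c\<eta>)
    then show "(\<lambda>x. integral {0..x} (h k) *\<^sub>R f' x) \<in> borel_measurable ?M"
      "(\<lambda>x. (integral {0..x} e - integral {0..1} e * integral {0..x} \<eta>) *\<^sub>R f' x) \<in> borel_measurable ?M" for k
      using f' by auto
  qed (use f' in auto)
  have "(\<lambda>k. LINT x|?M. h k x *\<^sub>R f x) \<longlonglongrightarrow>
      - (LINT x|?M. (integral {0..x} e - integral {0..1} e * integral {0..x} \<eta>) *\<^sub>R f' x)"
    unfolding weak_k by (intro tendsto_minus 2)
  with 1 show ?thesis using LIMSEQ_unique by blast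
qed

lemma unit_bump:
  obtains \<eta> :: "real \<Rightarrow> real" where "continuous_on UNIV \<eta>" "\<And>x. x \<notin> {1/4..3/4} \<Longrightarrow> \<eta> x = 0"
    "integral {0..1} \<eta> = 1" "\<And>x. 0 \<le> \<eta> x" "\<And>x. \<eta> x \<le> 3"
proof -
  \<comment> \<open>The parabola (x - 1/4) (3/4 - x) has integral 1/48 over [1/4, 3/4] and maximum
    1/16; the factor 48 gives unit mass and height 3.\<close>
  let ?p = "\<lambda>x::real. 96 * ((x - 1/4) * (3/4 - x)) / 2"
  let ?\<eta> = "\<lambda>x::real. max 0 (?p x)"
  have neg: "?p x < 0" if "x \<notin> {1/4..3/4}" for x
    using that by (auto simp: mult_less_0_iff)
  have nonneg: "0 \<le> ?p x" if "x \<in> {1/4..3/4}" for x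
    using that by (auto simp: zero_le_mult_iff)
  have "(?p has_integral (- 16 * (3/4)^3 + 24 * (3/4)^2 - 9 * (3/4) - (- 16 * (1/4)^3 + 24 * (1/4)^2 - 9 * (1/4)))) {1/4..3/4}"
    by (rule fundamental_theorem_of_calculus)
      (auto intro!: derivative_eq_intros simp: has_real_derivative_iff_has_vector_derivative[symmetric] field_simps power2_eq_square)
  then have "(?p has_integral 1) {1/4..3/4}" by (simp add: power2_eq_square power3_eq_cube)
  then have "((\<lambda>x. if x \<in> {1/4..3/4} then ?p x else 0) has_integral 1) {0..1}"
    by (subst has_integral_restrict) auto
  then have int: "(?\<eta> has_integral 1) {0..1}"
  proof (rule has_integral_eq[rotated])
    show "(if x \<in> {1/4..3/4} then ?p x else 0) = ?\<eta> x" for x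
      using neg[of x] nonneg[of x] by (cases "x \<in> {1/4..3/4}") auto
  qed
  show thesis
  proof (rule that[of ?\<eta>])
    show "?\<eta> x \<le> 3" for x
    proof -
      have "(x - 1/4) * (3/4 - x) = 1/16 - (x - 1/2)\<^sup>2" by (simp add: field_simps power2_eq_square)
      also have "\<dots> \<le> 1/16" by simp
      finally show ?thesis by simp
    qed
    show "?\<eta> x = 0" if "x \<notin> {1/4..3/4}" for x
      using neg[OF that] by simp
    show "continuous_on UNIV ?\<eta>" by (auto intro!: continuous_intros)
  qed (use int in \<open>auto simp: integral_unique\<close>)
qed

lemma weak_derivative_props:
  assumes "H1_on a b f"
  shows "L2_on {a..b} (weak_derivative a b f)" "has_weak_derivative f (weak_derivative a b f) a b"
  using someI_ex[of "\<lambda>f'. L2_on {a..b} f' \<and> has_weak_derivative f f' a b"] assms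
  by (auto simp: H1_on_def weak_derivative_def)

lemma L2_norm_le_H1_norm:
  "L2_norm {a..b} f \<le> H1_norm a b f" "L2_norm {a..b} (weak_derivative a b f) \<le> H1_norm a b f"
  unfolding H1_norm_def by (rule real_le_rsqrt; simp)+

text \<open>Removing the mean of e by a multiple of the bump \<eta> gives access to the weak
  integration by parts, which involves no boundary values of f. The primitive contributes 2 B
  against the weak derivative, and the removed bump, of height 3, contributes 3 B against f.\<close>

lemma H1_real_oscillation_bound:
  fixes e :: "real \<Rightarrow> real"
  assumes f: "H1_on 0 1 f" and e: "continuous_on UNIV e"
    and B: "\<And>x. x \<in> {0..1} \<Longrightarrow> \<bar>integral {0..x} e\<bar> \<le> B"
  shows "cmod (LINT x|lebesgue_on {0..1}. e x *\<^sub>R f x) \<le> 5 * B * H1_norm 0 1 f"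
proof -
  let ?M = "lebesgue_on {0..1::real}" and ?f' = "weak_derivative 0 1 f"
  obtain \<eta> :: "real \<Rightarrow> real" where \<eta>: "continuous_on UNIV \<eta>" "\<And>x. x \<notin> {1/4..3/4} \<Longrightarrow> \<eta> x = 0"
    "integral {0..1} \<eta> = 1" "\<And>x. 0 \<le> \<eta> x" "\<And>x. \<eta> x \<le> 3"
    by (metis unit_bump)
  have L2: "L2_on {0..1} f" "L2_on {0..1} ?f'"
    using f weak_derivative_props[OF f] by (auto simp: H1_on_def)
  have if0: "integrable ?M f" and if1: "integrable ?M ?f'"
    using L2 by (auto intro: L2_imp_integrable)
  have ieta: "\<eta> integrable_on {a..b}" for a b
    using \<eta>(1) continuous_on_subset integrable_continuous_interval by blast
  have N: "0 \<le> integral {0..x} \<eta>" "integral {0..x} \<eta> \<le> 1" if "x \<in> {0..1}" for x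
    using integral_subset_le[of "{0..x}" "{0..1}" \<eta>] that \<eta>(3,4) ieta
    by (auto intro: integral_nonneg)
  have mult_int: "integrable ?M (\<lambda>x. g x *\<^sub>R u x)" if "continuous_on {0..1} g" "integrable ?M u"
    for g :: "real \<Rightarrow> real" and u :: "real \<Rightarrow> complex"
    using integrable_continuous_mult[of 0 1 "\<lambda>x. complex_of_real (g x)" u] that
    by (simp add: scaleR_conv_of_real continuous_on_of_real)
  have ce: "continuous_on {0..1} e" and c\<eta>: "continuous_on {0..1} \<eta>"
    using e \<eta>(1) continuous_on_subset by blast+
  let ?E = "integral {0..1} e"
  have "(LINT x|?M. e x *\<^sub>R f x) = (LINT x|?M. (e x - ?E * \<eta> x) *\<^sub>R f x + ?E *\<^sub>R (\<eta> x *\<^sub>R f x))"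
    by (intro Bochner_Integration.integral_cong) (auto simp: algebra_simps)
  also have "\<dots> = (LINT x|?M. (e x - ?E * \<eta> x) *\<^sub>R f x) + ?E *\<^sub>R (LINT x|?M. \<eta> x *\<^sub>R f x)"
    by (subst Bochner_Integration.integral_add)
      (auto intro!: mult_int if0 continuous_intros ce c\<eta> simp del: scaleR_scaleR)
  also have "(LINT x|?M. (e x - ?E * \<eta> x) *\<^sub>R f x) = - (LINT x|?M. (integral {0..x} e - ?E * integral {0..x} \<eta>) *\<^sub>R ?f' x)"
    by (intro weak_integration_by_parts if0 if1 weak_derivative_props[OF f] e \<eta>)
  finally have eq: "(LINT x|?M. e x *\<^sub>R f x) = - (LINT x|?M. (integral {0..x} e - ?E * integral {0..x} \<eta>) *\<^sub>R ?f' x)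
     + ?E *\<^sub>R (LINT x|?M. \<eta> x *\<^sub>R f x)" .
  have B0: "0 \<le> B" and EB: "\<bar>?E\<bar> \<le> B" using B[of 0] B[of 1] by auto
  have cint: "continuous_on {0..1} (\<lambda>x. integral {0..x} g)" if "continuous_on UNIV g" for g :: "real \<Rightarrow> real"
    using that by (intro indefinite_integral_continuous_1 integrable_continuous_interval) (auto intro: continuous_on_subset)
  have "cmod (LINT x|?M. (integral {0..x} e - ?E * integral {0..x} \<eta>) *\<^sub>R ?f' x) \<le> (LINT x|?M. 2 * B * cmod (?f' x))"
  proof (rule order.trans[OF integral_norm_bound integral_mono_AE])
    show "integrable ?M (\<lambda>x. norm ((integral {0..x} e - ?E * integral {0..x} \<eta>) *\<^sub>R ?f' x))"
      by (intro integrable_norm mult_int if1 continuous_intros cint e \<eta>)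
    have "norm ((integral {0..x} e - ?E * integral {0..x} \<eta>) *\<^sub>R ?f' x) \<le> 2 * B * cmod (?f' x)" if x: "x \<in> {0..1}" for x
    proof -
      have "\<bar>integral {0..x} e - ?E * integral {0..x} \<eta>\<bar> \<le> \<bar>integral {0..x} e\<bar> + \<bar>?E\<bar> * \<bar>integral {0..x} \<eta>\<bar>"
        by (metis abs_mult abs_triangle_ineq4)
      also have "\<dots> \<le> B + B * 1" using N[OF x] by (intro add_mono mult_mono B EB B0 x) auto
      finally show ?thesis by (simp add: mult_right_mono)
    qed
    then show "AE x in ?M. norm ((integral {0..x} e - ?E * integral {0..x} \<eta>) *\<^sub>R ?f' x) \<le> 2 * B * cmod (?f' x)"
      by (auto simp: AE_restrict_space_iff)
  qed (use if1 in auto)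
  also have "\<dots> \<le> 2 * B * H1_norm 0 1 f"
    using L1_le_L2_unit_interval[OF L2(2)] L2_norm_le_H1_norm(2)[of 0 1 f] B0 by (simp add: mult_left_mono)
  finally have 1: "cmod (LINT x|?M. (integral {0..x} e - ?E * integral {0..x} \<eta>) *\<^sub>R ?f' x) \<le> 2 * B * H1_norm 0 1 f" .
  have "cmod (LINT x|?M. \<eta> x *\<^sub>R f x) \<le> (LINT x|?M. 3 * cmod (f x))"
  proof (rule order.trans[OF integral_norm_bound integral_mono_AE])
    show "integrable ?M (\<lambda>x. norm (\<eta> x *\<^sub>R f x))" by (intro integrable_norm mult_int if0 c\<eta>)
    show "AE x in ?M. norm (\<eta> x *\<^sub>R f x) \<le> 3 * cmod (f x)"
      using \<eta>(4,5) by (auto intro!: AE_I2 mult_right_mono)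
  qed (use if0 in auto)
  also have "\<dots> \<le> 3 * H1_norm 0 1 f"
    using L1_le_L2_unit_interval[OF L2(1)] L2_norm_le_H1_norm(1)[of 0 1 f] by simp
  finally have "\<bar>?E\<bar> * cmod (LINT x|?M. \<eta> x *\<^sub>R f x) \<le> B * (3 * H1_norm 0 1 f)"
    by (intro mult_mono EB B0) auto
  with 1 show ?thesis
    unfolding eq by (intro norm_triangle_le) (simp add: algebra_simps)
qed

text \<open>Test functions are real, so the real and imaginary parts of e are treated separately;
  hence 10 = 5 + 5.\<close>

lemma H1_oscillation_bound:
  fixes e :: "real \<Rightarrow> complex"
  assumes f: "H1_on 0 1 f" and e: "continuous_on UNIV e"
    and B: "\<And>x. x \<in> {0..1} \<Longrightarrow> cmod (integral {0..x} e) \<le> B"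
  shows "cmod (LINT x|lebesgue_on {0..1}. e x * f x) \<le> 10 * B * H1_norm 0 1 f"
proof -
  let ?M = "lebesgue_on {0..1::real}"
  have i: "e integrable_on {0..x}" for x
    using e continuous_on_subset integrable_continuous_interval by blast
  have "\<bar>integral {0..x} (\<lambda>x. Re (e x))\<bar> \<le> B" "\<bar>integral {0..x} (\<lambda>x. Im (e x))\<bar> \<le> B" if "x \<in> {0..1}" for x
    using integral_linear[OF i bounded_linear_Re, of x] integral_linear[OF i bounded_linear_Im, of x]
      B[OF that] abs_Re_le_cmod[of "integral {0..x} e"] abs_Im_le_cmod[of "integral {0..x} e"]
    by (auto simp: o_def)
  then have b: "cmod (LINT x|?M. Re (e x) *\<^sub>R f x) \<le> 5 * B * H1_norm 0 1 f"
    "cmod (LINT x|?M. Im (e x) *\<^sub>R f x) \<le> 5 * B * H1_norm 0 1 f"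
    using e by (intro H1_real_oscillation_bound f continuous_intros; simp)+
  have int: "integrable ?M (\<lambda>x. g x *\<^sub>R f x)" if "continuous_on UNIV g" for g :: "real \<Rightarrow> real"
  proof -
    have "continuous_on {0..1} g" using that continuous_on_subset by blast
    moreover have "integrable ?M f"
      using f by (intro L2_imp_integrable) (auto simp: H1_on_def)
    ultimately show ?thesis
      using integrable_continuous_mult[of 0 1 "\<lambda>x. complex_of_real (g x)" f]
      by (simp add: scaleR_conv_of_real continuous_on_of_real)
  qed
  have "(LINT x|?M. e x * f x) = (LINT x|?M. Re (e x) *\<^sub>R f x + \<i> * (Im (e x) *\<^sub>R f x))"
    by (intro Bochner_Integration.integral_cong) (auto simp: complex_eq_iff)
  also have "\<dots> = (LINT x|?M. Re (e x) *\<^sub>R f x) + \<i> * (LINT x|?M. Im (e x) *\<^sub>R f x)"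
    by (subst Bochner_Integration.integral_add)
      (auto intro!: int integrable_mult_right continuous_intros e simp del: mult_scaleR_right)
  finally show ?thesis
    using b norm_triangle_ineq[of "LINT x|?M. Re (e x) *\<^sub>R f x" "\<i> * (LINT x|?M. Im (e x) *\<^sub>R f x)"]
    by (simp add: norm_mult)
qed

section \<open>The Gaussian basis\<close>

text \<open>The pair is ordered (y, x) so that the real part becomes the inner variable of the
  iterated integral. There the integrands are a character over a period or a Gaussian
  transform.\<close>

lemma lborel_complex:
  "(lborel :: complex measure) = distr (lborel \<Otimes>\<^sub>M lborel) borel (\<lambda>(y, x). Complex x y)"
proof (rule lborel_eqI)
  have meas: "(\<lambda>(y, x). Complex x y) \<in> borel_measurable (lborel \<Otimes>\<^sub>M lborel)"
    unfolding Complex_eq by measurable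
  fix l u :: complex
  assume "\<And>b. b \<in> Basis \<Longrightarrow> l \<bullet> b \<le> u \<bullet> b"
  from this[of 1] this[of \<i>] have le: "Re l \<le> Re u" "Im l \<le> Im u"
    by (auto simp: Basis_complex_def)
  have "(\<lambda>(y, x). Complex x y) -` box l u \<inter> space (lborel \<Otimes>\<^sub>M lborel) = {Im l<..<Im u} \<times> {Re l<..<Re u}"
    by (auto simp: in_box_complex_iff space_pair_measure)
  then have "emeasure (distr (lborel \<Otimes>\<^sub>M lborel) borel (\<lambda>(y, x). Complex x y)) (box l u) =
      emeasure (lborel \<Otimes>\<^sub>M lborel) ({Im l<..<Im u} \<times> {Re l<..<Re u})"
    by (subst emeasure_distr[OF meas]) auto
  also have "\<dots> = ennreal (Im u - Im l) * ennreal (Re u - Re l)"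
    using le by (subst lborel.emeasure_pair_measure_Times) auto
  also have "\<dots> = (\<Prod>b\<in>Basis. (u - l) \<bullet> b)"
    using le by (simp add: Basis_complex_def ennreal_mult'' mult.commute)
  finally show "emeasure (distr (lborel \<Otimes>\<^sub>M lborel) borel (\<lambda>(y, x). Complex x y)) (box l u) = (\<Prod>b\<in>Basis. (u - l) \<bullet> b)" .
qed simp

lemma Complex_measurable: "(\<lambda>(y, x). Complex x y) \<in> borel_measurable (lborel \<Otimes>\<^sub>M lborel)"
  unfolding Complex_eq by measurable

lemma complex_integrable_iff:
  fixes f :: "complex \<Rightarrow> complex"
  assumes "f \<in> borel_measurable borel"
  shows "integrable lborel f \<longleftrightarrow> integrable (lborel \<Otimes>\<^sub>M lborel) (\<lambda>(y, x). f (Complex x y))"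
  unfolding lborel_complex
  by (subst integrable_distr_eq[OF Complex_measurable]) (use assms in \<open>auto simp: case_prod_unfold\<close>)

lemma complex_integral_iterated:
  fixes f :: "complex \<Rightarrow> complex"
  assumes f: "integrable lborel f"
  shows "(LINT z|lborel. f z) = (LINT y|lborel. LINT x|lborel. f (Complex x y))"
proof -
  have fm: "f \<in> borel_measurable borel" using f by (auto dest: borel_measurable_integrable)
  have i: "integrable (lborel \<Otimes>\<^sub>M lborel) (\<lambda>(y, x). f (Complex x y))"
    using complex_integrable_iff[OF fm] f by simp
  have "(LINT z|lborel. f z) = (LINT p|(lborel \<Otimes>\<^sub>M lborel). (\<lambda>(y, x). f (Complex x y)) p)"
    unfolding lborel_complex
    by (subst integral_distr[OF Complex_measurable]) (use fm in \<open>auto simp: case_prod_unfold\<close>)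
  also have "\<dots> = (LINT y|lborel. LINT x|lborel. f (Complex x y))"
    using lborel_pair.integral_fst'[OF i] by simp
  finally show ?thesis .
qed

lemma complex_integrable_product:
  fixes f g :: "real \<Rightarrow> complex"
  assumes f: "integrable lborel f" and g: "integrable lborel g"
  shows "integrable lborel (\<lambda>z. f (Re z) * g (Im z))"
proof -
  have [measurable]: "f \<in> borel_measurable borel" "g \<in> borel_measurable borel"
    using f g by (auto dest: borel_measurable_integrable)
  have "integrable (lborel \<Otimes>\<^sub>M lborel) (\<lambda>p. f (snd p) * g (fst p))"
  proof (rule lborel_pair.Fubini_integrable)
    show "(\<lambda>p. f (snd p) * g (fst p)) \<in> borel_measurable (lborel \<Otimes>\<^sub>M lborel)" by measurable
    show "integrable lborel (\<lambda>y. LINT x|lborel. norm (f (snd (y, x)) * g (fst (y, x))))"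
      using g by (simp add: norm_mult)
    show "AE y in lborel. integrable lborel (\<lambda>x. f (snd (y, x)) * g (fst (y, x)))"
      using f by simp
  qed
  then show ?thesis
    by (subst complex_integrable_iff) (auto simp: case_prod_unfold)
qed

text \<open>Up to the factor sqrt (2 pi) this is the characteristic function of the standard normal
  distribution.\<close>

lemma gaussian_fourier:
  fixes b :: real
  shows "integrable lborel (\<lambda>x. complex_of_real (exp (- x\<^sup>2 / 2)) * iexp (b * x))"
    and "(LINT x|lborel. complex_of_real (exp (- x\<^sup>2 / 2)) * iexp (b * x)) = complex_of_real (sqrt (2 * pi) * exp (- b\<^sup>2 / 2))"
proof -
  have e: "complex_of_real (exp (- x\<^sup>2 / 2)) = complex_of_real (sqrt (2 * pi)) * complex_of_real (std_normal_density x)" for x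
    by (simp add: std_normal_density_def)
  have feq: "(\<lambda>x. complex_of_real (exp (- x\<^sup>2 / 2)) * iexp (b * x)) =
      (\<lambda>x. complex_of_real (sqrt (2 * pi)) * (complex_of_real (std_normal_density x) * iexp (b * x)))"
    by (rule ext) (simp only: e mult.assoc)
  have "integrable lborel (\<lambda>x. complex_of_real (std_normal_density x) * iexp (b * x))"
  proof (rule Bochner_Integration.integrable_bound[of _ "\<lambda>x. std_normal_density x"])
    show "AE x in lborel. norm (complex_of_real (std_normal_density x) * iexp (b * x)) \<le> norm (std_normal_density x)"
      by (simp add: norm_mult)
  qed auto
  then show "integrable lborel (\<lambda>x. complex_of_real (exp (- x\<^sup>2 / 2)) * iexp (b * x))"
    unfolding feq by (rule integrable_mult_right)
  have "complex_of_real (exp (- b\<^sup>2 / 2)) = (LINT x|lborel. std_normal_density x *\<^sub>R iexp (b * x))"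
    using fun_cong[OF char_std_normal_distribution, of b] unfolding char_def
    by (subst (asm) integral_density) auto
  then have "(LINT x|lborel. complex_of_real (std_normal_density x) * iexp (b * x)) = complex_of_real (exp (- b\<^sup>2 / 2))"
    by (simp add: scaleR_conv_of_real)
  then show "(LINT x|lborel. complex_of_real (exp (- x\<^sup>2 / 2)) * iexp (b * x)) = complex_of_real (sqrt (2 * pi) * exp (- b\<^sup>2 / 2))"
    unfolding feq by (simp only: integral_mult_right_zero of_real_mult)
qed

text \<open>Translation by Re \<zeta> removes the real part of the linear term and leaves the
  Fourier transform of the Gaussian at Im \<zeta>, so no contour has to be moved.\<close>

lemma gaussian_laplace:
  fixes \<zeta> :: complex
  shows "integrable lborel (\<lambda>x::real. exp (- (complex_of_real x)\<^sup>2 / 2 + complex_of_real x * \<zeta>))"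
    and "(LINT x|lborel. exp (- (complex_of_real x)\<^sup>2 / 2 + complex_of_real x * \<zeta>)) = complex_of_real (sqrt (2 * pi)) * exp (\<zeta>\<^sup>2 / 2)"
proof -
  let ?f = "\<lambda>x::real. exp (- (complex_of_real x)\<^sup>2 / 2 + complex_of_real x * \<zeta>)"
  define a b where "a = Re \<zeta>" and "b = Im \<zeta>"
  have \<zeta>: "\<zeta> = complex_of_real a + \<i> * complex_of_real b" by (simp add: a_def b_def complex_eq)
  have f: "?f (a + 1 * x) = exp (complex_of_real (a\<^sup>2 / 2) + \<i> * complex_of_real (a * b)) * (complex_of_real (exp (- x\<^sup>2 / 2)) * iexp (b * x))" for x
    unfolding exp_of_real[symmetric] exp_add[symmetric] \<zeta>
    by (rule arg_cong[of _ _ exp]) (simp add: power2_eq_square field_simps)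
  have "integrable lborel (\<lambda>x. ?f (a + 1 * x))"
    unfolding f by (intro integrable_mult_right gaussian_fourier)
  then show "integrable lborel ?f"
    by (subst (asm) lborel_integrable_real_affine_iff) auto
  have "(LINT x|lborel. ?f x) = (LINT x|lborel. ?f (a + 1 * x))"
    by (subst lborel_integral_real_affine[of 1 _ a]) auto
  also have "\<dots> = exp (complex_of_real (a\<^sup>2 / 2) + \<i> * complex_of_real (a * b)) * complex_of_real (sqrt (2 * pi) * exp (- b\<^sup>2 / 2))"
    unfolding f by (simp only: integral_mult_right_zero gaussian_fourier(2))
  also have "\<dots> = complex_of_real (sqrt (2 * pi)) * (exp (complex_of_real (a\<^sup>2 / 2) + \<i> * complex_of_real (a * b)) * exp (complex_of_real (- b\<^sup>2 / 2)))"
    by (simp flip: exp_of_real)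
  also have "exp (complex_of_real (a\<^sup>2 / 2) + \<i> * complex_of_real (a * b)) * exp (complex_of_real (- b\<^sup>2 / 2)) = exp (\<zeta>\<^sup>2 / 2)"
    unfolding exp_add[symmetric] \<zeta>
    by (rule arg_cong[of _ _ exp]) (simp add: power2_eq_square field_simps)
  finally show "(LINT x|lborel. ?f x) = complex_of_real (sqrt (2 * pi)) * exp (\<zeta>\<^sup>2 / 2)" .
qed

lemma gaussian_shift:
  fixes a b :: real
  assumes a: "0 < a"
  shows "integrable lborel (\<lambda>y. exp (- (a * (y + b)\<^sup>2)))"
    and "(LINT y|lborel. exp (- (a * (y + b)\<^sup>2))) = sqrt (pi / a)"
proof -
  have e: "exp (- (a * (y + b)\<^sup>2)) = sqrt (pi / a) * normal_density (- b) (1 / sqrt (2 * a)) y" for y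
    using a by (simp add: normal_density_def power_divide real_sqrt_divide field_simps real_sqrt_mult)
  show "integrable lborel (\<lambda>y. exp (- (a * (y + b)\<^sup>2)))"
    unfolding e using a by (intro integrable_mult_right integrable_normal_density) simp
  show "(LINT y|lborel. exp (- (a * (y + b)\<^sup>2))) = sqrt (pi / a)"
    unfolding e using a by simp
qed

text \<open>In the variable Im z the modulus of \<psi> k is a Gaussian centred at - k \<delta>. The
  identity \<delta>^2 = pi Im \<tau> makes its exponent a complete square.\<close>

definition \<delta> :: real where "\<delta> = pi / \<gamma>"

definition psi_norm :: real where "psi_norm = (2 / (pi * \<gamma>\<^sup>2)) powr (1/4)"

definition gauss :: "int \<Rightarrow> real \<Rightarrow> real" where "gauss k y = exp (- (y + of_int k * \<delta>)\<^sup>2)"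

lemma delta_sq: "\<delta>\<^sup>2 = pi * sqrt 3 / 2"
  by (simp add: \<delta>_def \<gamma>_def power_divide) (simp add: power2_eq_square)

lemma delta_gamma: "\<delta> * \<gamma> = pi"
  using gamma_pos by (simp add: \<delta>_def)

lemma psi_norm_pos: "0 < psi_norm"
  using gamma_pos by (simp add: psi_norm_def)

lemma psi_norm_sq: "psi_norm\<^sup>2 = sqrt (2 / pi) / \<gamma>"
proof -
  have "psi_norm\<^sup>2 = (2 / (pi * \<gamma>\<^sup>2)) powr (1/2)"
    unfolding psi_norm_def by (simp add: powr_numeral[symmetric] powr_powr del: powr_numeral)
  also have "\<dots> = sqrt (2 / pi) / \<gamma>"
    using gamma_pos by (simp add: powr_half_sqrt real_sqrt_divide real_sqrt_mult)
  finally show ?thesis .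
qed

lemma tau_eq: "\<tau> = Complex (- 1/2) (sqrt 3 / 2)"
proof -
  have "\<tau> = cis (2 * pi / 3)" unfolding \<tau>_def cis_conv_exp by (simp add: mult_ac)
  then show ?thesis by (simp add: complex_eq_iff cos_120 sin_120)
qed

text \<open>The real part of z^2/2 - |z|^2/2 is - y^2, which the linear and quadratic terms in k
  complete to - (y + k \<delta>)^2. The phase - pi k^2 / 2 comes from Re \<tau> = -1/2.\<close>

lemma psi_Complex:
  "\<psi> k (Complex x y) = complex_of_real (psi_norm * gauss k y) *
     cis (x * y + 2 * \<delta> * of_int k * x - pi * (of_int k)\<^sup>2 / 2)"
proof -
  let ?w = "2 * \<i> * of_int k * complex_of_real pi * Complex x y / complex_of_real \<gamma>
     + \<i> * complex_of_real pi * \<tau> * (of_int k)\<^sup>2 + (Complex x y)\<^sup>2 / 2 - complex_of_real ((cmod (Complex x y))\<^sup>2 / 2)"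
  have k2: "(of_int k :: complex)\<^sup>2 = complex_of_real ((of_int k)\<^sup>2)" by simp
  have "Re ?w = - (2 * \<delta> * of_int k * y) - pi * sqrt 3 / 2 * (of_int k)\<^sup>2 + (x\<^sup>2 - y\<^sup>2) / 2 - (x\<^sup>2 + y\<^sup>2) / 2"
    unfolding k2 tau_eq by (simp add: \<delta>_def cmod_power2 Re_power2 del: of_real_power)
  also have "\<dots> = - (y + of_int k * \<delta>)\<^sup>2"
    unfolding delta_sq[symmetric] by (simp add: power2_eq_square field_simps)
  finally have re: "Re ?w = - (y + of_int k * \<delta>)\<^sup>2" .
  have im: "Im ?w = x * y + 2 * \<delta> * of_int k * x - pi * (of_int k)\<^sup>2 / 2"
    unfolding k2 tau_eq by (simp add: \<delta>_def Im_power2 del: of_real_power)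
  have "exp ?w = complex_of_real (exp (Re ?w)) * cis (Im ?w)" by (rule exp_eq_polar)
  then show ?thesis
    unfolding \<psi>_def psi_norm_def[symmetric] gauss_def re im by simp
qed

lemma psi_eq:
  "\<psi> k z = complex_of_real (psi_norm * gauss k (Im z)) *
     cis (Re z * Im z + 2 * \<delta> * of_int k * Re z - pi * (of_int k)\<^sup>2 / 2)"
  using psi_Complex[of k "Re z" "Im z"] by simp

lemma norm_psi: "cmod (\<psi> k z) = psi_norm * gauss k (Im z)"
  using psi_norm_pos by (simp add: psi_eq norm_mult gauss_def)

lemma continuous_psi: "continuous_on A (\<psi> k)"
proof -
  have "\<psi> k = (\<lambda>z. complex_of_real (psi_norm * gauss k (Im z)) *
     cis (Re z * Im z + 2 * \<delta> * of_int k * Re z - pi * (of_int k)\<^sup>2 / 2))"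
    by (rule ext) (rule psi_eq)
  then show ?thesis unfolding gauss_def by (auto intro!: continuous_intros)
qed

lemma psi_borel[measurable]: "\<psi> k \<in> borel_measurable borel"
  by (intro borel_measurable_continuous_onI continuous_psi)

lemma cnj_psi_borel[measurable]: "(\<lambda>z. cnj (\<psi> k z)) \<in> borel_measurable borel"
  by (intro borel_measurable_continuous_onI continuous_on_cnj continuous_psi)

lemma delta_sq_ge: "2 \<le> \<delta>\<^sup>2"
proof -
  have "1 \<le> sqrt (3::real)" "3 \<le> pi" using pi_gt3 by simp_all
  moreover have "3/2 \<le> sqrt (3::real)" by (rule real_le_rsqrt) (simp add: power2_eq_square)
  ultimately have "3 * (3/2) \<le> pi * sqrt 3" by (intro mult_mono) auto
  then show ?thesis unfolding delta_sq by simp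
qed

lemma delta_pos: "0 < \<delta>" using gamma_pos by (simp add: \<delta>_def)

text \<open>The centres \<open>-k \<delta>\<close> of the Gaussians are separated, so their sum is bounded.\<close>

lemma gauss_le:
  "gauss (\<lfloor>- y / \<delta>\<rfloor> + k) y \<le> exp 2 * exp (- (of_int k)\<^sup>2)"
proof -
  define t where "t = - y / \<delta> - of_int \<lfloor>- y / \<delta>\<rfloor>"
  have t: "0 \<le> t" "t \<le> 1" unfolding t_def by linarith+
  have "y + of_int (\<lfloor>- y / \<delta>\<rfloor> + k) * \<delta> = \<delta> * (of_int k - t)"
    using delta_pos by (simp add: t_def field_simps)
  then have "(y + of_int (\<lfloor>- y / \<delta>\<rfloor> + k) * \<delta>)\<^sup>2 = \<delta>\<^sup>2 * (of_int k - t)\<^sup>2" by (simp add: power_mult_distrib)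
  also have "\<dots> \<ge> 2 * (of_int k - t)\<^sup>2" using delta_sq_ge by (intro mult_right_mono) auto
  \<comment> \<open>After \<delta>^2 \<ge> 2 this identity recovers the full k^2 at the bounded cost
    2 t^2 \<le> 2, whence the factor exp 2.\<close>
  also have "2 * (of_int k - t)\<^sup>2 = (of_int k)\<^sup>2 - 2 * t\<^sup>2 + (of_int k - 2 * t)\<^sup>2"
    by (simp add: power2_eq_square algebra_simps)
  finally have "(of_int k)\<^sup>2 - 2 * t\<^sup>2 \<le> (y + of_int (\<lfloor>- y / \<delta>\<rfloor> + k) * \<delta>)\<^sup>2"
    using zero_le_power2[of "of_int k - 2 * t"] by linarith
  moreover have "t\<^sup>2 \<le> 1" using t by (simp add: abs_square_le_1)
  ultimately have "- (y + of_int (\<lfloor>- y / \<delta>\<rfloor> + k) * \<delta>)\<^sup>2 \<le> 2 + (- (of_int k)\<^sup>2)" by linarith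
  then show ?thesis unfolding gauss_def exp_add[symmetric] by simp
qed

lemma exp_neg_sq_summable_int: "(\<lambda>k::int. exp (- (c * (of_int k)\<^sup>2))) summable_on UNIV" if "0 < c" for c :: real
proof -
  have nat: "(\<lambda>n::nat. exp (- (c * (real n)\<^sup>2))) summable_on UNIV"
  proof (rule summable_on_comparison_test)
    show "(\<lambda>n. exp (- c) ^ n) summable_on UNIV"
      using that by (subst summable_on_UNIV_nonneg_real_iff) (auto intro!: summable_geometric)
    fix n :: nat
    have "real n \<le> (real n)\<^sup>2" by (simp add: power2_eq_square mult_le_cancel_left1 flip: of_nat_mult)
    then have "c * real n \<le> c * (real n)\<^sup>2" using that by (intro mult_left_mono) auto
    then show "exp (- (c * (real n)\<^sup>2)) \<le> exp (- c) ^ n"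
      by (simp add: exp_of_nat_mult[symmetric] mult.commute)
  qed auto
  have "(\<lambda>k::int. exp (- (c * (of_int k)\<^sup>2))) summable_on (range int \<union> range (\<lambda>n. - int n))"
  proof (rule summable_on_union)
    show "(\<lambda>k::int. exp (- (c * (of_int k)\<^sup>2))) summable_on range int"
      using nat by (subst summable_on_reindex) (auto simp: o_def)
    show "(\<lambda>k::int. exp (- (c * (of_int k)\<^sup>2))) summable_on range (\<lambda>n. - int n)"
      using nat by (subst summable_on_reindex) (auto simp: o_def inj_on_def)
  qed
  moreover have "range int \<union> range (\<lambda>n. - int n) = UNIV"
    by (auto simp: image_iff) (metis int_cases2)
  ultimately show ?thesis by simp
qed

definition psi_bound :: real where
  "psi_bound = psi_norm * (exp 2 * (\<Sum>\<^sub>\<infinity>k\<in>(UNIV::int set). exp (- (of_int k)\<^sup>2)))"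

lemma psi_abs_summable: "(\<lambda>k. cmod (\<psi> k z)) summable_on UNIV" (is ?S)
  and psi_infsum_le: "(\<Sum>\<^sub>\<infinity>k. cmod (\<psi> k z)) \<le> psi_bound" (is ?B)
proof -
  let ?m = "\<lfloor>- Im z / \<delta>\<rfloor>"
  have bij: "bij (\<lambda>k. ?m + k)" by (rule bij_betw_byWitness[of _ "\<lambda>k. k - ?m"]) auto
  have s: "(\<lambda>k::int. exp (- (of_int k)\<^sup>2) :: real) summable_on UNIV"
    using exp_neg_sq_summable_int[of 1] by simp
  have s': "(\<lambda>k::int. psi_norm * (exp 2 * exp (- (of_int k)\<^sup>2))) summable_on UNIV"
    by (intro summable_on_cmult_right s)
  have le: "cmod (\<psi> (?m + k) z) \<le> psi_norm * (exp 2 * exp (- (of_int k)\<^sup>2))" for k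
    unfolding norm_psi using psi_norm_pos gauss_le[of "Im z" k] by (intro mult_left_mono) auto
  have t: "(\<lambda>k. cmod (\<psi> (?m + k) z)) summable_on UNIV"
    using le by (intro summable_on_comparison_test[OF s']) auto
  then show ?S using summable_on_reindex_bij_betw[OF bij, of "\<lambda>k. cmod (\<psi> k z)"] by simp
  have "(\<Sum>\<^sub>\<infinity>k. cmod (\<psi> k z)) = (\<Sum>\<^sub>\<infinity>k. cmod (\<psi> (?m + k) z))"
    using infsum_reindex_bij_betw[OF bij, of "\<lambda>k. cmod (\<psi> k z)"] by simp
  also have "\<dots> \<le> (\<Sum>\<^sub>\<infinity>k::int. psi_norm * (exp 2 * exp (- (of_int k)\<^sup>2)))"
    by (intro infsum_mono t s' le)
  also have "\<dots> = psi_bound" unfolding psi_bound_def infsum_cmult_right' ..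
  finally show ?B .
qed

section \<open>Orthonormality on the strip\<close>

lemma strip_borel: "strip p \<in> sets borel"
proof -
  have "strip p = {z. - p / 2 < Re z} \<inter> {z. Re z \<le> p / 2}" by (auto simp: strip_def)
  also have "\<dots> \<in> sets borel"
    by (intro sets.Int borel_open borel_closed open_Collect_less closed_Collect_le continuous_intros)
  finally show ?thesis .
qed

lemma lebesgue_on_borel:
  fixes f :: "complex \<Rightarrow> complex"
  assumes [measurable]: "f \<in> borel_measurable borel" "S \<in> sets borel"
  shows "integrable (lebesgue_on S) f \<longleftrightarrow> integrable lborel (\<lambda>z. indicator S z *\<^sub>R f z)"
    and "(LINT z|lebesgue_on S. f z) = (LINT z|lborel. indicator S z *\<^sub>R f z)"
proof -
  have m: "(\<lambda>z. indicator S z *\<^sub>R f z) \<in> borel_measurable lborel" by simp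
  show "integrable (lebesgue_on S) f \<longleftrightarrow> integrable lborel (\<lambda>z. indicator S z *\<^sub>R f z)"
    by (subst integrable_restrict_space) (auto simp: integrable_completion[OF m])
  show "(LINT z|lebesgue_on S. f z) = (LINT z|lborel. indicator S z *\<^sub>R f z)"
    by (subst integral_restrict_space) (auto simp: integral_completion[OF m])
qed

lemma cis_orthogonal_Icc:
  assumes p: "0 < p"
  shows "has_bochner_integral lborel (\<lambda>x. indicator {a..a + p} x *\<^sub>R cis (2 * pi * of_int m * x / p))
    (if m = 0 then complex_of_real p else 0)"
proof -
  let ?f = "\<lambda>x. cis (2 * pi * of_int m * x / p)"
  have cont: "continuous_on A ?f" for A by (intro continuous_intros) (use p in auto)
  define F where "F = (\<lambda>x. if m = 0 then complex_of_real x else ?f x / (\<i> * (2 * pi * of_int m / p)))"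
  have "(F has_vector_derivative ?f x) (at x within {a..a + p})" for x
  proof (cases "m = 0")
    case True
    then show ?thesis unfolding F_def by (auto intro!: derivative_eq_intros)
  next
    case False
    have "((\<lambda>x. exp (\<i> * (2 * pi * of_int m / p) * complex_of_real x) / (\<i> * (2 * pi * of_int m / p)))
        has_vector_derivative exp (\<i> * (2 * pi * of_int m / p) * complex_of_real x)) (at x within {a..a + p})"
      by (rule has_vector_derivative_real_field) (use False p in \<open>auto intro!: derivative_eq_intros\<close>)
    moreover have "exp (\<i> * (2 * pi * of_int m / p) * complex_of_real x) = ?f x" for x
      by (simp add: cis_conv_exp mult_ac)
    ultimately show ?thesis using False unfolding F_def by simp
  qed
  then have hb: "has_bochner_integral lborel (\<lambda>x. indicator {a..a + p} x *\<^sub>R ?f x) (F (a + p) - F a)"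
    using p by (intro has_bochner_integral_FTC_Icc cont) auto
  have "?f (a + p) = ?f a * cis (2 * pi * of_int m)"
    using p unfolding cis_mult by (intro arg_cong[of _ _ cis]) (simp add: field_simps)
  also have "cis (2 * pi * of_int m) = 1" by (rule cis_multiple_2pi) simp
  finally have "F (a + p) - F a = (if m = 0 then complex_of_real p else 0)"
    by (simp add: F_def)
  with hb show ?thesis by simp
qed

text \<open>The strip is half open; its missing edge is a null set.\<close>

lemma cis_orthogonal:
  assumes p: "0 < p"
  shows "integrable lborel (\<lambda>x. indicator {- p / 2<..p / 2} x *\<^sub>R cis (2 * pi * of_int m * x / p))"
    and "(LINT x|lborel. indicator {- p / 2<..p / 2} x *\<^sub>R cis (2 * pi * of_int m * x / p)) = (if m = 0 then complex_of_real p else 0)"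
proof -
  let ?f = "\<lambda>x. cis (2 * pi * of_int m * x / p)"
  have e: "AE x in lborel. indicator {- p / 2..p / 2} x *\<^sub>R ?f x = indicator {- p / 2<..p / 2} x *\<^sub>R ?f x"
    using AE_lborel_singleton[of "- p / 2"] by eventually_elim (auto simp: indicator_def)
  have fm[measurable]: "?f \<in> borel_measurable borel"
    by (intro borel_measurable_continuous_onI continuous_intros) (use p in auto)
  have hb: "has_bochner_integral lborel (\<lambda>x. indicator {- p / 2..p / 2} x *\<^sub>R ?f x) (if m = 0 then complex_of_real p else 0)"
    using cis_orthogonal_Icc[OF p, of "- p / 2" m] by (simp add: field_simps)
  show "integrable lborel (\<lambda>x. indicator {- p / 2<..p / 2} x *\<^sub>R ?f x)"
    using hb e by (subst (asm) has_bochner_integral_iff, elim conjE, subst integrable_cong_AE[symmetric]) auto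
  have "(LINT x|lborel. indicator {- p / 2<..p / 2} x *\<^sub>R ?f x) = (LINT x|lborel. indicator {- p / 2..p / 2} x *\<^sub>R ?f x)"
    using e by (intro integral_cong_AE) auto
  also have "\<dots> = (if m = 0 then complex_of_real p else 0)"
    using hb by (simp add: has_bochner_integral_iff)
  finally show "(LINT x|lborel. indicator {- p / 2<..p / 2} x *\<^sub>R ?f x) = (if m = 0 then complex_of_real p else 0)" .
qed

lemma gauss_borel[measurable]: "gauss k \<in> borel_measurable borel"
  unfolding gauss_def by measurable

lemma gauss_nonneg: "0 \<le> gauss k y" and gauss_le_1: "gauss k y \<le> 1"
  by (simp_all add: gauss_def)

lemma gauss_integrable: "integrable lborel (gauss k)"
  using gaussian_shift(1)[of 1 "of_int k * \<delta>"] by (simp add: gauss_def[abs_def])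

text \<open>The phase x y cancels in the product, which therefore separates: a character of period
  \<gamma> in Re z and a product of two Gaussians in Im z. For m = n the latter has integral sqrt
  (pi / 2), and \<open>psi_norm\<close> is chosen so that psi_norm^2 \<gamma> sqrt (pi / 2) =
  1.\<close>

lemma psi_inner_integrable: "integrable (lebesgue_on (strip \<gamma>)) (\<lambda>z. \<psi> m z * cnj (\<psi> n z))"
  and psi_orthonormal: "(LINT z|lebesgue_on (strip \<gamma>). \<psi> m z * cnj (\<psi> n z)) = (if m = n then 1 else 0)"
proof -
  let ?f = "\<lambda>x. indicator {- \<gamma> / 2<..\<gamma> / 2} x *\<^sub>R cis (2 * pi * of_int (m - n) * x / \<gamma>)"
  define c where "c = cis (pi * (of_int n)\<^sup>2 / 2 - pi * (of_int m)\<^sup>2 / 2) * complex_of_real (psi_norm\<^sup>2)"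
  define g where "g = (\<lambda>y. c * complex_of_real (gauss m y * gauss n y))"
  have fg: "indicator (strip \<gamma>) z *\<^sub>R (\<psi> m z * cnj (\<psi> n z)) = ?f (Re z) * g (Im z)" for z
  proof -
    define x y where "x = Re z" and "y = Im z"
    have "cis (x * y + 2 * \<delta> * of_int m * x - pi * (of_int m)\<^sup>2 / 2) * cis (- (x * y + 2 * \<delta> * of_int n * x - pi * (of_int n)\<^sup>2 / 2))
      = cis (2 * pi * of_int (m - n) * x / \<gamma>) * cis (pi * (of_int n)\<^sup>2 / 2 - pi * (of_int m)\<^sup>2 / 2)"
    proof -
      have "2 * pi * of_int (m - n) * x / \<gamma> = 2 * \<delta> * of_int (m - n) * x" by (simp add: \<delta>_def)
      then show ?thesis
        unfolding cis_mult by (intro arg_cong[of _ _ cis]) (simp add: algebra_simps)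
    qed
    then have "\<psi> m z * cnj (\<psi> n z) = cis (2 * pi * of_int (m - n) * x / \<gamma>) * g y"
      unfolding psi_eq g_def c_def x_def[symmetric] y_def[symmetric]
      by (simp add: cis_cnj power2_eq_square algebra_simps)
    then show ?thesis by (simp add: strip_def x_def y_def indicator_def)
  qed
  have gi: "integrable lborel (\<lambda>y. gauss m y * gauss n y)"
  proof (rule Bochner_Integration.integrable_bound[OF gauss_integrable[of m]])
    show "AE y in lborel. norm (gauss m y * gauss n y) \<le> norm (gauss m y)"
      using gauss_nonneg gauss_le_1 by (simp add: mult_left_le)
  qed auto
  then have gi': "integrable lborel g" unfolding g_def by (intro integrable_mult_right integrable_of_real)
  note fi = cis_orthogonal[OF gamma_pos, of "m - n"]
  have b: "(\<lambda>z. \<psi> m z * cnj (\<psi> n z)) \<in> borel_measurable borel" by measurable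
  have prod: "integrable lborel (\<lambda>z. ?f (Re z) * g (Im z))"
    by (rule complex_integrable_product[OF fi(1) gi'])
  show "integrable (lebesgue_on (strip \<gamma>)) (\<lambda>z. \<psi> m z * cnj (\<psi> n z))"
    using prod unfolding lebesgue_on_borel(1)[OF b strip_borel] fg .
  have "(LINT z|lebesgue_on (strip \<gamma>). \<psi> m z * cnj (\<psi> n z)) = (LINT z|lborel. ?f (Re z) * g (Im z))"
    unfolding lebesgue_on_borel(2)[OF b strip_borel] fg ..
  also have "\<dots> = (LINT y|lborel. LINT x|lborel. ?f x * g y)"
    using complex_integral_iterated[OF prod] by simp
  also have "\<dots> = (if m - n = 0 then complex_of_real \<gamma> else 0) * (LINT y|lborel. g y)"
    by (simp only: integral_mult_left_zero integral_mult_right_zero fi(2))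
  also have "\<dots> = (if m = n then 1 else 0)"
  proof (cases "m = n")
    case True
    have "gauss n y * gauss n y = exp (- (2 * (y + of_int n * \<delta>)\<^sup>2))" for y
      unfolding gauss_def exp_add[symmetric] by simp
    then have "(LINT y|lborel. gauss n y * gauss n y) = sqrt (pi / 2)"
      using gaussian_shift(2)[of 2 "of_int n * \<delta>"] by simp
    then have "(LINT y|lborel. g y) = complex_of_real (psi_norm\<^sup>2 * sqrt (pi / 2))"
      using True unfolding g_def c_def integral_mult_right_zero integral_complex_of_real by simp
    moreover have "psi_norm\<^sup>2 * sqrt (pi / 2) * \<gamma> = 1"
      unfolding psi_norm_sq using gamma_pos by (simp add: real_sqrt_mult[symmetric])
    ultimately show ?thesis using True
      by (simp del: of_real_mult add: of_real_mult[symmetric] mult.commute)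
  qed simp
  finally show "(LINT z|lebesgue_on (strip \<gamma>). \<psi> m z * cnj (\<psi> n z)) = (if m = n then 1 else 0)" .
qed

lemma psi_L2: "L2_on (strip \<gamma>) (\<psi> n)"
proof -
  have "integrable (lebesgue_on (strip \<gamma>)) (\<lambda>z. norm (\<psi> n z * cnj (\<psi> n z)))"
    by (intro integrable_norm psi_inner_integrable)
  then show ?thesis
    unfolding L2_on_def by (auto simp: norm_mult power2_eq_square
        intro!: continuous_imp_measurable_on_sets_lebesgue continuous_psi strip_borel sets_completionI_sets)
qed

text \<open>The matrix element of the cubic term between three basis functions and a fourth; it
  depends only on the differences d and r of their indices. The cosine is the sign (-1)^(d r), left
  over from the quadratic phases of \<psi>.\<close>

definition coupling :: "int \<Rightarrow> int \<Rightarrow> real" where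
  "coupling d r = 1 / (\<gamma> * sqrt pi) * (cos (pi * of_int (d * r)) * exp (- (\<delta>\<^sup>2 * ((of_int d)\<^sup>2 + (of_int r)\<^sup>2))))"

lemma LLL_proj_lborel:
  assumes [measurable]: "u \<in> borel_measurable borel"
  shows "LLL_proj u z = complex_of_real (1 / pi * exp (- (cmod z)\<^sup>2 / 2)) *
     (LINT w|lborel. exp (cnj w * z - complex_of_real ((cmod w)\<^sup>2 / 2)) * u w)"
proof -
  have "(\<lambda>w. exp (cnj w * z - complex_of_real ((cmod w)\<^sup>2 / 2))) \<in> borel_measurable borel"
    by (intro borel_measurable_continuous_onI) (auto intro!: continuous_intros)
  then have "(\<lambda>w. exp (cnj w * z - complex_of_real ((cmod w)\<^sup>2 / 2)) * u w) \<in> borel_measurable lborel" by simp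
  then show ?thesis unfolding LLL_proj_def by (simp only: integral_completion)
qed

text \<open>With factors of indices k, l, m the result has index n = k - l + m, and d = k - l, r = l
  - m remain free. The integral over the real part is a Gaussian transform whose argument contains
  z, the one over the imaginary part a product of four Gaussians.\<close>

lemma LLL_proj_psi_triple:
  "LLL_proj (\<lambda>w. \<psi> (n + r) w * cnj (\<psi> (n + r - d) w) * \<psi> (n - d) w) z = complex_of_real (coupling d r) * \<psi> n z"
proof -
  define k l m where klm: "k = n + r" "l = n + r - d" "m = n - d"
  define \<beta> where "\<beta> = 2 * \<delta> * of_int n"
  define P where "P = - (pi * (of_int k)\<^sup>2 / 2) + pi * (of_int l)\<^sup>2 / 2 - pi * (of_int m)\<^sup>2 / 2"
  define G where "G = (\<lambda>y. gauss k y * gauss l y * gauss m y)"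
  define u where "u = (\<lambda>w. \<psi> k w * cnj (\<psi> l w) * \<psi> m w)"
  define K where "K = (\<lambda>w. exp (cnj w * z - complex_of_real ((cmod w)\<^sup>2 / 2)) * u w)"
  have nklm: "n = k - l + m" by (simp add: klm)
  have u: "u (Complex x y) = complex_of_real (psi_norm ^ 3 * G y) * cis (x * y + \<beta> * x + P)" for x y
  proof -
    have "cis (x * y + 2 * \<delta> * of_int k * x - pi * (of_int k)\<^sup>2 / 2) * cis (- (x * y + 2 * \<delta> * of_int l * x - pi * (of_int l)\<^sup>2 / 2))
       * cis (x * y + 2 * \<delta> * of_int m * x - pi * (of_int m)\<^sup>2 / 2) = cis (x * y + \<beta> * x + P)"
      unfolding cis_mult by (intro arg_cong[of _ _ cis]) (simp add: \<beta>_def P_def nklm algebra_simps)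
    then show ?thesis
      unfolding u_def psi_Complex G_def by (simp add: cis_cnj power3_eq_cube mult_ac)
  qed
  have K: "K (Complex x y) = exp (- (complex_of_real x)\<^sup>2 / 2 + complex_of_real x * (z + \<i> * complex_of_real (y + \<beta>))) *
      (exp (- (\<i> * complex_of_real y * z) - complex_of_real (y\<^sup>2 / 2)) * (complex_of_real (psi_norm ^ 3 * G y) * cis P))" for x y
  proof -
    have cm: "(cmod (Complex x y))\<^sup>2 = x\<^sup>2 + y\<^sup>2" by (simp add: cmod_power2)
    have "exp (cnj (Complex x y) * z - complex_of_real ((cmod (Complex x y))\<^sup>2 / 2)) * cis (x * y + \<beta> * x + P)
      = exp (- (complex_of_real x)\<^sup>2 / 2 + complex_of_real x * (z + \<i> * complex_of_real (y + \<beta>))) *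
      exp (- (\<i> * complex_of_real y * z) - complex_of_real (y\<^sup>2 / 2)) * cis P"
      unfolding cis_conv_exp exp_add[symmetric] cm
      by (intro arg_cong[of _ _ exp]) (simp add: Complex_eq power2_eq_square field_simps)
    then show ?thesis unfolding K_def u by (simp add: mult_ac)
  qed
  have um[measurable]: "u \<in> borel_measurable borel"
    unfolding u_def by (intro borel_measurable_times psi_borel cnj_psi_borel)
  have Km: "K \<in> borel_measurable borel"
  proof -
    have "(\<lambda>w. exp (cnj w * z - complex_of_real ((cmod w)\<^sup>2 / 2))) \<in> borel_measurable borel"
      by (intro borel_measurable_continuous_onI) (auto intro!: continuous_intros)
    then show ?thesis unfolding K_def by measurable
  qed
  have Gi: "integrable lborel (\<lambda>y. exp (y * Im z - y\<^sup>2 / 2))"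
    using integrable_norm[OF gaussian_laplace(1)[of "complex_of_real (Im z)"]]
    by (simp add: Re_power2 add.commute)
  have Fi: "integrable lborel (\<lambda>x. exp (x * Re z - x\<^sup>2 / 2))"
    using integrable_norm[OF gaussian_laplace(1)[of "complex_of_real (Re z)"]]
    by (simp add: Re_power2 add.commute)
  have Ki: "integrable lborel K"
  proof (rule Bochner_Integration.integrable_bound)
    show "integrable lborel (\<lambda>w. complex_of_real (exp (Re w * Re z - (Re w)\<^sup>2 / 2)) * complex_of_real (psi_norm ^ 3 * exp (Im w * Im z - (Im w)\<^sup>2 / 2)))"
      by (rule complex_integrable_product) (auto intro!: integrable_of_real Fi Gi simp del: of_real_mult of_real_exp)
    have "norm (K w) \<le> exp (Re w * Re z - (Re w)\<^sup>2 / 2) * (psi_norm ^ 3 * exp (Im w * Im z - (Im w)\<^sup>2 / 2))" for w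
    proof -
      have "G (Im w) \<le> 1 * 1 * 1" unfolding G_def using gauss_nonneg gauss_le_1 by (intro mult_mono) auto
      moreover have "norm (K (Complex (Re w) (Im w))) = exp (Re w * Re z - (Re w)\<^sup>2 / 2) * (exp (Im w * Im z - (Im w)\<^sup>2 / 2) * (psi_norm ^ 3 * G (Im w)))"
        unfolding K using psi_norm_pos gauss_nonneg
        by (simp add: norm_mult norm_power Re_power2 G_def)
      ultimately show ?thesis using psi_norm_pos
        by (simp add: mult_left_le mult.assoc mult.commute[of "psi_norm ^ 3"])
    qed
    then show "AE w in lborel. norm (K w) \<le> norm (complex_of_real (exp (Re w * Re z - (Re w)\<^sup>2 / 2)) * complex_of_real (psi_norm ^ 3 * exp (Im w * Im z - (Im w)\<^sup>2 / 2)))"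
      using psi_norm_pos by (intro AE_I2) (simp add: norm_mult del: of_real_mult of_real_exp)
  qed (use Km in simp)
  \<comment> \<open>Completing the square in y + \<beta> / 2 separates y from z. The factor with z
    is exp (z^2 / 2 + i z \<beta>), and \<beta> = 2 \<delta> n makes it that of \<psi> n.\<close>
  have inner: "(LINT x|lborel. K (Complex x y)) = complex_of_real (sqrt (2 * pi) * psi_norm ^ 3) * cis P *
      exp (z\<^sup>2 / 2 + \<i> * z * \<beta> - complex_of_real (\<beta>\<^sup>2 / 4)) * complex_of_real (exp (- (y + \<beta> / 2)\<^sup>2) * G y)" for y
  proof -
    have "exp ((z + \<i> * complex_of_real (y + \<beta>))\<^sup>2 / 2) * exp (- (\<i> * complex_of_real y * z) - complex_of_real (y\<^sup>2 / 2)) =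
      exp (z\<^sup>2 / 2 + \<i> * z * \<beta> - complex_of_real (\<beta>\<^sup>2 / 4)) * complex_of_real (exp (- (y + \<beta> / 2)\<^sup>2))"
      unfolding exp_of_real[symmetric] exp_add[symmetric]
      by (intro arg_cong[of _ _ exp]) (simp add: power2_eq_square field_simps)
    then show ?thesis
      unfolding K integral_mult_left_zero gaussian_laplace(2) by (simp add: mult_ac del: of_real_exp)
  qed
  \<comment> \<open>The four Gaussians belong to the indices n, n + r, n + r - d and n - d; s is
    their mean, and the squared deviations from it add up to d^2 + r^2.\<close>
  define s where "s = of_int n + (of_int r - of_int d) / (2::real)"
  have G4: "exp (- (y + \<beta> / 2)\<^sup>2) * G y = exp (- (\<delta>\<^sup>2 * ((of_int d)\<^sup>2 + (of_int r)\<^sup>2))) * exp (- (4 * (y + s * \<delta>)\<^sup>2))" for y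
    unfolding G_def gauss_def exp_add[symmetric] klm \<beta>_def s_def
    by (intro arg_cong[of _ _ exp]) (simp add: power2_eq_square field_simps)
  have "(LINT w|lborel. K w) = (LINT y|lborel. LINT x|lborel. K (Complex x y))"
    by (rule complex_integral_iterated[OF Ki])
  also have "\<dots> = complex_of_real (sqrt (2 * pi) * psi_norm ^ 3) * cis P *
      exp (z\<^sup>2 / 2 + \<i> * z * \<beta> - complex_of_real (\<beta>\<^sup>2 / 4)) *
      complex_of_real (exp (- (\<delta>\<^sup>2 * ((of_int d)\<^sup>2 + (of_int r)\<^sup>2))) * sqrt (pi / 4))"
    unfolding inner G4 by (simp only: integral_mult_right_zero integral_complex_of_real gaussian_shift(2)[of 4])
  finally have int: "(LINT w|lborel. K w) = \<dots>" .
  have phase: "cis P = complex_of_real (cos (pi * of_int (d * r))) * cis (- (pi * (of_int n)\<^sup>2 / 2))"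
  proof -
    have "P = - (pi * of_int (d * r)) + - (pi * (of_int n)\<^sup>2 / 2)"
      by (simp add: P_def klm power2_eq_square field_simps)
    moreover have "cis (- (pi * of_int (d * r))) = complex_of_real (cos (pi * of_int (d * r)))"
      using sin_npi_int[of "d * r"] by (simp add: complex_eq_iff)
    ultimately show ?thesis by (metis cis_mult)
  qed
  have psi: "complex_of_real (exp (- (cmod z)\<^sup>2 / 2)) * (exp (z\<^sup>2 / 2 + \<i> * z * \<beta> - complex_of_real (\<beta>\<^sup>2 / 4)) *
      cis (- (pi * (of_int n)\<^sup>2 / 2))) * complex_of_real psi_norm = \<psi> n z"
  proof -
    have "\<i> * pi * \<tau> * (of_int n)\<^sup>2 = - complex_of_real (\<beta>\<^sup>2 / 4) + \<i> * complex_of_real (- (pi * (of_int n)\<^sup>2 / 2))"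
    proof -
      have "\<beta>\<^sup>2 / 4 = pi * sqrt 3 / 2 * (of_int n)\<^sup>2" unfolding \<beta>_def power_mult_distrib delta_sq by simp
      then show ?thesis unfolding tau_eq by (simp add: complex_eq_iff)
    qed
    moreover have "2 * \<i> * of_int n * pi * z / \<gamma> = \<i> * z * \<beta>"
      by (simp add: \<beta>_def \<delta>_def)
    ultimately have "2 * \<i> * of_int n * complex_of_real pi * z / complex_of_real \<gamma> + \<i> * complex_of_real pi * \<tau> * (of_int n)\<^sup>2 +
        z\<^sup>2 / 2 - complex_of_real ((cmod z)\<^sup>2 / 2) =
      complex_of_real (- (cmod z)\<^sup>2 / 2) + (z\<^sup>2 / 2 + \<i> * z * \<beta> - complex_of_real (\<beta>\<^sup>2 / 4) +
        \<i> * complex_of_real (- (pi * (of_int n)\<^sup>2 / 2)))"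
      by (simp only: of_real_minus minus_divide_left[symmetric] diff_conv_add_uminus add_ac)
    then show ?thesis
      unfolding \<psi>_def psi_norm_def[symmetric] cis_conv_exp exp_of_real[symmetric] exp_add[symmetric]
      by (simp only: mult.commute)
  qed
  have const: "1 / pi * (sqrt (2 * pi) * psi_norm ^ 3) * sqrt (pi / 4) = 1 / (\<gamma> * sqrt pi) * psi_norm"
  proof -
    have "sqrt (2 * pi) * sqrt (2 / pi) = 2" by (simp add: real_sqrt_mult[symmetric])
    moreover have "1 / pi * (sqrt (2 * pi) * psi_norm ^ 3) * sqrt (pi / 4) =
        sqrt (2 * pi) * sqrt (2 / pi) * (sqrt pi / 2) * psi_norm / (\<gamma> * pi)"
    proof -
      have a: "psi_norm ^ 3 = sqrt (2 / pi) / \<gamma> * psi_norm"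
        unfolding psi_norm_sq[symmetric] by (simp add: power3_eq_cube power2_eq_square)
      have b: "sqrt (pi / 4) = sqrt pi / 2" by (simp add: real_sqrt_divide)
      show ?thesis unfolding a b by (simp add: mult_ac)
    qed
    moreover have "2 * (s / 2) * N / (g * (s * s)) = 1 / (g * s) * N" if "0 < s" for s N g :: real
      using that by (simp add: field_simps)
    from this[of "sqrt pi" psi_norm \<gamma>]
    have "2 * (sqrt pi / 2) * psi_norm / (\<gamma> * pi) = 1 / (\<gamma> * sqrt pi) * psi_norm" by simp
    ultimately show ?thesis by (simp only:)
  qed
  have "LLL_proj u z = complex_of_real (1 / pi * exp (- (cmod z)\<^sup>2 / 2)) * (LINT w|lborel. K w)"
    unfolding LLL_proj_lborel[OF um] K_def ..
  also have "\<dots> = complex_of_real (1 / pi * (sqrt (2 * pi) * psi_norm ^ 3) * sqrt (pi / 4)) * complex_of_real (cos (pi * of_int (d * r)) * exp (- (\<delta>\<^sup>2 * ((of_int d)\<^sup>2 + (of_int r)\<^sup>2)))) *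
      (complex_of_real (exp (- (cmod z)\<^sup>2 / 2)) * (exp (z\<^sup>2 / 2 + \<i> * z * \<beta> - complex_of_real (\<beta>\<^sup>2 / 4)) * cis (- (pi * (of_int n)\<^sup>2 / 2))))"
    unfolding int phase by (simp only: of_real_mult mult_ac)
  also have "\<dots> = complex_of_real (coupling d r) * \<psi> n z"
    unfolding const psi[symmetric] coupling_def by (simp only: of_real_mult mult_ac)
  finally show ?thesis unfolding u_def klm .
qed

section \<open>Series in the basis\<close>

text \<open>Unordered sums are limits along a net. Enumerating the index type by
  \<open>to_nat\<close> gives a sequence that passes every finite set, so that dominated convergence
  for sequences becomes applicable.\<close>

lemma filterlim_to_nat_sets:
  "filterlim (\<lambda>k. {i::'i::countable. to_nat i < k}) (finite_subsets_at_top UNIV) sequentially"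
  unfolding filterlim_finite_subsets_at_top
proof (intro allI impI)
  fix X :: "'i set"
  assume "finite X \<and> X \<subseteq> UNIV"
  then have X: "finite (to_nat ` X)" by simp
  have fin: "finite {i::'i. to_nat i < k}" for k
    by (rule finite_imageD[of to_nat]) (auto intro: finite_subset[of _ "{..<k}"])
  show "\<forall>\<^sub>F k in sequentially. finite {i::'i. to_nat i < k} \<and> X \<subseteq> {i. to_nat i < k} \<and> {i. to_nat i < k} \<subseteq> UNIV"
  proof (rule eventually_sequentiallyI)
    fix k assume k: "Suc (Max (to_nat ` X)) \<le> k"
    have "to_nat i < k" if "i \<in> X" for i
      using Max_ge[OF X, of "to_nat i"] that k by auto
    then show "finite {i::'i. to_nat i < k} \<and> X \<subseteq> {i. to_nat i < k} \<and> {i. to_nat i < k} \<subseteq> UNIV"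
      using fin by auto
  qed
qed

lemma infsum_borel_measurable:
  fixes f :: "'i::countable \<Rightarrow> 'a \<Rightarrow> complex"
  assumes m: "\<And>i. f i \<in> borel_measurable M"
    and s: "\<And>x. x \<in> space M \<Longrightarrow> (\<lambda>i. f i x) summable_on UNIV"
  shows "(\<lambda>x. \<Sum>\<^sub>\<infinity>i. f i x) \<in> borel_measurable M"
proof (rule borel_measurable_LIMSEQ_metric)
  show "(\<lambda>x. \<Sum>i\<in>{i. to_nat i < k}. f i x) \<in> borel_measurable M" for k
    by (intro borel_measurable_sum m)
  show "(\<lambda>k. \<Sum>i\<in>{i. to_nat i < k}. f i x) \<longlonglongrightarrow> (\<Sum>\<^sub>\<infinity>i. f i x)" if "x \<in> space M" for x
    using filterlim_compose[OF infsum_tendsto[OF s[OF that]] filterlim_to_nat_sets] .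
qed

text \<open>Finite exhaustion reduces the exchange to dominated convergence. The same majorant
  \<open>B\<close> bounds all finite sums of integrals of the moduli, which gives the absolute
  summability of the integrals.\<close>

lemma integral_infsum:
  fixes f :: "'i::countable \<Rightarrow> 'a \<Rightarrow> complex"
  assumes m: "\<And>i. f i \<in> borel_measurable M"
    and s: "\<And>x. x \<in> space M \<Longrightarrow> (\<lambda>i. cmod (f i x)) summable_on UNIV"
    and b: "\<And>x. x \<in> space M \<Longrightarrow> (\<Sum>\<^sub>\<infinity>i. cmod (f i x)) \<le> B x"
    and B: "integrable M B"
  shows "integrable M (\<lambda>x. \<Sum>\<^sub>\<infinity>i. f i x)"
    and "(\<lambda>i. cmod (LINT x|M. f i x)) summable_on UNIV"
    and "(LINT x|M. (\<Sum>\<^sub>\<infinity>i. f i x)) = (\<Sum>\<^sub>\<infinity>i. LINT x|M. f i x)"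
proof -
  let ?A = "\<lambda>k. {i::'i. to_nat i < k}"
  have s': "(\<lambda>i. f i x) summable_on UNIV" if "x \<in> space M" for x
    using s[OF that] by (rule abs_summable_summable)
  have fin_le: "(\<Sum>i\<in>F. cmod (f i x)) \<le> B x" if "x \<in> space M" "finite F" for F x
    by (rule order.trans[OF finite_sum_le_infsum b]) (use that s in auto)
  have norm_le: "cmod (\<Sum>i\<in>F. f i x) \<le> B x" if "x \<in> space M" "finite F" for F x
    by (rule order.trans[OF norm_sum fin_le[OF that]])
  have B0: "0 \<le> B x" if "x \<in> space M" for x using fin_le[OF that, of "{}"] by simp
  have int: "integrable M (f i)" for i
    by (rule Bochner_Integration.integrable_bound[OF B m])
      (use norm_le[of _ "{i}"] B0 in \<open>auto intro!: AE_I2\<close>)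
  have lim: "(\<lambda>k. \<Sum>i\<in>?A k. f i x) \<longlonglongrightarrow> (\<Sum>\<^sub>\<infinity>i. f i x)" if "x \<in> space M" for x
    using filterlim_compose[OF infsum_tendsto[OF s'[OF that]] filterlim_to_nat_sets] .
  have fin: "finite (?A k)" for k
    by (rule finite_imageD[of to_nat]) (auto intro: finite_subset[of _ "{..<k}"])
  have dom: "AE x in M. (\<lambda>k. \<Sum>i\<in>?A k. f i x) \<longlonglongrightarrow> (\<Sum>\<^sub>\<infinity>i. f i x)"
    "\<And>k. AE x in M. norm (\<Sum>i\<in>?A k. f i x) \<le> B x"
    using lim norm_le[OF _ fin] by (auto intro!: AE_I2)
  have meas: "(\<lambda>x. \<Sum>\<^sub>\<infinity>i. f i x) \<in> borel_measurable M" "\<And>k. (\<lambda>x. \<Sum>i\<in>?A k. f i x) \<in> borel_measurable M"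
    using m by (auto intro!: infsum_borel_measurable s')
  show "integrable M (\<lambda>x. \<Sum>\<^sub>\<infinity>i. f i x)"
    by (rule integrable_dominated_convergence[OF meas B dom])
  have "(\<lambda>k. LINT x|M. (\<Sum>i\<in>?A k. f i x)) \<longlonglongrightarrow> (LINT x|M. (\<Sum>\<^sub>\<infinity>i. f i x))"
    by (rule integral_dominated_convergence[OF meas B dom])
  then have l1: "(\<lambda>k. \<Sum>i\<in>?A k. LINT x|M. f i x) \<longlonglongrightarrow> (LINT x|M. (\<Sum>\<^sub>\<infinity>i. f i x))"
    by (simp add: int)
  show sum: "(\<lambda>i. cmod (LINT x|M. f i x)) summable_on UNIV"
  proof (rule nonneg_bdd_above_summable_on)
    have "(\<Sum>i\<in>F. cmod (LINT x|M. f i x)) \<le> (LINT x|M. B x)" if "finite F" for F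
    proof -
      have "(\<Sum>i\<in>F. cmod (LINT x|M. f i x)) \<le> (\<Sum>i\<in>F. LINT x|M. cmod (f i x))"
        by (intro sum_mono integral_norm_bound)
      also have "\<dots> = (LINT x|M. (\<Sum>i\<in>F. cmod (f i x)))" using int by simp
      also have "\<dots> \<le> (LINT x|M. B x)"
        using int B fin_le that by (intro integral_mono) auto
      finally show ?thesis .
    qed
    then show "bdd_above (sum (\<lambda>i. cmod (LINT x|M. f i x)) ` {F. F \<subseteq> UNIV \<and> finite F})"
      by (auto intro!: bdd_aboveI)
  qed auto
  have "(\<lambda>k. \<Sum>i\<in>?A k. LINT x|M. f i x) \<longlonglongrightarrow> (\<Sum>\<^sub>\<infinity>i. LINT x|M. f i x)"
    using filterlim_compose[OF infsum_tendsto[OF abs_summable_summable[OF sum]] filterlim_to_nat_sets] .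
  with l1 show "(LINT x|M. (\<Sum>\<^sub>\<infinity>i. f i x)) = (\<Sum>\<^sub>\<infinity>i. LINT x|M. f i x)"
    using LIMSEQ_unique by blast
qed

lemma infsum_product:
  fixes a :: "'i \<Rightarrow> 'c::{real_normed_field,banach,second_countable_topology}" and b :: "'j \<Rightarrow> 'c"
  assumes a: "(\<lambda>i. norm (a i)) summable_on UNIV" and b: "(\<lambda>j. norm (b j)) summable_on UNIV"
  shows "(\<lambda>p. norm (a (fst p) * b (snd p))) summable_on UNIV"
    and "(\<Sum>\<^sub>\<infinity>p. a (fst p) * b (snd p)) = (\<Sum>\<^sub>\<infinity>i. a i) * (\<Sum>\<^sub>\<infinity>j. b j)"
proof -
  have "(\<lambda>p. norm (a (fst p) * b (snd p))) summable_on Sigma UNIV (\<lambda>_. UNIV)"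
  proof (rule Infinite_Sum.abs_summable_on_Sigma_iff[where f = "\<lambda>p. a (fst p) * b (snd p)" and A = UNIV and B = "\<lambda>_. UNIV", THEN iffD2], intro conjI ballI)
    show "(\<lambda>j. norm (a (fst (i, j)) * b (snd (i, j)))) summable_on UNIV" for i
      unfolding norm_mult fst_conv snd_conv by (intro summable_on_cmult_right b)
    have "(\<lambda>i. norm (a i) * (\<Sum>\<^sub>\<infinity>j. norm (b j))) summable_on UNIV"
      by (intro summable_on_cmult_left a)
    moreover have "0 \<le> (\<Sum>\<^sub>\<infinity>j. norm (b j))" by (intro infsum_nonneg) simp
    ultimately show "(\<lambda>i. norm (\<Sum>\<^sub>\<infinity>j. norm (a (fst (i, j)) * b (snd (i, j))))) summable_on UNIV"
      unfolding norm_mult fst_conv snd_conv infsum_cmult_right' by (simp add: abs_mult)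
  qed
  then show s: "(\<lambda>p. norm (a (fst p) * b (snd p))) summable_on UNIV" by simp
  have "(\<lambda>p. a (fst p) * b (snd p)) summable_on Sigma UNIV (\<lambda>_. UNIV)"
    using abs_summable_summable[OF s] by simp
  from infsum_Sigma_banach[OF this]
  show "(\<Sum>\<^sub>\<infinity>p. a (fst p) * b (snd p)) = (\<Sum>\<^sub>\<infinity>i. a i) * (\<Sum>\<^sub>\<infinity>j. b j)"
    by (simp add: infsum_cmult_right' infsum_cmult_left')
qed

lemma kernel_integrable:
  "integrable lborel (\<lambda>w. cmod (exp (cnj w * z - complex_of_real ((cmod w)\<^sup>2 / 2))))"
proof -
  have Gi: "integrable lborel (\<lambda>y. complex_of_real (exp (y * c - y\<^sup>2 / 2)))" for c
    using integrable_norm[OF gaussian_laplace(1)[of "complex_of_real c"]]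
    by (intro integrable_of_real) (simp add: Re_power2 add.commute)
  have "integrable lborel (\<lambda>w. cmod (complex_of_real (exp (Re w * Re z - (Re w)\<^sup>2 / 2)) * complex_of_real (exp (Im w * Im z - (Im w)\<^sup>2 / 2))))"
    by (intro integrable_norm complex_integrable_product Gi)
  also have "(\<lambda>w. cmod (complex_of_real (exp (Re w * Re z - (Re w)\<^sup>2 / 2)) * complex_of_real (exp (Im w * Im z - (Im w)\<^sup>2 / 2)))) =
     (\<lambda>w. cmod (exp (cnj w * z - complex_of_real ((cmod w)\<^sup>2 / 2))))"
  proof
    fix w
    have c: "(cmod w)\<^sup>2 = (Re w)\<^sup>2 + (Im w)\<^sup>2" by (rule cmod_power2)
    show "cmod (complex_of_real (exp (Re w * Re z - (Re w)\<^sup>2 / 2)) * complex_of_real (exp (Im w * Im z - (Im w)\<^sup>2 / 2))) =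
     cmod (exp (cnj w * z - complex_of_real ((cmod w)\<^sup>2 / 2)))"
      unfolding norm_mult norm_of_real abs_exp_cancel exp_add[symmetric] norm_exp_eq_Re c
      by (intro arg_cong[of _ _ exp]) (simp add: add_divide_distrib)
  qed
  finally show ?thesis .
qed

text \<open>The pointwise sum. Unlike the L^2 expansion it makes sense for merely bounded
  coefficients and on the whole plane, the domain of the integral in
  \<open>LLL_proj\<close>.\<close>

definition psi_series :: "(int \<Rightarrow> complex) \<Rightarrow> complex \<Rightarrow> complex" where
  "psi_series c z = (\<Sum>\<^sub>\<infinity>n. c n * \<psi> n z)"

lemma psi_series_abs_summable:
  assumes "\<And>n. cmod (c n) \<le> K"
  shows "(\<lambda>n. cmod (c n * \<psi> n z)) summable_on UNIV"
    and "(\<Sum>\<^sub>\<infinity>n. cmod (c n * \<psi> n z)) \<le> K * psi_bound"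
proof -
  have K: "0 \<le> K" using assms[of 0] norm_ge_zero order.trans by blast
  have s: "(\<lambda>n. K * cmod (\<psi> n z)) summable_on UNIV" by (intro summable_on_cmult_right psi_abs_summable)
  have le: "cmod (c n * \<psi> n z) \<le> K * cmod (\<psi> n z)" for n
    unfolding norm_mult by (intro mult_right_mono assms) auto
  show s': "(\<lambda>n. cmod (c n * \<psi> n z)) summable_on UNIV"
    using le by (intro summable_on_comparison_test[OF s]) auto
  have "(\<Sum>\<^sub>\<infinity>n. cmod (c n * \<psi> n z)) \<le> (\<Sum>\<^sub>\<infinity>n. K * cmod (\<psi> n z))"
    by (intro infsum_mono s s' le)
  also have "\<dots> \<le> K * psi_bound"
    unfolding infsum_cmult_right' by (intro mult_left_mono psi_infsum_le K)
  finally show "(\<Sum>\<^sub>\<infinity>n. cmod (c n * \<psi> n z)) \<le> K * psi_bound" .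
qed

lemma psi_series_bound:
  assumes "\<And>n. cmod (c n) \<le> K"
  shows "cmod (psi_series c z) \<le> K * psi_bound"
  unfolding psi_series_def
  by (rule order.trans[OF norm_infsum_bound psi_series_abs_summable(2)[OF assms]])
    (rule psi_series_abs_summable(1)[OF assms])

lemma psi_series_borel:
  assumes "\<And>n. cmod (c n) \<le> K"
  shows "psi_series c \<in> borel_measurable borel"
  unfolding psi_series_def
  by (rule infsum_borel_measurable) (auto intro!: abs_summable_summable psi_series_abs_summable[OF assms])

lemma Psi0_eq: "\<Psi>\<^sub>0 z = psi_series (\<lambda>_. 1) z"
  by (simp add: \<Psi>\<^sub>0_def psi_series_def)

text \<open>The contribution of p = (d, r) to the coefficient of \<psi> n. The term c (n - d) stems
  from v in the third slot of the triple product, the conjugate term from the conjugate of v in the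
  middle slot.\<close>

definition interaction :: "(int \<Rightarrow> complex) \<Rightarrow> int \<Rightarrow> int \<times> int \<Rightarrow> complex" where
  "interaction c n p = (2 * c (n - fst p) + cnj (c (n + snd p - fst p))) * complex_of_real (coupling (fst p) (snd p))"

lemma coupling_abs_summable: "(\<lambda>p. \<bar>coupling (fst p) (snd p)\<bar>) summable_on UNIV"
proof (rule summable_on_comparison_test)
  let ?e = "\<lambda>k::int. exp (- (\<delta>\<^sup>2 * (of_int k)\<^sup>2))"
  have s: "(\<lambda>k. norm (?e k)) summable_on UNIV"
    using exp_neg_sq_summable_int[of "\<delta>\<^sup>2"] delta_pos by simp
  show "(\<lambda>p. 1 / (\<gamma> * sqrt pi) * norm (?e (fst p) * ?e (snd p))) summable_on UNIV"
    by (intro summable_on_cmult_right infsum_product s)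
  show "\<bar>coupling (fst p) (snd p)\<bar> \<le> 1 / (\<gamma> * sqrt pi) * norm (?e (fst p) * ?e (snd p))" for p :: "int \<times> int"
  proof -
    have "?e (fst p) * ?e (snd p) = exp (- (\<delta>\<^sup>2 * ((of_int (fst p))\<^sup>2 + (of_int (snd p))\<^sup>2)))"
      unfolding exp_add[symmetric] by (simp add: algebra_simps)
    then show ?thesis
      unfolding coupling_def abs_mult using gamma_pos
      by (intro mult_mono mult_left_le_one_le) (auto simp: abs_mult)
  qed
qed auto

definition coupling_sum :: real where
  "coupling_sum = (\<Sum>\<^sub>\<infinity>p. \<bar>coupling (fst p) (snd p)\<bar>)"

lemma coupling_mult_summable:
  fixes h :: "int \<times> int \<Rightarrow> complex"
  assumes "\<And>p. cmod (h p) \<le> K"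
  shows "(\<lambda>p. cmod (h p * complex_of_real (coupling (fst p) (snd p)))) summable_on UNIV"
    and "(\<Sum>\<^sub>\<infinity>p. cmod (h p * complex_of_real (coupling (fst p) (snd p)))) \<le> K * coupling_sum"
proof -
  have s: "(\<lambda>p. K * \<bar>coupling (fst p) (snd p)\<bar>) summable_on UNIV"
    by (intro summable_on_cmult_right coupling_abs_summable)
  have le: "cmod (h p * complex_of_real (coupling (fst p) (snd p))) \<le> K * \<bar>coupling (fst p) (snd p)\<bar>" for p
    unfolding norm_mult norm_of_real by (intro mult_right_mono assms) auto
  show s': "(\<lambda>p. cmod (h p * complex_of_real (coupling (fst p) (snd p)))) summable_on UNIV"
    using le by (intro summable_on_comparison_test[OF s]) auto
  show "(\<Sum>\<^sub>\<infinity>p. cmod (h p * complex_of_real (coupling (fst p) (snd p)))) \<le> K * coupling_sum"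
    unfolding coupling_sum_def infsum_cmult_right'[symmetric] by (intro infsum_mono s s' le)
qed

text \<open>Reindexes sums over (k, l, m) by the output index n = k - l + m and the differences d =
  k - l, r = l - m.\<close>

lemma bij_triple: "bij (\<lambda>(n::int, d, r). (n + r, n + r - d, n - d))"
  by (rule bij_betw_byWitness[where f' = "\<lambda>(k, l, m). (k - l + m, k - l, l - m)"]) auto

text \<open>All three factors are expanded and the sum over triples is reindexed by the output
  index, so that each term becomes a multiple of a single \<psi> n. Sum and integral are exchanged
  with the modulus of the kernel times 3 K psi_bound^3 as majorant. Replacing v by its series is
  harmless, as \<open>LLL_proj\<close> sees v only up to a null set.\<close>

lemma LLL_proj_psi_series:
  assumes c: "\<And>n. cmod (c n) \<le> K" and v: "v \<in> borel_measurable borel"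
    and ae: "AE w in lebesgue. v w = psi_series c w"
  shows "(\<lambda>i. cmod (interaction c (fst i) (snd i) * \<psi> (fst i) z)) summable_on UNIV"
    and "LLL_proj (\<lambda>w. 2 * (complex_of_real (cmod (\<Psi>\<^sub>0 w)))\<^sup>2 * v w + (\<Psi>\<^sub>0 w)\<^sup>2 * cnj (v w)) z =
      (\<Sum>\<^sub>\<infinity>i. interaction c (fst i) (snd i) * \<psi> (fst i) z)"
proof -
  define s where "s = psi_series c"
  have K: "0 \<le> K" using c[of 0] norm_ge_zero order.trans by blast
  have sm: "s \<in> borel_measurable borel" unfolding s_def by (rule psi_series_borel[OF c])
  have Pm: "\<Psi>\<^sub>0 \<in> borel_measurable borel"
    using psi_series_borel[of "\<lambda>_. 1" 1] by (simp add: Psi0_eq[abs_def])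
  let ?ker = "\<lambda>w. exp (cnj w * z - complex_of_real ((cmod w)\<^sup>2 / 2))"
  have kerm: "?ker \<in> borel_measurable borel"
    by (intro borel_measurable_continuous_onI) (auto intro!: continuous_intros)
  define Q where "Q = (\<lambda>u w. 2 * (complex_of_real (cmod (\<Psi>\<^sub>0 w)))\<^sup>2 * u w + (\<Psi>\<^sub>0 w)\<^sup>2 * cnj (u w))"
  have Qm: "Q u \<in> borel_measurable borel" if "u \<in> borel_measurable borel" for u
  proof -
    have "(\<lambda>w. cnj (u w)) \<in> borel_measurable borel"
      using measurable_compose[OF that borel_measurable_continuous_onI[OF continuous_on_cnj[OF continuous_on_id]]] by simp
    then show ?thesis unfolding Q_def using that Pm by measurable
  qed
  have "LLL_proj (Q v) z = LLL_proj (Q s) z"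
    unfolding LLL_proj_def
  proof (intro arg_cong2[of _ _ _ _ "(*)"] refl integral_cong_AE)
    show "(\<lambda>w. ?ker w * Q v w) \<in> borel_measurable lebesgue" "(\<lambda>w. ?ker w * Q s w) \<in> borel_measurable lebesgue"
      using Qm[OF v] Qm[OF sm] kerm by (auto intro!: measurable_completion)
    show "AE w in lebesgue. ?ker w * Q v w = ?ker w * Q s w"
      using ae by eventually_elim (simp add: Q_def s_def)
  qed
  define D where "D = (\<lambda>(n, d, r). 2 * c (n - d) + cnj (c (n + r - d)))"
  have D: "cmod (D i) \<le> 3 * K" for i
  proof (cases i)
    case (fields n d r)
    then show ?thesis
      using c[of "n - d"] c[of "n + r - d"] norm_triangle_ineq[of "2 * c (n - d)" "cnj (c (n + r - d))"]
      by (simp add: D_def norm_mult)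
  qed
  define T where "T = (\<lambda>(n, d, r) w. \<psi> (n + r) w * cnj (\<psi> (n + r - d) w) * \<psi> (n - d) w)"
  define U where "U = (\<lambda>(k, l, m) w. \<psi> k w * (cnj (\<psi> l w) * \<psi> m w))"
  define \<phi> where "\<phi> = (\<lambda>(n::int, d, r). (n + r, n + r - d, n - d))"
  have bij: "bij \<phi>" unfolding \<phi>_def by (rule bij_triple)
  have TU: "T i w = U (\<phi> i) w" for i w
    by (simp add: T_def U_def \<phi>_def mult.assoc split: prod.splits)
  have D': "D i = (\<lambda>(k, l, m). 2 * c m + cnj (c l)) (\<phi> i)" for i
    by (simp add: D_def \<phi>_def split: prod.splits)
  have psum: "(\<lambda>k. cmod (\<psi> k w)) summable_on UNIV" "(\<lambda>k. cmod (cnj (\<psi> k w))) summable_on UNIV" for w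
    using psi_abs_summable[of w] by simp_all
  have csum: "(\<lambda>k. cmod (c k * \<psi> k w)) summable_on UNIV" "(\<lambda>k. cmod (cnj (c k * \<psi> k w))) summable_on UNIV" for w
    using psi_series_abs_summable(1)[where c = c and z = w, OF c] by (simp_all only: complex_mod_cnj)
  have triple: "(\<lambda>p. cmod (a (fst p) * (b (fst (snd p)) * e (snd (snd p))))) summable_on UNIV"
      "(\<Sum>\<^sub>\<infinity>p. a (fst p) * (b (fst (snd p)) * e (snd (snd p)))) = infsum a UNIV * (infsum b UNIV * infsum e UNIV)"
      "(\<Sum>\<^sub>\<infinity>p. cmod (a (fst p) * (b (fst (snd p)) * e (snd (snd p))))) = (\<Sum>\<^sub>\<infinity>k. cmod (a k)) * ((\<Sum>\<^sub>\<infinity>k. cmod (b k)) * (\<Sum>\<^sub>\<infinity>k. cmod (e k)))"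
    if "(\<lambda>k. cmod (a k)) summable_on UNIV" "(\<lambda>k. cmod (b k)) summable_on UNIV" "(\<lambda>k. cmod (e k)) summable_on UNIV"
    for a b e :: "int \<Rightarrow> complex"
  proof -
    note be = infsum_product[OF that(2,3)]
    note abe = infsum_product[OF that(1) be(1)]
    show "(\<lambda>p. cmod (a (fst p) * (b (fst (snd p)) * e (snd (snd p))))) summable_on UNIV" using abe(1) .
    show "(\<Sum>\<^sub>\<infinity>p. a (fst p) * (b (fst (snd p)) * e (snd (snd p)))) = infsum a UNIV * (infsum b UNIV * infsum e UNIV)"
      using abe(2) be(2) by simp
    have n: "(\<lambda>k. norm (cmod (a k))) summable_on UNIV" "(\<lambda>k. norm (cmod (b k))) summable_on UNIV" "(\<lambda>k. norm (cmod (e k))) summable_on UNIV"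
      using that by simp_all
    note nbe = infsum_product[OF n(2,3)]
    show "(\<Sum>\<^sub>\<infinity>p. cmod (a (fst p) * (b (fst (snd p)) * e (snd (snd p))))) = (\<Sum>\<^sub>\<infinity>k. cmod (a k)) * ((\<Sum>\<^sub>\<infinity>k. cmod (b k)) * (\<Sum>\<^sub>\<infinity>k. cmod (e k)))"
      using infsum_product(2)[OF n(1) nbe(1)] nbe(2) by (simp add: norm_mult)
  qed
  have U': "U p w = \<psi> (fst p) w * (cnj (\<psi> (fst (snd p)) w) * \<psi> (snd (snd p)) w)" for p w
    by (simp add: U_def split: prod.splits)
  have Usum: "(\<lambda>p. cmod (U p w)) summable_on UNIV" for w
    unfolding U' by (intro triple(1) psum)
  have pb: "0 \<le> (\<Sum>\<^sub>\<infinity>k. cmod (\<psi> k w))" for w by (intro infsum_nonneg) simp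
  have Ub: "(\<Sum>\<^sub>\<infinity>p. cmod (U p w)) \<le> psi_bound * (psi_bound * psi_bound)" for w
    unfolding U' triple(3)[OF psum(1) psum(2) psum(1)]
    using psi_infsum_le[of w] pb[of w] by (intro mult_mono) (auto intro: mult_nonneg_nonneg order.trans)
  have Tsum: "(\<lambda>i. cmod (T i w)) summable_on UNIV" for w
    unfolding TU using summable_on_reindex_bij_betw[OF bij, of "\<lambda>p. cmod (U p w)"] Usum by simp
  have Tb: "(\<Sum>\<^sub>\<infinity>i. cmod (T i w)) \<le> psi_bound * (psi_bound * psi_bound)" for w
    unfolding TU using infsum_reindex_bij_betw[OF bij, of "\<lambda>p. cmod (U p w)"] Ub by simp
  have DTsum': "(\<lambda>i. 3 * K * cmod (T i w)) summable_on UNIV" for w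
    by (intro summable_on_cmult_right Tsum)
  have DTle: "cmod (D i * T i w) \<le> 3 * K * cmod (T i w)" for i w
    unfolding norm_mult by (intro mult_right_mono D) auto
  have DTsum: "(\<lambda>i. cmod (D i * T i w)) summable_on UNIV" for w
    using DTle by (intro summable_on_comparison_test[OF DTsum']) auto
  have DTb: "(\<Sum>\<^sub>\<infinity>i. cmod (D i * T i w)) \<le> 3 * K * (psi_bound * (psi_bound * psi_bound))" for w
  proof -
    have "(\<Sum>\<^sub>\<infinity>i. cmod (D i * T i w)) \<le> (\<Sum>\<^sub>\<infinity>i. 3 * K * cmod (T i w))"
      by (intro infsum_mono DTsum DTsum' DTle)
    also have "\<dots> \<le> 3 * K * (psi_bound * (psi_bound * psi_bound))"
      unfolding infsum_cmult_right' using K by (intro mult_left_mono Tb) auto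
    finally show ?thesis .
  qed
  have Qs: "Q s w = (\<Sum>\<^sub>\<infinity>i. D i * T i w)" for w
  proof -
    have 1: "(\<Sum>\<^sub>\<infinity>p. \<psi> (fst p) w * (cnj (\<psi> (fst (snd p)) w) * (c (snd (snd p)) * \<psi> (snd (snd p)) w))) = \<Psi>\<^sub>0 w * (cnj (\<Psi>\<^sub>0 w) * s w)"
      using triple(2)[OF psum(1)[of w] psum(2)[of w] csum(1)[of w]]
      by (simp add: \<Psi>\<^sub>0_def s_def psi_series_def)
    have 2: "(\<Sum>\<^sub>\<infinity>p. \<psi> (fst p) w * (cnj (c (fst (snd p)) * \<psi> (fst (snd p)) w) * \<psi> (snd (snd p)) w)) = \<Psi>\<^sub>0 w * (cnj (s w) * \<Psi>\<^sub>0 w)"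
      using triple(2)[OF psum(1)[of w] csum(2)[of w] psum(1)[of w]]
      by (simp only: \<Psi>\<^sub>0_def s_def psi_series_def infsum_cnj)
    have s1: "(\<lambda>p. \<psi> (fst p) w * (cnj (\<psi> (fst (snd p)) w) * (c (snd (snd p)) * \<psi> (snd (snd p)) w))) summable_on UNIV"
      by (rule abs_summable_summable, rule triple(1)[OF psum(1)[of w] psum(2)[of w] csum(1)[of w]])
    have s2: "(\<lambda>p. \<psi> (fst p) w * (cnj (c (fst (snd p)) * \<psi> (fst (snd p)) w) * \<psi> (snd (snd p)) w)) summable_on UNIV"
      by (rule abs_summable_summable, rule triple(1)[OF psum(1)[of w] csum(2)[of w] psum(1)[of w]])
    have "(\<Sum>\<^sub>\<infinity>i. D i * T i w) = (\<Sum>\<^sub>\<infinity>i. (\<lambda>p. (\<lambda>(k, l, m). 2 * c m + cnj (c l)) p * U p w) (\<phi> i))"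
      by (simp add: TU D')
    also have "\<dots> = (\<Sum>\<^sub>\<infinity>p. (\<lambda>(k, l, m). 2 * c m + cnj (c l)) p * U p w)"
      by (rule infsum_reindex_bij_betw[OF bij])
    also have "\<dots> = (\<Sum>\<^sub>\<infinity>p. 2 * (\<psi> (fst p) w * (cnj (\<psi> (fst (snd p)) w) * (c (snd (snd p)) * \<psi> (snd (snd p)) w)))
        + \<psi> (fst p) w * (cnj (c (fst (snd p)) * \<psi> (fst (snd p)) w) * \<psi> (snd (snd p)) w))"
      by (intro infsum_cong) (simp add: U' algebra_simps split: prod.splits)
    also have "\<dots> = 2 * (\<Psi>\<^sub>0 w * (cnj (\<Psi>\<^sub>0 w) * s w)) + \<Psi>\<^sub>0 w * (cnj (s w) * \<Psi>\<^sub>0 w)"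
      by (subst infsum_add) (auto simp only: infsum_cmult_right' 1 2 intro!: summable_on_cmult_right s1 s2)
    also have "\<dots> = Q s w"
      by (simp add: Q_def power2_eq_square mult_ac flip: complex_norm_square[unfolded power2_eq_square])
    finally show ?thesis ..
  qed
  have Tm: "T i \<in> borel_measurable borel" for i
    unfolding T_def by (cases i) (auto intro!: borel_measurable_times)
  have f: "(\<lambda>w. ?ker w * (D i * T i w)) \<in> borel_measurable lborel" for i
    using kerm Tm[of i] by simp
  have si: "(\<lambda>i. cmod (?ker w * (D i * T i w))) summable_on UNIV" for w
    unfolding norm_mult[of "?ker w"] by (intro summable_on_cmult_right DTsum)
  have sb: "(\<Sum>\<^sub>\<infinity>i. cmod (?ker w * (D i * T i w))) \<le> cmod (?ker w) * (3 * K * (psi_bound * (psi_bound * psi_bound)))" for w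
    unfolding norm_mult[of "?ker w"] infsum_cmult_right' by (intro mult_left_mono DTb) auto
  have B: "integrable lborel (\<lambda>w. cmod (?ker w) * (3 * K * (psi_bound * (psi_bound * psi_bound))))"
    by (intro integrable_mult_left kernel_integrable)
  note swap = integral_infsum[OF f si sb B]
  let ?pre = "complex_of_real (1 / pi * exp (- (cmod z)\<^sup>2 / 2))"
  have term_eq: "?pre * (LINT w|lborel. ?ker w * (D i * T i w)) = interaction c (fst i) (snd i) * \<psi> (fst i) z" for i
  proof (cases i)
    case (fields n d r)
    have "?pre * (LINT w|lborel. ?ker w * (D i * T i w)) = D i * (?pre * (LINT w|lborel. ?ker w * T i w))"
    proof -
      have "(LINT w|lborel. ?ker w * (D i * T i w)) = (LINT w|lborel. D i * (?ker w * T i w))"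
        by (intro Bochner_Integration.integral_cong) (auto simp: mult_ac)
      then show ?thesis by (simp only: integral_mult_right_zero mult_ac)
    qed
    also have "?pre * (LINT w|lborel. ?ker w * T i w) = complex_of_real (coupling d r) * \<psi> n z"
      using LLL_proj_psi_triple[of n r d z] LLL_proj_lborel[OF Tm[of i], of z] by (simp add: T_def fields)
    finally show ?thesis by (simp add: D_def fields interaction_def mult_ac)
  qed
  have "(\<lambda>i. cmod (?pre * (LINT w|lborel. ?ker w * (D i * T i w)))) summable_on UNIV"
    unfolding norm_mult[of ?pre] by (intro summable_on_cmult_right swap(2))
  then show "(\<lambda>i. cmod (interaction c (fst i) (snd i) * \<psi> (fst i) z)) summable_on UNIV"
    unfolding term_eq .
  have "LLL_proj (Q s) z = ?pre * (LINT w|lborel. ?ker w * Q s w)"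
    by (rule LLL_proj_lborel[OF Qm[OF sm]])
  also have "(LINT w|lborel. ?ker w * Q s w) = (LINT w|lborel. (\<Sum>\<^sub>\<infinity>i. ?ker w * (D i * T i w)))"
    unfolding Qs infsum_cmult_right' ..
  also have "\<dots> = (\<Sum>\<^sub>\<infinity>i. LINT w|lborel. ?ker w * (D i * T i w))" by (rule swap(3))
  also have "?pre * \<dots> = (\<Sum>\<^sub>\<infinity>i. interaction c (fst i) (snd i) * \<psi> (fst i) z)"
    unfolding infsum_cmult_right'[symmetric] term_eq ..
  finally have "LLL_proj (Q v) z = (\<Sum>\<^sub>\<infinity>i. interaction c (fst i) (snd i) * \<psi> (fst i) z)"
    using \<open>LLL_proj (Q v) z = LLL_proj (Q s) z\<close> by simp
  then show "LLL_proj (\<lambda>w. 2 * (complex_of_real (cmod (\<Psi>\<^sub>0 w)))\<^sup>2 * v w + (\<Psi>\<^sub>0 w)\<^sup>2 * cnj (v w)) z =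
      (\<Sum>\<^sub>\<infinity>i. interaction c (fst i) (snd i) * \<psi> (fst i) z)"
    unfolding Q_def .
qed

lemma psi_L1: "integrable (lebesgue_on (strip \<gamma>)) (\<psi> n)"
proof -
  have "integrable lborel (\<lambda>z. complex_of_real (indicator {- \<gamma> / 2<..\<gamma> / 2} (Re z)) * complex_of_real (psi_norm * gauss n (Im z)))"
    by (rule complex_integrable_product)
      (auto intro!: integrable_of_real gauss_integrable integrable_real_indicator simp: gamma_pos less_imp_le simp del: of_real_mult)
  then have "integrable lborel (\<lambda>z. indicator (strip \<gamma>) z *\<^sub>R \<psi> n z)"
  proof (rule Bochner_Integration.integrable_bound)
    show "(\<lambda>z. indicator (strip \<gamma>) z *\<^sub>R \<psi> n z) \<in> borel_measurable lborel"
      using strip_borel by simp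
    show "AE z in lborel. norm (indicator (strip \<gamma>) z *\<^sub>R \<psi> n z) \<le>
        norm (complex_of_real (indicator {- \<gamma> / 2<..\<gamma> / 2} (Re z)) * complex_of_real (psi_norm * gauss n (Im z)))"
      using psi_norm_pos gauss_nonneg
      by (intro AE_I2) (auto simp: norm_psi norm_mult strip_def indicator_def simp del: of_real_mult)
  qed
  then show ?thesis using lebesgue_on_borel(1)[OF psi_borel strip_borel] by blast
qed

text \<open>Orthonormality keeps only the terms with first index n. The exchange with the integral
  is dominated by a multiple of |\<psi> n|, because the sums of |coupling| and of |\<psi>| are
  bounded uniformly in the index and in z.\<close>

lemma LLL_proj_coefficient:
  assumes c: "\<And>n. cmod (c n) \<le> K" and v: "v \<in> borel_measurable borel"
    and ae: "AE w in lebesgue. v w = psi_series c w"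
  shows "(LINT z|lebesgue_on (strip \<gamma>).
      LLL_proj (\<lambda>w. 2 * (complex_of_real (cmod (\<Psi>\<^sub>0 w)))\<^sup>2 * v w + (\<Psi>\<^sub>0 w)\<^sup>2 * cnj (v w)) z * cnj (\<psi> n z)) =
    (\<Sum>\<^sub>\<infinity>p. interaction c n p)"
proof -
  let ?M = "lebesgue_on (strip \<gamma>)"
  have K: "0 \<le> K" using c[of 0] norm_ge_zero order.trans by blast
  note L = LLL_proj_psi_series[where c = c, OF c v ae]
  have hb: "cmod (2 * c (n' - fst p) + cnj (c (n' + snd p - fst p))) \<le> 3 * K" for n' p
    using c[of "n' - fst p"] c[of "n' + snd p - fst p"]
      norm_triangle_ineq[of "2 * c (n' - fst p)" "cnj (c (n' + snd p - fst p))"] by (simp add: norm_mult)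
  have cs: "(\<Sum>\<^sub>\<infinity>p. cmod (interaction c n' p)) \<le> 3 * K * coupling_sum" for n'
    unfolding interaction_def by (rule coupling_mult_summable(2)[OF hb])
  let ?f = "\<lambda>i z. interaction c (fst i) (snd i) * \<psi> (fst i) z * cnj (\<psi> n z)"
  have f: "?f i \<in> borel_measurable ?M" for i
    by (intro borel_measurable_times continuous_imp_measurable_on_sets_lebesgue continuous_psi
        continuous_on_cnj borel_measurable_const sets_completionI_sets) (simp_all add: strip_borel)
  have si: "(\<lambda>i. cmod (?f i z)) summable_on UNIV" for z
    unfolding norm_mult[of _ "cnj (\<psi> n z)"] by (intro summable_on_cmult_left L)
  have inter: "(\<Sum>\<^sub>\<infinity>i. cmod (interaction c (fst i) (snd i) * \<psi> (fst i) z)) \<le> 3 * K * coupling_sum * psi_bound" for z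
  proof -
    let ?g = "\<lambda>i. cmod (interaction c (fst i) (snd i) * \<psi> (fst i) z)"
    have "infsum ?g UNIV = (\<Sum>\<^sub>\<infinity>n'. \<Sum>\<^sub>\<infinity>p. ?g (n', p))"
      using infsum_Sigma_banach[of ?g UNIV "\<lambda>_. UNIV"] L(1)[of z] by simp
    also have "\<dots> = (\<Sum>\<^sub>\<infinity>n'. (\<Sum>\<^sub>\<infinity>p. cmod (interaction c n' p)) * cmod (\<psi> n' z))"
      by (simp add: norm_mult infsum_cmult_left')
    also have "\<dots> \<le> (\<Sum>\<^sub>\<infinity>n'. 3 * K * coupling_sum * cmod (\<psi> n' z))"
    proof (rule infsum_mono)
      show s: "(\<lambda>n'. 3 * K * coupling_sum * cmod (\<psi> n' z)) summable_on UNIV"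
        by (intro summable_on_cmult_right psi_abs_summable)
      show le: "(\<Sum>\<^sub>\<infinity>p. cmod (interaction c n' p)) * cmod (\<psi> n' z) \<le> 3 * K * coupling_sum * cmod (\<psi> n' z)" for n'
        by (intro mult_right_mono cs) auto
      show "(\<lambda>n'. (\<Sum>\<^sub>\<infinity>p. cmod (interaction c n' p)) * cmod (\<psi> n' z)) summable_on UNIV"
        by (rule summable_on_comparison_test[OF s le]) (intro mult_nonneg_nonneg infsum_nonneg; simp)
    qed
    also have "\<dots> \<le> 3 * K * coupling_sum * psi_bound"
      unfolding infsum_cmult_right'
      using K by (intro mult_left_mono psi_infsum_le) (auto simp: coupling_sum_def intro!: mult_nonneg_nonneg infsum_nonneg)
    finally show ?thesis .
  qed
  have sb: "(\<Sum>\<^sub>\<infinity>i. cmod (?f i z)) \<le> 3 * K * coupling_sum * psi_bound * cmod (\<psi> n z)" for z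
    unfolding norm_mult[of _ "cnj (\<psi> n z)"] infsum_cmult_left' complex_mod_cnj
    by (intro mult_right_mono inter) auto
  have B: "integrable ?M (\<lambda>z. 3 * K * coupling_sum * psi_bound * cmod (\<psi> n z))"
    by (intro integrable_mult_right integrable_norm psi_L1)
  note swap = integral_infsum[OF f si sb B]
  have int: "(LINT z|?M. ?f i z) = (if fst i = n then interaction c n (snd i) else 0)" for i
  proof -
    have "(LINT z|?M. ?f i z) = interaction c (fst i) (snd i) * (LINT z|?M. \<psi> (fst i) z * cnj (\<psi> n z))"
      by (simp only: mult.assoc integral_mult_right_zero)
    then show ?thesis by (simp add: psi_orthonormal)
  qed
  have "(LINT z|?M. (\<Sum>\<^sub>\<infinity>i. ?f i z)) = (\<Sum>\<^sub>\<infinity>i. if fst i = n then interaction c n (snd i) else 0)"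
    unfolding swap(3) int ..
  also have "\<dots> = (\<Sum>\<^sub>\<infinity>i\<in>Pair n ` UNIV. interaction c n (snd i))"
    by (rule infsum_cong_neutral) auto
  also have "\<dots> = (\<Sum>\<^sub>\<infinity>p. interaction c n p)"
    by (subst infsum_reindex) (auto simp: inj_on_def o_def)
  finally show ?thesis unfolding L(2) infsum_cmult_left' .
qed

text \<open>The L^2 expansion is known on the strip only, while \<Pi> integrates over the plane.
  Countably many translates of the strip by multiples of \<gamma> cover the plane.\<close>

lemma AE_lebesgue_on_UN_strip:
  assumes ae: "AE z in lebesgue_on (strip \<gamma>). P z"
    and per: "\<And>z. P (z + complex_of_real \<gamma>) \<longleftrightarrow> P z"
  shows "AE z in lebesgue. P z"
proof -
  have ae': "AE z in lebesgue. z \<in> strip \<gamma> \<longrightarrow> P z"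
    using ae strip_borel by (subst (asm) AE_restrict_space_iff) auto
  have perk: "P (z + of_int k * complex_of_real \<gamma>) \<longleftrightarrow> P z" for k z
  proof (induction k rule: int_induct[where k = 0])
    case (step1 i)
    then show ?case using per[of "z + of_int i * complex_of_real \<gamma>"] by (simp add: algebra_simps)
  next
    case (step2 i)
    then show ?case using per[of "z + of_int (i - 1) * complex_of_real \<gamma>"] by (simp add: algebra_simps)
  qed simp
  have neg: "negligible {z \<in> strip \<gamma>. \<not> P z}"
  proof -
    obtain N where "N \<in> null_sets lebesgue" "{z \<in> space lebesgue. \<not> (z \<in> strip \<gamma> \<longrightarrow> P z)} \<subseteq> N"
      using ae' unfolding eventually_ae_filter by blast
    then show ?thesis
      by (auto simp: negligible_iff_null_sets[symmetric] intro: negligible_subset)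
  qed
  let ?N = "\<Union>k::int. (+) (- (of_int k * complex_of_real \<gamma>)) ` {z \<in> strip \<gamma>. \<not> P z}"
  have "negligible ?N"
    by (rule negligible_countable_Union) (use neg negligible_translation in blast)+
  moreover have "{z. \<not> P z} \<subseteq> ?N"
  proof
    fix z assume z: "z \<in> {z. \<not> P z}"
    \<comment> \<open>The ceiling matches the half-open strip: it puts Re z / \<gamma> + k into
      (-1/2, 1/2].\<close>
    define k where "k = - \<lceil>Re z / \<gamma> - 1/2\<rceil>"
    have "Re z / \<gamma> + of_int k \<le> 1/2" "- 1/2 < Re z / \<gamma> + of_int k"
      unfolding k_def by linarith+
    then have "Re z + of_int k * \<gamma> \<le> \<gamma> / 2" "- \<gamma> / 2 < Re z + of_int k * \<gamma>"
      using gamma_pos by (simp_all add: field_simps)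
    then have "z + of_int k * complex_of_real \<gamma> \<in> {z \<in> strip \<gamma>. \<not> P z}"
      using z perk[of z k] by (auto simp: strip_def)
    then have "- (of_int k * complex_of_real \<gamma>) + (z + of_int k * complex_of_real \<gamma>) \<in> ?N" by blast
    then show "z \<in> ?N" by simp
  qed
  ultimately have "negligible {z. \<not> P z}" by (rule negligible_subset)
  then show ?thesis by (intro AE_I'[of "{z. \<not> P z}"]) (auto simp: negligible_iff_null_sets)
qed

section \<open>The equation for the coefficients\<close>

lemma has_vector_derivative_iff_norm:
  "(f has_vector_derivative d) (at t within S) \<longleftrightarrow>
    ((\<lambda>s. norm (f s - f t - (s - t) *\<^sub>R d) / \<bar>s - t\<bar>) \<longlongrightarrow> 0) (at t within S)"
  unfolding has_vector_derivative_def has_derivative_iff_norm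
  by (simp add: bounded_linear_scaleR_left)

text \<open>Differentiability is known for each coordinate only, while the derivative is bounded
  through the supremum of the whole family. Picard iteration copes with this: the uniform bound K on
  [0, t] improves to K (M s)^j / j! for every j.\<close>

lemma family_ode_zero:
  fixes g g' :: "real \<Rightarrow> 'i \<Rightarrow> complex"
  assumes d: "\<And>t i. 0 \<le> t \<Longrightarrow> ((\<lambda>s. g s i) has_vector_derivative g' t i) (at t within {0..})"
    and b: "\<And>t B i. 0 \<le> t \<Longrightarrow> (\<And>j. norm (g t j) \<le> B) \<Longrightarrow> norm (g' t i) \<le> M * B"
    and M: "0 \<le> M" and init: "\<And>i. g 0 i = 0"
    and bd: "\<And>T. \<exists>K. \<forall>t\<in>{0..T}. \<forall>i. norm (g t i) \<le> K"
    and t: "0 \<le> t"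
  shows "g t i = 0"
proof -
  obtain K where K: "\<And>s i. s \<in> {0..t} \<Longrightarrow> norm (g s i) \<le> K" using bd[of t] by blast
  have iter: "norm (g s i) \<le> K * M ^ j * s ^ j / fact j" if "s \<in> {0..t}" for s i j
    using that
  proof (induction j arbitrary: s i)
    case 0
    then show ?case using K by simp
  next
    case (Suc j)
    show ?case
    proof (cases "s = 0")
      case True
      then show ?thesis by (simp add: init)
    next
      case False
      let ?\<phi> = "\<lambda>s. K * M ^ Suc j * s ^ Suc j / fact (Suc j)"
      have "norm (g s i - g 0 i) \<le> ?\<phi> s - ?\<phi> 0"
      proof (rule differentiable_bound_general)
        show "0 < s" using False Suc.prems by auto
        have "continuous_on {0..} (\<lambda>s. g s i)"
          using d[of _ i] by (auto simp: continuous_on_eq_continuous_within intro: has_vector_derivative_continuous)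
        then show "continuous_on {0..s} (\<lambda>s. g s i)" by (rule continuous_on_subset) auto
        show "continuous_on {0..s} ?\<phi>" by (intro continuous_intros) auto
        fix x assume x: "0 < x" "x < s"
        then show "((\<lambda>s. g s i) has_vector_derivative g' x i) (at x)"
          using d[of x i] by (simp add: at_within_interior[of x "{0..}"])
        have "(?\<phi> has_real_derivative K * M ^ Suc j * (real (Suc j) * x ^ j) / fact (Suc j)) (at x)"
          using DERIV_cdivide[OF DERIV_cmult[OF DERIV_pow[of "Suc j" x UNIV], of "K * M ^ Suc j"], of "fact (Suc j)"] by simp
        moreover have "K * M ^ Suc j * (real (Suc j) * x ^ j) / fact (Suc j) = M * (K * M ^ j * x ^ j / fact j)"
          unfolding fact_Suc by (simp add: field_simps del: of_nat_Suc)
        ultimately show "(?\<phi> has_vector_derivative M * (K * M ^ j * x ^ j / fact j)) (at x)"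
          by (simp only: has_real_derivative_iff_has_vector_derivative)
        show "norm (g' x i) \<le> M * (K * M ^ j * x ^ j / fact j)"
          using x Suc.prems by (intro b Suc.IH) auto
      qed
      then show ?thesis by (simp add: init)
    qed
  qed
  have "(\<lambda>j. inverse (fact j) * (M * t) ^ j) \<longlonglongrightarrow> 0"
    by (rule summable_LIMSEQ_zero[OF summable_exp])
  then have "(\<lambda>j. K * (inverse (fact j) * (M * t) ^ j)) \<longlonglongrightarrow> K * 0" by (rule tendsto_mult_left)
  then have "(\<lambda>j. K * M ^ j * t ^ j / fact j) \<longlonglongrightarrow> 0"
    by (simp add: field_simps power_mult_distrib)
  then have "norm (g t i) \<le> 0"
    using iter[of t i] t by (intro LIMSEQ_le_const) auto
  then show ?thesis by simp
qed

definition linear_field :: "(int \<Rightarrow> complex) \<Rightarrow> (int \<Rightarrow> complex) \<Rightarrow> int \<Rightarrow> complex" where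
  "linear_field x y n = (\<Sum>\<^sub>\<infinity>p. (2 * x (n - fst p) + y (n + snd p - fst p)) * complex_of_real (coupling (fst p) (snd p)))
     - complex_of_real lam * x n"

lemma linear_field_summable:
  assumes "\<And>n. cmod (x n) \<le> K" "\<And>n. cmod (y n) \<le> K"
  shows "(\<lambda>p. cmod ((2 * x (n - fst p) + y (n + snd p - fst p)) * complex_of_real (coupling (fst p) (snd p)))) summable_on UNIV"
    and "cmod (linear_field x y n) \<le> (3 * coupling_sum + \<bar>lam\<bar>) * K"
proof -
  have hb: "cmod (2 * x (n - fst p) + y (n + snd p - fst p)) \<le> 3 * K" for p
    using assms(1)[of "n - fst p"] assms(2)[of "n + snd p - fst p"]
      norm_triangle_ineq[of "2 * x (n - fst p)" "y (n + snd p - fst p)"] by (simp add: norm_mult)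
  show s: "(\<lambda>p. cmod ((2 * x (n - fst p) + y (n + snd p - fst p)) * complex_of_real (coupling (fst p) (snd p)))) summable_on UNIV"
    by (rule coupling_mult_summable(1)[OF hb])
  have "cmod (linear_field x y n) \<le> (\<Sum>\<^sub>\<infinity>p. cmod ((2 * x (n - fst p) + y (n + snd p - fst p)) * complex_of_real (coupling (fst p) (snd p))))
      + cmod (complex_of_real lam * x n)"
    unfolding linear_field_def by (intro order.trans[OF norm_triangle_ineq4] add_right_mono norm_infsum_bound s)
  also have "\<dots> \<le> 3 * K * coupling_sum + \<bar>lam\<bar> * K"
    using coupling_mult_summable(2)[OF hb] assms(1)[of n] by (intro add_mono) (auto simp: norm_mult mult_left_mono)
  finally show "cmod (linear_field x y n) \<le> (3 * coupling_sum + \<bar>lam\<bar>) * K" by (simp add: algebra_simps)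
qed

lemma linear_field_diff:
  assumes "\<And>n. cmod (x n) \<le> K" "\<And>n. cmod (y n) \<le> K" "\<And>n. cmod (x' n) \<le> K" "\<And>n. cmod (y' n) \<le> K"
  shows "linear_field x y n - linear_field x' y' n = linear_field (\<lambda>n. x n - x' n) (\<lambda>n. y n - y' n) n"
proof -
  let ?s = "\<lambda>x y p. (2 * x (n - fst p) + y (n + snd p - fst p)) * complex_of_real (coupling (fst p) (snd p))"
  have s: "?s x y summable_on UNIV" "?s x' y' summable_on UNIV"
    using linear_field_summable(1)[where x = x and y = y and K = K, OF assms(1,2)]
      linear_field_summable(1)[where x = x' and y = y' and K = K, OF assms(3,4)]
    by (auto intro: abs_summable_summable)
  have "infsum (?s x y) UNIV - infsum (?s x' y') UNIV = (\<Sum>\<^sub>\<infinity>p. ?s x y p + - ?s x' y' p)"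
    using s by (subst infsum_add) (auto simp: infsum_uminus summable_on_uminus)
  also have "\<dots> = (\<Sum>\<^sub>\<infinity>p. ?s (\<lambda>n. x n - x' n) (\<lambda>n. y n - y' n) p)"
    by (intro infsum_cong) (simp add: algebra_simps)
  finally show ?thesis unfolding linear_field_def by (simp add: algebra_simps)
qed

text \<open>In the application \<open>y\<close> is the conjugate of \<open>x\<close>; decoupling the two makes the system complex-linear.\<close>

definition solves_pair :: "(real \<Rightarrow> int \<Rightarrow> complex) \<Rightarrow> (real \<Rightarrow> int \<Rightarrow> complex) \<Rightarrow> bool" where
  "solves_pair x y \<longleftrightarrow>
     (\<forall>t\<ge>0. \<forall>n. ((\<lambda>s. x s n) has_vector_derivative - \<i> * linear_field (x t) (y t) n) (at t within {0..}) \<and>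
                ((\<lambda>s. y s n) has_vector_derivative \<i> * linear_field (y t) (x t) n) (at t within {0..})) \<and>
     (\<forall>T. \<exists>K. \<forall>t\<in>{0..T}. \<forall>n. cmod (x t n) \<le> K \<and> cmod (y t n) \<le> K)"

lemma solves_pair_unique:
  assumes s: "solves_pair x y" "solves_pair x' y'"
    and init: "x 0 = x' 0" "y 0 = y' 0" and t: "0 \<le> t"
  shows "x t n = x' t n"
proof -
  \<comment> \<open>The Boolean tag merges both components into one family, since the field of each
    is bounded by the supremum over both.\<close>
  define g where "g = (\<lambda>t (i :: int \<times> bool). if snd i then x t (fst i) - x' t (fst i) else y t (fst i) - y' t (fst i))"
  define g' where "g' = (\<lambda>t (i :: int \<times> bool). if snd i
     then - \<i> * (linear_field (\<lambda>n. x t n - x' t n) (\<lambda>n. y t n - y' t n) (fst i))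
     else \<i> * (linear_field (\<lambda>n. y t n - y' t n) (\<lambda>n. x t n - x' t n) (fst i)))"
  have bd: "\<exists>K. \<forall>t\<in>{0..T}. \<forall>n. cmod (x t n) \<le> K \<and> cmod (y t n) \<le> K \<and> cmod (x' t n) \<le> K \<and> cmod (y' t n) \<le> K" for T
  proof -
    obtain K where "\<forall>t\<in>{0..T}. \<forall>n. cmod (x t n) \<le> K \<and> cmod (y t n) \<le> K" using s(1) unfolding solves_pair_def by blast
    moreover obtain K' where "\<forall>t\<in>{0..T}. \<forall>n. cmod (x' t n) \<le> K' \<and> cmod (y' t n) \<le> K'" using s(2) unfolding solves_pair_def by blast
    ultimately show ?thesis by (intro exI[of _ "max K K'"]) (auto intro: max.coboundedI1 max.coboundedI2)
  qed
  have "g t (n, True) = 0"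
  proof (rule family_ode_zero[of g g' "3 * coupling_sum + \<bar>lam\<bar>"])
    fix t :: real and i :: "int \<times> bool" assume t: "0 \<le> t"
    have "t \<in> {0..t}" using t by simp
    with bd[of t] obtain K where K: "\<And>n. cmod (x t n) \<le> K" "\<And>n. cmod (y t n) \<le> K"
      "\<And>n. cmod (x' t n) \<le> K" "\<And>n. cmod (y' t n) \<le> K" by blast
    have dx: "((\<lambda>s. x s m) has_vector_derivative - \<i> * linear_field (x t) (y t) m) (at t within {0..})"
      "((\<lambda>s. y s m) has_vector_derivative \<i> * linear_field (y t) (x t) m) (at t within {0..})"
      "((\<lambda>s. x' s m) has_vector_derivative - \<i> * linear_field (x' t) (y' t) m) (at t within {0..})"
      "((\<lambda>s. y' s m) has_vector_derivative \<i> * linear_field (y' t) (x' t) m) (at t within {0..})" for m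
      using s t unfolding solves_pair_def by blast+
    show "((\<lambda>s. g s i) has_vector_derivative g' t i) (at t within {0..})"
    proof (cases "snd i")
      case True
      then show ?thesis unfolding g_def g'_def
        using has_vector_derivative_diff[OF dx(1)[of "fst i"] dx(3)[of "fst i"]]
          linear_field_diff[where x = "x t" and y = "y t" and x' = "x' t" and y' = "y' t", OF K, of "fst i"]
        by (simp add: algebra_simps)
    next
      case False
      then show ?thesis unfolding g_def g'_def
        using has_vector_derivative_diff[OF dx(2)[of "fst i"] dx(4)[of "fst i"]]
          linear_field_diff[where x = "y t" and y = "x t" and x' = "y' t" and y' = "x' t", OF K(2,1,4,3), of "fst i"]
        by (simp add: algebra_simps)
    qed
  next
    fix t B :: real and i :: "int \<times> bool" assume t: "0 \<le> t" and B: "\<And>j. cmod (g t j) \<le> B"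
    have "cmod (x t n - x' t n) \<le> B" "cmod (y t n - y' t n) \<le> B" for n
      using B[of "(n, True)"] B[of "(n, False)"] by (simp_all add: g_def)
    then show "cmod (g' t i) \<le> (3 * coupling_sum + \<bar>lam\<bar>) * B"
      unfolding g'_def by (auto simp: norm_mult intro!: linear_field_summable(2))
  next
    show "0 \<le> 3 * coupling_sum + \<bar>lam\<bar>" by (simp add: coupling_sum_def infsum_nonneg)
    show "g 0 i = 0" for i by (simp add: g_def init)
    show "\<exists>K. \<forall>t\<in>{0..T}. \<forall>i. cmod (g t i) \<le> K" for T
    proof -
      obtain K where K: "\<forall>t\<in>{0..T}. \<forall>n. cmod (x t n) \<le> K \<and> cmod (y t n) \<le> K \<and> cmod (x' t n) \<le> K \<and> cmod (y' t n) \<le> K"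
        using bd by blast
      have "cmod (g t i) \<le> K + K" if "t \<in> {0..T}" for t i
      proof -
        have "cmod (x t n - x' t n) \<le> K + K" "cmod (y t n - y' t n) \<le> K + K" for n
          by (rule order.trans[OF norm_triangle_ineq4 add_mono]; use K that in blast)+
        then show ?thesis by (simp add: g_def)
      qed
      then show ?thesis by blast
    qed
  qed (rule t)
  then show ?thesis by (simp add: g_def)
qed

section \<open>From the solution in L^2 to its coefficients\<close>

lemma psi_L2_norm: "L2_norm (strip \<gamma>) (\<psi> n) = 1"
proof -
  have "complex_of_real (LINT z|lebesgue_on (strip \<gamma>). (cmod (\<psi> n z))\<^sup>2) = (LINT z|lebesgue_on (strip \<gamma>). \<psi> n z * cnj (\<psi> n z))"
    unfolding integral_complex_of_real[symmetric] by (intro Bochner_Integration.integral_cong refl complex_norm_square)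
  then have "(LINT z|lebesgue_on (strip \<gamma>). (cmod (\<psi> n z))\<^sup>2) = 1"
    unfolding psi_orthonormal by (simp only: of_real_eq_1_iff if_True refl)
  then show ?thesis by (simp add: L2_norm_def)
qed

lemma L2_norm_cnj: "L2_norm S (\<lambda>x. cnj (u x)) = L2_norm S u"
  by (simp add: L2_norm_def)

lemma psi_coefficient_bound:
  assumes "L2_on (strip \<gamma>) u"
  shows "cmod (LINT z|lebesgue_on (strip \<gamma>). u z * cnj (\<psi> n z)) \<le> L2_norm (strip \<gamma>) u"
  using L2_Cauchy_Schwarz[OF assms L2_on_cnj[OF psi_L2]] by (simp add: L2_norm_cnj psi_L2_norm)

text \<open>A subsequence of the partial sums converges almost everywhere to u, while pointwise they
  converge to \<open>psi_series c\<close>; the limits agree.\<close>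

lemma L2_has_sum_AE:
  assumes sum: "L2_has_sum (strip \<gamma>) (\<lambda>n z. c n * \<psi> n z) u" and c: "\<And>n. cmod (c n) \<le> K"
  shows "AE z in lebesgue_on (strip \<gamma>). u z = psi_series c z"
proof -
  let ?M = "lebesgue_on (strip \<gamma>)"
  let ?A = "\<lambda>k. {i::int. to_nat i < k}"
  define w where "w = (\<lambda>k z. (\<Sum>n\<in>?A k. c n * \<psi> n z) - u z)"
  have u: "L2_on (strip \<gamma>) u" using sum by (simp add: L2_has_sum_def)
  have fin: "finite (?A k)" for k
    by (rule finite_imageD[of to_nat]) (auto intro: finite_subset[of _ "{..<k}"])
  have w: "L2_on (strip \<gamma>) (w k)" for k
    unfolding w_def by (intro L2_on_diff L2_on_sum L2_on_cmult psi_L2 u fin)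
  have "(\<lambda>k. L2_norm (strip \<gamma>) (w k)) \<longlonglongrightarrow> 0"
    using filterlim_compose[OF _ filterlim_to_nat_sets] sum unfolding w_def L2_has_sum_def by blast
  then have "(\<lambda>k. (L2_norm (strip \<gamma>) (w k))\<^sup>2) \<longlonglongrightarrow> 0\<^sup>2" by (rule tendsto_power)
  then have "(\<lambda>k. LINT z|?M. norm ((cmod (w k z))\<^sup>2)) \<longlonglongrightarrow> 0"
    by (simp add: L2_norm_sq)
  then obtain r where r: "strict_mono r" "AE z in ?M. (\<lambda>k. (cmod (w (r k) z))\<^sup>2) \<longlonglongrightarrow> 0"
    using tendsto_L1_AE_subseq[of ?M "\<lambda>k z. (cmod (w k z))\<^sup>2"] w unfolding L2_on_def by blast
  from r(2) show ?thesis
  proof eventually_elim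
    case (elim z)
    then have "(\<lambda>k. sqrt ((cmod (w (r k) z))\<^sup>2)) \<longlonglongrightarrow> sqrt 0" by (rule tendsto_real_sqrt)
    then have "(\<lambda>k. w (r k) z) \<longlonglongrightarrow> 0" by (simp add: tendsto_norm_zero_iff)
    from tendsto_add[OF this tendsto_const[of "u z"]]
    have 1: "(\<lambda>k. \<Sum>n\<in>?A (r k). c n * \<psi> n z) \<longlonglongrightarrow> u z" by (simp add: w_def)
    have "(\<lambda>k. \<Sum>n\<in>?A k. c n * \<psi> n z) \<longlonglongrightarrow> psi_series c z"
      unfolding psi_series_def
      using filterlim_compose[OF infsum_tendsto[OF abs_summable_summable[OF psi_series_abs_summable(1)[where c = c and z = z, OF c]]] filterlim_to_nat_sets] .
    from LIMSEQ_subseq_LIMSEQ[OF this r(1)]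
    have "(\<lambda>k. \<Sum>n\<in>?A (r k). c n * \<psi> n z) \<longlonglongrightarrow> psi_series c z" by (simp add: o_def)
    with 1 show ?case using LIMSEQ_unique by blast
  qed
qed

lemma psi_translate: "\<psi> n (z + complex_of_real \<gamma>) = cis (\<gamma> * Im z) * \<psi> n z"
proof -
  have "cis ((Re z + \<gamma>) * Im z + 2 * \<delta> * of_int n * (Re z + \<gamma>) - pi * (of_int n)\<^sup>2 / 2) =
     cis (\<gamma> * Im z) * cis (Re z * Im z + 2 * \<delta> * of_int n * Re z - pi * (of_int n)\<^sup>2 / 2) * cis (2 * pi * of_int n)"
    unfolding cis_mult using delta_gamma by (intro arg_cong[of _ _ cis]) (simp add: algebra_simps)
  also have "cis (2 * pi * of_int n) = 1" by (rule cis_multiple_2pi) simp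
  finally show ?thesis unfolding psi_eq[of n] by simp
qed

lemma F_space_translate:
  assumes "u \<in> F_space \<gamma>"
  shows "u (z + complex_of_real \<gamma>) = cis (\<gamma> * Im z) * u z"
proof -
  have e: "exp ((complex_of_real \<gamma> * cnj z - cnj (complex_of_real \<gamma>) * z) / 2) = cis (- (\<gamma> * Im z))"
    unfolding cis_conv_exp by (intro arg_cong[of _ _ exp]) (simp add: complex_eq_iff)
  have "u z = cis (- (\<gamma> * Im z)) * u (z + complex_of_real \<gamma>)"
  proof -
    have "magnetic_translation (complex_of_real \<gamma>) u z = u z" using assms by (simp add: F_space_def)
    then show ?thesis unfolding magnetic_translation_def e by simp
  qed
  then show ?thesis by (simp add: mult.assoc[symmetric] cis_mult)
qed

lemma F_space_continuous:
  assumes "u \<in> F_space p"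
  shows "continuous_on UNIV u"
proof -
  obtain F where F: "F holomorphic_on UNIV" "\<And>z. u z = complex_of_real (exp (- (cmod z)\<^sup>2 / 2)) * F z"
    using assms unfolding F_space_def E_tilde_def by blast
  have "continuous_on UNIV (\<lambda>z. complex_of_real (exp (- (cmod z)\<^sup>2 / 2)) * F z)"
    using holomorphic_on_imp_continuous_on[OF F(1)] by (auto intro!: continuous_intros)
  then show ?thesis using F(2) by (simp add: fun_eq_iff[symmetric] cong: continuous_on_cong)
qed

text \<open>Both sides pick up the factor cis (\<gamma> Im z) under translation by \<gamma>, so
  their equality is a periodic condition and spreads from the strip to the plane.\<close>

lemma F_space_eq_series:
  assumes u: "u \<in> F_space \<gamma>" and sum: "L2_has_sum (strip \<gamma>) (\<lambda>n z. c n * \<psi> n z) u"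
    and c: "\<And>n. cmod (c n) \<le> K"
  shows "AE z in lebesgue. u z = psi_series c z"
proof (rule AE_lebesgue_on_UN_strip[OF L2_has_sum_AE[where c = c, OF sum c]])
  fix z
  have "psi_series c (z + complex_of_real \<gamma>) = (\<Sum>\<^sub>\<infinity>n. cis (\<gamma> * Im z) * (c n * \<psi> n z))"
    unfolding psi_series_def psi_translate by (intro infsum_cong) (simp add: mult_ac)
  also have "\<dots> = cis (\<gamma> * Im z) * psi_series c z" unfolding psi_series_def infsum_cmult_right' ..
  finally show "u (z + complex_of_real \<gamma>) = psi_series c (z + complex_of_real \<gamma>) \<longleftrightarrow> u z = psi_series c z"
    unfolding F_space_translate[OF u] by simp
qed

text \<open>The coefficients are the pairings of v with \<psi> n, so L^2 differentiability of the
  curve passes to each of them, and the coefficient formula for the projected term identifies the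
  derivative.\<close>

lemma coefficients_solve:
  fixes c :: "real \<Rightarrow> int \<Rightarrow> complex"
  assumes sol: "linearized_solution v"
    and sum: "\<And>t. 0 \<le> t \<Longrightarrow> L2_has_sum (strip \<gamma>) (\<lambda>n z. c t n * \<psi> n z) (v t)"
  shows "solves_pair c (\<lambda>t n. cnj (c t n))"
proof -
  let ?S = "strip \<gamma>" let ?M = "lebesgue_on ?S"
  obtain v' where v: "\<And>t. 0 \<le> t \<Longrightarrow> v t \<in> F_space \<gamma>" "\<And>t. 0 \<le> t \<Longrightarrow> L2_on ?S (v t)"
    and v': "\<And>t. 0 \<le> t \<Longrightarrow> has_L2_derivative v (v' t) ?S t {0..}"
    and eq: "\<And>t z. 0 \<le> t \<Longrightarrow> \<i> * v' t z + complex_of_real lam * v t z =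
      LLL_proj (\<lambda>w. 2 * (complex_of_real (cmod (\<Psi>\<^sub>0 w)))\<^sup>2 * v t w + (\<Psi>\<^sub>0 w)\<^sup>2 * cnj (v t w)) z"
    using sol unfolding linearized_solution_def by blast
  have L2v': "L2_on ?S (v' t)" if "0 \<le> t" for t
    using v'[OF that] by (simp add: has_L2_derivative_def)
  have c: "(LINT z|?M. v t z * cnj (\<psi> n z)) = c t n" if "0 \<le> t" for t n
    by (rule L2_has_sum_coefficient[OF sum[OF that] psi_L2 psi_orthonormal])
  have cb: "cmod (c t n) \<le> L2_norm ?S (v t)" if "0 \<le> t" for t n
    using psi_coefficient_bound[OF v(2)[OF that], of n] unfolding c[OF that] .
  define d where "d = (\<lambda>t n. LINT z|?M. v' t z * cnj (\<psi> n z))"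
  \<comment> \<open>By Cauchy-Schwarz with the unit vector \<psi> n, the error of the difference
    quotient of a coefficient is at most that of the curve, uniformly in n.\<close>
  have quot: "cmod (c s n - c t n - (s - t) *\<^sub>R d t n) / \<bar>s - t\<bar> \<le> L2_norm ?S (\<lambda>z. (v s z - v t z) /\<^sub>R (s - t) - v' t z)"
    if st: "0 \<le> s" "0 \<le> t" "s \<noteq> t" for s t n
  proof -
    let ?w = "\<lambda>z. (v s z - v t z) /\<^sub>R (s - t) - v' t z"
    have iu: "integrable ?M (\<lambda>z. u z * cnj (\<psi> n z))" if "L2_on ?S u" for u
      by (intro L2_integrable_product that L2_on_cnj psi_L2)
    have "L2_on ?S (\<lambda>z. complex_of_real (inverse (s - t)) * (v s z - v t z) - v' t z)"
      by (intro L2_on_diff L2_on_cmult v L2v' st)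
    then have L2w: "L2_on ?S ?w" by (simp add: scaleR_conv_of_real)
    have "(LINT z|?M. ?w z * cnj (\<psi> n z)) =
      (LINT z|?M. complex_of_real (inverse (s - t)) * (v s z * cnj (\<psi> n z) - v t z * cnj (\<psi> n z)) - v' t z * cnj (\<psi> n z))"
      by (intro Bochner_Integration.integral_cong) (simp_all add: scaleR_conv_of_real algebra_simps)
    also have "\<dots> = complex_of_real (inverse (s - t)) * (c s n - c t n) - d t n"
      using iu[OF v(2)[OF st(1)]] iu[OF v(2)[OF st(2)]] iu[OF L2v'[OF st(2)]]
      by (simp add: c st d_def)
    finally have int: "(LINT z|?M. ?w z * cnj (\<psi> n z)) = complex_of_real (inverse (s - t)) * (c s n - c t n) - d t n" .
    have "c s n - c t n - (s - t) *\<^sub>R d t n = complex_of_real (s - t) * (LINT z|?M. ?w z * cnj (\<psi> n z))"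
      unfolding int using st(3) by (simp add: scaleR_conv_of_real algebra_simps flip: of_real_diff)
    then have "cmod (c s n - c t n - (s - t) *\<^sub>R d t n) / \<bar>s - t\<bar> = cmod (LINT z|?M. ?w z * cnj (\<psi> n z))"
      using st(3) by (simp only: norm_mult norm_of_real) simp
    then show ?thesis using psi_coefficient_bound[OF L2w, of n] by simp
  qed
  have lim: "((\<lambda>s. L2_norm ?S (\<lambda>z. (v s z - v t z) /\<^sub>R (s - t) - v' t z)) \<longlongrightarrow> 0) (at t within {0..})" if "0 \<le> t" for t
    using v'[OF that] by (simp add: has_L2_derivative_def)
  have der: "((\<lambda>s. c s n) has_vector_derivative d t n) (at t within {0..})" if t: "0 \<le> t" for t n
    unfolding has_vector_derivative_iff_norm
  proof (rule tendsto_sandwich[OF _ _ tendsto_const lim[OF t]])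
    show "\<forall>\<^sub>F s in at t within {0..}. cmod (c s n - c t n - (s - t) *\<^sub>R d t n) / \<bar>s - t\<bar> \<le> L2_norm ?S (\<lambda>z. (v s z - v t z) /\<^sub>R (s - t) - v' t z)"
      using quot t by (auto simp: eventually_at_filter)
  qed auto
  have deq: "d t n = - \<i> * linear_field (c t) (\<lambda>n. cnj (c t n)) n" if t: "0 \<le> t" for t n
  proof -
    have iu: "integrable ?M (\<lambda>z. u z * cnj (\<psi> n z))" if "L2_on ?S u" for u
      by (intro L2_integrable_product that L2_on_cnj psi_L2)
    have "(LINT z|?M. (\<i> * v' t z + complex_of_real lam * v t z) * cnj (\<psi> n z)) =
       (LINT z|?M. \<i> * (v' t z * cnj (\<psi> n z)) + complex_of_real lam * (v t z * cnj (\<psi> n z)))"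
      by (intro Bochner_Integration.integral_cong) (simp_all add: algebra_simps)
    also have "\<dots> = \<i> * d t n + complex_of_real lam * c t n"
      using iu[OF v(2)[OF t]] iu[OF L2v'[OF t]] by (simp add: c t d_def)
    finally have "\<i> * d t n + complex_of_real lam * c t n = (\<Sum>\<^sub>\<infinity>p. interaction (c t) n p)"
      unfolding eq[OF t]
      using LLL_proj_coefficient[where c = "c t" and v = "v t", OF cb[OF t] _ F_space_eq_series[where c = "c t", OF v(1)[OF t] sum[OF t] cb[OF t]], of n]
        borel_measurable_continuous_onI[OF F_space_continuous[OF v(1)[OF t]]] by simp
    then have "\<i> * d t n = linear_field (c t) (\<lambda>n. cnj (c t n)) n"
      by (simp add: linear_field_def interaction_def algebra_simps)
    then show ?thesis by (simp add: mult.assoc[symmetric] flip: \<open>\<i> * d t n = _\<close>)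
  qed
  have cnj_field: "cnj (linear_field x y n) = linear_field (\<lambda>n. cnj (x n)) (\<lambda>n. cnj (y n)) n" for x y n
    unfolding linear_field_def complex_cnj_diff infsum_cnj[symmetric] by simp
  have bounded: "\<exists>K. \<forall>t\<in>{0..T}. \<forall>n. cmod (c t n) \<le> K" for T
  proof (cases "0 \<le> T")
    case True
    \<comment> \<open>Differentiability bounds the coefficients near each time, and bisection by
      \<open>Bolzano\<close> joins these bounds. The intersection with the nonnegative times is
      there because small intervals around t = 0 reach below 0, where v is not controlled.\<close>
    define P where "P = (\<lambda>a b. \<exists>K. \<forall>t\<in>{a..b} \<inter> {0..}. \<forall>n. cmod (c t n) \<le> K)"
    have "P 0 T"
      using True
    proof (induction rule: Bolzano)
      case (trans a b e)
      then obtain K K' where "\<forall>t\<in>{a..b} \<inter> {0..}. \<forall>n. cmod (c t n) \<le> K" "\<forall>t\<in>{b..e} \<inter> {0..}. \<forall>n. cmod (c t n) \<le> K'"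
        unfolding P_def by blast
      then show ?case unfolding P_def
        by (intro exI[of _ "max K K'"]) (force intro: max.coboundedI1 max.coboundedI2)
    next
      case (local t)
      then have t: "0 \<le> t" by simp
      obtain \<epsilon> where \<epsilon>: "0 < \<epsilon>" "\<And>s. s \<in> {0..} \<Longrightarrow> s \<noteq> t \<Longrightarrow> dist s t < \<epsilon> \<Longrightarrow>
          L2_norm ?S (\<lambda>z. (v s z - v t z) /\<^sub>R (s - t) - v' t z) < 1"
        using order_tendstoD(2)[OF lim[OF t], of 1] unfolding eventually_at by auto
      define K where "K = L2_norm ?S (v t) + (1 + L2_norm ?S (v' t))"
      have "cmod (c s n) \<le> K" if s: "0 \<le> s" "\<bar>s - t\<bar> < min \<epsilon> 1" for s n
      proof (cases "s = t")
        case True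
        then show ?thesis using cb[OF t, of n] L2_norm_nonneg[of ?S "v' t"] by (simp add: K_def)
      next
        case False
        have d: "cmod (d t n) \<le> L2_norm ?S (v' t)"
          unfolding d_def by (rule psi_coefficient_bound[OF L2v'[OF t]])
        have "cmod (c s n - c t n - (s - t) *\<^sub>R d t n) / \<bar>s - t\<bar> \<le> 1"
          by (rule order.trans[OF quot[OF s(1) t False] less_imp_le[OF \<epsilon>(2)]]) (use s False in \<open>auto simp: dist_real_def\<close>)
        then have a: "cmod (c s n - c t n - (s - t) *\<^sub>R d t n) \<le> \<bar>s - t\<bar>" using False by (simp add: field_simps)
        have b: "cmod ((s - t) *\<^sub>R d t n) \<le> 1 * L2_norm ?S (v' t)"
          unfolding norm_scaleR using s d by (intro mult_mono) auto
        have "c s n = (c s n - c t n - (s - t) *\<^sub>R d t n) + (c t n + (s - t) *\<^sub>R d t n)" by simp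
        then have "cmod (c s n) \<le> cmod (c s n - c t n - (s - t) *\<^sub>R d t n) + (cmod (c t n) + cmod ((s - t) *\<^sub>R d t n))"
          by (metis norm_triangle_ineq norm_triangle_mono order_refl)
        then show ?thesis using a b cb[OF t, of n] s unfolding K_def by simp
      qed
      then have "P a b" if "a \<le> t \<and> t \<le> b \<and> b - a < min \<epsilon> 1" for a b
        unfolding P_def
      proof (intro exI ballI allI)
        fix s n assume "s \<in> {a..b} \<inter> {0..}"
        then have "0 \<le> s" "\<bar>s - t\<bar> < min \<epsilon> 1" using that by auto
        then show "cmod (c s n) \<le> K" by (rule \<open>\<And>s n. 0 \<le> s \<Longrightarrow> \<bar>s - t\<bar> < min \<epsilon> 1 \<Longrightarrow> cmod (c s n) \<le> K\<close>)
      qed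
      then show ?case using \<epsilon>(1) by (intro exI[of _ "min \<epsilon> 1"]) auto
    qed
    then show ?thesis unfolding P_def by auto
  qed auto
  show ?thesis
    unfolding solves_pair_def
  proof (intro conjI allI impI)
    fix t :: real and n assume t: "0 \<le> t"
    show "((\<lambda>s. c s n) has_vector_derivative - \<i> * linear_field (c t) (\<lambda>n. cnj (c t n)) n) (at t within {0..})"
      using der[OF t, of n] unfolding deq[OF t] .
    from has_vector_derivative_cnj[OF this]
    show "((\<lambda>s. cnj (c s n)) has_vector_derivative \<i> * linear_field (\<lambda>n. cnj (c t n)) (c t) n) (at t within {0..})"
      by (simp add: cnj_field)
  next
    show "\<exists>K. \<forall>t\<in>{0..T}. \<forall>n. cmod (c t n) \<le> K \<and> cmod (cnj (c t n)) \<le> K" for T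
      using bounded[of T] by simp
  qed
qed

text \<open>On [0, 1] the phase m is bounded by some B, so |exp (i y) - 1 - i y| \<le> y^2 with y =
  (s - t) m bounds the integrand of the remainder by (s - t)^2 B^2 |h|, which is integrable.\<close>

lemma fourier_phase_derivative:
  fixes m :: "real \<Rightarrow> real" and h :: "real \<Rightarrow> complex"
  assumes m: "continuous_on UNIV m" and h: "integrable (lebesgue_on {0..1}) h"
  shows "((\<lambda>t. LINT \<xi>|lebesgue_on {0..1}. cis (t * m \<xi>) * h \<xi>) has_vector_derivative
      (LINT \<xi>|lebesgue_on {0..1}. cis (t * m \<xi>) * (\<i> * complex_of_real (m \<xi>) * h \<xi>))) (at t within S)"
proof -
  let ?M = "lebesgue_on {0..1::real}"
  have "continuous_on {0..1} m" using m continuous_on_subset by blast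
  then have "bounded (m ` {0..1})" by (intro compact_imp_bounded compact_continuous_image) auto
  then obtain B where B: "\<And>\<xi>. \<xi> \<in> {0..1} \<Longrightarrow> \<bar>m \<xi>\<bar> \<le> B" unfolding bounded_iff real_norm_def by (meson imageI)
  have cm: "continuous_on {0..1} m" by fact
  have mult: "integrable ?M (\<lambda>\<xi>. g \<xi> * h \<xi>)" if "continuous_on {0..1} g" for g
    by (rule integrable_continuous_mult[OF that h])
  have i0: "integrable ?M (\<lambda>\<xi>. cis (s * m \<xi>) * h \<xi>)" for s
    by (intro mult continuous_intros cm)
  have i1: "integrable ?M (\<lambda>\<xi>. cis (t * m \<xi>) * (\<i> * complex_of_real (m \<xi>) * h \<xi>))"
    using mult[of "\<lambda>\<xi>. cis (t * m \<xi>) * (\<i> * complex_of_real (m \<xi>))"]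
    by (simp add: mult.assoc continuous_intros cm)
  let ?d = "LINT \<xi>|?M. cis (t * m \<xi>) * (\<i> * complex_of_real (m \<xi>) * h \<xi>)"
  define L where "L = (LINT \<xi>|?M. B\<^sup>2 * cmod (h \<xi>))"
  have est: "cmod ((LINT \<xi>|?M. cis (s * m \<xi>) * h \<xi>) - (LINT \<xi>|?M. cis (t * m \<xi>) * h \<xi>) - (s - t) *\<^sub>R ?d) / \<bar>s - t\<bar> \<le> \<bar>s - t\<bar> * L" for s
  proof -
    have eq: "(LINT \<xi>|?M. cis (s * m \<xi>) * h \<xi>) - (LINT \<xi>|?M. cis (t * m \<xi>) * h \<xi>) - (s - t) *\<^sub>R ?d =
      (LINT \<xi>|?M. cis (s * m \<xi>) * h \<xi> - cis (t * m \<xi>) * h \<xi> - (s - t) *\<^sub>R (cis (t * m \<xi>) * (\<i> * complex_of_real (m \<xi>) * h \<xi>)))"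
      using i0 i1 by (simp del: scaleR_conv_of_real)
    have "cmod \<dots> \<le> (LINT \<xi>|?M. \<bar>s - t\<bar>\<^sup>2 * (B\<^sup>2 * cmod (h \<xi>)))"
    proof (rule order.trans[OF integral_norm_bound integral_mono_AE])
      show "integrable ?M (\<lambda>\<xi>. norm (cis (s * m \<xi>) * h \<xi> - cis (t * m \<xi>) * h \<xi> - (s - t) *\<^sub>R (cis (t * m \<xi>) * (\<i> * complex_of_real (m \<xi>) * h \<xi>))))"
        by (intro integrable_norm Bochner_Integration.integrable_diff i0 i1 integrable_scaleR_right)
      show "integrable ?M (\<lambda>\<xi>. \<bar>s - t\<bar>\<^sup>2 * (B\<^sup>2 * cmod (h \<xi>)))"
        by (intro integrable_mult_right integrable_norm h)
      have "norm (cis (s * m \<xi>) * h \<xi> - cis (t * m \<xi>) * h \<xi> - (s - t) *\<^sub>R (cis (t * m \<xi>) * (\<i> * complex_of_real (m \<xi>) * h \<xi>)))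
          \<le> \<bar>s - t\<bar>\<^sup>2 * (B\<^sup>2 * cmod (h \<xi>))" if \<xi>: "\<xi> \<in> {0..1}" for \<xi>
      proof -
        let ?x = "(s - t) * m \<xi>"
        have x: "cmod (iexp ?x - (1 + \<i> * ?x)) \<le> ?x\<^sup>2"
        proof -
          have "cmod (iexp ?x - (1 + \<i> * ?x)) \<le> \<bar>?x\<bar>\<^sup>2 / 2"
            using iexp_approx1[of ?x 1] by (simp add: numeral_2_eq_2)
          also have "\<dots> \<le> ?x\<^sup>2" by simp
          finally show ?thesis .
        qed
        have "cis (s * m \<xi>) = cis (t * m \<xi>) * iexp ?x"
          by (simp add: cis_conv_exp exp_add[symmetric] algebra_simps)
        then have "cis (s * m \<xi>) * h \<xi> - cis (t * m \<xi>) * h \<xi> - (s - t) *\<^sub>R (cis (t * m \<xi>) * (\<i> * complex_of_real (m \<xi>) * h \<xi>))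
            = cis (t * m \<xi>) * ((iexp ?x - (1 + \<i> * ?x)) * h \<xi>)"
          by (simp add: scaleR_conv_of_real algebra_simps)
        then have "norm (cis (s * m \<xi>) * h \<xi> - cis (t * m \<xi>) * h \<xi> - (s - t) *\<^sub>R (cis (t * m \<xi>) * (\<i> * complex_of_real (m \<xi>) * h \<xi>)))
            = cmod (iexp ?x - (1 + \<i> * ?x)) * cmod (h \<xi>)" by (simp only: norm_mult norm_cis mult_1)
        also have "\<dots> \<le> ?x\<^sup>2 * cmod (h \<xi>)" by (intro mult_right_mono x) auto
        also have "?x\<^sup>2 \<le> \<bar>s - t\<bar>\<^sup>2 * B\<^sup>2"
          unfolding power_mult_distrib power2_abs using B[OF \<xi>]
          by (intro mult_left_mono) (auto intro: abs_le_square_iff[THEN iffD1, OF order.trans[OF _ abs_ge_self]])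
        finally show ?thesis by (simp add: mult.assoc mult_right_mono)
      qed
      then show "AE \<xi> in ?M. norm (cis (s * m \<xi>) * h \<xi> - cis (t * m \<xi>) * h \<xi> - (s - t) *\<^sub>R (cis (t * m \<xi>) * (\<i> * complex_of_real (m \<xi>) * h \<xi>)))
          \<le> \<bar>s - t\<bar>\<^sup>2 * (B\<^sup>2 * cmod (h \<xi>))" by (simp add: AE_restrict_space_iff)
    qed
    also have "\<dots> = \<bar>s - t\<bar> * (\<bar>s - t\<bar> * L)" by (simp add: L_def power2_eq_square)
    finally show ?thesis unfolding eq
      by (cases "s = t") (simp_all add: pos_divide_le_eq mult.commute)
  qed
  have "((\<lambda>s. \<bar>s - t\<bar> * L) \<longlongrightarrow> \<bar>t - t\<bar> * L) (at t within S)" by (intro tendsto_intros)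
  then have lim: "((\<lambda>s. \<bar>s - t\<bar> * L) \<longlongrightarrow> 0) (at t within S)" by simp
  show ?thesis
    unfolding has_vector_derivative_iff_norm
    by (rule tendsto_sandwich[OF _ _ tendsto_const lim]) (use est in auto)
qed

text \<open>The exponent is positive because \<open>fourier_mode\<close> has a negative one: this is
  the pairing with its conjugate.\<close>

definition fourier_coeff :: "(real \<Rightarrow> complex) \<Rightarrow> int \<Rightarrow> complex" where
  "fourier_coeff h n = (LINT \<xi>|lebesgue_on {0..1}. cis (2 * pi * of_int n * \<xi>) * h \<xi>)"

section \<open>The Fourier symbol of the coupling\<close>

lemma sums_int_even:
  fixes f :: "int \<Rightarrow> real"
  assumes s: "f summable_on UNIV" and e: "\<And>k. f (- k) = f k"
  shows "infsum f UNIV = f 0 + 2 * (\<Sum>n. f (int (Suc n)))"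
proof -
  have r: "UNIV = {0::int} \<union> (range (\<lambda>n. int (Suc n)) \<union> range (\<lambda>n. - int (Suc n)))"
  proof -
    have "k = 0 \<or> k \<in> range (\<lambda>n. int (Suc n)) \<or> k \<in> range (\<lambda>n. - int (Suc n))" for k :: int
      by (cases k rule: int_cases3) (auto simp: image_iff gr0_conv_Suc)
    then show ?thesis by blast
  qed
  have p: "(\<lambda>n. f (int (Suc n))) summable_on UNIV"
    using summable_on_subset_banach[OF s, of "range (\<lambda>n. int (Suc n))"]
      summable_on_reindex[of "\<lambda>n. int (Suc n)" UNIV f]
    by (simp add: inj_on_def o_def)
  have sub: "f summable_on A" for A using summable_on_subset_banach[OF s] by blast
  have P: "infsum f (range (\<lambda>n. int (Suc n))) = (\<Sum>\<^sub>\<infinity>n. f (int (Suc n)))"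
    by (subst infsum_reindex) (auto simp: inj_on_def o_def)
  have N: "infsum f (range (\<lambda>n. - int (Suc n))) = (\<Sum>\<^sub>\<infinity>n. f (int (Suc n)))"
    by (subst infsum_reindex) (auto simp: inj_on_def o_def e simp del: of_nat_Suc)
  have "infsum f UNIV = infsum f {0} + (infsum f (range (\<lambda>n. int (Suc n))) + infsum f (range (\<lambda>n. - int (Suc n))))"
  proof -
    have "{0} \<inter> (range (\<lambda>n. int (Suc n)) \<union> range (\<lambda>n. - int (Suc n))) = {}"
      "range (\<lambda>n. int (Suc n)) \<inter> range (\<lambda>n. - int (Suc n)) = {}" by auto
    note d = infsum_Un_disjoint[OF sub sub this(1)] infsum_Un_disjoint[OF sub sub this(2)]
    show ?thesis unfolding d[symmetric] r[symmetric] ..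
  qed
  also have "\<dots> = f 0 + 2 * (\<Sum>\<^sub>\<infinity>n. f (int (Suc n)))" unfolding P N by simp
  also have "(\<Sum>\<^sub>\<infinity>n. f (int (Suc n))) = (\<Sum>n. f (int (Suc n)))"
    using has_sum_imp_sums[OF has_sum_infsum[OF p]] by (simp add: sums_iff)
  finally show ?thesis .
qed

lemma infsum_even_cis:
  fixes w :: "int \<Rightarrow> real"
  assumes s: "(\<lambda>k. \<bar>w k\<bar>) summable_on UNIV" and e: "\<And>k. w (- k) = w k"
  shows "(\<Sum>\<^sub>\<infinity>k. complex_of_real (w k) * cis (2 * pi * of_int k * \<xi>)) =
    complex_of_real (w 0 + 2 * (\<Sum>n. w (int (Suc n)) * cos (2 * pi * real (Suc n) * \<xi>)))"
proof -
  let ?f = "\<lambda>k. complex_of_real (w k) * cis (2 * pi * of_int k * \<xi>)"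
  have "(\<lambda>k. cmod (?f k)) summable_on UNIV" using s by (simp add: norm_mult)
  then have f: "(?f has_sum infsum ?f UNIV) UNIV" by (rule has_sum_infsum[OF abs_summable_summable])
  have re: "((\<lambda>k. w k * cos (2 * pi * of_int k * \<xi>)) has_sum Re (infsum ?f UNIV)) UNIV"
    using has_sum_Re[OF f] by simp
  have im: "((\<lambda>k. w k * sin (2 * pi * of_int k * \<xi>)) has_sum Im (infsum ?f UNIV)) UNIV"
    using has_sum_Im[OF f] by simp
  have bij: "bij (uminus :: int \<Rightarrow> int)" by (rule bij_betw_byWitness[of _ uminus]) auto
  have "(\<Sum>\<^sub>\<infinity>k. w k * sin (2 * pi * of_int k * \<xi>)) = (\<Sum>\<^sub>\<infinity>k. w (- k) * sin (2 * pi * of_int (- k) * \<xi>))"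
    by (rule infsum_reindex_bij_betw[OF bij, symmetric])
  also have "\<dots> = - (\<Sum>\<^sub>\<infinity>k. w k * sin (2 * pi * of_int k * \<xi>))"
    by (simp add: e infsum_uminus)
  finally have "Im (infsum ?f UNIV) = 0" using infsumI[OF im] by simp
  moreover have "Re (infsum ?f UNIV) = w 0 + 2 * (\<Sum>n. w (int (Suc n)) * cos (2 * pi * real (Suc n) * \<xi>))"
    using sums_int_even[OF has_sum_imp_summable[OF re]] infsumI[OF re] by (simp add: e del: of_nat_Suc)
  ultimately show ?thesis by (simp add: complex_eq_iff)
qed

definition theta_weight :: "int \<Rightarrow> real" where "theta_weight k = exp (- (\<delta>\<^sup>2 * (of_int k)\<^sup>2))"

definition odd_weight :: "int \<Rightarrow> real" where "odd_weight k = (if odd k then theta_weight k else 0)"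

lemma weights_summable: "(\<lambda>k. \<bar>theta_weight k\<bar>) summable_on UNIV" "(\<lambda>k. \<bar>odd_weight k\<bar>) summable_on UNIV"
proof -
  show t: "(\<lambda>k. \<bar>theta_weight k\<bar>) summable_on UNIV"
    using exp_neg_sq_summable_int[of "\<delta>\<^sup>2"] delta_pos by (simp add: theta_weight_def)
  show "(\<lambda>k. \<bar>odd_weight k\<bar>) summable_on UNIV"
    by (rule summable_on_comparison_test[OF t]) (auto simp: odd_weight_def)
qed

lemma theta_weight_nat: "exp (- pi\<^sup>2 * (real n)\<^sup>2 / \<gamma>\<^sup>2) = theta_weight (int n)"
  by (simp add: theta_weight_def \<delta>_def power_divide)

lemma theta_weight_series:
  "(\<Sum>\<^sub>\<infinity>k. complex_of_real (theta_weight k) * cis (2 * pi * of_int k * \<xi>)) = complex_of_real (ell \<xi>)"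
  unfolding infsum_even_cis[of theta_weight, OF weights_summable(1), unfolded theta_weight_def, simplified, folded theta_weight_def]
  by (simp only: ell_def theta_weight_nat) (simp add: theta_weight_def)

lemma odd_weight_series:
  "(\<Sum>\<^sub>\<infinity>k. complex_of_real (odd_weight k) * cis (2 * pi * of_int k * \<xi>)) = complex_of_real (hh \<xi>)"
proof -
  have e: "odd_weight (- k) = odd_weight k" for k by (simp add: odd_weight_def theta_weight_def)
  let ?g = "\<lambda>n. odd_weight (int (Suc n)) * cos (2 * pi * real (Suc n) * \<xi>)"
  \<comment> \<open>The n-th term has frequency n + 1, so the odd frequencies sit at even n.\<close>
  have "(\<Sum>n. ?g n) = (\<Sum>n. ?g (2 * n))"
    using suminf_mono_reindex[of "\<lambda>n. 2 * n" ?g]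
    by (force simp: strict_mono_def odd_weight_def elim: evenE)
  also have "\<dots> = (\<Sum>k. exp (- pi\<^sup>2 * (2 * real k + 1)\<^sup>2 / \<gamma>\<^sup>2) * cos (2 * (2 * real k + 1) * pi * \<xi>))"
  proof (rule suminf_cong)
    fix k
    have "exp (- pi\<^sup>2 * (2 * real k + 1)\<^sup>2 / \<gamma>\<^sup>2) = theta_weight (int (Suc (2 * k)))"
      using theta_weight_nat[of "Suc (2 * k)"] by (simp add: add.commute)
    moreover have "2 * pi * real (Suc (2 * k)) * \<xi> = 2 * (2 * real k + 1) * pi * \<xi>" by simp
    ultimately show "?g (2 * k) = exp (- pi\<^sup>2 * (2 * real k + 1)\<^sup>2 / \<gamma>\<^sup>2) * cos (2 * (2 * real k + 1) * pi * \<xi>)"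
      by (simp only: odd_weight_def) simp
  qed
  finally show ?thesis
    unfolding infsum_even_cis[of odd_weight, OF weights_summable(2) e] hh_def by (simp add: odd_weight_def)
qed

text \<open>The sign (-1)^(d r) equals 1 - 2 when d and r are both odd and 1 otherwise. This splits
  the kernel into two products and is the origin of the combination of \<open>ell\<close> and
  \<open>hh\<close> in the symbols.\<close>

lemma coupling_eq:
  "coupling d r = 1 / (\<gamma> * sqrt pi) * (theta_weight d * theta_weight r - 2 * (odd_weight d * odd_weight r))"
proof -
  have "cos (pi * of_int (d * r)) = 1 - 2 * (if odd d \<and> odd r then 1 else 0)"
    using cos_npi_int[of "d * r"] by auto
  moreover have "exp (- (\<delta>\<^sup>2 * ((of_int d)\<^sup>2 + (of_int r)\<^sup>2))) = theta_weight d * theta_weight r"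
    unfolding theta_weight_def exp_add[symmetric] by (simp add: algebra_simps)
  ultimately show ?thesis unfolding coupling_def odd_weight_def by simp
qed

text \<open>Each product kernel sums separately in d and r: weights on all integers give
  \<open>ell\<close>, those on the odd integers give \<open>hh\<close>.\<close>

lemma coupling_symbol:
  "(\<Sum>\<^sub>\<infinity>p. cis (2 * pi * of_int (fst p) * \<xi>) * cis (2 * pi * of_int (snd p) * \<eta>) * complex_of_real (coupling (fst p) (snd p)))
    = complex_of_real (1 / (\<gamma> * sqrt pi) * (ell \<xi> * ell \<eta> - 2 * (hh \<xi> * hh \<eta>)))"
proof -
  let ?t = "\<lambda>\<xi> k. complex_of_real (theta_weight k) * cis (2 * pi * of_int k * \<xi>)"
  let ?o = "\<lambda>\<xi> k. complex_of_real (odd_weight k) * cis (2 * pi * of_int k * \<xi>)"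
  have s: "(\<lambda>k. norm (?t \<xi> k)) summable_on UNIV" "(\<lambda>k. norm (?o \<xi> k)) summable_on UNIV" for \<xi>
    using weights_summable by (simp_all add: norm_mult)
  note T = infsum_product[OF s(1)[of \<xi>] s(1)[of \<eta>]] and O = infsum_product[OF s(2)[of \<xi>] s(2)[of \<eta>]]
  have "(\<Sum>\<^sub>\<infinity>p. cis (2 * pi * of_int (fst p) * \<xi>) * cis (2 * pi * of_int (snd p) * \<eta>) * complex_of_real (coupling (fst p) (snd p)))
    = (\<Sum>\<^sub>\<infinity>p. complex_of_real (1 / (\<gamma> * sqrt pi)) * (?t \<xi> (fst p) * ?t \<eta> (snd p) + - 2 * (?o \<xi> (fst p) * ?o \<eta> (snd p))))"
    by (intro infsum_cong) (simp add: coupling_eq algebra_simps)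
  also have "\<dots> = complex_of_real (1 / (\<gamma> * sqrt pi)) * (complex_of_real (ell \<xi>) * complex_of_real (ell \<eta>)
      + - 2 * (complex_of_real (hh \<xi>) * complex_of_real (hh \<eta>)))"
    unfolding infsum_cmult_right' theta_weight_series[symmetric] odd_weight_series[symmetric] T(2)[symmetric] O(2)[symmetric]
    by (subst infsum_add) (auto simp only: infsum_cmult_right' intro!: summable_on_cmult_right abs_summable_summable[OF T(1)] abs_summable_summable[OF O(1)])
  finally show ?thesis by (simp only: of_real_mult of_real_add of_real_diff) simp
qed

lemma ell_hh_uminus: "ell (- \<xi>) = ell \<xi>" "hh (- \<xi>) = hh \<xi>"
  by (simp_all add: ell_def hh_def)

lemma C1_continuous: "C1 f \<Longrightarrow> continuous_on A f"
  unfolding C1_def by (meson DERIV_isCont continuous_at_imp_continuous_on)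

lemma coeff_continuous: "continuous_on A coeff_a" "continuous_on A coeff_b" "continuous_on A \<mu>"
proof -
  show b: "continuous_on A coeff_b" and "continuous_on A \<mu>"
    by (intro C1_continuous C1_coeff_b C1_mu)+
  have "continuous_on A (\<lambda>\<xi>. coeff_a \<xi> + coeff_b \<xi> - coeff_b \<xi>)"
    by (intro continuous_on_diff C1_continuous C1_symbol_sum b)
  then show "continuous_on A coeff_a" by simp
qed

text \<open>A shift of the index becomes multiplication by a character. In the x-part only d is
  shifted, so the symbol of the coupling is evaluated at (\<xi>, 0) and, after the factor 2 and
  subtraction of \<open>lam\<close>, gives a. In the y-part r is shifted as well, so the evaluation
  is at (\<xi>, \<xi>) and gives b.\<close>

lemma linear_field_fourier:
  assumes F: "integrable (lebesgue_on {0..1}) F" and G: "integrable (lebesgue_on {0..1}) G"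
  shows "linear_field (fourier_coeff F) (fourier_coeff G) n =
    fourier_coeff (\<lambda>\<xi>. complex_of_real (coeff_a \<xi>) * F \<xi> + complex_of_real (coeff_b \<xi>) * G \<xi>) n"
proof -
  let ?M = "lebesgue_on {0..1::real}"
  have mult: "integrable ?M (\<lambda>\<xi>. g \<xi> * u \<xi>)" if "continuous_on {0..1} g" "integrable ?M u" for g u :: "real \<Rightarrow> complex"
    by (rule integrable_continuous_mult[OF that])
  let ?e = "\<lambda>k \<xi>. cis (2 * pi * of_int k * \<xi>)"
  have ei: "integrable ?M (\<lambda>\<xi>. ?e k \<xi> * u \<xi>)" if "integrable ?M u" for k u
    by (intro mult that continuous_intros)
  define f where "f = (\<lambda>p \<xi>. (2 * (?e (n - fst p) \<xi> * F \<xi>) + ?e (n + snd p - fst p) \<xi> * G \<xi>) * complex_of_real (coupling (fst p) (snd p)))"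
  have fi: "integrable ?M (f p)" for p
    unfolding f_def by (intro integrable_mult_left Bochner_Integration.integrable_add integrable_mult_right ei F G)
  have hb: "cmod (2 * (?e (n - fst p) \<xi> * F \<xi>) + ?e (n + snd p - fst p) \<xi> * G \<xi>) \<le> 2 * cmod (F \<xi>) + cmod (G \<xi>)" for p \<xi>
    by (rule order.trans[OF norm_triangle_ineq]) (simp add: norm_mult)
  have fs: "(\<lambda>p. cmod (f p \<xi>)) summable_on UNIV" and fb: "(\<Sum>\<^sub>\<infinity>p. cmod (f p \<xi>)) \<le> (2 * cmod (F \<xi>) + cmod (G \<xi>)) * coupling_sum" for \<xi>
    unfolding f_def by (rule coupling_mult_summable[OF hb])+
  have B: "integrable ?M (\<lambda>\<xi>. (2 * cmod (F \<xi>) + cmod (G \<xi>)) * coupling_sum)"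
    using F G by (intro integrable_mult_left Bochner_Integration.integrable_add integrable_mult_right integrable_norm)
  have swap: "(LINT \<xi>|?M. (\<Sum>\<^sub>\<infinity>p. f p \<xi>)) = (\<Sum>\<^sub>\<infinity>p. LINT \<xi>|?M. f p \<xi>)"
    by (rule integral_infsum(3)[OF borel_measurable_integrable[OF fi] fs fb B])
  have int: "(LINT \<xi>|?M. f p \<xi>) = (2 * fourier_coeff F (n - fst p) + fourier_coeff G (n + snd p - fst p)) * complex_of_real (coupling (fst p) (snd p))" for p
    unfolding f_def fourier_coeff_def
    using ei[OF F, of "n - fst p"] ei[OF G, of "n + snd p - fst p"] by simp
  have sum: "(\<Sum>\<^sub>\<infinity>p. f p \<xi>) = ?e n \<xi> * (complex_of_real (coeff_a \<xi> + lam) * F \<xi> + complex_of_real (coeff_b \<xi>) * G \<xi>)" for \<xi>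
  proof -
    let ?c = "\<lambda>\<eta> p. cis (2 * pi * of_int (fst p) * (- \<xi>)) * cis (2 * pi * of_int (snd p) * \<eta>) * complex_of_real (coupling (fst p) (snd p))"
    have s: "?c \<eta> summable_on UNIV" for \<eta>
      by (rule abs_summable_summable, rule coupling_mult_summable(1)[of _ 1]) (simp add: norm_mult)
    have e1: "?e (n - fst p) \<xi> = ?e n \<xi> * (cis (2 * pi * of_int (fst p) * (- \<xi>)) * cis (2 * pi * of_int (snd p) * 0))"
      and e2: "?e (n + snd p - fst p) \<xi> = ?e n \<xi> * (cis (2 * pi * of_int (fst p) * (- \<xi>)) * cis (2 * pi * of_int (snd p) * \<xi>))" for p :: "int \<times> int"
      unfolding cis_mult by (intro arg_cong[of _ _ cis]; simp add: algebra_simps)+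
    have "(\<Sum>\<^sub>\<infinity>p. f p \<xi>) = (\<Sum>\<^sub>\<infinity>p. 2 * ?e n \<xi> * F \<xi> * ?c 0 p + ?e n \<xi> * G \<xi> * ?c \<xi> p)"
      unfolding f_def e1 e2 by (intro infsum_cong) (simp only: algebra_simps)
    also have "\<dots> = 2 * ?e n \<xi> * F \<xi> * infsum (?c 0) UNIV + ?e n \<xi> * G \<xi> * infsum (?c \<xi>) UNIV"
      by (subst infsum_add) (auto simp only: infsum_cmult_right' intro!: summable_on_cmult_right s)
    also have "infsum (?c 0) UNIV = complex_of_real (1 / (\<gamma> * sqrt pi) * (ell \<xi> * ell 0 - 2 * (hh \<xi> * hh 0)))"
      unfolding coupling_symbol ell_hh_uminus ..
    also have "\<dots> = complex_of_real ((coeff_a \<xi> + lam) / 2)"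
      using gamma_pos by (intro arg_cong[of _ _ complex_of_real]) (simp add: coeff_a_def field_simps)
    also have "infsum (?c \<xi>) UNIV = complex_of_real (coeff_b \<xi>)"
      unfolding coupling_symbol ell_hh_uminus coeff_b_def by (simp add: power2_eq_square)
    finally show ?thesis by (simp add: algebra_simps)
  qed
  have cont: "continuous_on {0..1} (\<lambda>\<xi>. complex_of_real (coeff_a \<xi>))" "continuous_on {0..1} (\<lambda>\<xi>. complex_of_real (coeff_b \<xi>))"
    by (intro continuous_on_of_real coeff_continuous)+
  have i1: "integrable ?M (\<lambda>\<xi>. ?e n \<xi> * (complex_of_real (coeff_a \<xi>) * F \<xi> + complex_of_real (coeff_b \<xi>) * G \<xi>))"
    by (intro ei Bochner_Integration.integrable_add mult cont F G)
  have "(LINT \<xi>|?M. (\<Sum>\<^sub>\<infinity>p. f p \<xi>)) = (LINT \<xi>|?M. ?e n \<xi> * (complex_of_real (coeff_a \<xi>) * F \<xi> + complex_of_real (coeff_b \<xi>) * G \<xi>) + complex_of_real lam * (?e n \<xi> * F \<xi>))"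
    unfolding sum by (intro Bochner_Integration.integral_cong) (simp_all add: algebra_simps)
  also have "\<dots> = fourier_coeff (\<lambda>\<xi>. complex_of_real (coeff_a \<xi>) * F \<xi> + complex_of_real (coeff_b \<xi>) * G \<xi>) n + complex_of_real lam * fourier_coeff F n"
    unfolding fourier_coeff_def using i1 ei[OF F] by simp
  finally show ?thesis
    unfolding linear_field_def swap int by simp
qed

section \<open>Solution formula and decay\<close>

text \<open>On the eigenspaces the field acts as multiplication by \<mu> or - \<mu>, which is what
  differentiating cis (t \<mu>) and cis (- t \<mu>) produces. The phases have modulus 1, so L^1
  norms bound the coefficients uniformly in t and n.\<close>

lemma fourier_pair_solves:
  assumes int: "integrable (lebesgue_on {0..1}) h1" "integrable (lebesgue_on {0..1}) h2"
      "integrable (lebesgue_on {0..1}) k1" "integrable (lebesgue_on {0..1}) k2"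
    and eigen: "AE \<xi> in lebesgue_on {0..1}.
      complex_of_real (coeff_a \<xi>) * h1 \<xi> + complex_of_real (coeff_b \<xi>) * k1 \<xi> = - complex_of_real (\<mu> \<xi>) * h1 \<xi> \<and>
      complex_of_real (coeff_a \<xi>) * h2 \<xi> + complex_of_real (coeff_b \<xi>) * k2 \<xi> = complex_of_real (\<mu> \<xi>) * h2 \<xi> \<and>
      complex_of_real (coeff_a \<xi>) * k1 \<xi> + complex_of_real (coeff_b \<xi>) * h1 \<xi> = complex_of_real (\<mu> \<xi>) * k1 \<xi> \<and>
      complex_of_real (coeff_a \<xi>) * k2 \<xi> + complex_of_real (coeff_b \<xi>) * h2 \<xi> = - complex_of_real (\<mu> \<xi>) * k2 \<xi>"
  shows "solves_pair (\<lambda>t. fourier_coeff (\<lambda>\<xi>. cis (t * \<mu> \<xi>) * h1 \<xi> + cis (- t * \<mu> \<xi>) * h2 \<xi>))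
     (\<lambda>t. fourier_coeff (\<lambda>\<xi>. cis (t * \<mu> \<xi>) * k1 \<xi> + cis (- t * \<mu> \<xi>) * k2 \<xi>))"
proof -
  let ?M = "lebesgue_on {0..1::real}"
  let ?e = "\<lambda>n \<xi>. cis (2 * pi * of_int n * \<xi>)"
  have mult: "integrable ?M (\<lambda>\<xi>. g \<xi> * u \<xi>)" if "continuous_on {0..1} g" "integrable ?M u" for g u :: "real \<Rightarrow> complex"
    by (rule integrable_continuous_mult[OF that])
  have ei: "integrable ?M (\<lambda>\<xi>. ?e k \<xi> * u \<xi>)" if "integrable ?M u" for k u
    by (intro mult that continuous_intros)
  have ph: "integrable ?M (\<lambda>\<xi>. cis (s * \<mu> \<xi>) * u \<xi>)" if "integrable ?M u" for s u
    by (intro mult that continuous_intros coeff_continuous)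
  have mi: "integrable ?M (\<lambda>\<xi>. complex_of_real (\<mu> \<xi>) * u \<xi>)" if "integrable ?M u" for u
    by (intro mult that continuous_on_of_real coeff_continuous)
  have split: "fourier_coeff (\<lambda>\<xi>. cis (t * \<mu> \<xi>) * u \<xi> + cis (- t * \<mu> \<xi>) * w \<xi>) n =
      (LINT \<xi>|?M. cis (t * \<mu> \<xi>) * (?e n \<xi> * u \<xi>)) + (LINT \<xi>|?M. cis (t * - \<mu> \<xi>) * (?e n \<xi> * w \<xi>))"
    if "integrable ?M u" "integrable ?M w" for t n u w
  proof -
    have "fourier_coeff (\<lambda>\<xi>. cis (t * \<mu> \<xi>) * u \<xi> + cis (- t * \<mu> \<xi>) * w \<xi>) n =
      (LINT \<xi>|?M. cis (t * \<mu> \<xi>) * (?e n \<xi> * u \<xi>) + cis (- t * \<mu> \<xi>) * (?e n \<xi> * w \<xi>))"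
      unfolding fourier_coeff_def by (intro Bochner_Integration.integral_cong) (simp_all add: algebra_simps)
    also have "\<dots> = (LINT \<xi>|?M. cis (t * \<mu> \<xi>) * (?e n \<xi> * u \<xi>)) + (LINT \<xi>|?M. cis (- t * \<mu> \<xi>) * (?e n \<xi> * w \<xi>))"
      by (intro Bochner_Integration.integral_add ph ei that)
    finally show ?thesis by simp
  qed
  have der: "((\<lambda>s. fourier_coeff (\<lambda>\<xi>. cis (s * \<mu> \<xi>) * u \<xi> + cis (- s * \<mu> \<xi>) * w \<xi>) n) has_vector_derivative
     \<i> * fourier_coeff (\<lambda>\<xi>. complex_of_real (\<mu> \<xi>) * (cis (t * \<mu> \<xi>) * u \<xi> - cis (- t * \<mu> \<xi>) * w \<xi>)) n) (at t within {0..})"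
    if uw: "integrable ?M u" "integrable ?M w" for t n u w
  proof -
    have cm: "continuous_on UNIV \<mu>" "continuous_on UNIV (\<lambda>\<xi>. - \<mu> \<xi>)"
      by (intro continuous_intros coeff_continuous)+
    have "((\<lambda>s. fourier_coeff (\<lambda>\<xi>. cis (s * \<mu> \<xi>) * u \<xi> + cis (- s * \<mu> \<xi>) * w \<xi>) n) has_vector_derivative
      (LINT \<xi>|?M. cis (t * \<mu> \<xi>) * (\<i> * complex_of_real (\<mu> \<xi>) * (?e n \<xi> * u \<xi>))) +
      (LINT \<xi>|?M. cis (t * - \<mu> \<xi>) * (\<i> * complex_of_real (- \<mu> \<xi>) * (?e n \<xi> * w \<xi>)))) (at t within {0..})"
      unfolding split[OF uw]
      by (intro has_vector_derivative_add fourier_phase_derivative cm ei uw)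
    moreover have "(LINT \<xi>|?M. cis (t * \<mu> \<xi>) * (\<i> * complex_of_real (\<mu> \<xi>) * (?e n \<xi> * u \<xi>))) +
      (LINT \<xi>|?M. cis (t * - \<mu> \<xi>) * (\<i> * complex_of_real (- \<mu> \<xi>) * (?e n \<xi> * w \<xi>))) =
      \<i> * fourier_coeff (\<lambda>\<xi>. complex_of_real (\<mu> \<xi>) * (cis (t * \<mu> \<xi>) * u \<xi> - cis (- t * \<mu> \<xi>) * w \<xi>)) n"
    proof -
      have i: "integrable ?M (\<lambda>\<xi>. ?e n \<xi> * (complex_of_real (\<mu> \<xi>) * (cis (s * \<mu> \<xi>) * g \<xi>)))" if "integrable ?M g" for s g
        by (intro ei mi ph that)
      have "(LINT \<xi>|?M. cis (t * \<mu> \<xi>) * (\<i> * complex_of_real (\<mu> \<xi>) * (?e n \<xi> * u \<xi>))) =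
          \<i> * (LINT \<xi>|?M. ?e n \<xi> * (complex_of_real (\<mu> \<xi>) * (cis (t * \<mu> \<xi>) * u \<xi>)))"
        "(LINT \<xi>|?M. cis (t * - \<mu> \<xi>) * (\<i> * complex_of_real (- \<mu> \<xi>) * (?e n \<xi> * w \<xi>))) =
          - \<i> * (LINT \<xi>|?M. ?e n \<xi> * (complex_of_real (\<mu> \<xi>) * (cis (- t * \<mu> \<xi>) * w \<xi>)))"
        unfolding integral_mult_right_zero[symmetric]
        by (intro Bochner_Integration.integral_cong; simp add: mult_ac)+
      moreover have "fourier_coeff (\<lambda>\<xi>. complex_of_real (\<mu> \<xi>) * (cis (t * \<mu> \<xi>) * u \<xi> - cis (- t * \<mu> \<xi>) * w \<xi>)) n =
          (LINT \<xi>|?M. ?e n \<xi> * (complex_of_real (\<mu> \<xi>) * (cis (t * \<mu> \<xi>) * u \<xi>)) - ?e n \<xi> * (complex_of_real (\<mu> \<xi>) * (cis (- t * \<mu> \<xi>) * w \<xi>)))"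
        unfolding fourier_coeff_def by (intro Bochner_Integration.integral_cong) (simp_all add: algebra_simps)
      moreover have "\<dots> = (LINT \<xi>|?M. ?e n \<xi> * (complex_of_real (\<mu> \<xi>) * (cis (t * \<mu> \<xi>) * u \<xi>))) -
          (LINT \<xi>|?M. ?e n \<xi> * (complex_of_real (\<mu> \<xi>) * (cis (- t * \<mu> \<xi>) * w \<xi>)))"
        by (intro Bochner_Integration.integral_diff i uw)
      ultimately show ?thesis by (simp only: right_diff_distrib) simp
    qed
    ultimately show ?thesis by simp
  qed
  let ?F = "\<lambda>t \<xi>. cis (t * \<mu> \<xi>) * h1 \<xi> + cis (- t * \<mu> \<xi>) * h2 \<xi>"
  let ?G = "\<lambda>t \<xi>. cis (t * \<mu> \<xi>) * k1 \<xi> + cis (- t * \<mu> \<xi>) * k2 \<xi>"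
  have FG: "integrable ?M (?F t)" "integrable ?M (?G t)" for t
    by (intro Bochner_Integration.integrable_add ph int)+
  have fc_cong: "fourier_coeff u n = fourier_coeff w n"
    if "integrable ?M u" "integrable ?M w" "AE \<xi> in ?M. u \<xi> = w \<xi>" for u w n
    unfolding fourier_coeff_def
    using that(3) by (intro integral_cong_AE borel_measurable_integrable ei that(1,2)) (auto elim: eventually_mono)
  have ab: "integrable ?M (\<lambda>\<xi>. complex_of_real (coeff_a \<xi>) * u \<xi> + complex_of_real (coeff_b \<xi>) * w \<xi>)"
    if "integrable ?M u" "integrable ?M w" for u w
    by (intro Bochner_Integration.integrable_add mult continuous_on_of_real coeff_continuous that)
  have eqF: "linear_field (fourier_coeff (?F t)) (fourier_coeff (?G t)) n =
      - fourier_coeff (\<lambda>\<xi>. complex_of_real (\<mu> \<xi>) * (cis (t * \<mu> \<xi>) * h1 \<xi> - cis (- t * \<mu> \<xi>) * h2 \<xi>)) n" for t n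
  proof -
    have "linear_field (fourier_coeff (?F t)) (fourier_coeff (?G t)) n =
      fourier_coeff (\<lambda>\<xi>. - (complex_of_real (\<mu> \<xi>) * (cis (t * \<mu> \<xi>) * h1 \<xi> - cis (- t * \<mu> \<xi>) * h2 \<xi>))) n"
      unfolding linear_field_fourier[OF FG]
    proof (rule fc_cong)
      show "AE \<xi> in ?M. complex_of_real (coeff_a \<xi>) * ?F t \<xi> + complex_of_real (coeff_b \<xi>) * ?G t \<xi> =
          - (complex_of_real (\<mu> \<xi>) * (cis (t * \<mu> \<xi>) * h1 \<xi> - cis (- t * \<mu> \<xi>) * h2 \<xi>))"
        using eigen
      proof eventually_elim
        case (elim \<xi>)
        have "complex_of_real (coeff_a \<xi>) * ?F t \<xi> + complex_of_real (coeff_b \<xi>) * ?G t \<xi> =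
           cis (t * \<mu> \<xi>) * (complex_of_real (coeff_a \<xi>) * h1 \<xi> + complex_of_real (coeff_b \<xi>) * k1 \<xi>) +
           cis (- t * \<mu> \<xi>) * (complex_of_real (coeff_a \<xi>) * h2 \<xi> + complex_of_real (coeff_b \<xi>) * k2 \<xi>)"
          by (simp only: algebra_simps)
        also have "\<dots> = cis (t * \<mu> \<xi>) * (- complex_of_real (\<mu> \<xi>) * h1 \<xi>) +
           cis (- t * \<mu> \<xi>) * (complex_of_real (\<mu> \<xi>) * h2 \<xi>)"
          using elim by presburger
        finally show ?case by (simp add: algebra_simps)
      qed
    qed (intro ab FG, intro integrable_minus mi Bochner_Integration.integrable_diff ph int)
    then show ?thesis unfolding fourier_coeff_def by simp
  qed
  have eqG: "linear_field (fourier_coeff (?G t)) (fourier_coeff (?F t)) n =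
      fourier_coeff (\<lambda>\<xi>. complex_of_real (\<mu> \<xi>) * (cis (t * \<mu> \<xi>) * k1 \<xi> - cis (- t * \<mu> \<xi>) * k2 \<xi>)) n" for t n
    unfolding linear_field_fourier[OF FG(2,1)]
  proof (rule fc_cong)
    show "AE \<xi> in ?M. complex_of_real (coeff_a \<xi>) * ?G t \<xi> + complex_of_real (coeff_b \<xi>) * ?F t \<xi> =
        complex_of_real (\<mu> \<xi>) * (cis (t * \<mu> \<xi>) * k1 \<xi> - cis (- t * \<mu> \<xi>) * k2 \<xi>)"
      using eigen
    proof eventually_elim
      case (elim \<xi>)
      have "complex_of_real (coeff_a \<xi>) * ?G t \<xi> + complex_of_real (coeff_b \<xi>) * ?F t \<xi> =
         cis (t * \<mu> \<xi>) * (complex_of_real (coeff_a \<xi>) * k1 \<xi> + complex_of_real (coeff_b \<xi>) * h1 \<xi>) +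
         cis (- t * \<mu> \<xi>) * (complex_of_real (coeff_a \<xi>) * k2 \<xi> + complex_of_real (coeff_b \<xi>) * h2 \<xi>)"
        by (simp only: algebra_simps)
      also have "\<dots> = cis (t * \<mu> \<xi>) * (complex_of_real (\<mu> \<xi>) * k1 \<xi>) +
         cis (- t * \<mu> \<xi>) * (- complex_of_real (\<mu> \<xi>) * k2 \<xi>)"
        using elim by presburger
      finally show ?case by (simp add: algebra_simps)
    qed
  qed (intro ab FG, intro mi Bochner_Integration.integrable_diff ph int)
  have bound: "cmod (fourier_coeff (\<lambda>\<xi>. cis (t * \<mu> \<xi>) * u \<xi> + cis (- t * \<mu> \<xi>) * w \<xi>) n) \<le> (LINT \<xi>|?M. cmod (u \<xi>)) + (LINT \<xi>|?M. cmod (w \<xi>))"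
    if "integrable ?M u" "integrable ?M w" for t n u w
    unfolding split[OF that]
    using integral_norm_bound[of ?M "\<lambda>\<xi>. cis (t * \<mu> \<xi>) * (?e n \<xi> * u \<xi>)"]
      integral_norm_bound[of ?M "\<lambda>\<xi>. cis (t * - \<mu> \<xi>) * (?e n \<xi> * w \<xi>)"]
    by (intro order.trans[OF norm_triangle_ineq] add_mono) (auto simp: norm_mult)
  show ?thesis
    unfolding solves_pair_def
  proof (intro conjI allI impI)
    fix t :: real and n
    show "((\<lambda>s. fourier_coeff (?F s) n) has_vector_derivative - \<i> * linear_field (fourier_coeff (?F t)) (fourier_coeff (?G t)) n) (at t within {0..})"
      unfolding eqF using der[OF int(1,2), of n t] by simp
    show "((\<lambda>s. fourier_coeff (?G s) n) has_vector_derivative \<i> * linear_field (fourier_coeff (?G t)) (fourier_coeff (?F t)) n) (at t within {0..})"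
      unfolding eqG using der[OF int(3,4), of n t] .
  next
    show "\<exists>K. \<forall>t\<in>{0..T}. \<forall>n. cmod (fourier_coeff (?F t) n) \<le> K \<and> cmod (fourier_coeff (?G t) n) \<le> K" for T
      by (rule exI[of _ "max ((LINT \<xi>|?M. cmod (h1 \<xi>)) + (LINT \<xi>|?M. cmod (h2 \<xi>))) ((LINT \<xi>|?M. cmod (k1 \<xi>)) + (LINT \<xi>|?M. cmod (k2 \<xi>)))"])
        (intro ballI allI conjI max.coboundedI1[OF bound[OF int(1,2)]] max.coboundedI2[OF bound[OF int(3,4)]])
  qed
qed

text \<open>The ratio \<open>(a - b) / \<mu>\<close>, written so that it stays smooth at the zeros of \<open>\<mu>\<close>.\<close>

definition symbol_ratio :: "real \<Rightarrow> real" where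
  "symbol_ratio \<xi> = \<mu> \<xi> / (coeff_a \<xi> + coeff_b \<xi>)"

lemma symbol_ratio_identities:
  "(coeff_a \<xi> + coeff_b \<xi>) * symbol_ratio \<xi> = \<mu> \<xi>" "\<mu> \<xi> * symbol_ratio \<xi> = coeff_a \<xi> - coeff_b \<xi>"
  using symbol_sum_pos[of \<xi>] mu_sq[of \<xi>]
  by (simp_all add: symbol_ratio_def power2_eq_square)

lemma C1_symbol_ratio: "C1 symbol_ratio"
proof -
  have "coeff_a x + coeff_b x \<noteq> 0" for x using symbol_sum_pos[of x] by simp
  then show ?thesis
    using C1_divide[OF C1_mu C1_symbol_sum] unfolding symbol_ratio_def[abs_def] by blast
qed

text \<open>\<open>(h1, k1)\<close> and \<open>(h2, k2)\<close> are the components of \<open>(f, g)\<close> in the eigenspaces of the matrix with rows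
  \<open>(a, b)\<close> and \<open>(- b, - a)\<close>; \<open>G\<close> absorbs the division by \<open>\<mu>\<close>.\<close>

lemma eigen_decomposition:
  fixes f g G :: complex
  assumes fg: "f + g = complex_of_real (\<mu> \<xi>) * G"
  defines "\<nu> \<equiv> complex_of_real (symbol_ratio \<xi>)" and "b \<equiv> complex_of_real (coeff_b \<xi>)" and "a \<equiv> complex_of_real (coeff_a \<xi>)"
    and "m \<equiv> complex_of_real (\<mu> \<xi>)"
  defines "h1 \<equiv> (1 - \<nu>) / 2 * f + - (b / 2) * G" and "h2 \<equiv> (1 + \<nu>) / 2 * f + b / 2 * G"
    and "k1 \<equiv> (1 + \<nu>) / 2 * g + b / 2 * G" and "k2 \<equiv> (1 - \<nu>) / 2 * g + - (b / 2) * G"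
  shows "a * h1 + b * k1 = - m * h1" "a * h2 + b * k2 = m * h2" "a * k1 + b * h1 = m * k1" "a * k2 + b * h2 = - m * k2"
proof -
  have 1: "(a + b) * \<nu> = m" "m * \<nu> = a - b"
    using symbol_ratio_identities[of \<xi>] unfolding a_def b_def \<nu>_def m_def by (metis of_real_add of_real_diff of_real_mult)+
  have g: "g = m * G - f" using fg by (simp add: m_def eq_diff_eq add.commute)
  have a: "a = b + m * \<nu>" using 1(2) by simp
  \<comment> \<open>Once g and a are substituted, this is the remaining relation between b, \<nu>
    and m; the eigenvector identities follow from multiples of it.\<close>
  have mm: "2 * b * \<nu> + m * \<nu> * \<nu> = m" using 1(1) unfolding a by (simp add: algebra_simps)
  have mm': "2 * (b * (\<nu> * x)) = m * x - m * (\<nu> * (\<nu> * x))" for x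
    using arg_cong[OF mm, of "\<lambda>y. y * x"] by (simp add: algebra_simps)
  define F K where "F = f / 2" and "K = G / 2"
  have halves: "f = 2 * F" "G = 2 * K" by (simp_all add: F_def K_def)
  have h: "h1 = (1 - \<nu>) * F - b * K" "h2 = (1 + \<nu>) * F + b * K"
    "k1 = (1 + \<nu>) * (m * K - F) + b * K" "k2 = (1 - \<nu>) * (m * K - F) - b * K"
    unfolding h1_def h2_def k1_def k2_def g halves by (simp_all add: field_simps)
  show "a * h1 + b * k1 = - m * h1" "a * h2 + b * k2 = m * h2" "a * k1 + b * h1 = m * k1" "a * k2 + b * h2 = - m * k2"
    unfolding h a using mm'[of F] mm'[of "m * K"] mm'[of "b * K"] by (simp_all add: algebra_simps)
qed

section \<open>Decay of the solution formula\<close>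

lemma mu_phase_decay:
  assumes A: "C1 A"
  shows "\<exists>C\<ge>0. \<forall>q t s \<sigma>. q \<in> {0..1} \<longrightarrow> 0 < t \<longrightarrow> \<bar>\<sigma>\<bar> = 1 \<longrightarrow>
     cmod (integral {0..q} (\<lambda>\<xi>. cis (\<sigma> * t * \<mu> \<xi> + s * \<xi>) * complex_of_real (A \<xi>))) \<le> C * t powr (-1/3)"
proof -
  obtain A' where A': "\<And>x. (A has_real_derivative A' x) (at x)" "continuous_on UNIV A'"
    using A unfolding C1_def by blast
  have d: "((\<lambda>x. complex_of_real (A x)) has_vector_derivative complex_of_real (A' x)) (at x)" for x
    using A'(1)[of x] by (intro has_vector_derivative_of_real) (simp add: has_real_derivative_iff_has_vector_derivative)
  have c: "continuous_on UNIV (\<lambda>x. complex_of_real (A' x))" by (intro continuous_on_of_real A')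
  obtain C where C: "\<And>q t s \<sigma>. q \<in> {0..1} \<Longrightarrow> 0 < t \<Longrightarrow> \<bar>\<sigma>\<bar> = 1 \<Longrightarrow>
     cmod (integral {0..q} (\<lambda>\<xi>. cis (\<sigma> * t * \<mu> \<xi> + s * \<xi>) * complex_of_real (A \<xi>))) \<le> C * t powr (-1/3)"
    using oscillatory_decay_amplitude[OF mu_oscillatory_decay zero_le_one coeff_continuous(3) d c] by blast
  have "0 \<le> C"
    using order.trans[OF norm_ge_zero C[of 0 1 1 0]] by simp
  then show ?thesis using C by blast
qed

lemma lebesgue_unit_integral:
  fixes g :: "real \<Rightarrow> complex"
  assumes "continuous_on {0..1} g"
  shows "(LINT \<xi>|lebesgue_on {0..1}. g \<xi>) = integral {0..1} g"
proof (rule lebesgue_integral_eq_integral)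
  have "integrable (lebesgue_on {0..1::real}) (\<lambda>\<xi>. g \<xi> * 1)"
    by (rule integrable_continuous_mult[OF assms]) (auto intro!: L2_imp_integrable L2_on_const)
  then show "integrable (lebesgue_on {0..1}) g" by simp
qed simp

lemma fourier_modes:
  "L2_on {0..1} (fourier_mode n)"
  "(LINT \<xi>|lebesgue_on {0..1}. fourier_mode m \<xi> * cnj (fourier_mode n \<xi>)) = (if m = n then 1 else 0)"
proof -
  have fm: "fourier_mode n \<xi> = cis (- (2 * pi * of_int n * \<xi>))" for n \<xi>
    unfolding fourier_mode_def cis_conv_exp by (simp add: mult_ac)
  have cont: "continuous_on A (fourier_mode n)" for n A
    unfolding fm[abs_def] by (intro continuous_intros)
  have "integrable (lebesgue_on {0..1::real}) (\<lambda>\<xi>. 1 :: real)"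
    using L2_on_const[of "{0..1::real}" 1] by (simp add: L2_on_def)
  then show "L2_on {0..1} (fourier_mode n)"
    unfolding L2_on_def using cont by (auto simp: fm intro!: continuous_imp_measurable_on_sets_lebesgue)
  let ?f = "\<lambda>\<xi>. cis (2 * pi * of_int (n - m) * \<xi> / 1)"
  have fb: "?f \<in> borel_measurable borel" by (intro borel_measurable_continuous_onI continuous_intros) auto
  then have m: "(\<lambda>\<xi>. indicator {0..1} \<xi> *\<^sub>R ?f \<xi>) \<in> borel_measurable lborel" by simp
  have "(LINT \<xi>|lebesgue_on {0..1}. fourier_mode m \<xi> * cnj (fourier_mode n \<xi>)) = (LINT \<xi>|lebesgue_on {0..1}. ?f \<xi>)"
    unfolding fm cis_cnj cis_mult by (intro Bochner_Integration.integral_cong refl arg_cong[of _ _ cis]) (simp add: algebra_simps)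
  also have "\<dots> = (LINT \<xi>|lebesgue. indicator {0..1} \<xi> *\<^sub>R ?f \<xi>)"
    by (rule integral_restrict_space) simp
  also have "\<dots> = (LINT \<xi>|lborel. indicator {0..1} \<xi> *\<^sub>R ?f \<xi>)"
    by (rule integral_completion[OF m])
  also have "\<dots> = (if n - m = 0 then complex_of_real 1 else 0)"
    using cis_orthogonal_Icc[of 1 0 "n - m"] by (simp only: has_bochner_integral_iff add_0 zero_less_one)
  finally show "(LINT \<xi>|lebesgue_on {0..1}. fourier_mode m \<xi> * cnj (fourier_mode n \<xi>)) = (if m = n then 1 else 0)"
    by auto
qed

lemma cnj_fourier_mode: "cnj (fourier_mode n \<xi>) = cis (2 * pi * of_int n * \<xi>)"
  unfolding fourier_mode_def cis_conv_exp exp_cnj by (simp add: mult_ac)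

lemma Linf_norm_le:
  assumes u: "u \<in> F_space \<gamma>" and sum: "L2_has_sum (strip \<gamma>) (\<lambda>n z. c n * \<psi> n z) u"
    and c: "\<And>n. cmod (c n) \<le> D"
  shows "Linf_norm (strip \<gamma>) u \<le> ereal (D * psi_bound)"
  unfolding Linf_norm_def
proof (rule esssup_I)
  have "u \<in> borel_measurable (lebesgue_on (strip \<gamma>))"
    using sum by (simp add: L2_has_sum_def L2_on_def)
  then show "(\<lambda>z. ereal (cmod (u z))) \<in> borel_measurable (lebesgue_on (strip \<gamma>))" by simp
  show "AE z in lebesgue_on (strip \<gamma>). ereal (cmod (u z)) \<le> ereal (D * psi_bound)"
    using L2_has_sum_AE[where c = c, OF sum c] by eventually_elim (simp add: psi_series_bound[OF c])
qed

text \<open>Together with \<open>amplitude_cross\<close>: the multipliers of f and of G in the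
  component that oscillates with frequency \<sigma> \<mu>, that is, in h1 for \<sigma> = 1 and in h2
  for \<sigma> = -1.\<close>

definition amplitude_self :: "real \<Rightarrow> real \<Rightarrow> real" where
  "amplitude_self \<sigma> \<xi> = (1 - \<sigma> * symbol_ratio \<xi>) / 2"

definition amplitude_cross :: "real \<Rightarrow> real \<Rightarrow> real" where
  "amplitude_cross \<sigma> \<xi> = - (\<sigma> * coeff_b \<xi>) / 2"

lemma C1_affine:
  assumes "C1 f"
  shows "C1 (\<lambda>x. p + q * f x)"
proof -
  obtain f' where d: "\<And>x. (f has_real_derivative f' x) (at x)" and c: "continuous_on UNIV f'"
    using assms unfolding C1_def by blast
  have "((\<lambda>x. p + q * f x) has_real_derivative q * f' x) (at x)" for x
    by (auto intro!: derivative_eq_intros d)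
  moreover have "continuous_on UNIV (\<lambda>x. q * f' x)" by (intro continuous_intros c)
  ultimately show ?thesis unfolding C1_def by (intro exI[of _ "\<lambda>x. q * f' x"]) auto
qed

lemma C1_amplitude: "C1 (amplitude_self \<sigma>)" "C1 (amplitude_cross \<sigma>)"
  using C1_affine[OF C1_symbol_ratio, of "1/2" "- \<sigma> / 2"] C1_affine[OF C1_coeff_b, of 0 "- \<sigma> / 2"]
  by (simp_all add: amplitude_self_def[abs_def] amplitude_cross_def[abs_def] diff_divide_distrib)

definition evolved :: "(real \<Rightarrow> real) \<Rightarrow> (real \<Rightarrow> complex) \<Rightarrow> real \<Rightarrow> real \<Rightarrow> int \<Rightarrow> complex" where
  "evolved A f \<sigma> t n = (LINT \<xi>|lebesgue_on {0..1}.
     cis (\<sigma> * t * \<mu> \<xi> + 2 * pi * of_int n * \<xi>) * complex_of_real (A \<xi>) * f \<xi>)"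

lemma continuous_phase:
  assumes "C1 A"
  shows "continuous_on S (\<lambda>\<xi>. cis (\<sigma> * t * \<mu> \<xi> + s * \<xi>) * complex_of_real (A \<xi>))"
  by (intro continuous_intros continuous_on_of_real coeff_continuous C1_continuous assms)

text \<open>G is a parameter tied to f + g by the factor \<mu> instead of a quotient. It can thus be
  taken as 0 when g = - f and as (f + g) / \<mu> for H^1 data.\<close>

lemma coefficient_evolution:
  fixes c :: "real \<Rightarrow> int \<Rightarrow> complex"
  assumes sol: "linearized_solution v"
    and sum: "\<And>t. 0 \<le> t \<Longrightarrow> L2_has_sum (strip \<gamma>) (\<lambda>n z. c t n * \<psi> n z) (v t)"
    and int: "integrable (lebesgue_on {0..1}) f" "integrable (lebesgue_on {0..1}) g" "integrable (lebesgue_on {0..1}) G"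
    and G: "AE \<xi> in lebesgue_on {0..1}. f \<xi> + g \<xi> = complex_of_real (\<mu> \<xi>) * G \<xi>"
    and init: "\<And>n. fourier_coeff f n = c 0 n" "\<And>n. fourier_coeff g n = cnj (c 0 n)"
    and t: "0 \<le> t"
  shows "c t n = (evolved (amplitude_self 1) f 1 t n + evolved (amplitude_cross 1) G 1 t n) +
     (evolved (amplitude_self (- 1)) f (- 1) t n + evolved (amplitude_cross (- 1)) G (- 1) t n)"
proof -
  let ?M = "lebesgue_on {0..1::real}"
  define h1 where "h1 = (\<lambda>\<xi>. (1 - complex_of_real (symbol_ratio \<xi>)) / 2 * f \<xi> + - (complex_of_real (coeff_b \<xi>) / 2) * G \<xi>)"
  define h2 where "h2 = (\<lambda>\<xi>. (1 + complex_of_real (symbol_ratio \<xi>)) / 2 * f \<xi> + complex_of_real (coeff_b \<xi>) / 2 * G \<xi>)"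
  define k1 where "k1 = (\<lambda>\<xi>. (1 + complex_of_real (symbol_ratio \<xi>)) / 2 * g \<xi> + complex_of_real (coeff_b \<xi>) / 2 * G \<xi>)"
  define k2 where "k2 = (\<lambda>\<xi>. (1 - complex_of_real (symbol_ratio \<xi>)) / 2 * g \<xi> + - (complex_of_real (coeff_b \<xi>) / 2) * G \<xi>)"
  have cont: "continuous_on {0..1} (\<lambda>\<xi>. complex_of_real (symbol_ratio \<xi>))" "continuous_on {0..1} (\<lambda>\<xi>. complex_of_real (coeff_b \<xi>))"
    by (intro continuous_on_of_real C1_continuous C1_symbol_ratio coeff_continuous)+
  have ints: "integrable ?M h1" "integrable ?M h2" "integrable ?M k1" "integrable ?M k2"
    unfolding h1_def h2_def k1_def k2_def
    by (intro Bochner_Integration.integrable_add integrable_continuous_mult int; auto intro!: continuous_intros cont)+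
  have "AE \<xi> in ?M.
      complex_of_real (coeff_a \<xi>) * h1 \<xi> + complex_of_real (coeff_b \<xi>) * k1 \<xi> = - complex_of_real (\<mu> \<xi>) * h1 \<xi> \<and>
      complex_of_real (coeff_a \<xi>) * h2 \<xi> + complex_of_real (coeff_b \<xi>) * k2 \<xi> = complex_of_real (\<mu> \<xi>) * h2 \<xi> \<and>
      complex_of_real (coeff_a \<xi>) * k1 \<xi> + complex_of_real (coeff_b \<xi>) * h1 \<xi> = complex_of_real (\<mu> \<xi>) * k1 \<xi> \<and>
      complex_of_real (coeff_a \<xi>) * k2 \<xi> + complex_of_real (coeff_b \<xi>) * h2 \<xi> = - complex_of_real (\<mu> \<xi>) * k2 \<xi>"
    using G by eventually_elim (use eigen_decomposition in \<open>simp only: h1_def h2_def k1_def k2_def simp_thms\<close>)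
  note pair = fourier_pair_solves[OF ints this]
  have "h1 \<xi> + h2 \<xi> = f \<xi>" "k1 \<xi> + k2 \<xi> = g \<xi>" for \<xi>
    by (simp_all add: h1_def h2_def k1_def k2_def field_simps)
  then have i0: "c 0 = fourier_coeff (\<lambda>\<xi>. cis (0 * \<mu> \<xi>) * h1 \<xi> + cis (- 0 * \<mu> \<xi>) * h2 \<xi>)"
    "(\<lambda>n. cnj (c 0 n)) = fourier_coeff (\<lambda>\<xi>. cis (0 * \<mu> \<xi>) * k1 \<xi> + cis (- 0 * \<mu> \<xi>) * k2 \<xi>)"
    using init by auto
  have "c t n = fourier_coeff (\<lambda>\<xi>. cis (t * \<mu> \<xi>) * h1 \<xi> + cis (- t * \<mu> \<xi>) * h2 \<xi>) n"
    by (rule solves_pair_unique[OF coefficients_solve[OF sol sum] pair i0 t])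
  also have "\<dots> = (LINT \<xi>|?M.
      ((cis (1 * t * \<mu> \<xi> + 2 * pi * of_int n * \<xi>) * complex_of_real (amplitude_self 1 \<xi>) * f \<xi> +
        cis (1 * t * \<mu> \<xi> + 2 * pi * of_int n * \<xi>) * complex_of_real (amplitude_cross 1 \<xi>) * G \<xi>) +
       (cis (- 1 * t * \<mu> \<xi> + 2 * pi * of_int n * \<xi>) * complex_of_real (amplitude_self (- 1) \<xi>) * f \<xi> +
        cis (- 1 * t * \<mu> \<xi> + 2 * pi * of_int n * \<xi>) * complex_of_real (amplitude_cross (- 1) \<xi>) * G \<xi>)))"
    unfolding fourier_coeff_def cis_mult[symmetric]
    by (intro Bochner_Integration.integral_cong)
      (simp_all add: h1_def h2_def amplitude_self_def amplitude_cross_def algebra_simps)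
  also have "\<dots> = (evolved (amplitude_self 1) f 1 t n + evolved (amplitude_cross 1) G 1 t n) +
     (evolved (amplitude_self (- 1)) f (- 1) t n + evolved (amplitude_cross (- 1)) G (- 1) t n)"
  proof -
    have "integrable ?M (\<lambda>\<xi>. cis (\<sigma> * t * \<mu> \<xi> + 2 * pi * of_int n * \<xi>) * complex_of_real (A \<xi>) * u \<xi>)"
      if "C1 A" "integrable ?M u" for \<sigma> A u
      by (rule integrable_continuous_mult[OF continuous_phase[OF that(1)] that(2)])
    note i = this[OF C1_amplitude(1) int(1)] this[OF C1_amplitude(2) int(3)]
    show ?thesis
      unfolding evolved_def
      by (simp only: Bochner_Integration.integral_add Bochner_Integration.integrable_add i)
  qed
  finally show ?thesis .
qed

lemma evolved_H1_decay:
  assumes "C1 A"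
  shows "\<exists>C\<ge>0. \<forall>f \<sigma> t n. H1_on 0 1 f \<longrightarrow> 0 < t \<longrightarrow> \<bar>\<sigma>\<bar> = 1 \<longrightarrow>
     cmod (evolved A f \<sigma> t n) \<le> C * t powr (-1/3) * H1_norm 0 1 f"
proof -
  obtain C where C: "0 \<le> C" "\<And>q t s \<sigma>. q \<in> {0..1} \<Longrightarrow> 0 < t \<Longrightarrow> \<bar>\<sigma>\<bar> = 1 \<Longrightarrow>
     cmod (integral {0..q} (\<lambda>\<xi>. cis (\<sigma> * t * \<mu> \<xi> + s * \<xi>) * complex_of_real (A \<xi>))) \<le> C * t powr (-1/3)"
    using mu_phase_decay[OF assms] by blast
  have "cmod (evolved A f \<sigma> t n) \<le> 10 * C * t powr (-1/3) * H1_norm 0 1 f"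
    if "H1_on 0 1 f" "0 < t" "\<bar>\<sigma>\<bar> = 1" for f \<sigma> t n
    using H1_oscillation_bound[OF that(1) continuous_phase[OF assms] C(2)[OF _ that(2,3)], of "2 * pi * of_int n"]
    by (simp add: evolved_def mult.assoc)
  then show ?thesis using C(1) by (intro exI[of _ "10 * C"]) simp
qed

text \<open>A Fourier mode m only changes the slope of the linear phase from n to n - m. The decay
  is uniform in the slope, so it applies to every mode separately, and the absolute sum of c
  collects the bounds.\<close>

lemma evolved_absolute_decay:
  assumes "C1 A"
  shows "\<exists>C\<ge>0. \<forall>c \<sigma> t n. (\<lambda>m. cmod (c m)) summable_on UNIV \<longrightarrow> 0 < t \<longrightarrow> \<bar>\<sigma>\<bar> = 1 \<longrightarrow>
     cmod (evolved A (\<lambda>\<xi>. \<Sum>\<^sub>\<infinity>m. c m * fourier_mode m \<xi>) \<sigma> t n) \<le> C * t powr (-1/3) * (\<Sum>\<^sub>\<infinity>m. cmod (c m))"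
proof -
  obtain C where C: "0 \<le> C" "\<And>q t s \<sigma>. q \<in> {0..1} \<Longrightarrow> 0 < t \<Longrightarrow> \<bar>\<sigma>\<bar> = 1 \<Longrightarrow>
     cmod (integral {0..q} (\<lambda>\<xi>. cis (\<sigma> * t * \<mu> \<xi> + s * \<xi>) * complex_of_real (A \<xi>))) \<le> C * t powr (-1/3)"
    using mu_phase_decay[OF assms] by blast
  have "cmod (evolved A (\<lambda>\<xi>. \<Sum>\<^sub>\<infinity>m. c m * fourier_mode m \<xi>) \<sigma> t n) \<le> C * t powr (-1/3) * (\<Sum>\<^sub>\<infinity>m. cmod (c m))"
    if c: "(\<lambda>m. cmod (c m)) summable_on UNIV" and t: "0 < t" "\<bar>\<sigma>\<bar> = 1" for c \<sigma> t n
  proof -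
    let ?M = "lebesgue_on {0..1::real}"
    let ?e = "\<lambda>\<xi>. cis (\<sigma> * t * \<mu> \<xi> + 2 * pi * of_int n * \<xi>) * complex_of_real (A \<xi>)"
    let ?f = "\<lambda>m \<xi>. ?e \<xi> * (c m * fourier_mode m \<xi>)"
    have fm: "cmod (fourier_mode m \<xi>) = 1" for m \<xi> by (simp add: fourier_mode_def)
    have i: "integrable ?M (fourier_mode m)" for m by (intro L2_imp_integrable fourier_modes) simp
    have fi: "integrable ?M (?f m)" for m
      by (intro integrable_continuous_mult continuous_phase assms integrable_mult_right i)
    have nf: "cmod (?f m \<xi>) = \<bar>A \<xi>\<bar> * cmod (c m)" for m \<xi> by (simp add: norm_mult fm)
    have sm: "(\<lambda>m. cmod (?f m \<xi>)) summable_on UNIV" for \<xi>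
      unfolding nf by (intro summable_on_cmult_right c)
    have sb: "(\<Sum>\<^sub>\<infinity>m. cmod (?f m \<xi>)) \<le> \<bar>A \<xi>\<bar> * (\<Sum>\<^sub>\<infinity>m. cmod (c m))" for \<xi>
      unfolding nf by (simp add: infsum_cmult_right')
    have "integrable ?M (\<lambda>\<xi>. complex_of_real (A \<xi>) * 1)"
      by (rule integrable_continuous_mult)
        (auto intro!: continuous_on_of_real C1_continuous assms L2_imp_integrable L2_on_const)
    from integrable_norm[OF this] have Ai: "integrable ?M (\<lambda>\<xi>. \<bar>A \<xi>\<bar> * (\<Sum>\<^sub>\<infinity>m. cmod (c m)))"
      by (intro integrable_mult_left) simp
    note swap = integral_infsum[where f = ?f, OF borel_measurable_integrable[OF fi] sm sb Ai]
    have each: "cmod (LINT \<xi>|?M. ?f m \<xi>) \<le> C * t powr (-1/3) * cmod (c m)" for m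
    proof -
      have "(LINT \<xi>|?M. ?f m \<xi>) = (LINT \<xi>|?M. c m * (cis (\<sigma> * t * \<mu> \<xi> + 2 * pi * of_int (n - m) * \<xi>) * complex_of_real (A \<xi>)))"
      proof (intro Bochner_Integration.integral_cong refl)
        fix \<xi> :: real
        have "fourier_mode m \<xi> = cis (- (2 * pi * of_int m * \<xi>))"
          unfolding fourier_mode_def cis_conv_exp by (simp add: mult_ac)
        moreover have "cis (\<sigma> * t * \<mu> \<xi> + 2 * pi * of_int (n - m) * \<xi>) = cis (\<sigma> * t * \<mu> \<xi> + 2 * pi * of_int n * \<xi>) * cis (- (2 * pi * of_int m * \<xi>))"
          unfolding cis_mult by (simp add: algebra_simps)
        ultimately show "?f m \<xi> = c m * (cis (\<sigma> * t * \<mu> \<xi> + 2 * pi * of_int (n - m) * \<xi>) * complex_of_real (A \<xi>))"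
          by (simp only: mult_ac)
      qed
      also have "\<dots> = c m * integral {0..1} (\<lambda>\<xi>. cis (\<sigma> * t * \<mu> \<xi> + 2 * pi * of_int (n - m) * \<xi>) * complex_of_real (A \<xi>))"
        by (simp only: integral_mult_right_zero lebesgue_unit_integral[OF continuous_phase[OF assms]])
      finally have eq: "(LINT \<xi>|?M. ?f m \<xi>) = c m * integral {0..1} (\<lambda>\<xi>. cis (\<sigma> * t * \<mu> \<xi> + 2 * pi * of_int (n - m) * \<xi>) * complex_of_real (A \<xi>))" .
      show ?thesis
        unfolding eq using mult_left_mono[OF C(2)[of 1 t \<sigma> "2 * pi * of_int (n - m)"] norm_ge_zero[of "c m"]] t
        by (simp add: norm_mult mult_ac)
    qed
    have "evolved A (\<lambda>\<xi>. \<Sum>\<^sub>\<infinity>m. c m * fourier_mode m \<xi>) \<sigma> t n = (LINT \<xi>|?M. (\<Sum>\<^sub>\<infinity>m. ?f m \<xi>))"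
      unfolding evolved_def by (simp add: infsum_cmult_right')
    also have "\<dots> = (\<Sum>\<^sub>\<infinity>m. LINT \<xi>|?M. ?f m \<xi>)" by (rule swap(3))
    finally have "cmod (evolved A (\<lambda>\<xi>. \<Sum>\<^sub>\<infinity>m. c m * fourier_mode m \<xi>) \<sigma> t n) \<le> (\<Sum>\<^sub>\<infinity>m. cmod (LINT \<xi>|?M. ?f m \<xi>))"
      using norm_infsum_bound[OF swap(2)] by (simp only:)
    also have "\<dots> \<le> (\<Sum>\<^sub>\<infinity>m. C * t powr (-1/3) * cmod (c m))"
      by (intro infsum_mono swap(2) summable_on_cmult_right c each)
    finally show ?thesis by (simp add: infsum_cmult_right')
  qed
  then show ?thesis using C(1) by blast
qed

section \<open>From the initial data to the two estimates\<close>

lemma fourier_coeff_L2_sum: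
  assumes "L2_has_sum {0..1} (\<lambda>n \<xi>. x n * fourier_mode n \<xi>) f"
  shows "fourier_coeff f n = x n"
  using L2_has_sum_coefficient[OF assms fourier_modes] by (simp add: fourier_coeff_def cnj_fourier_mode mult.commute)

lemma fourier_coeff_absolute_sum:
  assumes c: "(\<lambda>m. cmod (c m)) summable_on (UNIV :: int set)"
  shows "fourier_coeff (\<lambda>\<xi>. \<Sum>\<^sub>\<infinity>m. c m * fourier_mode m \<xi>) n = c n"
    and "integrable (lebesgue_on {0..1}) (\<lambda>\<xi>. \<Sum>\<^sub>\<infinity>m. c m * fourier_mode m \<xi>)"
proof -
  let ?M = "lebesgue_on {0..1::real}"
  have fm: "cmod (fourier_mode m \<xi>) = 1" for m \<xi> by (simp add: fourier_mode_def)
  have i: "integrable ?M (fourier_mode m)" for m by (intro L2_imp_integrable fourier_modes) simp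
  have one: "integrable ?M (\<lambda>_. \<Sum>\<^sub>\<infinity>m. cmod (c m))"
    by (simp add: finite_measure.integrable_const finite_measure_lebesgue_on)
  show "integrable ?M (\<lambda>\<xi>. \<Sum>\<^sub>\<infinity>m. c m * fourier_mode m \<xi>)"
    by (rule integral_infsum(1)[OF _ _ _ one])
      (use c i in \<open>auto simp: norm_mult fm intro!: borel_measurable_integrable\<close>)
  have ei: "integrable ?M (\<lambda>\<xi>. cis (2 * pi * of_int n * \<xi>) * (c m * fourier_mode m \<xi>))" for m
    by (intro integrable_continuous_mult integrable_mult_right i continuous_intros)
  have "fourier_coeff (\<lambda>\<xi>. \<Sum>\<^sub>\<infinity>m. c m * fourier_mode m \<xi>) n = (LINT \<xi>|?M. (\<Sum>\<^sub>\<infinity>m. cis (2 * pi * of_int n * \<xi>) * (c m * fourier_mode m \<xi>)))"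
    unfolding fourier_coeff_def by (simp add: infsum_cmult_right')
  also have "\<dots> = (\<Sum>\<^sub>\<infinity>m. LINT \<xi>|?M. cis (2 * pi * of_int n * \<xi>) * (c m * fourier_mode m \<xi>))"
    by (rule integral_infsum(3)[OF borel_measurable_integrable[OF ei] _ _ one]) (use c in \<open>auto simp: norm_mult fm\<close>)
  also have "\<dots> = (\<Sum>\<^sub>\<infinity>m. if m = n then c n else 0)"
  proof (rule infsum_cong)
    fix m
    have "(LINT \<xi>|?M. cis (2 * pi * of_int n * \<xi>) * (c m * fourier_mode m \<xi>)) =
        (LINT \<xi>|?M. c m * (fourier_mode m \<xi> * cnj (fourier_mode n \<xi>)))"
      by (simp add: cnj_fourier_mode mult_ac)
    then show "(LINT \<xi>|?M. cis (2 * pi * of_int n * \<xi>) * (c m * fourier_mode m \<xi>)) = (if m = n then c n else 0)"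
      by (simp only: integral_mult_right_zero fourier_modes) simp
  qed
  also have "\<dots> = (\<Sum>\<^sub>\<infinity>m\<in>{n}. if m = n then c n else 0)" by (rule infsum_cong_neutral) auto
  finally show "fourier_coeff (\<lambda>\<xi>. \<Sum>\<^sub>\<infinity>m. c m * fourier_mode m \<xi>) n = c n" by simp
qed

text \<open>The sum over n is taken under the integral of |u \<psi> n|, where the sum of |\<psi> n|
  is at most \<open>psi_bound\<close> at every point.\<close>

lemma L1_coefficients_summable:
  assumes sum: "L2_has_sum (strip \<gamma>) (\<lambda>n z. c n * \<psi> n z) u" and u: "L1_on (strip \<gamma>) u"
  shows "(\<lambda>n. cmod (c n)) summable_on UNIV" "(\<Sum>\<^sub>\<infinity>n. cmod (c n)) \<le> psi_bound * L1_norm (strip \<gamma>) u"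
proof -
  let ?M = "lebesgue_on (strip \<gamma>)"
  have u2: "L2_on (strip \<gamma>) u" using sum by (simp add: L2_has_sum_def)
  have i: "integrable ?M (\<lambda>z. cmod (u z * cnj (\<psi> n z)))" for n
    by (intro integrable_norm L2_integrable_product u2 L2_on_cnj psi_L2)
  have c: "cmod (c n) \<le> (LINT z|?M. cmod (u z * cnj (\<psi> n z)))" for n
    unfolding L2_has_sum_coefficient[OF sum psi_L2 psi_orthonormal, symmetric] by (rule integral_norm_bound)
  have fin: "(\<Sum>n\<in>F. cmod (c n)) \<le> psi_bound * L1_norm (strip \<gamma>) u" if F: "finite F" for F
  proof -
    have "(\<Sum>n\<in>F. cmod (c n)) \<le> (\<Sum>n\<in>F. LINT z|?M. cmod (u z * cnj (\<psi> n z)))" by (intro sum_mono c)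
    also have "\<dots> = (LINT z|?M. (\<Sum>n\<in>F. cmod (u z * cnj (\<psi> n z))))"
      by (rule Bochner_Integration.integral_sum[symmetric]) (rule i)
    also have "\<dots> \<le> (LINT z|?M. psi_bound * cmod (u z))"
    proof (rule integral_mono)
      fix z
      have "(\<Sum>n\<in>F. cmod (\<psi> n z)) \<le> (\<Sum>\<^sub>\<infinity>n. cmod (\<psi> n z))"
        by (intro finite_sum_le_infsum psi_abs_summable F) auto
      then have "cmod (u z) * (\<Sum>n\<in>F. cmod (\<psi> n z)) \<le> cmod (u z) * psi_bound"
        using psi_infsum_le[of z] by (intro mult_left_mono) auto
      then show "(\<Sum>n\<in>F. cmod (u z * cnj (\<psi> n z))) \<le> psi_bound * cmod (u z)"
        by (simp add: norm_mult sum_distrib_left mult.commute)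
    qed (use u i in \<open>auto simp: L1_on_def\<close>)
    finally show ?thesis by (simp add: L1_norm_def)
  qed
  show s: "(\<lambda>n. cmod (c n)) summable_on UNIV"
    by (rule nonneg_bdd_above_summable_on) (auto intro!: bdd_aboveI2 fin)
  show "(\<Sum>\<^sub>\<infinity>n. cmod (c n)) \<le> psi_bound * L1_norm (strip \<gamma>) u"
    by (rule infsum_le_finite_sums[OF s fin])
qed

text \<open>L^1 data make the Fourier series of f absolutely convergent, so f can be taken as its
  pointwise sum and the mode-by-mode decay replaces any regularity of f. The conjugate data are g =
  - f, and G = 0 satisfies the required relation.\<close>

lemma imaginary_data_decay:
  "\<exists>C. \<forall>v\<^sub>0 v (c :: real \<Rightarrow> int \<Rightarrow> complex).
        v\<^sub>0 \<in> F_space \<gamma> \<inter> E_tilde \<longrightarrow>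
        linearized_solution v \<longrightarrow> v 0 = v\<^sub>0 \<longrightarrow>
        (\<forall>t\<ge>0. L2_has_sum (strip \<gamma>) (\<lambda>n z. c t n * \<psi> n z) (v t)) \<longrightarrow>
        (\<forall>n. Re (c 0 n) = 0) \<longrightarrow>
        L1_on (strip \<gamma>) v\<^sub>0 \<longrightarrow>
        (\<forall>t>0. Linf_norm (strip \<gamma>) (v t)
                 \<le> ereal (C * t powr (-1/3) * L1_norm (strip \<gamma>) v\<^sub>0))"
proof -
  have unit: "\<bar>1::real\<bar> = 1" "\<bar>- 1::real\<bar> = 1" by simp_all
  obtain C1 where C1: "0 \<le> C1" "\<And>c t n. (\<lambda>m. cmod (c m)) summable_on UNIV \<Longrightarrow> 0 < t \<Longrightarrow>
     cmod (evolved (amplitude_self 1) (\<lambda>\<xi>. \<Sum>\<^sub>\<infinity>m. c m * fourier_mode m \<xi>) 1 t n) \<le> C1 * t powr (-1/3) * (\<Sum>\<^sub>\<infinity>m. cmod (c m))"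
    using evolved_absolute_decay[OF C1_amplitude(1)[of 1]] unit(1) by blast
  obtain C2 where C2: "0 \<le> C2" "\<And>c t n. (\<lambda>m. cmod (c m)) summable_on UNIV \<Longrightarrow> 0 < t \<Longrightarrow>
     cmod (evolved (amplitude_self (- 1)) (\<lambda>\<xi>. \<Sum>\<^sub>\<infinity>m. c m * fourier_mode m \<xi>) (- 1) t n) \<le> C2 * t powr (-1/3) * (\<Sum>\<^sub>\<infinity>m. cmod (c m))"
    using evolved_absolute_decay[OF C1_amplitude(1)[of "- 1"]] unit(2) by blast
  have "Linf_norm (strip \<gamma>) (v t) \<le> ereal (((C1 + C2) * psi_bound * psi_bound) * t powr (-1/3) * L1_norm (strip \<gamma>) (v 0))"
    if sol: "linearized_solution v" and sum: "\<And>t. 0 \<le> t \<Longrightarrow> L2_has_sum (strip \<gamma>) (\<lambda>n z. c t n * \<psi> n z) (v t)"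
      and im: "\<And>n. Re (c 0 n) = 0" and L1: "L1_on (strip \<gamma>) (v 0)" and t: "0 < t"
    for v t and c :: "real \<Rightarrow> int \<Rightarrow> complex"
  proof -
    let ?f = "\<lambda>\<xi>. \<Sum>\<^sub>\<infinity>m. c 0 m * fourier_mode m \<xi>"
    note s = L1_coefficients_summable[OF sum[OF order_refl] L1]
    note fc = fourier_coeff_absolute_sum[OF s(1)]
    have cc: "cnj (c 0 n) = - c 0 n" for n using im[of n] by (simp add: complex_eq_iff)
    have gc: "fourier_coeff (\<lambda>\<xi>. - ?f \<xi>) n = cnj (c 0 n)" for n
      using fc(1)[of n] by (simp add: cc fourier_coeff_def)
    have ev: "c t n = evolved (amplitude_self 1) ?f 1 t n + evolved (amplitude_self (- 1)) ?f (- 1) t n" for n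
      using coefficient_evolution[where c = c and G = "\<lambda>_. 0", OF sol sum fc(2) integrable_minus[OF fc(2)] _ _ fc(1) gc, of t n] t
      by (simp add: evolved_def)
    have "cmod (c t n) \<le> (C1 + C2) * t powr (-1/3) * (psi_bound * L1_norm (strip \<gamma>) (v 0))" for n
    proof -
      have "cmod (c t n) \<le> C1 * t powr (-1/3) * (\<Sum>\<^sub>\<infinity>m. cmod (c 0 m)) + C2 * t powr (-1/3) * (\<Sum>\<^sub>\<infinity>m. cmod (c 0 m))"
        unfolding ev by (intro order.trans[OF norm_triangle_ineq] add_mono C1(2) C2(2) s(1) t)
      also have "\<dots> = (C1 + C2) * t powr (-1/3) * (\<Sum>\<^sub>\<infinity>m. cmod (c 0 m))" by (simp add: algebra_simps)
      also have "\<dots> \<le> (C1 + C2) * t powr (-1/3) * (psi_bound * L1_norm (strip \<gamma>) (v 0))"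
        using C1(1) C2(1) by (intro mult_left_mono s(2)) auto
      finally show ?thesis .
    qed
    from Linf_norm_le[where c = "c t", OF _ sum this] sol t show ?thesis
      by (simp add: linearized_solution_def mult_ac)
  qed
  then show ?thesis by (intro exI[of _ "(C1 + C2) * psi_bound * psi_bound"]) blast
qed

lemma H1_data_decay:
  "\<exists>C. \<forall>v\<^sub>0 v (c :: real \<Rightarrow> int \<Rightarrow> complex) f\<^sub>0 g\<^sub>0.
        v\<^sub>0 \<in> F_space \<gamma> \<inter> E_tilde \<longrightarrow>
        linearized_solution v \<longrightarrow> v 0 = v\<^sub>0 \<longrightarrow>
        (\<forall>t\<ge>0. L2_has_sum (strip \<gamma>) (\<lambda>n z. c t n * \<psi> n z) (v t)) \<longrightarrow>
        L2_has_sum {0..1} (\<lambda>n \<xi>. c 0 n * fourier_mode n \<xi>) f\<^sub>0 \<longrightarrow>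
        L2_has_sum {0..1} (\<lambda>n \<xi>. cnj (c 0 n) * fourier_mode n \<xi>) g\<^sub>0 \<longrightarrow>
        H1_on 0 1 f\<^sub>0 \<longrightarrow>
        H1_on 0 1 (\<lambda>\<xi>. (f\<^sub>0 \<xi> + g\<^sub>0 \<xi>) / complex_of_real (\<mu> \<xi>)) \<longrightarrow>
        (\<forall>t>0. Linf_norm (strip \<gamma>) (v t)
                 \<le> ereal (C * t powr (-1/3) *
                     (H1_norm 0 1 f\<^sub>0 +
                      H1_norm 0 1 (\<lambda>\<xi>. (f\<^sub>0 \<xi> + g\<^sub>0 \<xi>) / complex_of_real (\<mu> \<xi>)))))"
proof -
  have unit: "\<bar>1::real\<bar> = 1" "\<bar>- 1::real\<bar> = 1" by simp_all
  obtain p1 where p1: "0 \<le> p1" "\<And>f t n. H1_on 0 1 f \<Longrightarrow> 0 < t \<Longrightarrow> cmod (evolved (amplitude_self 1) f 1 t n) \<le> p1 * t powr (-1/3) * H1_norm 0 1 f"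
    using evolved_H1_decay[OF C1_amplitude(1)[of 1]] unit(1) by blast
  obtain p2 where p2: "0 \<le> p2" "\<And>f t n. H1_on 0 1 f \<Longrightarrow> 0 < t \<Longrightarrow> cmod (evolved (amplitude_cross 1) f 1 t n) \<le> p2 * t powr (-1/3) * H1_norm 0 1 f"
    using evolved_H1_decay[OF C1_amplitude(2)[of 1]] unit(1) by blast
  obtain p3 where p3: "0 \<le> p3" "\<And>f t n. H1_on 0 1 f \<Longrightarrow> 0 < t \<Longrightarrow> cmod (evolved (amplitude_self (- 1)) f (- 1) t n) \<le> p3 * t powr (-1/3) * H1_norm 0 1 f"
    using evolved_H1_decay[OF C1_amplitude(1)[of "- 1"]] unit(2) by blast
  obtain p4 where p4: "0 \<le> p4" "\<And>f t n. H1_on 0 1 f \<Longrightarrow> 0 < t \<Longrightarrow> cmod (evolved (amplitude_cross (- 1)) f (- 1) t n) \<le> p4 * t powr (-1/3) * H1_norm 0 1 f"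
    using evolved_H1_decay[OF C1_amplitude(2)[of "- 1"]] unit(2) by blast
  define K where "K = (p1 + p3) + (p2 + p4)"
  have "Linf_norm (strip \<gamma>) (v t) \<le> ereal ((K * psi_bound) * t powr (-1/3) * (H1_norm 0 1 f + H1_norm 0 1 (\<lambda>\<xi>. (f \<xi> + g \<xi>) / complex_of_real (\<mu> \<xi>))))"
    if sol: "linearized_solution v" and sum: "\<And>t. 0 \<le> t \<Longrightarrow> L2_has_sum (strip \<gamma>) (\<lambda>n z. c t n * \<psi> n z) (v t)"
      and f: "L2_has_sum {0..1} (\<lambda>n \<xi>. c 0 n * fourier_mode n \<xi>) f"
      and g: "L2_has_sum {0..1} (\<lambda>n \<xi>. cnj (c 0 n) * fourier_mode n \<xi>) g"
      and H1: "H1_on 0 1 f" "H1_on 0 1 (\<lambda>\<xi>. (f \<xi> + g \<xi>) / complex_of_real (\<mu> \<xi>))" and t: "0 < t"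
    for v t f g and c :: "real \<Rightarrow> int \<Rightarrow> complex"
  proof -
    let ?M = "lebesgue_on {0..1::real}"
    let ?G = "\<lambda>\<xi>. (f \<xi> + g \<xi>) / complex_of_real (\<mu> \<xi>)"
    have int: "integrable ?M f" "integrable ?M g" "integrable ?M ?G"
      using f g H1 by (auto simp: L2_has_sum_def H1_on_def intro!: L2_imp_integrable)
    have fc: "fourier_coeff f n = c 0 n" "fourier_coeff g n = cnj (c 0 n)" for n
      by (rule fourier_coeff_L2_sum[OF f], rule fourier_coeff_L2_sum[OF g])
    \<comment> \<open>At 0 and 1 the symbol \<mu> vanishes and the quotient takes the default value
      0, so f + g = \<mu> G is established off this null set.\<close>
    have "AE \<xi> in lebesgue. \<xi> \<noteq> 0 \<and> \<xi> \<noteq> (1::real)"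
      by (intro AE_conjI AE_completion AE_lborel_singleton)
    then have "AE \<xi> in ?M. \<xi> \<noteq> 0 \<and> \<xi> \<noteq> 1" by (subst AE_restrict_space_iff) auto
    then have G: "AE \<xi> in ?M. f \<xi> + g \<xi> = complex_of_real (\<mu> \<xi>) * ?G \<xi>"
      using AE_space
    proof eventually_elim
      case (elim \<xi>)
      then have "\<mu> \<xi> \<noteq> 0" by (intro mu_nonzero) auto
      then show ?case by simp
    qed
    have "cmod (c t n) \<le> K * t powr (-1/3) * (H1_norm 0 1 f + H1_norm 0 1 ?G)" for n
    proof -
      let ?s = "t powr (-1/3)"
      have ev: "c t n = (evolved (amplitude_self 1) f 1 t n + evolved (amplitude_cross 1) ?G 1 t n) +
          (evolved (amplitude_self (- 1)) f (- 1) t n + evolved (amplitude_cross (- 1)) ?G (- 1) t n)"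
        using coefficient_evolution[where c = c, OF sol sum int G fc less_imp_le[OF t]] .
      have "cmod (c t n) \<le> (p1 * ?s * H1_norm 0 1 f + p2 * ?s * H1_norm 0 1 ?G) + (p3 * ?s * H1_norm 0 1 f + p4 * ?s * H1_norm 0 1 ?G)"
        unfolding ev
        by (intro order.trans[OF norm_triangle_ineq] add_mono p1 p2 p3 p4 H1 t)
      also have "\<dots> = ?s * ((p1 + p3) * H1_norm 0 1 f + (p2 + p4) * H1_norm 0 1 ?G)" by (simp add: algebra_simps)
      also have "\<dots> \<le> ?s * (K * H1_norm 0 1 f + K * H1_norm 0 1 ?G)"
        using p1(1) p2(1) p3(1) p4(1)
        by (intro mult_left_mono add_mono mult_right_mono) (auto simp: K_def H1_norm_def)
      finally show ?thesis by (simp add: algebra_simps)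
    qed
    from Linf_norm_le[where c = "c t", OF _ sum this] sol t show ?thesis
      by (simp add: linearized_solution_def mult_ac)
  qed
  then show ?thesis by (intro exI[of _ "K * psi_bound"]) blast
qed

theorem theorem5p11:
  shows
    "(\<exists>C. \<forall>v\<^sub>0 v (c :: real \<Rightarrow> int \<Rightarrow> complex).
        v\<^sub>0 \<in> F_space \<gamma> \<inter> E_tilde \<longrightarrow>
        linearized_solution v \<longrightarrow> v 0 = v\<^sub>0 \<longrightarrow>
        (\<forall>t\<ge>0. L2_has_sum (strip \<gamma>) (\<lambda>n z. c t n * \<psi> n z) (v t)) \<longrightarrow>
        (\<forall>n. Re (c 0 n) = 0) \<longrightarrow>
        L1_on (strip \<gamma>) v\<^sub>0 \<longrightarrow>
        (\<forall>t>0. Linf_norm (strip \<gamma>) (v t)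
                 \<le> ereal (C * t powr (-1/3) * L1_norm (strip \<gamma>) v\<^sub>0)))
     \<and>
     (\<exists>C. \<forall>v\<^sub>0 v (c :: real \<Rightarrow> int \<Rightarrow> complex) f\<^sub>0 g\<^sub>0.
        v\<^sub>0 \<in> F_space \<gamma> \<inter> E_tilde \<longrightarrow>
        linearized_solution v \<longrightarrow> v 0 = v\<^sub>0 \<longrightarrow>
        (\<forall>t\<ge>0. L2_has_sum (strip \<gamma>) (\<lambda>n z. c t n * \<psi> n z) (v t)) \<longrightarrow>
        L2_has_sum {0..1} (\<lambda>n \<xi>. c 0 n * fourier_mode n \<xi>) f\<^sub>0 \<longrightarrow>
        L2_has_sum {0..1} (\<lambda>n \<xi>. cnj (c 0 n) * fourier_mode n \<xi>) g\<^sub>0 \<longrightarrow>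
        H1_on 0 1 f\<^sub>0 \<longrightarrow>
        H1_on 0 1 (\<lambda>\<xi>. (f\<^sub>0 \<xi> + g\<^sub>0 \<xi>) / complex_of_real (\<mu> \<xi>)) \<longrightarrow>
        (\<forall>t>0. Linf_norm (strip \<gamma>) (v t)
                 \<le> ereal (C * t powr (-1/3) *
                     (H1_norm 0 1 f\<^sub>0 +
                      H1_norm 0 1 (\<lambda>\<xi>. (f\<^sub>0 \<xi> + g\<^sub>0 \<xi>) / complex_of_real (\<mu> \<xi>))))))"
  by (rule conjI[OF imaginary_data_decay H1_data_decay])

end
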